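(* Suppose that $1\le p<\infty$, with $\frac1p+\frac1{p'}=1$. Let $\delta\ge0$ be an integer, $1\le r<p'$, and let $0<\eta<1$ if $1<r<p'$, or $0<\eta\le1$ if $r=1$. Let $T$ be a Calderón-Zygmund operator with kernel $K\in\mathcal{SK}(\mu,A)$. Then there exists a constant $C>0$ such that $$\|T(f)\|_{\mathcal L^{(1,p,\eta)}_{r,\phi_1,\delta}}\le C\,\|f\|_{\infty,p'}\qquad\text{for all } f\in(L^\infty,\ell^{p'}).$$
   Context: All spaces are over $\mathbb R^d$; cubes have edges parallel to the axes; $\lambda Q$ is the cube with the same center as $Q$ and side-length $\lambda$ times that of $Q$. Standard kernels: for $A>0$, $\mu>0$, $\mathcal{SK}(\mu,A)$ is the class of functions $K:\mathbb R^d\times\mathbb R^d\setminus\{(x,x):x\in\mathbb R^d\}\to\mathbb C$ such that $|K(x,y)|\le A|x-y|^{-d}$; $|K(x,y)-K(x,z)|\le A\frac{|y-z|^\mu}{|x-y|^{d+\mu}}$ if $|x-y|\ge2|y-z|$; and $|K(x,y)-K(w,y)|\le A\frac{|x-w|^\mu}{|x-y|^{d+\mu}}$ if $|x-y|\ge2|x-w|$. A Calderón-Zygmund operator with kernel $K$ is a linear operator $T$ bounded on $L^2$ such that $T(f)(x)=\int K(x,y)f(y)\,dy$ for all $f\in L^2$ with compact support and $x\notin\mathrm{supp}(f)$. Amalgam spaces: with $Q_k=k+[0,1)^d$, $k\in\mathbb Z^d$, put $\|f\|_{q,p}:=\big\|\{\|f\chi_{Q_k}\|_{L^q}\}_{k\in\mathbb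 Z^d}\big\|_{\ell^p}$ for $0<q,p\le\infty$; $(L^q,\ell^p)$ is the space of $f$ with $\|f\|_{q,p}<\infty$. The space $\mathcal L^{(q,p,\eta)}_{r,\phi_1,\delta}$ ($0<q\le1$, $0<p<\infty$, $0<\eta<\infty$, $1\le r<\infty$, $\delta\ge0$ an integer): let $\mathcal P_\delta$ be the space of polynomials on $\mathbb R^d$ of degree at most $\delta$, and for $g\in L^r_{\mathrm{loc}}$ and a cube $Q$ let $P_Q^\delta(g)$ be the unique element of $\mathcal P_\delta$ with $\int_Q[g-P_Q^\delta(g)]\mathfrak q\,dx=0$ for all $\mathfrak q\in\mathcal P_\delta$. Let $K(d)>1$ and $C_0>1$ be fixed constants, independent of all open sets and families of cubes considered (those of the Whitney-type covering used in the atomic decomposition of Hardy-amalgam spaces: there open sets $\Omega\neq\mathbb R^d$ are written as unions of cubes $Q^n$ with $\sum_n\chi_{Q^n}\le K(d)$, and the atoms are supported in $C_0Q^n$). For an open set $\Omega\subsetneq\mathbb R^d$ put $$O(g,\Omega,r):=\sup\sum_{n\ge0}|\widetilde{Q^n}|^{1/r'}\Big(\int_{\widetilde{Q^n}}|g(x)-P^\delta_{\widetilde{Q^n}}(g)(x)|^r\,dx\Big)^{1/r},\qquad \widetilde{Q^n}=C_0Q^n,\ \tfrac1r+\tfrac1{r'}=1,$$ the supremum being over all families of cubes $\{Q^n\}_{n\ge0}$ with $Q^n\subset\Omega$ for all $n$ and $\sum_{n\ge0}\chi_{Q^n}\le K(d)$ (value $0$ if $\Omega=\emptyset$). Then $g\in\mathcal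 L^{(q,p,\eta)}_{r,\phi_1,\delta}$ if there is $C>0$ such that $$\sum_{j\in\mathbb Z}2^jO(g,\Omega^j,r)\le C\Big\|\sum_{j\in\mathbb Z}2^{j\eta}\chi_{\Omega^j}\Big\|_{\frac q\eta,\frac p\eta}^{1/\eta}$$ for all families of open sets $\{\Omega^j\}_{j\in\mathbb Z}$ for which the (quasi-)norm on the right is finite (which forces $\Omega^j\ne\mathbb R^d$); $\|g\|_{\mathcal L^{(q,p,\eta)}_{r,\phi_1,\delta}}$ is the infimum of such $C$. Elements are considered modulo $\mathcal P_\delta$. (The symbol $\phi_1(Q)=\|\chi_Q\|_{q,p}/|Q|$ is only part of the notation.) Meaning of $T(f)$: if $p>1$, then $(L^\infty,\ell^{p'})\subset L^{p'}$ with $1<p'<\infty$, and $T(f)$ is the value of the bounded extension of $T$ to $L^{p'}$. If $p=1$, then $(L^\infty,\ell^{p'})=L^\infty$ and $T(f)$ is the usual extension of a Calderón-Zygmund operator to $L^\infty$, i.e. the function, determined modulo constants, with $\int T(f)g\,dx=\int f\,T^*(g)\,dx$ for all compactly supported $g\in L^2$ with $\int g\,dx=0$, where $T^*$ is the transpose of $T$, defined by $\int T(u)v\,dx=\int u\,T^*(v)\,dx$ for $u,v\in L^2$ (for such $g$, $T^*(g)\in L^1$). *)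

theory Defs
  imports "HOL-Analysis.Analysis" "HOL-Probability.Essential_Supremum"
begin

text \<open>
  The space \<open>\<real>\<^sup>d\<close> is \<^typ>\<open>real^'n\<close> with \<open>d = CARD('n)\<close>, and functions are complex-valued.
  Elements of Lebesgue-type spaces are represented by functions and compared almost everywhere.
  Exponents that may be infinite are of type \<^typ>\<open>ennreal\<close>.
\<close>


section \<open>Lebesgue and amalgam norms\<close>

text \<open>Only used for \<open>a > 0\<close>; in particular \<open>0 powr a = 0\<close> is the right value.\<close>

definition enn_powr :: "ennreal \<Rightarrow> real \<Rightarrow> ennreal" where
  "enn_powr x a = (if x = \<infinity> then \<infinity> else ennreal (enn2real x powr a))"

definition Lp_norm :: "'a measure \<Rightarrow> ennreal \<Rightarrow> ('a \<Rightarrow> ennreal) \<Rightarrow> ennreal" where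
  "Lp_norm M p F =
    (if p = \<infinity> then esssup M F
     else enn_powr (\<integral>\<^sup>+ x. enn_powr (F x) (enn2real p) \<partial>M) (1 / enn2real p))"

definition Lp :: "ennreal \<Rightarrow> (real^'n \<Rightarrow> complex) set" where
  "Lp p = {f \<in> borel_measurable lebesgue. Lp_norm lebesgue p (\<lambda>x. ennreal (cmod (f x))) < \<infinity>}"

definition Lp_loc :: "real \<Rightarrow> (real^'n \<Rightarrow> complex) set" where
  "Lp_loc r = {f \<in> borel_measurable lebesgue.
     \<forall>S. compact S \<longrightarrow> set_integrable lebesgue S (\<lambda>x. cmod (f x) powr r)}"

definition unit_cube_at :: "int^'n \<Rightarrow> (real^'n) set" where
  "unit_cube_at k = {x. \<forall>i. of_int (k $ i) \<le> x $ i \<and> x $ i < of_int (k $ i) + 1}"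

text \<open>The amalgam (quasi-)norm of a nonnegative function; the outer \<open>\<ell>\<^sup>p\<close> norm is the
  \<open>L\<^sup>p\<close> norm for counting measure.\<close>

definition amalgam_norm :: "ennreal \<Rightarrow> ennreal \<Rightarrow> (real^'n \<Rightarrow> ennreal) \<Rightarrow> ennreal" where
  "amalgam_norm q p F =
    Lp_norm (count_space (UNIV :: (int^'n) set)) p
      (\<lambda>k. Lp_norm lebesgue q (\<lambda>x. F x * indicator (unit_cube_at k) x))"

definition amalgam :: "ennreal \<Rightarrow> ennreal \<Rightarrow> (real^'n \<Rightarrow> complex) set" where
  "amalgam q p = {f \<in> borel_measurable lebesgue.
     amalgam_norm q p (\<lambda>x. ennreal (cmod (f x))) < \<infinity>}"


section \<open>Standard kernels and Calderon-Zygmund operators\<close>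

text \<open>Kernels live off the diagonal; values on the diagonal are unconstrained and never matter.
  When \<open>x \<noteq> y\<close>, the conditions \<open>\<bar>x-y\<bar> \<ge> 2\<bar>y-z\<bar>\<close> and \<open>\<bar>x-y\<bar> \<ge> 2\<bar>x-w\<bar>\<close> force \<open>x \<noteq> z\<close>
  and \<open>w \<noteq> y\<close>.\<close>

definition standard_kernels ::
    "real \<Rightarrow> real \<Rightarrow> (real^'n \<Rightarrow> real^'n \<Rightarrow> complex) set" where
  "standard_kernels \<mu> A = {K.
     (\<forall>x y. x \<noteq> y \<longrightarrow> cmod (K x y) \<le> A / norm (x - y) ^ CARD('n)) \<and>
     (\<forall>x y z. x \<noteq> y \<and> norm (x - y) \<ge> 2 * norm (y - z) \<longrightarrow>
        cmod (K x y - K x z)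
          \<le> A * (norm (y - z) powr \<mu> / norm (x - y) powr (real CARD('n) + \<mu>))) \<and>
     (\<forall>x y w. x \<noteq> y \<and> norm (x - y) \<ge> 2 * norm (x - w) \<longrightarrow>
        cmod (K x y - K w y)
          \<le> A * (norm (x - w) powr \<mu> / norm (x - y) powr (real CARD('n) + \<mu>)))}"

text \<open>A linear operator bounded on \<open>L\<^sup>s\<close>. Linearity holds almost everywhere; together with
  boundedness it makes \<open>T\<close> respect almost everywhere equality.\<close>

definition bounded_linear_Lp ::
    "ennreal \<Rightarrow> ((real^'n \<Rightarrow> complex) \<Rightarrow> (real^'n \<Rightarrow> complex)) \<Rightarrow> bool" where
  "bounded_linear_Lp s T \<longleftrightarrow>
     (\<forall>f\<in>Lp s. T f \<in> Lp s) \<and>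
     (\<forall>f\<in>Lp s. \<forall>g\<in>Lp s. \<forall>a b.
        AE x in lebesgue. T (\<lambda>y. a * f y + b * g y) x = a * T f x + b * T g x) \<and>
     (\<exists>B::real. \<forall>f\<in>Lp s.
        Lp_norm lebesgue s (\<lambda>x. ennreal (cmod (T f x)))
          \<le> ennreal B * Lp_norm lebesgue s (\<lambda>x. ennreal (cmod (f x))))"

definition calderon_zygmund ::
    "((real^'n \<Rightarrow> complex) \<Rightarrow> (real^'n \<Rightarrow> complex)) \<Rightarrow> (real^'n \<Rightarrow> real^'n \<Rightarrow> complex) \<Rightarrow> bool" where
  "calderon_zygmund T K \<longleftrightarrow>
     bounded_linear_Lp 2 T \<and>
     (\<forall>f\<in>Lp 2. compact (closure {x. f x \<noteq> 0}) \<longrightarrow>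
        (AE x in lebesgue. x \<notin> closure {x. f x \<noteq> 0} \<longrightarrow>
           T f x = (LINT y|lebesgue. K x y * f y)))"

definition is_transpose ::
    "((real^'n \<Rightarrow> complex) \<Rightarrow> (real^'n \<Rightarrow> complex)) \<Rightarrow>
     ((real^'n \<Rightarrow> complex) \<Rightarrow> (real^'n \<Rightarrow> complex)) \<Rightarrow> bool" where
  "is_transpose T T' \<longleftrightarrow>
     (\<forall>v\<in>Lp 2. T' v \<in> Lp 2) \<and>
     (\<forall>u\<in>Lp 2. \<forall>v\<in>Lp 2.
        (LINT x|lebesgue. T u x * v x) = (LINT x|lebesgue. u x * T' v x))"

text \<open>\<open>extended_value T s f h\<close> says that \<open>h\<close> is (a representative of) \<open>T(f)\<close> for \<open>f \<in> L\<^sup>s\<close>.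
  For \<open>s < \<infinity>\<close> this is the value of the bounded extension of \<open>T\<close> from \<open>L\<^sup>2 \<inter> L\<^sup>s\<close> to \<open>L\<^sup>s\<close>, which
  is determined almost everywhere by density. For \<open>s = \<infinity>\<close> it is determined modulo constants.
  Local square integrability is exactly what makes \<open>h * g\<close> integrable for all the test
  functions \<open>g\<close>.\<close>

definition extended_value ::
    "((real^'n \<Rightarrow> complex) \<Rightarrow> (real^'n \<Rightarrow> complex)) \<Rightarrow> ennreal \<Rightarrow>
     (real^'n \<Rightarrow> complex) \<Rightarrow> (real^'n \<Rightarrow> complex) \<Rightarrow> bool" where
  "extended_value T s f h \<longleftrightarrow>
     (if s = \<infinity> then
        h \<in> Lp_loc 2 \<and>
        (\<exists>T'. is_transpose T T' \<and>
           (\<forall>g\<in>Lp 2. compact (closure {x. g x \<noteq> 0}) \<and> (LINT x|lebesgue. g x) = 0 \<longrightarrow>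
              (LINT x|lebesgue. h x * g x) = (LINT x|lebesgue. f x * T' g x)))
      else
        h \<in> Lp s \<and>
        (\<exists>S. bounded_linear_Lp s S \<and>
           (\<forall>u\<in>Lp 2 \<inter> Lp s. AE x in lebesgue. S u x = T u x) \<and>
           (AE x in lebesgue. h x = S f x)))"


section \<open>The Campanato-type spaces\<close>

text \<open>Cubes are closed, nondegenerate, and given by centre \<open>c\<close> and side length \<open>l > 0\<close>, so the
  dilate \<open>\<lambda>Q\<close> of \<open>cube c l\<close> is \<open>cube c (\<lambda> * l)\<close>. Using open or half-open cubes instead does not
  change the suprema below, by slightly shrinking finitely many cubes.\<close>

definition cube :: "real^'n \<Rightarrow> real \<Rightarrow> (real^'n) set" where
  "cube c l = cbox (c - (\<chi> i. l / 2)) (c + (\<chi> i. l / 2))"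

definition polys :: "nat \<Rightarrow> (real^'n \<Rightarrow> complex) set" where
  "polys \<delta> = {P. \<exists>a :: ('n \<Rightarrow> nat) \<Rightarrow> complex.
     P = (\<lambda>x. \<Sum>\<alpha> | (\<Sum>i\<in>UNIV. \<alpha> i) \<le> \<delta>. a \<alpha> * of_real (\<Prod>i\<in>UNIV. (x $ i) ^ \<alpha> i))}"

definition poly_proj ::
    "nat \<Rightarrow> (real^'n) set \<Rightarrow> (real^'n \<Rightarrow> complex) \<Rightarrow> (real^'n \<Rightarrow> complex)" where
  "poly_proj \<delta> Q g = (THE P. P \<in> polys \<delta> \<and>
     (\<forall>q\<in>polys \<delta>. (LINT x:Q|lebesgue. (g x - P x) * q x) = 0))"

text \<open>\<open>|Q|\<^bsup>1/r'\<^esup> (\<integral>\<^sub>Q |g - P\<^sub>Q(g)|\<^sup>r)\<^bsup>1/r\<^esup>\<close> with \<open>1/r' = 1 - 1/r\<close>; only used for \<open>g\<close> locally in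
  \<open>L\<^sup>r\<close>, so that the integral is finite.\<close>

definition oscillation :: "nat \<Rightarrow> real \<Rightarrow> (real^'n \<Rightarrow> complex) \<Rightarrow> (real^'n) set \<Rightarrow> real" where
  "oscillation \<delta> r g Q =
     measure lebesgue Q powr (1 - 1 / r) *
     (LINT x:Q|lebesgue. cmod (g x - poly_proj \<delta> Q g x) powr r) powr (1 / r)"

text \<open>\<open>Kd\<close> bounds the overlap and \<open>C\<^sub>0\<close> is the dilation factor. For \<open>\<Omega> = {}\<close> there is no
  admissible family, and the supremum is \<open>0\<close>.\<close>

definition osc_sup ::
    "real \<Rightarrow> real \<Rightarrow> nat \<Rightarrow> (real^'n \<Rightarrow> complex) \<Rightarrow> (real^'n) set \<Rightarrow> real \<Rightarrow> ennreal" where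
  "osc_sup Kd C\<^sub>0 \<delta> g \<Omega> r =
     (SUP (c, l) \<in> {(c :: nat \<Rightarrow> real^'n, l :: nat \<Rightarrow> real).
           (\<forall>n. 0 < l n \<and> cube (c n) (l n) \<subseteq> \<Omega>) \<and>
           (\<forall>x. (\<Sum>n. indicator (cube (c n) (l n)) x) \<le> ennreal Kd)}.
        \<Sum>n. ennreal (oscillation \<delta> r g (cube (c n) (C\<^sub>0 * l n))))"

text \<open>The norm of \<open>\<L>\<^bsub>r,\<phi>\<^sub>1,\<delta>\<^esub>\<^bsup>(q,p,\<eta>)\<^esup>\<close>; it is \<open>\<infinity>\<close> exactly when \<open>g\<close> is not in the space.\<close>

definition campanato_norm ::
    "real \<Rightarrow> real \<Rightarrow> real \<Rightarrow> real \<Rightarrow> real \<Rightarrow> real \<Rightarrow> nat \<Rightarrow> (real^'n \<Rightarrow> complex) \<Rightarrow> ennreal" where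
  "campanato_norm Kd C\<^sub>0 q p \<eta> r \<delta> g =
     Inf {ennreal C | C. 0 < C \<and> g \<in> Lp_loc r \<and>
       (\<forall>\<Omega> :: int \<Rightarrow> (real^'n) set.
          (let N = amalgam_norm (ennreal (q / \<eta>)) (ennreal (p / \<eta>))
                     (\<lambda>x. \<Sum>\<^sub>\<infinity>j\<in>UNIV. ennreal (2 powr (of_int j * \<eta>)) * indicator (\<Omega> j) x)
           in (\<forall>j. open (\<Omega> j)) \<and> N < \<infinity> \<longrightarrow>
              (\<Sum>\<^sub>\<infinity>j\<in>UNIV. ennreal (2 powr of_int j) * osc_sup Kd C\<^sub>0 \<delta> g (\<Omega> j) r)
                \<le> ennreal C * enn_powr N (1 / \<eta>)))}"

end

theory Submission
  imports Defs
begin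

text \<open>
  Why the theorem holds. Let \<open>h = T f\<close>, let \<open>Q\<close> be a cube with centre \<open>c\<close>, and let \<open>R\<close> be comparable to the
  side of the dilated cube. Split \<open>f\<close> at the sphere of radius \<open>2R\<close> about \<open>c\<close>. On the dilated cube, up to an additive
  constant,
  \<open>h(y) = T(near part)(y) + \<integral> (K(y,x) - K(c,x)) f(x) 1(\<bar>x - c\<bar> \<ge> 2R) dx\<close>  (\<open>weak_value_local\<close>).
  Suppose that the averages of \<open>\<bar>f\<bar>\<^sup>s\<close> over the balls about \<open>c\<close> of radius at least \<open>2R\<close> are at most \<open>\<Gamma>\<^sup>s\<close>, where
  \<open>1 < s\<close> and \<open>r \<le> s < p'\<close>. The boundedness of \<open>T\<close> on \<open>L\<^sup>s\<close> (\<open>calderon_zygmund_Ls\<close>) controls the first term in \<open>L\<^sup>s\<close>,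
  and the smoothness of the kernel controls the second one pointwise (\<open>far_part_bound\<close>). The polynomial projection
  reproduces constants and is dominated by averages (\<open>poly_proj_bound\<close>), so the constant disappears and the oscillation of \<open>h\<close> over the
  dilated cube is at most a constant times \<open>\<bar>Q\<bar> \<Gamma>\<close> (\<open>oscillation_bound\<close>).

  The amalgam norm enters through a discrete maximal function. If \<open>N\<^sub>k\<close> is the essential supremum of \<open>\<bar>f\<bar>\<close> on the unit
  cube with index \<open>k\<close>, then all averages of \<open>\<bar>f\<bar>\<^sup>s\<close> over balls centred in that cube are at most \<open>g\<^sub>k\<^sup>s\<close>, where \<open>g\<^sup>s\<close> is a
  multiple of the maximal function of \<open>N\<^sup>s\<close> on the lattice. This maximal function is bounded on \<open>\<ell>\<^sup>q\<close> for \<open>q = p'/s > 1\<close>,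
  hence the norm of \<open>g\<close> in \<open>\<ell>\<^bsup>p'\<^esup>\<close> is at most a constant times the amalgam norm of \<open>f\<close> (\<open>local_averages\<close>). If \<open>p' = \<infinity>\<close>, then
  \<open>f\<close> is bounded and a constant sequence \<open>g\<close> suffices. The choice of \<open>s\<close> is the place where \<open>r < p'\<close> is used. Regard \<open>g\<close> as a function on \<open>\<real>\<^sup>d\<close> that is constant on unit cubes. The oscillation over the dilate
  of \<open>Q\<close> is then at most \<open>C \<integral>\<^sub>Q g\<close>, and bounded overlap gives \<open>O(h,\<Omega>,r) \<le> C \<integral>\<^sub>\<Omega> g\<close> (\<open>osc_sup_le\<close>).
  Finally \<open>\<Sum> 2\<^sup>j \<chi>\<^sub>j \<le> (\<Sum> 2\<^bsup>j\<eta>\<^esup> \<chi>\<^sub>j)\<^bsup>1/\<eta>\<^esup>\<close> because \<open>\<eta> \<le> 1\<close>, and Hoelder's inequality between \<open>(L\<^sup>1, \<ell>\<^sup>p)\<close> and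
  \<open>(L\<^sup>\<infinity>, \<ell>\<^bsup>p'\<^esup>)\<close> finishes the estimate (\<open>campanato_norm_le\<close>).

  Three ingredients are developed from the definitions. Boundedness on \<open>L\<^sup>s\<close> comes from a Calderon-Zygmund decomposition of functions
  that are constant on the cells of a mesh, which gives a weak type bound with a truncated right-hand side; integration
  over the levels gives \<open>1 < s < 2\<close>, and the transpose gives \<open>s > 2\<close>. The transpose comes from the Riesz representation
  theorem in \<open>L\<^sup>2\<close>. Both meanings of \<open>T f\<close>, for \<open>p > 1\<close> and for \<open>p = 1\<close>, imply the same weak
  identity \<open>\<integral> h g = \<integral> f T'(g)\<close> for bounded compactly supported \<open>g\<close> with mean zero (\<open>weak_value\<close>), from which the
  local formula above follows; so the two cases are treated together.

  Powers are handled through the integral \<open>\<integral> \<bar>f\<bar>\<^sup>s\<close> (\<open>Ipow\<close>) without taking roots; the inequality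
  \<open>(a + b)\<^sup>s \<le> 2\<^sup>s (a\<^sup>s + b\<^sup>s)\<close> then replaces the triangle inequality, at the price of constants.
\<close>

text \<open>Below, \<open>NN x. F x\<close> is the integral of a nonnegative function over \<open>\<real>\<^sup>d\<close>.\<close>

abbreviation Meas :: "('a::euclidean_space => 'b::topological_space) set" where
 "Meas == borel_measurable lebesgue"

abbreviation enorm :: "complex => ennreal" where
 "enorm z == ennreal (cmod z)"

abbreviation NN_integral :: "('a::euclidean_space => ennreal) => ennreal" (binder "NN " 10) where
 "NN_integral F == nn_integral lebesgue F"

section \<open>Power integrals\<close>

lemma norm_lebesgue_measurable [measurable]: "norm \<in> borel_measurable (lebesgue :: 'a::euclidean_space measure)"
 by (intro measurable_completion) simp

lemma cnj_measurable [measurable (raw)]: "f \<in> borel_measurable M ==> (%x. cnj (f x)) \<in> borel_measurable M"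
 by (rule borel_measurable_continuous_on[of cnj]) (auto intro: continuous_intros)

lemma sigma_finite_lebesgue: "sigma_finite_measure (lebesgue :: 'a::euclidean_space measure)"
proof
 show "\<exists>A::'a set set. countable A \<and> A \<subseteq> sets lebesgue \<and> \<Union> A = space lebesgue \<and>
   (\<forall>a\<in>A. emeasure lebesgue a ~= \<infinity>)"
 proof (intro exI[of _ "range (%n::nat. cball (0::'a) (real n))"] conjI ballI)
  show "\<Union> (range (%n::nat. cball (0::'a) (real n))) = space lebesgue"
   by (auto simp: real_arch_simple)
 next
  fix a assume "a \<in> range (%n::nat. cball (0::'a) (real n))"
  then show "emeasure lebesgue a ~= \<infinity>"
   using emeasure_bounded_finite[of a] by auto
 qed auto
qed

interpretation leb: sigma_finite_measure "lebesgue :: 'a::euclidean_space measure"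
 by (rule sigma_finite_lebesgue)

interpretation leb2: pair_sigma_finite "lebesgue :: 'a::euclidean_space measure"
  "lebesgue :: 'b::euclidean_space measure"
 by (simp add: pair_sigma_finite_def sigma_finite_lebesgue)

lemma enn_powr_ennreal: "0 <= x ==> enn_powr (ennreal x) a = ennreal (x powr a)"
 by (simp add: enn_powr_def)

lemma enn_powr_top [simp]: "enn_powr \<infinity> a = \<infinity>"
 by (simp add: enn_powr_def)

lemma enn_powr_0 [simp]: "enn_powr 0 a = 0"
 by (simp add: enn_powr_def)

lemma enn_powr_powr: "enn_powr (enn_powr x a) b = enn_powr x (a * b)"
 by (cases x) (auto simp: enn_powr_def powr_powr top_unique)

lemma enn_powr_mono: "x <= y ==> 0 <= a ==> enn_powr x a <= enn_powr y a"
 by (cases x; cases y) (auto simp: enn_powr_def top_unique intro!: ennreal_leI powr_mono2)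

lemma enn_powr_mult: "x ~= \<infinity> ==> y ~= \<infinity> ==> enn_powr (x * y) a = enn_powr x a * enn_powr y a"
 by (cases x; cases y)
   (auto simp: enn_powr_def powr_mult ennreal_mult enn2real_mult ennreal_mult_eq_top_iff top_unique)

lemma enn_powr_1 [simp]: "enn_powr x 1 = x"
 by (cases x) (auto simp: enn_powr_def)

lemma enn_powr_finite_iff: "enn_powr x a < \<infinity> \<longleftrightarrow> x < \<infinity>"
 by (cases x) (auto simp: enn_powr_def)

lemma enn_powr_eq_top_iff [simp]: "enn_powr x a = top \<longleftrightarrow> x = top"
 by (cases x) (auto simp: enn_powr_def)

lemma enn_powr_le_iff:
 "0 < a ==> enn_powr x a <= y \<longleftrightarrow> x <= enn_powr y (1 / a)"
proof -
 assume a: "0 < a"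
 have "enn_powr x a <= y ==> x <= enn_powr y (1 / a)"
  using enn_powr_mono[of "enn_powr x a" y "1/a"] a by (simp add: enn_powr_powr)
 moreover have "x <= enn_powr y (1 / a) ==> enn_powr x a <= y"
  using enn_powr_mono[of x "enn_powr y (1/a)" a] a by (simp add: enn_powr_powr)
 ultimately show ?thesis by blast
qed

lemma enn_powr_measurable [measurable]:
 "f \<in> borel_measurable M ==> (%x. enn_powr (f x) a) \<in> borel_measurable M"
 unfolding enn_powr_def by (rule measurable_If) (auto intro: borel_measurable_const)

definition Ipow :: "real => (real^'n => complex) => ennreal" where
 "Ipow s f = (NN x. ennreal (cmod (f x) powr s))"

lemma ennreal_real_less_top [simp]: "ennreal s ~= \<infinity>" by simp

lemma Lp_norm_ennreal:
 assumes "0 < s"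
 shows "Lp_norm M (ennreal s) F = enn_powr (\<integral>\<^sup>+ x. enn_powr (F x) s \<partial>M) (1 / s)"
 using assms by (simp add: Lp_norm_def)

lemma Lp_norm_Ipow:
 assumes "0 < s"
 shows "Lp_norm lebesgue (ennreal s) (%x. enorm (f x)) = enn_powr (Ipow s f) (1 / s)"
 using assms by (simp add: Lp_norm_ennreal Ipow_def enn_powr_ennreal)

lemma mem_Lp_iff:
 assumes "0 < s"
 shows "f \<in> Lp (ennreal s) \<longleftrightarrow> f \<in> Meas \<and> Ipow s f < \<infinity>"
 using assms unfolding Lp_def by (simp add: Lp_norm_Ipow enn_powr_finite_iff del: ennreal_less_top infinity_ennreal_def)

lemma mem_Lp2_iff: "f \<in> Lp 2 \<longleftrightarrow> f \<in> Meas \<and> Ipow 2 f < \<infinity>"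
 using mem_Lp_iff[of 2 f] by simp

lemma Ipow_mono_AE:
 "AE x in lebesgue. cmod (f x) <= cmod (g x) ==> 0 <= s ==> Ipow s f <= Ipow s g"
 unfolding Ipow_def by (intro nn_integral_mono_AE) (auto elim!: eventually_mono intro!: ennreal_leI powr_mono2)

lemma Ipow_cong_AE: "AE x in lebesgue. f x = g x ==> Ipow s f = Ipow s g"
 unfolding Ipow_def by (intro nn_integral_cong_AE) (auto elim!: eventually_mono)

lemma Ipow_scale: "0 <= c ==> Ipow s (%x. a * f x) = ennreal (cmod a powr s) * Ipow s f"
 if "f \<in> Meas" for c :: real
 using that unfolding Ipow_def by (simp add: norm_mult powr_mult ennreal_mult nn_integral_cmult)

lemma powr_add_le:
 fixes a b :: real assumes "0 <= a" "0 <= b" "0 < s"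
 shows "(a + b) powr s <= 2 powr s * (a powr s + b powr s)"
proof -
 have "(a + b) powr s <= (2 * max a b) powr s"
  using assms by (intro powr_mono2) auto
 also have "... = 2 powr s * max a b powr s"
  using assms by (simp add: powr_mult)
 also have "max a b powr s <= a powr s + b powr s" by (auto simp: max_def)
 finally show ?thesis by simp
qed

lemma Ipow_add:
 assumes [measurable]: "f \<in> Meas" "g \<in> Meas" and "0 < s"
 shows "Ipow s (%x. f x + g x) <= ennreal (2 powr s) * (Ipow s f + Ipow s g)"
proof -
 have "Ipow s (%x. f x + g x) <=
   (NN x. ennreal (2 powr s) * (ennreal (cmod (f x) powr s) + ennreal (cmod (g x) powr s)))"
  unfolding Ipow_def
 proof (rule nn_integral_mono)
  fix x
  have "cmod (f x + g x) powr s <= (cmod (f x) + cmod (g x)) powr s"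
   using assms(3) by (intro powr_mono2) (auto intro: norm_triangle_ineq)
  also have "... <= 2 powr s * (cmod (f x) powr s + cmod (g x) powr s)"
   using assms(3) by (intro powr_add_le) auto
  finally show "ennreal (cmod (f x + g x) powr s) <=
    ennreal (2 powr s) * (ennreal (cmod (f x) powr s) + ennreal (cmod (g x) powr s))"
   by (simp flip: ennreal_plus ennreal_mult)
 qed
 also have "... = ennreal (2 powr s) * (Ipow s f + Ipow s g)"
  unfolding Ipow_def by (simp add: nn_integral_cmult nn_integral_add)
 finally show ?thesis .
qed

lemma Ipow_minus: "Ipow s (%x. - f x) = Ipow s f"
 by (simp add: Ipow_def)

lemma Ipow_diff:
 assumes [measurable]: "f \<in> Meas" "g \<in> Meas" and "0 < s"
 shows "Ipow s (%x. f x - g x) <= ennreal (2 powr s) * (Ipow s f + Ipow s g)"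
 using Ipow_add[of f "%x. - g x" s] assms by (simp add: Ipow_minus)

lemma Lp_lincomb:
 assumes "0 < s" "f \<in> Lp (ennreal s)" "g \<in> Lp (ennreal s)"
 shows "(%x. a * f x + b * g x) \<in> Lp (ennreal s)"
proof -
 have m[measurable]: "f \<in> Meas" "g \<in> Meas"
  using assms by (auto simp: mem_Lp_iff)
 have "Ipow s (%x. a * f x + b * g x) <= ennreal (2 powr s) * (Ipow s (%x. a * f x) + Ipow s (%x. b * g x))"
  using assms by (intro Ipow_add) auto
 also have "... < \<infinity>"
  using assms Ipow_scale[OF m(1), of 0 s a] Ipow_scale[OF m(2), of 0 s b]
  by (auto simp: mem_Lp_iff ennreal_mult_less_top)
 finally show ?thesis using assms by (auto simp: mem_Lp_iff)
qed

lemma Lp_add: "0 < s ==> f \<in> Lp (ennreal s) ==> g \<in> Lp (ennreal s) ==> (%x. f x + g x) \<in> Lp (ennreal s)"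
 using Lp_lincomb[of s f g 1 1] by simp
lemma Lp_diff: "0 < s ==> f \<in> Lp (ennreal s) ==> g \<in> Lp (ennreal s) ==> (%x. f x - g x) \<in> Lp (ennreal s)"
 using Lp_lincomb[of s f g 1 "-1"] by simp
lemma Lp_cmult: "0 < s ==> f \<in> Lp (ennreal s) ==> (%x. a * f x) \<in> Lp (ennreal s)"
 using Lp_lincomb[of s f f a 0] by simp
lemma Lp_cnj: "0 < s ==> f \<in> Lp (ennreal s) ==> (%x. cnj (f x)) \<in> Lp (ennreal s)"
 by (auto simp: mem_Lp_iff Ipow_def)

lemma Lp_dominated:
 assumes "0 < s" "g \<in> Lp (ennreal s)" "f \<in> Meas"
  "AE x in lebesgue. cmod (f x) <= cmod (g x)"
 shows "f \<in> Lp (ennreal s)"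
 using assms Ipow_mono_AE[OF assms(4), of s] by (auto simp: mem_Lp_iff)

lemma Lp_restrict:
 assumes "0 < s" "f \<in> Lp (ennreal s)" "S \<in> sets lebesgue"
 shows "(%x. f x * indicator S x) \<in> Lp (ennreal s)"
 using assms(3) by (intro Lp_dominated[OF assms(1,2)])
   (use assms in \<open>auto simp: mem_Lp_iff indicator_def norm_mult\<close>)

lemma Lp_bounded_support:
 fixes f :: "real^'n => complex"
 assumes "0 < s" "f \<in> Meas" "AE x in lebesgue. cmod (f x) <= B * indicator S x"
  "bounded S" "S \<in> sets lebesgue"
 shows "f \<in> Lp (ennreal s)"
proof -
 have fin: "emeasure lebesgue S < \<infinity>"
  using fmeasurableD2[OF bounded_set_imp_lmeasurable[OF assms(4,5)]] by (simp only: less_top infinity_ennreal_def)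
 have "Ipow s f <= (NN x. ennreal (\<bar>B\<bar> powr s) * indicator S x)"
  unfolding Ipow_def
 proof (rule nn_integral_mono_AE)
  show "AE x in lebesgue. ennreal (cmod (f x) powr s) <= ennreal (\<bar>B\<bar> powr s) * indicator S x"
   using assms(3)
  proof eventually_elim
   case (elim x)
   then show ?case
    using assms(1) by (auto simp: indicator_def intro!: ennreal_leI powr_mono2)
  qed
 qed
 also have "... = ennreal (\<bar>B\<bar> powr s) * emeasure lebesgue S"
  using assms(5) by (simp add: nn_integral_cmult_indicator)
 also have "... < \<infinity>" using fin by (simp add: ennreal_mult_less_top)
 finally show ?thesis using assms by (simp add: mem_Lp_iff)
qed

definition trunc :: "nat => (real^'n => complex) => real^'n => complex" where
 "trunc n f x = (if norm x <= real n \<and> cmod (f x) <= real n then f x else 0)"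

lemma trunc_measurable [measurable]:
 assumes [measurable]: "f \<in> Meas"
 shows "trunc n f \<in> Meas"
 unfolding trunc_def by measurable

lemma trunc_eventually: "\<forall>\<^sub>F n in sequentially. trunc n f x = f x"
proof -
 obtain N :: nat where N: "max (norm x) (cmod (f x)) <= real N"
  using real_arch_simple by blast
 show ?thesis unfolding eventually_sequentially
  by (rule exI[of _ N]) (use N in \<open>auto simp: trunc_def\<close>)
qed

lemma trunc_norm_le: "cmod (trunc n f x) <= cmod (f x)"
 by (simp add: trunc_def)

lemma trunc_Lp:
 assumes "f \<in> Meas" "0 < s"
 shows "trunc n f \<in> Lp (ennreal s)"
proof (rule Lp_bounded_support[OF assms(2), of _ "real n" "cball 0 (real n)"])
 show "AE x in lebesgue. cmod (trunc n f x) <= real n * indicator (cball 0 (real n)) x"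
  by (auto simp: trunc_def indicator_def)
qed (use assms in auto)

text \<open>Dominated convergence; truncations are bounded with bounded support, hence belong to every \<open>L\<^sup>s\<close>, which makes
 \<open>L\<^sup>2 \<inter> L\<^sup>s\<close> dense in \<open>L\<^sup>s\<close>.\<close>

lemma Ipow_trunc:
 fixes f :: "real^'n => complex"
 assumes [measurable]: "f \<in> Meas" and s: "0 < s" and fin: "Ipow s f < \<infinity>"
 shows "(%n. Ipow s (%x. trunc n f x - f x)) \<longlonglongrightarrow> 0"
  and "(%n. Ipow s (trunc n f)) \<longlonglongrightarrow> Ipow s f"
proof -
 have "(%n. Ipow s (%x. trunc n f x - f x)) \<longlonglongrightarrow> (\<integral>\<^sup>+x. 0 \<partial>(lebesgue :: (real^'n) measure))"
  unfolding Ipow_def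
 proof (rule nn_integral_dominated_convergence[where w="%x. ennreal (cmod (f x) powr s)"])
  show "AE x in lebesgue. (%i. ennreal (cmod (trunc i f x - f x) powr s)) \<longlonglongrightarrow> 0"
  proof (rule AE_I2)
   fix x
   show "(%i. ennreal (cmod (trunc i f x - f x) powr s)) \<longlonglongrightarrow> 0"
    by (rule tendsto_eventually) (use trunc_eventually[of f x] in \<open>auto elim!: eventually_mono\<close>)
  qed
  show "!!j. AE x in lebesgue. ennreal (cmod (trunc j f x - f x) powr s) <= ennreal (cmod (f x) powr s)"
   using s by (auto simp: trunc_def)
 qed (use fin in \<open>auto simp: Ipow_def\<close>)
 then show "(%n. Ipow s (%x. trunc n f x - f x)) \<longlonglongrightarrow> 0" by simp
 show "(%n. Ipow s (trunc n f)) \<longlonglongrightarrow> Ipow s f"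
  unfolding Ipow_def
 proof (rule nn_integral_dominated_convergence[where w="%x. ennreal (cmod (f x) powr s)"])
  show "AE x in lebesgue. (%i. ennreal (cmod (trunc i f x) powr s)) \<longlonglongrightarrow> ennreal (cmod (f x) powr s)"
  proof (rule AE_I2)
   fix x
   show "(%i. ennreal (cmod (trunc i f x) powr s)) \<longlonglongrightarrow> ennreal (cmod (f x) powr s)"
    by (rule tendsto_eventually) (use trunc_eventually[of f x] in \<open>auto elim!: eventually_mono\<close>)
  qed
  show "!!j. AE x in lebesgue. ennreal (cmod (trunc j f x) powr s) <= ennreal (cmod (f x) powr s)"
   using s by (auto simp: trunc_def)
 qed (use fin in \<open>auto simp: Ipow_def\<close>)
qed

text \<open>The sum of \<open>2\<^bsup>sn\<^esup> \<bar>d\<^sub>n\<bar>\<^sup>s\<close> has finite integral, so almost everywhere its terms tend to zero, and then \<open>\<bar>d\<^sub>n\<bar> \<le> 2\<^bsup>-n\<^esup>\<close> eventually.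
 The weight makes the argument work for \<open>s < 1\<close> as well.\<close>

lemma AE_summable_Ipow:
 fixes d :: "nat => real^'n => complex"
 assumes [measurable]: "!!n. d n \<in> Meas" and s: "0 < s"
  and le: "!!n. Ipow s (d n) <= ennreal (((1/2)^n) * (1/2) powr (s * n))"
 shows "AE x in lebesgue. summable (%n. cmod (d n x))"
proof -
 have "(NN x. (\<Sum>n. ennreal (2 powr (s * n)) * ennreal (cmod (d n x) powr s)))
   = (\<Sum>n. ennreal (2 powr (s * n)) * Ipow s (d n))"
  by (subst nn_integral_suminf) (auto simp: nn_integral_cmult Ipow_def)
 also have "... <= (\<Sum>n. ennreal ((1/2)^n))"
 proof (rule suminf_le)
  fix n
  have "ennreal (2 powr (s * n)) * Ipow s (d n)
    <= ennreal (2 powr (s * n)) * ennreal (((1/2)^n) * (1/2) powr (s * n))"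
   by (intro mult_left_mono le) auto
  also have "... = ennreal ((1/2)^n)"
   by (simp add: powr_divide flip: ennreal_mult)
  finally show "ennreal (2 powr (s * n)) * Ipow s (d n) <= ennreal ((1/2)^n)" .
 qed auto
 also have "... = ennreal (\<Sum>n. (1/2)^n)"
  by (intro suminf_ennreal2) auto
 also have "... < \<infinity>" by simp
 finally have "AE x in lebesgue. (\<Sum>n. ennreal (2 powr (s * n)) * ennreal (cmod (d n x) powr s)) ~= \<infinity>"
  by (intro nn_integral_PInf_AE) auto
 then show ?thesis
 proof eventually_elim
  case (elim x)
  have "summable (%n. 2 powr (s * n) * cmod (d n x) powr s)"
   using elim by (intro summable_suminf_not_top) (auto simp: ennreal_mult)
  then have "(%n. 2 powr (s * n) * cmod (d n x) powr s) \<longlonglongrightarrow> 0"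
   by (rule summable_LIMSEQ_zero)
  then have "\<forall>\<^sub>F n in sequentially. 2 powr (s * n) * cmod (d n x) powr s < 1"
   by (rule order_tendstoD) auto
  then have "\<forall>\<^sub>F n in sequentially. norm (cmod (d n x)) <= (1/2)^n"
  proof eventually_elim
   case (elim n)
   have "(2^n * cmod (d n x)) powr s < 1"
    using elim by (simp add: powr_mult powr_powr mult.commute flip: powr_realpow)
   then have "2^n * cmod (d n x) <= 1"
    using s by (metis ge_one_powr_ge_zero less_eq_real_def not_le)
   then show ?case by (simp add: field_simps)
  qed
  then show ?case
   by (rule summable_comparison_test_ev) auto
 qed
qed

lemma Ipow_Fatou:
 fixes f :: "nat => real^'n => complex"
 assumes [measurable]: "!!n. f n \<in> Meas" "g \<in> Meas" and s: "0 < s"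
  and lim: "AE x in lebesgue. (%n. f n x) \<longlonglongrightarrow> g x"
  and ev: "\<forall>\<^sub>F n in sequentially. Ipow s (f n) <= c"
 shows "Ipow s g <= c"
proof -
 have "Ipow s g = (NN x. liminf (%n. ennreal (cmod (f n x) powr s)))"
  unfolding Ipow_def
 proof (rule nn_integral_cong_AE)
  show "AE x in lebesgue. ennreal (cmod (g x) powr s) = liminf (%n. ennreal (cmod (f n x) powr s))"
   using lim
  proof eventually_elim
   case (elim x)
   have "(%n. ennreal (cmod (f n x) powr s)) \<longlonglongrightarrow> ennreal (cmod (g x) powr s)"
    using elim s by (intro tendsto_ennrealI tendsto_powr2 tendsto_norm tendsto_const) auto
   from lim_imp_Liminf[OF _ this] show ?case by simp
  qed
 qed
 also have "... <= liminf (%n. Ipow s (f n))"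
  unfolding Ipow_def by (rule nn_integral_liminf) auto
 also have "... <= liminf (%n. c)"
  by (rule Liminf_mono) (use ev in auto)
 also have "... = c" by (simp add: Liminf_const)
 finally show ?thesis .
qed

lemma Ipow_eq_0_iff:
 assumes "f \<in> Meas"
 shows "Ipow s f = 0 \<longleftrightarrow> (AE x in lebesgue. f x = 0)"
 using assms unfolding Ipow_def by (subst nn_integral_0_iff_AE) (auto simp: ennreal_eq_0_iff)

lemma Ipow_limit_unique:
 fixes f :: "nat => real^'n => complex"
 assumes [measurable]: "!!n. f n \<in> Meas" "g \<in> Meas" "h \<in> Meas"
  and s: "0 < s"
  and lim: "(%n. Ipow s (%x. f n x - g x)) \<longlonglongrightarrow> 0" "(%n. Ipow s (%x. f n x - h x)) \<longlonglongrightarrow> 0"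
 shows "Ipow s (%x. g x - h x) = 0"
proof -
 have "(%n. ennreal (2 powr s) * (Ipow s (%x. f n x - h x) + Ipow s (%x. f n x - g x))) \<longlonglongrightarrow> ennreal (2 powr s) * (0 + 0)"
  by (intro ennreal_tendsto_cmult tendsto_add lim) auto
 moreover have "Ipow s (%x. g x - h x) <= ennreal (2 powr s) * (Ipow s (%x. f n x - h x) + Ipow s (%x. f n x - g x))" for n
  using Ipow_diff[of "%x. f n x - h x" "%x. f n x - g x" s] s by simp
 ultimately have "Ipow s (%x. g x - h x) <= ennreal (2 powr s) * (0 + 0)"
  by (intro tendsto_lowerbound[of _ _ sequentially]) auto
 then show ?thesis by simp
qed

text \<open>Completeness of \<open>L\<^sup>s\<close>: a rapidly converging subsequence converges almost everywhere, and Fatou's lemma identifies its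
 limit as the limit of the whole sequence.\<close>

lemma Ipow_Cauchy_complete:
 fixes f :: "nat => real^'n => complex"
 assumes m: "!!n. f n \<in> Meas" and s: "0 < s"
  and C: "!!e::real. e > 0 ==> \<exists>N. \<forall>m\<ge>N. \<forall>n\<ge>N. Ipow s (%x. f m x - f n x) <= ennreal e"
 shows "\<exists>g r. g \<in> Meas \<and> strict_mono r \<and> (AE x in lebesgue. (%n. f (r n) x) \<longlonglongrightarrow> g x) \<and>
   (%n. Ipow s (%x. f n x - g x)) \<longlonglongrightarrow> 0"
proof -
 note m[measurable]
 define e where "e n = ((1/2)^n) * (1/2) powr (s * real n)" for n :: nat
 have "e n > 0" for n by (simp add: e_def)
 then have "\<forall>k. \<exists>N. \<forall>m\<ge>N. \<forall>n\<ge>N. Ipow s (%x. f m x - f n x) <= ennreal (e k)"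
  using C by blast
 then obtain N where N: "!!k m n. m \<ge> N k ==> n \<ge> N k ==> Ipow s (%x. f m x - f n x) <= ennreal (e k)"
  by metis
 define r where "r = rec_nat (N 0) (%k v. max (Suc v) (N (Suc k)))"
 have r0: "r 0 = N 0" and rS: "r (Suc k) = max (Suc (r k)) (N (Suc k))" for k
  by (simp_all add: r_def)
 have rmono: "strict_mono r" by (simp add: strict_mono_Suc_iff rS less_max_iff_disj)
 have rN: "r k \<ge> N k" for k by (cases k) (auto simp: r0 rS)
 have "AE x in lebesgue. summable (%k. cmod (f (r (Suc k)) x - f (r k) x))"
 proof (rule AE_summable_Ipow[OF _ s])
  fix k
  have "r (Suc k) \<ge> N k"
   using rN[of k] strict_mono_less_eq[OF rmono, of k "Suc k"] by simp
  then show "Ipow s (%x. f (r (Suc k)) x - f (r k) x) <= ennreal ((1/2)^k * (1/2) powr (s * real k))"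
   using N[of k, OF _ rN] by (simp add: e_def)
 qed auto
 then have conv: "AE x in lebesgue. convergent (%k. f (r k) x)"
 proof eventually_elim
  case (elim x)
  then have "summable (%k. f (r (Suc k)) x - f (r k) x)"
   by (rule summable_norm_cancel)
  then have "convergent (%n. \<Sum>k<n. f (r (Suc k)) x - f (r k) x)"
   by (simp add: summable_iff_convergent)
  then have "convergent (%n. f (r n) x - f (r 0) x)"
   using sum_lessThan_telescope[of "%k. f (r k) x"] by simp
  then have "convergent (%n. (f (r n) x - f (r 0) x) + f (r 0) x)"
   by (intro convergent_add convergent_const)
  then show ?case by simp
 qed
 define g where "g x = lim (%k. f (r k) x)" for x
 have g[measurable]: "g \<in> Meas"
  unfolding g_def by measurable
 have lim: "AE x in lebesgue. (%n. f (r n) x) \<longlonglongrightarrow> g x"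
  using conv by eventually_elim (simp add: g_def convergent_LIMSEQ_iff)
 have "(%n. Ipow s (%x. f n x - g x)) \<longlonglongrightarrow> 0"
 proof (rule order_tendstoI)
  fix a :: ennreal assume "0 < a"
  then obtain b where b: "0 < b" "b < a" using dense by blast
  then obtain e :: real where e: "0 < e" "ennreal e < a"
   by (cases b) auto
  from C[OF e(1)] obtain N where N: "!!m n. m \<ge> N ==> n \<ge> N ==> Ipow s (%x. f m x - f n x) <= ennreal e"
   by blast
  show "\<forall>\<^sub>F n in sequentially. Ipow s (%x. f n x - g x) < a"
   unfolding eventually_sequentially
  proof (intro exI allI impI)
   fix n assume n: "N <= n"
   have "Ipow s (%x. f n x - g x) <= ennreal e"
   proof (rule Ipow_Fatou[of "%k x. f n x - f (r k) x"])
    show "AE x in lebesgue. (%k. f n x - f (r k) x) \<longlonglongrightarrow> f n x - g x"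
     using lim by eventually_elim (auto intro!: tendsto_intros)
    show "\<forall>\<^sub>F k in sequentially. Ipow s (%x. f n x - f (r k) x) <= ennreal e"
     unfolding eventually_sequentially
     by (rule exI[of _ N]) (auto intro!: N n order_trans[OF _ seq_suble[OF rmono]])
   qed (use s in auto)
   then show "Ipow s (%x. f n x - g x) < a" using e(2) by simp
  qed
 qed auto
 then show ?thesis using g rmono lim by blast
qed

lemma tendsto0_ennreal_small:
 fixes X :: "nat => ennreal"
 assumes "X \<longlonglongrightarrow> 0" "0 < (e::real)"
 shows "\<exists>N. \<forall>n\<ge>N. X n <= ennreal e"
proof -
 have "\<forall>\<^sub>F n in sequentially. X n < ennreal e"
  using assms by (intro order_tendstoD(2)) auto
 then show ?thesis unfolding eventually_sequentially by (meson less_imp_le)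
qed

lemma Ipow_Cauchy:
 fixes f :: "nat => real^'n => complex"
 assumes [measurable]: "!!n. f n \<in> Meas" "g \<in> Meas" and s: "0 < s"
  and lim: "(%n. Ipow s (%x. f n x - g x)) \<longlonglongrightarrow> 0" and e: "0 < (e::real)"
 shows "\<exists>N. \<forall>m\<ge>N. \<forall>n\<ge>N. Ipow s (%x. f m x - f n x) <= ennreal e"
proof -
 define e' where "e' = e / (2 * 2 powr s)"
 have e': "0 < e'" using e by (simp add: e'_def)
 obtain N where N: "!!n. n \<ge> N ==> Ipow s (%x. f n x - g x) <= ennreal e'"
  using tendsto0_ennreal_small[OF lim e'] by blast
 have "Ipow s (%x. f m x - f n x) <= ennreal e" if "m \<ge> N" "n \<ge> N" for m n
 proof -
  have "Ipow s (%x. (f m x - g x) - (f n x - g x)) <=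
    ennreal (2 powr s) * (Ipow s (%x. f m x - g x) + Ipow s (%x. f n x - g x))"
   using s by (intro Ipow_diff) auto
  also have "... <= ennreal (2 powr s) * (ennreal e' + ennreal e')"
   using N that by (intro mult_left_mono add_mono) auto
  also have "... = ennreal e"
   using e' by (simp add: e'_def flip: ennreal_plus ennreal_mult)
  finally show ?thesis by simp
 qed
 then show ?thesis by blast
qed

lemma Ipow_tendsto_AE_subseq:
 fixes f :: "nat => real^'n => complex"
 assumes m: "!!n. f n \<in> Meas" and g[measurable]: "g \<in> Meas" and s: "0 < s"
  and lim: "(%n. Ipow s (%x. f n x - g x)) \<longlonglongrightarrow> 0"
 shows "\<exists>r. strict_mono r \<and> (AE x in lebesgue. (%n. f (r n) x) \<longlonglongrightarrow> g x)"
proof -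
 note m[measurable]
 obtain h r where h[measurable]: "h \<in> Meas" and r: "strict_mono r"
  and ae: "AE x in lebesgue. (%n. f (r n) x) \<longlonglongrightarrow> h x" and lim2: "(%n. Ipow s (%x. f n x - h x)) \<longlonglongrightarrow> 0"
  using Ipow_Cauchy_complete[OF m s Ipow_Cauchy[OF m g s lim]] by blast
 have "Ipow s (%x. g x - h x) = 0"
  using Ipow_limit_unique[OF m g h s lim lim2] .
 then have "AE x in lebesgue. g x = h x"
  using Ipow_eq_0_iff[of "%x. g x - h x" s] by auto
 with ae have "AE x in lebesgue. (%n. f (r n) x) \<longlonglongrightarrow> g x"
  by eventually_elim auto
 with r show ?thesis by blast
qed

lemma Ipow2: "Ipow 2 f = (NN x. (enorm (f x))\<^sup>2)"
 unfolding Ipow_def by (intro nn_integral_cong) (simp add: ennreal_power)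

lemma Ipow2_mult:
 assumes [measurable]: "f \<in> Meas" "g \<in> Meas"
 shows "(NN x. enorm (f x * g x))\<^sup>2 <= Ipow 2 f * Ipow 2 g"
proof -
 have "(NN x. enorm (f x * g x)) = (NN x. enorm (f x) * enorm (g x))"
  by (intro nn_integral_cong) (simp add: norm_mult ennreal_mult)
 then show ?thesis using Cauchy_Schwarz_nn_integral[of "%x. enorm (f x)" lebesgue "%x. enorm (g x)"]
  by (simp add: Ipow2)
qed

lemma L2_integrable_mult:
 assumes "f \<in> Lp 2" "g \<in> Lp 2"
 shows "integrable lebesgue (%x. f x * g x)"
proof -
 have m[measurable]: "f \<in> Meas" "g \<in> Meas"
  using assms by (auto simp: mem_Lp2_iff)
 have "(NN x. enorm (f x * g x))\<^sup>2 < \<infinity>"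
  using Ipow2_mult[OF m] assms by (auto simp: mem_Lp2_iff ennreal_mult_less_top intro: le_less_trans)
 then have "(NN x. enorm (f x * g x)) < \<infinity>"
  by (simp only: infinity_ennreal_def power_less_top_ennreal) simp
 then show ?thesis by (intro integrableI_bounded) auto
qed

lemma integrable_ennreal_bound:
 fixes f :: "'a => complex"
 shows "enorm (integral\<^sup>L M f) <= (\<integral>\<^sup>+x. enorm (f x) \<partial>M)"
proof (cases "integrable M f")
 case True
 have "enorm (integral\<^sup>L M f) <= ennreal (integral\<^sup>L M (%x. cmod (f x)))"
  by (intro ennreal_leI integral_norm_bound)
 also have "... = (\<integral>\<^sup>+x. enorm (f x) \<partial>M)"
  using True by (subst nn_integral_eq_integral) auto
 finally show ?thesis .
qed (simp add: not_integrable_integral_eq)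

lemma L2_Cauchy_Schwarz:
 assumes "f \<in> Lp 2" "g \<in> Lp 2"
 shows "(enorm (LINT x|lebesgue. f x * g x))\<^sup>2 <= Ipow 2 f * Ipow 2 g"
proof -
 have "(enorm (LINT x|lebesgue. f x * g x))\<^sup>2 <= (NN x. enorm (f x * g x))\<^sup>2"
  by (intro power_mono integrable_ennreal_bound) auto
 also have "... <= Ipow 2 f * Ipow 2 g"
  using assms by (intro Ipow2_mult) (auto simp: mem_Lp2_iff)
 finally show ?thesis .
qed

lemma L2_integral_tendsto:
 assumes "!!n. f n \<in> Lp 2" "h \<in> Lp 2" "g \<in> Lp 2" and lim: "(%n. Ipow 2 (%x. f n x - h x)) \<longlonglongrightarrow> 0"
 shows "(%n. LINT x|lebesgue. f n x * g x) \<longlonglongrightarrow> (LINT x|lebesgue. h x * g x)"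
proof -
 have d: "(%x. f n x - h x) \<in> Lp 2" for n
  using Lp_diff[of 2 "f n" h] assms by simp
 have gf: "Ipow 2 g < \<infinity>" using assms by (simp add: mem_Lp2_iff)
 have eq: "(LINT x|lebesgue. f n x * g x) - (LINT x|lebesgue. h x * g x) = (LINT x|lebesgue. (f n x - h x) * g x)" for n
  using L2_integrable_mult[OF assms(1,3)] L2_integrable_mult[OF assms(2,3)] by (simp add: left_diff_distrib)
 have "(%n. Ipow 2 g * Ipow 2 (%x. f n x - h x)) \<longlonglongrightarrow> Ipow 2 g * 0"
  using gf by (intro ennreal_tendsto_cmult lim) auto
 then have z: "(%n. Ipow 2 g * Ipow 2 (%x. f n x - h x)) \<longlonglongrightarrow> 0" by simp
 have b: "ennreal ((cmod ((LINT x|lebesgue. f n x * g x) - (LINT x|lebesgue. h x * g x)))\<^sup>2) <= Ipow 2 g * Ipow 2 (%x. f n x - h x)" for n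
  using L2_Cauchy_Schwarz[OF d assms(3), of n] unfolding eq by (simp add: ennreal_power mult.commute)
 have "(%n. ennreal ((cmod ((LINT x|lebesgue. f n x * g x) - (LINT x|lebesgue. h x * g x)))\<^sup>2)) \<longlonglongrightarrow> ennreal 0"
  using tendsto_sandwich[of "%n. 0" _ sequentially, OF _ _ tendsto_const z] b by auto
 then have "(%n. (cmod ((LINT x|lebesgue. f n x * g x) - (LINT x|lebesgue. h x * g x)))\<^sup>2) \<longlonglongrightarrow> 0"
  by (subst (asm) tendsto_ennreal_iff) auto
 then have "(%n. cmod ((LINT x|lebesgue. f n x * g x) - (LINT x|lebesgue. h x * g x))) \<longlonglongrightarrow> 0"
  using tendsto_real_sqrt[of _ 0 sequentially] by fastforce
 then show ?thesis
  by (simp add: LIM_zero_iff tendsto_norm_zero_iff)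
qed

lemma set_L2_integrable:
 assumes "f \<in> Lp 2" "S \<in> sets lebesgue" "bounded S"
 shows "integrable lebesgue (%x. f x * indicator S x)"
proof -
 have "(%x. indicator S x :: complex) \<in> Lp (ennreal 2)"
  using assms by (intro Lp_bounded_support[of 2 _ 1 S]) (auto simp: indicator_def)
 then show ?thesis using L2_integrable_mult[OF assms(1)] by simp
qed

text \<open>Raising the norm inequality to the power \<open>s\<close> removes the roots from the definition.\<close>

lemma bounded_linear_Lp_iff:
 fixes T :: "(real^'n => complex) => real^'n => complex"
 assumes s: "0 < s"
 shows "bounded_linear_Lp (ennreal s) T \<longleftrightarrow>
   (\<forall>f\<in>Lp (ennreal s). T f \<in> Lp (ennreal s)) \<and>
   (\<forall>f\<in>Lp (ennreal s). \<forall>g\<in>Lp (ennreal s). \<forall>a b.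
    AE x in lebesgue. T (%y. a * f y + b * g y) x = a * T f x + b * T g x) \<and>
   (\<exists>C::real. 0 < C \<and> (\<forall>f\<in>Lp (ennreal s). Ipow s (T f) <= ennreal C * Ipow s f))"
 (is "?L \<longleftrightarrow> ?A \<and> ?B \<and> ?C")
proof -
 have *: "(\<forall>f\<in>Lp (ennreal s). Lp_norm lebesgue (ennreal s) (%x. enorm (T f x))
     <= ennreal B * Lp_norm lebesgue (ennreal s) (%x. enorm (f x))) \<longleftrightarrow>
    (\<forall>f\<in>Lp (ennreal s). Ipow s (T f) <= ennreal (B powr s) * Ipow s f)" if B: "0 <= B" for B
 proof (intro ball_cong refl)
  fix f :: "real^'n => complex" assume f: "f \<in> Lp (ennreal s)"
  have "enn_powr (Ipow s (T f)) (1 / s) <= ennreal B * enn_powr (Ipow s f) (1 / s) \<longleftrightarrow>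
    Ipow s (T f) <= enn_powr (ennreal B * enn_powr (Ipow s f) (1 / s)) s"
   using s by (subst enn_powr_le_iff) auto
  also have "enn_powr (ennreal B * enn_powr (Ipow s f) (1 / s)) s = ennreal (B powr s) * Ipow s f"
   using f s B by (subst enn_powr_mult) (auto simp: enn_powr_ennreal enn_powr_powr mem_Lp_iff)
  finally show "(Lp_norm lebesgue (ennreal s) (%x. enorm (T f x))
     <= ennreal B * Lp_norm lebesgue (ennreal s) (%x. enorm (f x))) \<longleftrightarrow>
    Ipow s (T f) <= ennreal (B powr s) * Ipow s f"
   using s by (simp add: Lp_norm_Ipow)
 qed
 have "(\<exists>B::real. \<forall>f\<in>Lp (ennreal s). Lp_norm lebesgue (ennreal s) (%x. enorm (T f x))
     <= ennreal B * Lp_norm lebesgue (ennreal s) (%x. enorm (f x))) \<longleftrightarrow> ?C" (is "?N \<longleftrightarrow> ?C")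
 proof
  assume ?N
  then obtain B where B: "\<forall>f\<in>Lp (ennreal s). Lp_norm lebesgue (ennreal s) (%x. enorm (T f x))
     <= ennreal B * Lp_norm lebesgue (ennreal s) (%x. enorm (f x))" by blast
  have X: "ennreal B * X <= ennreal (\<bar>B\<bar> + 1) * X" for X
   by (intro mult_right_mono ennreal_leI) auto
  have "\<forall>f\<in>Lp (ennreal s). Lp_norm lebesgue (ennreal s) (%x. enorm (T f x))
     <= ennreal (\<bar>B\<bar> + 1) * Lp_norm lebesgue (ennreal s) (%x. enorm (f x))"
   using B by (blast intro: order_trans X)
  then have "\<forall>f\<in>Lp (ennreal s). Ipow s (T f) <= ennreal ((\<bar>B\<bar> + 1) powr s) * Ipow s f"
   by (subst (asm) *) auto
  then show ?C by (intro exI[of _ "(\<bar>B\<bar> + 1) powr s"]) auto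
 next
  assume ?C
  then obtain C where C: "0 < C" "\<forall>f\<in>Lp (ennreal s). Ipow s (T f) <= ennreal C * Ipow s f" by blast
  then show ?N
   using *[of "C powr (1/s)"] s by (intro exI[of _ "C powr (1/s)"]) (auto simp: powr_powr)
 qed
 then show ?thesis unfolding bounded_linear_Lp_def by blast
qed

lemma bounded_linear_L2_iff:
 "bounded_linear_Lp 2 T \<longleftrightarrow>
   (\<forall>f\<in>Lp 2. T f \<in> Lp 2) \<and>
   (\<forall>f\<in>Lp 2. \<forall>g\<in>Lp 2. \<forall>a b.
    AE x in lebesgue. T (%y. a * f y + b * g y) x = a * T f x + b * T g x) \<and>
   (\<exists>C::real. 0 < C \<and> (\<forall>f\<in>Lp 2. Ipow 2 (T f) <= ennreal C * Ipow 2 f))"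
 using bounded_linear_Lp_iff[of 2 T] by simp

section \<open>The transpose on \<open>L\<^sup>2\<close>\<close>

definition L2sq :: "(real^'n => complex) => real" where
 "L2sq f = Re (LINT x|lebesgue. f x * cnj (f x))"

lemma Lp2_add: "f \<in> Lp 2 ==> g \<in> Lp 2 ==> (%x. f x + g x) \<in> Lp 2"
 using Lp_add[of 2 f g] by simp
lemma Lp2_diff: "f \<in> Lp 2 ==> g \<in> Lp 2 ==> (%x. f x - g x) \<in> Lp 2"
 using Lp_diff[of 2 f g] by simp
lemma Lp2_cmult: "f \<in> Lp 2 ==> (%x. a * f x) \<in> Lp 2"
 using Lp_cmult[of 2 f a] by simp
lemma Lp2_cnj: "f \<in> Lp 2 ==> (%x. cnj (f x)) \<in> Lp 2"
 using Lp_cnj[of 2 f] by simp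
lemma Lp2_lincomb: "f \<in> Lp 2 ==> g \<in> Lp 2 ==> (%x. a * f x + b * g x) \<in> Lp 2"
 using Lp_lincomb[of 2 f g a b] by simp
lemma Lp2_measurable: "f \<in> Lp 2 ==> f \<in> Meas"
 by (simp add: mem_Lp2_iff)

lemma Ipow2_L2sq:
 assumes "f \<in> Lp 2"
 shows "Ipow 2 f = ennreal (L2sq f)"
proof -
 have [measurable]: "f \<in> Meas" using assms by (rule Lp2_measurable)
 have int: "integrable lebesgue (%x. f x * cnj (f x))"
  using L2_integrable_mult[OF assms Lp2_cnj[OF assms]] .
 have eq: "Re (f x * cnj (f x)) = (cmod (f x))\<^sup>2" for x
  by (simp add: complex_mult_cnj cmod_power2)
 have "integrable lebesgue (%x. (cmod (f x))\<^sup>2)"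
  using integrable_Re[OF int] unfolding eq .
 moreover have "L2sq f = (LINT x|lebesgue. (cmod (f x))\<^sup>2)"
  unfolding L2sq_def using int by (simp only: integral_Re[symmetric] eq)
 ultimately show ?thesis
  by (simp add: Ipow2 ennreal_power nn_integral_eq_integral)
qed

lemma L2sq_nonneg: "0 <= L2sq f"
proof -
 have "Re (f x * cnj (f x)) = (cmod (f x))\<^sup>2" for x
  by (simp add: complex_mult_cnj cmod_power2)
 then show ?thesis
  unfolding L2sq_def
  by (cases "integrable lebesgue (%x. f x * cnj (f x))")
    (auto simp: not_integrable_integral_eq simp flip: integral_Re intro!: integral_nonneg_AE)
qed

lemma L2sq_add:
 assumes "f \<in> Lp 2" "g \<in> Lp 2"
 shows "L2sq (%x. f x + of_real t * g x) =
   L2sq f + 2 * t * Re (LINT x|lebesgue. f x * cnj (g x)) + t\<^sup>2 * L2sq g"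
proof -
 have i: "integrable lebesgue (%x. f x * cnj (f x))" "integrable lebesgue (%x. f x * cnj (g x))"
   "integrable lebesgue (%x. cnj (f x * cnj (g x)))" "integrable lebesgue (%x. g x * cnj (g x))"
  using assms L2_integrable_mult Lp2_cnj by (auto simp del: complex_cnj_mult)
 have "(f x + of_real t * g x) * cnj (f x + of_real t * g x) =
  f x * cnj (f x) + (of_real t * (f x * cnj (g x)) + (of_real t * cnj (f x * cnj (g x)) + of_real (t\<^sup>2) * (g x * cnj (g x))))" for x
  by (simp add: algebra_simps power2_eq_square)
 then have "L2sq (%x. f x + of_real t * g x) = Re ((LINT x|lebesgue. f x * cnj (f x)) +
   (of_real t * (LINT x|lebesgue. f x * cnj (g x)) +
    (of_real t * (LINT x|lebesgue. cnj (f x * cnj (g x))) + of_real (t\<^sup>2) * (LINT x|lebesgue. g x * cnj (g x)))))"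
  unfolding L2sq_def using i by (simp del: complex_cnj_mult)
 also have "(LINT x|lebesgue. cnj (f x * cnj (g x))) = cnj (LINT x|lebesgue. f x * cnj (g x))"
  by (simp del: complex_cnj_mult)
 finally show ?thesis unfolding L2sq_def by simp
qed

text \<open>The representing function is the minimiser of \<open>\<parallel>f\<parallel>\<^sup>2 / 2 - Re \<Lambda> f\<close>: the parallelogram law makes minimising
 sequences Cauchy, and the first variation of the functional at the minimiser is the representation.\<close>

lemma L2_Riesz:
 fixes \<Lambda> :: "(real^'n => complex) => complex"
 assumes lin: "!!f g a b. f \<in> Lp 2 ==> g \<in> Lp 2 ==> \<Lambda> (%x. a * f x + b * g x) = a * \<Lambda> f + b * \<Lambda> g"
  and bnd: "!!f. f \<in> Lp 2 ==> (cmod (\<Lambda> f))\<^sup>2 <= C * L2sq f" and C: "0 <= C"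
 shows "\<exists>w\<in>Lp 2. \<forall>f\<in>Lp 2. \<Lambda> f = (LINT x|lebesgue. f x * w x)"
proof -
 define \<phi> where "\<phi> f = L2sq f / 2 - Re (\<Lambda> f)" for f
 have ge: "- (C / 2) <= \<phi> f" if "f \<in> Lp 2" for f
 proof -
  have "(cmod (\<Lambda> f))\<^sup>2 <= (L2sq f / 2 + C / 2)\<^sup>2"
   using bnd[OF that] sum_squares_ge_zero[of "L2sq f / 2 - C / 2" 0]
   by (simp add: power2_eq_square algebra_simps)
  then have "cmod (\<Lambda> f) <= L2sq f / 2 + C / 2"
   by (rule power2_le_imp_le) (use L2sq_nonneg[of f] C in auto)
  then show ?thesis using complex_Re_le_cmod[of "\<Lambda> f"] by (simp add: \<phi>_def)
 qed
 have zero: "(%x::real^'n. 0::complex) \<in> Lp 2"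
  by (simp add: mem_Lp2_iff Ipow_def)
 define m where "m = Inf (\<phi> ` Lp 2)"
 have bdd: "bdd_below (\<phi> ` Lp 2)" using ge by (auto intro!: bdd_belowI)
 have mle: "m <= \<phi> f" if "f \<in> Lp 2" for f
  unfolding m_def using that bdd by (intro cInf_lower) auto
 have "\<exists>f\<in>Lp 2. \<phi> f < m + 1 / real (Suc n)" for n
 proof -
  have "\<exists>y\<in>\<phi> ` Lp 2. y < m + 1 / real (Suc n)"
   using zero bdd by (subst cInf_less_iff[symmetric]) (auto simp: m_def)
  then show ?thesis by blast
 qed
 then obtain F where F: "!!n. F n \<in> Lp 2" and F\<phi>: "!!n. \<phi> (F n) < m + 1 / real (Suc n)"
  by metis
 have Fm[measurable]: "F n \<in> Meas" for n using F by (rule Lp2_measurable)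
 have aux: "4 * p + 4 * q - 8 * r <= 4 * (m + a) + 4 * (m + b) - 8 * m"
  if "m <= r" "p < m + a" "q < m + b" for p q r a b m :: real
 proof -
  have "4 * p + 4 * q - 8 * r <= 4 * (m + a) + 4 * (m + b) - 8 * r"
   using that by (intro diff_right_mono add_mono mult_left_mono) auto
  then show ?thesis using that(1) by simp
 qed
 have par: "L2sq (%x. F j x - F k x) <= 4 / real (Suc j) + 4 / real (Suc k)" for j k
 proof -
  let ?f = "F j" and ?g = "F k"
  have h: "(%x. (1/2) * ?f x + (1/2) * ?g x) \<in> Lp 2" using F by (intro Lp2_lincomb)
  have "L2sq (%x. (1/2) * (?f x + ?g x)) = L2sq (%x. ?f x + ?g x) / 4"
   unfolding L2sq_def by simp
  then have a: "L2sq (%x. (1/2) * ?f x + (1/2) * ?g x) = L2sq (%x. ?f x + ?g x) / 4"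
   by (simp add: add_divide_distrib)
  have b: "\<Lambda> (%x. (1/2) * ?f x + (1/2) * ?g x) = (1/2) * \<Lambda> ?f + (1/2) * \<Lambda> ?g"
   using F by (intro lin)
  have "L2sq (%x. ?f x - ?g x) = 2 * L2sq ?f + 2 * L2sq ?g - L2sq (%x. ?f x + ?g x)"
   using L2sq_add[OF F F, of j 1 k] L2sq_add[OF F F, of j "-1" k] by simp
  also have "... = 4 * \<phi> ?f + 4 * \<phi> ?g - 8 * \<phi> (%x. (1/2) * ?f x + (1/2) * ?g x)"
   unfolding \<phi>_def a b by (simp add: algebra_simps)
  also have "... <= 4 * (m + 1 / real (Suc j)) + 4 * (m + 1 / real (Suc k)) - 8 * m"
   by (rule aux[OF mle[OF h] F\<phi>[of j] F\<phi>[of k]])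
  finally show ?thesis by simp
 qed
 have "\<exists>N. \<forall>i\<ge>N. \<forall>n\<ge>N. Ipow 2 (%x. F i x - F n x) <= ennreal e" if e: "e > 0" for e
 proof -
  obtain N :: nat where N: "8 / e < real N" using reals_Archimedean2 by blast
  have Npos: "N > 0" using N e by (metis divide_pos_pos gr0I less_trans not_less_iff_gr_or_eq of_nat_0 zero_less_numeral)
  have "4 / real (Suc i) <= e / 2" if "i \<ge> N" for i
  proof -
   have "8 / e < real (Suc i)" using N that by linarith
   then show ?thesis using e by (simp add: field_simps)
  qed
  note small = this
  have "Ipow 2 (%x. F i x - F n x) <= ennreal e" if "i \<ge> N" "n \<ge> N" for i n
  proof -
   have "L2sq (%x. F i x - F n x) <= e / 2 + e / 2"
    by (rule order_trans[OF par add_mono[OF small[OF that(1)] small[OF that(2)]]])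
   then show ?thesis using Ipow2_L2sq[OF Lp2_diff[OF F F], of i n] by (simp add: ennreal_leI)
  qed
  then show ?thesis by blast
 qed
 from Ipow_Cauchy_complete[OF Fm _ this]
 obtain w0 where w0m[measurable]: "w0 \<in> Meas" and lim: "(%n. Ipow 2 (%x. F n x - w0 x)) \<longlonglongrightarrow> 0"
  by auto
 have w0: "w0 \<in> Lp 2"
 proof -
  obtain N where N: "Ipow 2 (%x. F N x - w0 x) <= ennreal 1"
   using tendsto0_ennreal_small[OF lim, of 1] by auto
  then have d: "(%x. F N x - w0 x) \<in> Lp 2" by (auto simp: mem_Lp2_iff intro: le_less_trans)
  from Lp2_diff[OF F[of N] d] show ?thesis by simp
 qed
 have Re: "Re (LINT x|lebesgue. w0 x * cnj (g x)) = Re (\<Lambda> g)" if g: "g \<in> Lp 2" for g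
 proof -
  define a where "a = Re (LINT x|lebesgue. w0 x * cnj (g x)) - Re (\<Lambda> g)"
  have q: "0 <= t * a + t\<^sup>2 * (L2sq g / 2)" for t :: real
  proof -
   have "- (1 / real (Suc n)) <= t * (Re (LINT x|lebesgue. F n x * cnj (g x)) - Re (\<Lambda> g)) + t\<^sup>2 * (L2sq g / 2)" for n
   proof -
    have "(%x. F n x + of_real t * g x) \<in> Lp 2"
     using Lp2_lincomb[OF F g, of 1 n "of_real t"] by simp
    from mle[OF this] have "m <= L2sq (%x. F n x + of_real t * g x) / 2 - Re (\<Lambda> (%x. F n x + of_real t * g x))"
     by (simp add: \<phi>_def)
    also have "\<Lambda> (%x. F n x + of_real t * g x) = \<Lambda> (F n) + of_real t * \<Lambda> g"
     using lin[OF F g, of 1 n "of_real t"] by simp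
    finally have "m <= \<phi> (F n) + t * (Re (LINT x|lebesgue. F n x * cnj (g x)) - Re (\<Lambda> g)) + t\<^sup>2 * (L2sq g / 2)"
     unfolding L2sq_add[OF F g] \<phi>_def by (simp add: algebra_simps add_divide_distrib)
    then show ?thesis using F\<phi>[of n] by simp
   qed
   moreover have "(%n. t * (Re (LINT x|lebesgue. F n x * cnj (g x)) - Re (\<Lambda> g)) + t\<^sup>2 * (L2sq g / 2))
     \<longlonglongrightarrow> t * a + t\<^sup>2 * (L2sq g / 2)"
    unfolding a_def using L2_integral_tendsto[OF F w0 Lp2_cnj[OF g] lim]
    by (intro tendsto_intros)
   moreover have "(%n. - (1 / real (Suc n))) \<longlonglongrightarrow> - 0"
    using LIMSEQ_inverse_real_of_nat by (intro tendsto_minus) (simp add: inverse_eq_divide)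
   ultimately show ?thesis
    by (intro LIMSEQ_le[of "%n. - (1 / real (Suc n))" 0]) auto
  qed
  have "a = 0"
  proof (rule ccontr)
   assume a: "a ~= 0"
   define b where "b = L2sq g / 2 + 1"
   have b: "b > 0" "L2sq g / 2 < b" using L2sq_nonneg[of g] by (auto simp: b_def)
   have "0 <= - (a / b) * a + (- (a / b))\<^sup>2 * (L2sq g / 2)" by (rule q)
   also have "... < - (a / b) * a + (- (a / b))\<^sup>2 * b"
    using a b by (intro add_strict_left_mono mult_strict_left_mono) auto
   also have "... = 0" using b by (simp add: power2_eq_square)
   finally show False by simp
  qed
  then show ?thesis by (simp add: a_def)
 qed
 have full: "\<Lambda> g = (LINT x|lebesgue. g x * cnj (w0 x))" if g: "g \<in> Lp 2" for g
 proof -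
  have ig: "(%x. \<i> * g x) \<in> Lp 2" using g by (rule Lp2_cmult)
  have "\<Lambda> (%x. \<i> * g x) = \<i> * \<Lambda> g" using lin[OF g g, of \<i> 0] by simp
  then have "Re (LINT x|lebesgue. - \<i> * (w0 x * cnj (g x))) = Re (\<i> * \<Lambda> g)"
   using Re[OF ig] by (simp add: mult_ac)
  then have Im: "Im (LINT x|lebesgue. w0 x * cnj (g x)) = - Im (\<Lambda> g)"
   by (subst (asm) integral_mult_right_zero) simp
  have "(LINT x|lebesgue. cnj (w0 x * cnj (g x))) = cnj (LINT x|lebesgue. w0 x * cnj (g x))"
   by (simp del: complex_cnj_mult)
  then have "(LINT x|lebesgue. g x * cnj (w0 x)) = cnj (LINT x|lebesgue. w0 x * cnj (g x))"
   by (simp add: mult.commute)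
  also have "... = \<Lambda> g" using Im Re[OF g] by (simp add: complex_eq_iff)
  finally show ?thesis by simp
 qed
 show ?thesis using full Lp2_cnj[OF w0] by (intro bexI[of _ "%x. cnj (w0 x)"]) auto
qed

lemma bounded_linear_Lp_mem: "bounded_linear_Lp s T ==> f \<in> Lp s ==> T f \<in> Lp s"
 by (simp add: bounded_linear_Lp_def)

lemma bounded_linear_Lp_lin: "bounded_linear_Lp s T ==> f \<in> Lp s ==> g \<in> Lp s ==>
  AE x in lebesgue. T (%y. a * f y + b * g y) x = a * T f x + b * T g x"
 by (simp add: bounded_linear_Lp_def)

lemma bounded_linear_L2_bound:
 assumes "bounded_linear_Lp 2 T"
 obtains C :: real where "0 < C" "!!f. f \<in> Lp 2 ==> Ipow 2 (T f) <= ennreal C * Ipow 2 f"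
 using assms unfolding bounded_linear_L2_iff by blast

lemma transpose_exists:
 assumes T: "bounded_linear_Lp 2 T"
 shows "\<exists>T'. is_transpose T T'"
proof -
 obtain C where C: "0 < C" "!!f. f \<in> Lp 2 ==> Ipow 2 (T f) <= ennreal C * Ipow 2 f"
  using bounded_linear_L2_bound[OF T] by blast
 note Tmem = bounded_linear_Lp_mem[OF T] and Tlin = bounded_linear_Lp_lin[OF T]
 have "\<exists>w\<in>Lp 2. \<forall>u\<in>Lp 2. (LINT x|lebesgue. T u x * v x) = (LINT x|lebesgue. u x * w x)" if v: "v \<in> Lp 2" for v
 proof (rule L2_Riesz[where C="C * L2sq v"])
  fix f g :: "real^'a => complex" and a b assume fg: "f \<in> Lp 2" "g \<in> Lp 2"
  have [measurable]: "T (%x. a * f x + b * g x) \<in> Meas" "T f \<in> Meas"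
    "T g \<in> Meas" "v \<in> Meas"
   using fg v by (auto intro!: Lp2_measurable Tmem Lp2_lincomb)
  have "(LINT x|lebesgue. T (%x. a * f x + b * g x) x * v x) = (LINT x|lebesgue. (a * (T f x * v x) + b * (T g x * v x)))"
  proof (rule integral_cong_AE)
   show "AE x in lebesgue. T (%x. a * f x + b * g x) x * v x = a * (T f x * v x) + b * (T g x * v x)"
    using Tlin[OF fg, of a b] by eventually_elim (simp add: algebra_simps)
  qed auto
  also have "... = a * (LINT x|lebesgue. T f x * v x) + b * (LINT x|lebesgue. T g x * v x)"
   using L2_integrable_mult[OF Tmem[OF fg(1)] v] L2_integrable_mult[OF Tmem[OF fg(2)] v] by simp
  finally show "(LINT x|lebesgue. T (%x. a * f x + b * g x) x * v x) =
    a * (LINT x|lebesgue. T f x * v x) + b * (LINT x|lebesgue. T g x * v x)" .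
 next
  fix f :: "real^'a => complex" assume f: "f \<in> Lp 2"
  have "(enorm (LINT x|lebesgue. T f x * v x))\<^sup>2 <= Ipow 2 (T f) * Ipow 2 v"
   using L2_Cauchy_Schwarz[OF Tmem[OF f] v] .
  also have "... <= (ennreal C * Ipow 2 f) * Ipow 2 v"
   by (intro mult_right_mono C f) auto
  finally show "(cmod (LINT x|lebesgue. T f x * v x))\<^sup>2 <= C * L2sq v * L2sq f"
   using C(1) by (simp add: Ipow2_L2sq f v ennreal_power L2sq_nonneg mult_ac flip: ennreal_mult)
 qed (use C(1) L2sq_nonneg[of v] in auto)
 then obtain T' where "!!v. v \<in> Lp 2 ==> T' v \<in> Lp 2 \<and> (\<forall>u\<in>Lp 2. (LINT x|lebesgue. T u x * v x) = (LINT x|lebesgue. u x * T' v x))"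
  by metis
 then show ?thesis unfolding is_transpose_def by blast
qed

lemma L2_eq_0_AE:
 assumes "f \<in> Lp 2" "!!u. u \<in> Lp 2 ==> (LINT x|lebesgue. u x * f x) = 0"
 shows "AE x in lebesgue. f x = 0"
proof -
 have "L2sq f = 0" unfolding L2sq_def using assms(2)[OF Lp2_cnj[OF assms(1)]] by (simp add: mult.commute)
 then show ?thesis using Ipow2_L2sq[OF assms(1)] Ipow_eq_0_iff[OF Lp2_measurable[OF assms(1)], of 2] by simp
qed

text \<open>Test the duality identity with the conjugate of \<open>T' v\<close>.\<close>

lemma transpose_bounded:
 assumes T: "bounded_linear_Lp 2 T" and T': "is_transpose T T'"
 shows "bounded_linear_Lp 2 T'"
proof -
 obtain C where C: "0 < C" "!!f. f \<in> Lp 2 ==> Ipow 2 (T f) <= ennreal C * Ipow 2 f"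
  using bounded_linear_L2_bound[OF T] by blast
 note Tmem = bounded_linear_Lp_mem[OF T]
 have mem: "!!v. v \<in> Lp 2 ==> T' v \<in> Lp 2"
  and eq: "!!u v. u \<in> Lp 2 ==> v \<in> Lp 2 ==> (LINT x|lebesgue. T u x * v x) = (LINT x|lebesgue. u x * T' v x)"
  using T' unfolding is_transpose_def by auto
 show ?thesis unfolding bounded_linear_L2_iff
 proof (intro conjI ballI allI)
  fix f g :: "real^'a => complex" and a b assume fg: "f \<in> Lp 2" "g \<in> Lp 2"
  let ?h = "%y. a * f y + b * g y"
  have h: "?h \<in> Lp 2" using fg by (rule Lp2_lincomb)
  have "AE x in lebesgue. T' ?h x - (a * T' f x + b * T' g x) = 0"
  proof (rule L2_eq_0_AE)
   show "(%x. T' ?h x - (a * T' f x + b * T' g x)) \<in> Lp 2"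
    using fg h by (intro Lp2_diff Lp2_lincomb mem)
   fix u :: "real^'a => complex" assume u: "u \<in> Lp 2"
   have i: "integrable lebesgue (%x. u x * T' ?h x)" "integrable lebesgue (%x. u x * T' f x)" "integrable lebesgue (%x. u x * T' g x)"
     "integrable lebesgue (%x. T u x * f x)" "integrable lebesgue (%x. T u x * g x)"
    using u fg h mem Tmem by (auto intro!: L2_integrable_mult)
   have "(LINT x|lebesgue. u x * (T' ?h x - (a * T' f x + b * T' g x))) =
     (LINT x|lebesgue. u x * T' ?h x - (a * (u x * T' f x) + b * (u x * T' g x)))"
    by (simp add: algebra_simps)
   also have "... = (LINT x|lebesgue. u x * T' ?h x) - (a * (LINT x|lebesgue. u x * T' f x) + b * (LINT x|lebesgue. u x * T' g x))"
    using i by simp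
   also have "... = (LINT x|lebesgue. T u x * ?h x) - (a * (LINT x|lebesgue. T u x * f x) + b * (LINT x|lebesgue. T u x * g x))"
    using eq[OF u h] eq[OF u fg(1)] eq[OF u fg(2)] by simp
   also have "(LINT x|lebesgue. T u x * ?h x) = (LINT x|lebesgue. (a * (T u x * f x) + b * (T u x * g x)))"
    by (simp add: algebra_simps)
   also have "... = a * (LINT x|lebesgue. T u x * f x) + b * (LINT x|lebesgue. T u x * g x)"
    using i by simp
   finally show "(LINT x|lebesgue. u x * (T' ?h x - (a * T' f x + b * T' g x))) = 0" by simp
  qed
  then show "AE x in lebesgue. T' ?h x = a * T' f x + b * T' g x" by simp
 next
  show "\<exists>C::real. 0 < C \<and> (\<forall>f\<in>Lp 2. Ipow 2 (T' f) <= ennreal C * Ipow 2 f)"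
  proof (intro exI conjI ballI)
   fix v :: "real^'a => complex" assume v: "v \<in> Lp 2"
   let ?w = "%x. cnj (T' v x)"
   have w: "?w \<in> Lp 2" using v by (intro Lp2_cnj mem)
   have X: "(LINT x|lebesgue. T ?w x * v x) = of_real (L2sq (T' v))"
   proof -
    have "(LINT x|lebesgue. T' v x * cnj (T' v x)) = of_real (Re (LINT x|lebesgue. T' v x * cnj (T' v x)))"
     by (subst complex_eq_iff) (use L2_integrable_mult[OF mem[OF v] w] in \<open>simp flip: integral_Im\<close>)
    then show ?thesis unfolding L2sq_def using eq[OF w v] by (simp add: mult.commute)
   qed
   have "(enorm (LINT x|lebesgue. T ?w x * v x))\<^sup>2 <= Ipow 2 (T ?w) * Ipow 2 v"
    using L2_Cauchy_Schwarz[OF Tmem[OF w] v] .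
   also have "... <= (ennreal C * Ipow 2 ?w) * Ipow 2 v"
    by (intro mult_right_mono C w) auto
   also have "Ipow 2 ?w = Ipow 2 (T' v)" by (simp add: Ipow_def)
   finally have "(L2sq (T' v))\<^sup>2 <= C * L2sq (T' v) * L2sq v"
    using C(1) unfolding X by (simp add: Ipow2_L2sq mem v ennreal_power L2sq_nonneg flip: ennreal_mult)
   then have "L2sq (T' v) <= C * L2sq v"
    using L2sq_nonneg[of "T' v"] L2sq_nonneg[of v] C(1)
    by (cases "L2sq (T' v) = 0") (auto simp: power2_eq_square mult_ac)
   then show "Ipow 2 (T' v) <= ennreal C * Ipow 2 v"
    using C(1) by (simp add: Ipow2_L2sq mem v L2sq_nonneg ennreal_leI flip: ennreal_mult)
  qed (rule C(1))
 qed (use mem in auto)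
qed

section \<open>Kernels\<close>

lemma kernel_size:
 "K \<in> standard_kernels \<mu> A ==> x ~= y ==> cmod (K x y) <= A / norm (x - y) ^ CARD('n)"
 for K :: "real^'n => real^'n => complex"
 unfolding standard_kernels_def by blast

lemma kernel_smooth2:
 "K \<in> standard_kernels \<mu> A ==> x ~= y ==> norm (x - y) \<ge> 2 * norm (y - z) ==>
   cmod (K x y - K x z) <= A * (norm (y - z) powr \<mu> / norm (x - y) powr (real CARD('n) + \<mu>))"
 for K :: "real^'n => real^'n => complex"
 unfolding standard_kernels_def by blast

lemma kernel_smooth1:
 "K \<in> standard_kernels \<mu> A ==> x ~= y ==> norm (x - y) \<ge> 2 * norm (x - w) ==>
   cmod (K x y - K w y) <= A * (norm (x - w) powr \<mu> / norm (x - y) powr (real CARD('n) + \<mu>))"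
 for K :: "real^'n => real^'n => complex"
 unfolding standard_kernels_def by blast

lemma standard_kernels_swap:
 fixes K :: "real^'n => real^'n => complex"
 assumes K: "K \<in> standard_kernels \<mu> A"
 shows "(%x y. K y x) \<in> standard_kernels \<mu> A"
 unfolding standard_kernels_def mem_Collect_eq
proof (intro conjI allI impI; (elim conjE)?)
 show "cmod (K y x) <= A / norm (x - y) ^ CARD('n)" if "x ~= y" for x y
  using kernel_size[OF K, of y x] that by (simp add: norm_minus_commute)
 show "cmod (K y x - K z x) <= A * (norm (y - z) powr \<mu> / norm (x - y) powr (real CARD('n) + \<mu>))"
  if "x ~= y" "2 * norm (y - z) <= norm (x - y)" for x y z
  using kernel_smooth1[OF K, of y x z] that by (simp add: norm_minus_commute)
 show "cmod (K y x - K y w) <= A * (norm (x - w) powr \<mu> / norm (x - y) powr (real CARD('n) + \<mu>))"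
  if "x ~= y" "2 * norm (x - w) <= norm (x - y)" for x y w
  using kernel_smooth2[OF K, of y x w] that by (simp add: norm_minus_commute)
qed

text \<open>The two smoothness conditions make a kernel continuous off the diagonal, hence measurable.\<close>

lemma kernel_continuous:
 fixes K :: "real^'n => real^'n => complex"
 assumes K: "K \<in> standard_kernels \<mu> A" and \<mu>: "0 < \<mu>"
 shows "continuous_on {p. fst p ~= snd p} (%p. K (fst p) (snd p))"
proof -
 have op: "open {p::(real^'n) \<times> (real^'n). fst p ~= snd p}"
  by (intro open_Collect_neq continuous_intros)
 have "isCont (%p. K (fst p) (snd p)) (x0, y0)" if ne: "x0 ~= y0" for x0 y0
 proof -
  define F where "F = at (x0, y0)"
  have fx: "(fst \<longlongrightarrow> x0) F" and fy: "(snd \<longlongrightarrow> y0) F"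
   unfolding F_def by (auto intro!: tendsto_eq_intros)
  have l1: "((%p. norm (fst p - snd p) - 2 * norm (fst p - x0)) \<longlongrightarrow> norm (x0 - y0) - 2 * norm (x0 - x0)) F"
   by (intro tendsto_intros fx fy)
  have ev1: "\<forall>\<^sub>F p in F. 0 < norm (fst p - snd p) - 2 * norm (fst p - x0)"
   using order_tendstoD(1)[OF l1, of 0] ne by simp
  have l2: "((%p. norm (x0 - snd p) - 2 * norm (snd p - y0)) \<longlongrightarrow> norm (x0 - y0) - 2 * norm (y0 - y0)) F"
   by (intro tendsto_intros fx fy)
  have ev2: "\<forall>\<^sub>F p in F. 0 < norm (x0 - snd p) - 2 * norm (snd p - y0)"
   using order_tendstoD(1)[OF l2, of 0] ne by simp
  let ?B = "%p. A * (norm (fst p - x0) powr \<mu> / norm (fst p - snd p) powr (real CARD('n) + \<mu>))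
   + A * (norm (snd p - y0) powr \<mu> / norm (x0 - snd p) powr (real CARD('n) + \<mu>))"
  have ev: "\<forall>\<^sub>F p in F. norm (K (fst p) (snd p) - K x0 y0) <= ?B p"
   using ev1 ev2
  proof eventually_elim
   case (elim p)
   have ne1: "fst p ~= snd p" "x0 ~= snd p"
    using elim norm_ge_zero[of "fst p - x0"] norm_ge_zero[of "snd p - y0"] by auto
   have "norm (K (fst p) (snd p) - K x0 y0) <= norm (K (fst p) (snd p) - K x0 (snd p)) + norm (K x0 (snd p) - K x0 y0)"
    using norm_triangle_ineq[of "K (fst p) (snd p) - K x0 (snd p)" "K x0 (snd p) - K x0 y0"] by simp
   also have "... <= ?B p"
    using elim ne1 by (intro add_mono kernel_smooth1[OF K] kernel_smooth2[OF K]) auto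
   finally show ?case .
  qed
  have "(?B \<longlongrightarrow> A * (norm (x0 - x0) powr \<mu> / norm (x0 - y0) powr (real CARD('n) + \<mu>))
   + A * (norm (y0 - y0) powr \<mu> / norm (x0 - y0) powr (real CARD('n) + \<mu>))) F"
   using \<mu> ne by (intro tendsto_intros fx fy tendsto_powr2) (auto simp: eventually_at_filter)
  then have B0: "(?B \<longlongrightarrow> 0) F" using \<mu> by simp
  have "((%p. K (fst p) (snd p) - K x0 y0) \<longlongrightarrow> 0) F"
   by (rule Lim_null_comparison[OF ev B0])
  then show ?thesis
   unfolding isCont_def F_def by (simp add: LIM_zero_iff)
 qed
 then show ?thesis by (auto simp: continuous_on_eq_continuous_at[OF op])
qed

text \<open>Kernels are arbitrary on the diagonal; fixing the value there makes the kernel jointly measurable.\<close>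

definition offdiag :: "(real^'n => real^'n => complex) => real^'n => real^'n => complex" where
 "offdiag K x y = (if x = y then 0 else K x y)"

lemma lebesgue_pair_id: "(%p::(real^'n) \<times> (real^'n). p) \<in> lebesgue \<Otimes>\<^sub>M lebesgue \<rightarrow>\<^sub>M borel"
proof -
 have id: "(%x::real^'n. x) \<in> lebesgue \<rightarrow>\<^sub>M borel" by (intro measurable_completion) simp
 have "(%p::(real^'n) \<times> (real^'n). (fst p, snd p)) \<in> lebesgue \<Otimes>\<^sub>M lebesgue \<rightarrow>\<^sub>M borel \<Otimes>\<^sub>M borel"
  by (intro measurable_Pair measurable_compose[OF measurable_fst id] measurable_compose[OF measurable_snd id])
 then show ?thesis by (simp add: borel_prod)
qed

lemma offdiag_measurable:
 fixes K :: "real^'n => real^'n => complex"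
 assumes K: "K \<in> standard_kernels \<mu> A" and \<mu>: "0 < \<mu>"
 shows "(%p. offdiag K (fst p) (snd p)) \<in> borel_measurable (lebesgue \<Otimes>\<^sub>M lebesgue)"
proof -
 have "(%p. indicator {p. fst p ~= snd p} p *\<^sub>R K (fst p) (snd p)) \<in> borel_measurable borel"
  by (intro borel_measurable_continuous_on_indicator kernel_continuous[OF K \<mu>] borel_open open_Collect_neq continuous_intros)
 then have "(%p. offdiag K (fst p) (snd p)) \<in> borel_measurable borel"
  by (rule measurable_cong[THEN iffD1, rotated]) (auto simp: offdiag_def indicator_def)
 from measurable_compose[OF lebesgue_pair_id this] show ?thesis .
qed

lemma lebesgue_Fubini:
 fixes F :: "real^'n => real^'n => complex"
 assumes m: "(%p. F (fst p) (snd p)) \<in> borel_measurable (lebesgue \<Otimes>\<^sub>M lebesgue)"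
  and fin: "(NN x. (NN y. enorm (F x y))) < \<infinity>"
 shows "(LINT x|lebesgue. LINT y|lebesgue. F x y) = (LINT y|lebesgue. LINT x|lebesgue. F x y)"
  and "integrable lebesgue (%x. LINT y|lebesgue. F x y)"
  and "integrable lebesgue (%y. LINT x|lebesgue. F x y)"
proof -
 have i: "integrable (lebesgue \<Otimes>\<^sub>M lebesgue) (%(x, y). F x y)"
 proof (rule integrableI_bounded)
  have "(\<integral>\<^sup>+p. enorm (F (fst p) (snd p)) \<partial>(lebesgue \<Otimes>\<^sub>M lebesgue)) =
    (NN x. (NN y. enorm (F (fst (x, y)) (snd (x, y)))))"
   using m by (intro leb.nn_integral_fst[symmetric]) auto
  then show "(\<integral>\<^sup>+p. enorm (case p of (x, y) => F x y) \<partial>(lebesgue \<Otimes>\<^sub>M lebesgue)) < \<infinity>"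
   using fin by (simp add: case_prod_beta)
 qed (use m in \<open>simp add: case_prod_beta\<close>)
 show "(LINT x|lebesgue. LINT y|lebesgue. F x y) = (LINT y|lebesgue. LINT x|lebesgue. F x y)"
  using leb2.Fubini_integral[OF i] by simp
 show "integrable lebesgue (%x. LINT y|lebesgue. F x y)"
  using leb2.integrable_fst'[OF i] by simp
 show "integrable lebesgue (%y. LINT x|lebesgue. F x y)"
  using leb2.integrable_snd[OF i] by simp
qed

text \<open>Tested against functions that live at a positive distance from the support, the transpose is given by the transposed
 kernel, by Fubini's theorem.\<close>

lemma transpose_calderon_zygmund:
 fixes K :: "real^'n => real^'n => complex"
 assumes K: "K \<in> standard_kernels \<mu> A" and \<mu>: "0 < \<mu>" and A: "0 < A"
  and T: "calderon_zygmund T K" and T': "is_transpose T T'"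
 shows "calderon_zygmund T' (%x y. K y x)"
proof -
 have T2: "bounded_linear_Lp 2 T" using T by (simp add: calderon_zygmund_def)
 have T'2: "bounded_linear_Lp 2 T'" using transpose_bounded[OF T2 T'] .
 have Tk: "!!f. f \<in> Lp 2 ==> compact (closure {x. f x ~= 0}) ==>
   AE x in lebesgue. x \<notin> closure {x. f x ~= 0} --> T f x = (LINT y|lebesgue. K x y * f y)"
  using T by (auto simp: calderon_zygmund_def)
 have Tmem: "!!f. f \<in> Lp 2 ==> T f \<in> Lp 2" using T2 by (simp add: bounded_linear_Lp_def)
 have mem: "!!v. v \<in> Lp 2 ==> T' v \<in> Lp 2"
  and eq: "!!u v. u \<in> Lp 2 ==> v \<in> Lp 2 ==> (LINT x|lebesgue. T u x * v x) = (LINT x|lebesgue. u x * T' v x)"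
  using T' unfolding is_transpose_def by auto
 note om = offdiag_measurable[OF K \<mu>]
 have "AE x in lebesgue. x \<notin> closure {x. f x ~= 0} --> T' f x = (LINT y|lebesgue. K y x * f y)"
  if f: "f \<in> Lp 2" and cpt: "compact (closure {x. f x ~= 0})" for f
 proof -
  define S where "S = closure {x. f x ~= 0}"
  have S: "compact S" "!!x. f x ~= 0 ==> x \<in> S"
   using cpt closure_subset[of "{x. f x ~= 0}"] unfolding S_def by auto
  have Sm: "S \<in> sets lebesgue" using S(1) by (simp add: compact_imp_closed)
  have [measurable]: "f \<in> Meas" using f by (rule Lp2_measurable)
  have fint: "integrable lebesgue f"
  proof -
   have "(%x. f x * indicator S x) = f" by (rule ext) (use S(2) in \<open>auto simp: indicator_def\<close>)
   then show ?thesis using set_L2_integrable[OF f Sm compact_imp_bounded[OF S(1)]] by simp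
  qed
  define G where "G x = (LINT y|lebesgue. offdiag K y x * f y)" for x
  have pm: "(%p. offdiag K (snd p) (fst p)) \<in> borel_measurable (lebesgue \<Otimes>\<^sub>M lebesgue)"
   using measurable_compose[OF measurable_pair_swap' om] by (simp add: case_prod_beta)
  have fm1: "(%p::(real^'n) \<times> (real^'n). f (fst p)) \<in> borel_measurable (lebesgue \<Otimes>\<^sub>M lebesgue)"
   and fm2: "(%p::(real^'n) \<times> (real^'n). f (snd p)) \<in> borel_measurable (lebesgue \<Otimes>\<^sub>M lebesgue)" by auto
  have Gm[measurable]: "G \<in> Meas"
   unfolding G_def
   by (rule leb.borel_measurable_lebesgue_integral) (use borel_measurable_times[OF pm fm2] in \<open>simp add: case_prod_beta\<close>)
  define D where "D x = T' f x - G x" for x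
  have [measurable]: "D \<in> Meas"
   unfolding D_def using Lp2_measurable[OF mem[OF f]] by measurable
  define E where "E N = cball 0 (real N) \<inter> (\<Inter>y\<in>S. {x. 1 / real (Suc N) <= dist x y})" for N :: nat
  have DE: "AE x in lebesgue. x \<in> E N --> D x = 0" for N
  proof -
   have clE: "closed (E N)"
    unfolding E_def by (intro closed_Int closed_cball closed_INT ballI closed_Collect_le continuous_intros)
   have bE: "bounded (E N)" unfolding E_def by (rule bounded_subset[OF bounded_cball]) auto
   have Em[measurable]: "E N \<in> sets lebesgue" using clE by simp
   define u where "u x = (if x \<in> E N then cnj (D x) / of_real (cmod (D x)) else 0)" for x
   have um[measurable]: "u \<in> Meas" unfolding u_def by measurable
   have ule: "cmod (u x) <= 1 * indicator (E N) x" for x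
    by (auto simp: u_def norm_divide)
   have u: "u \<in> Lp 2" using Lp_bounded_support[of 2 u 1 "E N"] ule bE by simp
   have uint: "integrable lebesgue u"
   proof -
    have "(%x. u x * indicator (E N) x) = u" by (rule ext) (auto simp: u_def indicator_def)
    then show ?thesis using set_L2_integrable[OF u Em bE] by simp
   qed
   have clu: "closure {x. u x ~= 0} \<subseteq> E N"
    using clE by (intro closure_minimal) (auto simp: u_def split: if_splits)
   have cptu: "compact (closure {x. u x ~= 0})"
    using clu bE by (auto simp: compact_eq_bounded_closed intro: bounded_subset)
   have far: "1 / real (Suc N) <= dist x y" if "u x ~= 0" "f y ~= 0" for x y
    using that S(2) by (auto simp: u_def E_def split: if_splits)
   define B where "B = A / (1 / real (Suc N)) ^ CARD('n)"
   have bound: "cmod (offdiag K y x * u x * f y) <= B * (cmod (u x) * cmod (f y))" for x y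
   proof (cases "u x ~= 0 \<and> f y ~= 0")
    case True
    then have d: "1 / real (Suc N) <= norm (y - x)" using far[of x y] by (simp add: dist_norm norm_minus_commute)
    then have ne: "y ~= x" by auto
    have "cmod (K y x) <= A / norm (y - x) ^ CARD('n)" using kernel_size[OF K ne] .
    also have "... <= B" unfolding B_def using d A ne by (intro divide_left_mono power_mono mult_pos_pos zero_less_power) auto
    finally have "cmod (K y x) * (cmod (u x) * cmod (f y)) <= B * (cmod (u x) * cmod (f y))"
     by (intro mult_right_mono) auto
    then show ?thesis using ne by (simp add: offdiag_def norm_mult mult.assoc)
   qed auto
   have um2: "(%p::(real^'n) \<times> (real^'n). u (snd p)) \<in> borel_measurable (lebesgue \<Otimes>\<^sub>M lebesgue)" by auto
   have Fm: "(%p. offdiag K (fst p) (snd p) * u (snd p) * f (fst p)) \<in> borel_measurable (lebesgue \<Otimes>\<^sub>M lebesgue)"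
    by (intro borel_measurable_times om um2 fm1)
   have Ffin: "(NN y. (NN x. enorm (offdiag K y x * u x * f y))) < \<infinity>"
   proof -
    have "(NN y. (NN x. enorm (offdiag K y x * u x * f y))) <=
      (NN y. (NN x. ennreal B * (enorm (u x) * enorm (f y))))"
     using bound A by (intro nn_integral_mono) (auto simp: B_def intro!: ennreal_leI simp flip: ennreal_mult)
    also have "... = ennreal B * (integral\<^sup>N lebesgue (%x. enorm (u x)) * integral\<^sup>N lebesgue (%x. enorm (f x)))"
     by (simp add: nn_integral_cmult nn_integral_multc)
    also have "... < \<infinity>"
     using uint fint by (simp add: integrable_iff_bounded ennreal_mult_less_top)
    finally show ?thesis .
   qed
   note Fub = lebesgue_Fubini[OF Fm Ffin]
   have uG: "u x * G x = (LINT y|lebesgue. offdiag K y x * u x * f y)" for x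
    unfolding G_def by (subst integral_mult_right_zero[symmetric]) (simp add: mult_ac)
   have "(LINT x|lebesgue. u x * T' f x) = (LINT y|lebesgue. T u y * f y)" using eq[OF u f] by simp
   also have "... = (LINT y|lebesgue. LINT x|lebesgue. offdiag K y x * u x * f y)"
   proof (rule integral_cong_AE)
    show "AE y in lebesgue. T u y * f y = (LINT x|lebesgue. offdiag K y x * u x * f y)"
     using Tk[OF u cptu]
    proof eventually_elim
     case (elim y)
     show ?case
     proof (cases "f y = 0")
      case False
      then have "y \<in> S" by (rule S(2))
      then have yE: "y \<notin> E N" by (auto simp: E_def intro!: bexI[of _ y])
      then have "y \<notin> closure {x. u x ~= 0}" using clu by blast
      then have "T u y = (LINT x|lebesgue. K y x * u x)" using elim by blast
      also have "... = (LINT x|lebesgue. offdiag K y x * u x)"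
       by (intro Bochner_Integration.integral_cong refl) (use yE in \<open>auto simp: offdiag_def u_def\<close>)
      finally show ?thesis by simp
     qed simp
    qed
    show "(%y. LINT x|lebesgue. offdiag K y x * u x * f y) \<in> Meas"
     using Fub(2) by (rule borel_measurable_integrable)
   qed (use Lp2_measurable[OF Tmem[OF u]] in measurable)
   also have "... = (LINT x|lebesgue. LINT y|lebesgue. offdiag K y x * u x * f y)" by (rule Fub(1))
   also have "... = (LINT x|lebesgue. u x * G x)" unfolding uG ..
   finally have e1: "(LINT x|lebesgue. u x * T' f x) = (LINT x|lebesgue. u x * G x)" .
   have i1: "integrable lebesgue (%x. u x * T' f x)" using u f by (intro L2_integrable_mult mem)
   have i2: "integrable lebesgue (%x. u x * G x)"
    using Fub(3) unfolding uG .
   have uD: "u x * T' f x - u x * G x = of_real (cmod (D x) * indicator (E N) x)" for x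
   proof -
    have "u x * T' f x - u x * G x = u x * D x" by (simp add: D_def algebra_simps)
    moreover have "cnj z / of_real (cmod z) * z = of_real (cmod z)" for z :: complex
     using complex_norm_square[of z] by (cases "z = 0") (simp_all add: field_simps power2_eq_square)
    ultimately show ?thesis by (simp add: u_def indicator_def)
   qed
   have "integrable lebesgue (%x. complex_of_real (cmod (D x) * indicator (E N) x))"
    using Bochner_Integration.integrable_diff[OF i1 i2] unfolding uD .
   then have i3: "integrable lebesgue (%x. cmod (D x) * indicator (E N) x)"
    by (subst (asm) complex_of_real_integrable_eq)
   have "(LINT x|lebesgue. complex_of_real (cmod (D x) * indicator (E N) x)) = 0"
    using e1 Bochner_Integration.integral_diff[OF i1 i2] unfolding uD by (simp del: of_real_mult)
   then have "complex_of_real (LINT x|lebesgue. cmod (D x) * indicator (E N) x) = 0"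
    by (simp only: integral_complex_of_real)
   then have "(LINT x|lebesgue. cmod (D x) * indicator (E N) x) = 0" by (simp only: of_real_eq_0_iff)
   then have "AE x in lebesgue. cmod (D x) * indicator (E N) x = 0"
    using i3 by (subst (asm) integral_nonneg_eq_0_iff_AE) auto
   then show ?thesis by eventually_elim (auto simp: indicator_def)
  qed
  have "AE x in lebesgue. \<forall>N. x \<in> E N --> D x = 0" unfolding AE_all_countable using DE by blast
  then show ?thesis
  proof eventually_elim
   case (elim x)
   show ?case
   proof
    assume "x \<notin> closure {x. f x ~= 0}"
    then have xS: "x \<notin> S" by (simp add: S_def)
    have "\<exists>e>0. \<forall>y\<in>S. e <= dist x y"
     using separate_point_closed[of S x] S(1) xS by (auto simp: compact_imp_closed)
    then obtain e where e: "e > 0" "!!y. y \<in> S ==> e <= dist x y" by blast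
    obtain N :: nat where N: "max (norm x) (1 / e) <= real N" using real_arch_simple by blast
    have "1 / e <= real (Suc N)" using N by simp
    then have "1 / real (Suc N) <= e" using e(1) by (simp add: field_simps)
    then have "x \<in> E N" using N e(2) by (auto simp: E_def intro: order_trans)
    then have "T' f x = G x" using elim by (auto simp: D_def)
    also have "G x = (LINT y|lebesgue. K y x * f y)"
     unfolding G_def by (intro Bochner_Integration.integral_cong refl) (use xS S(2) in \<open>auto simp: offdiag_def\<close>)
    finally show "T' f x = (LINT y|lebesgue. K y x * f y)" .
   qed
  qed
 qed
 then show ?thesis using T'2 by (auto simp: calderon_zygmund_def)
qed

section \<open>Tails of kernels\<close>

lemma cball_sets_lebesgue [measurable]: "cball (c::'a::euclidean_space) r \<in> sets lebesgue"
 by (intro lmeasurable_cball fmeasurableD)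

lemma norm_diff_measurable [measurable]:
 "(%x. norm (x - c)) \<in> borel_measurable (lebesgue :: 'a::euclidean_space measure)"
 by (intro measurable_completion) measurable

lemma emeasure_lebesgue_cball:
 fixes c :: "real^'n"
 shows "0 <= r ==> emeasure lebesgue (cball c r) = ennreal (unit_ball_vol (real CARD('n)) * r ^ CARD('n))"
 using emeasure_cball[of r c] by simp

lemma binary_scale:
 fixes t :: real assumes "1 <= t"
 shows "\<exists>k::nat. 2 ^ k <= t \<and> t <= 2 ^ Suc k"
proof -
 obtain n :: nat where n: "t < 2 ^ n"
  using real_arch_pow[of 2 t] by auto
 define m where "m = (LEAST n::nat. t < 2 ^ n)"
 have m: "t < 2 ^ m" "!!k. k < m ==> \<not> t < 2 ^ k"
  unfolding m_def using LeastI[of "%n. t < 2 ^ n", OF n] not_less_Least by auto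
 have "m ~= 0" using m(1) assms by (cases m) auto
 then obtain k where k: "m = Suc k" by (cases m) auto
 show ?thesis using m(1) m(2)[of k] k by (intro exI[of _ k]) auto
qed

text \<open>Cut the complement of the ball into the annuli \<open>2\<^sup>k R \<le> \<bar>y - c\<bar> \<le> 2\<^bsup>k+1\<^esup> R\<close>. On each of them the weight is at most
 \<open>2\<^bsup>-k\<mu>\<^esup> (2\<^sup>k R)\<^bsup>-d\<^esup>\<close>, so the hypothesis on the averages leaves a geometric series.\<close>

lemma tail_integral:
 fixes F :: "real^'n => ennreal"
 assumes [measurable]: "F \<in> Meas" and R: "0 < R" and \<mu>: "0 < \<mu>"
  and M: "!!\<rho>. R <= \<rho> ==> (NN y. F y * indicator (cball c \<rho>) y) <= ennreal (\<rho> ^ CARD('n)) * M"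
 shows "(NN y. ennreal (R powr \<mu> / norm (y - c) powr (real CARD('n) + \<mu>)) * F y * indicator {y. R <= norm (y - c)} y)
   <= ennreal (2 ^ CARD('n) / (1 - 2 powr (-\<mu>))) * M"
proof -
 let ?d = "CARD('n)"
 define q where "q = (2::real) powr (-\<mu>)"
 have q: "0 < q" "q < 1" using \<mu> by (auto simp: q_def powr_less_one)
 define w where "w k = q ^ k / (2 ^ k * R) ^ ?d" for k :: nat
 have w0: "0 <= w k" for k using q R by (simp add: w_def)
 have pt: "ennreal (R powr \<mu> / norm (y - c) powr (real ?d + \<mu>)) * F y * indicator {y. R <= norm (y - c)} y
   <= (\<Sum>k. ennreal (w k) * (F y * indicator (cball c (2 ^ Suc k * R)) y))" for y
 proof (cases "R <= norm (y - c)")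
  case True
  then have "1 <= norm (y - c) / R" using R by simp
  then obtain k where k: "2 ^ k <= norm (y - c) / R" "norm (y - c) / R <= 2 ^ Suc k"
   using binary_scale by blast
  then have k1: "2 ^ k * R <= norm (y - c)" and k2: "norm (y - c) <= 2 ^ Suc k * R"
   using R by (simp_all add: field_simps)
  have "R powr \<mu> / norm (y - c) powr (real ?d + \<mu>) <= R powr \<mu> / (2 ^ k * R) powr (real ?d + \<mu>)"
   using k1 R \<mu> True by (intro divide_left_mono powr_mono2 mult_pos_pos) auto
  also have "... = w k"
  proof -
   have "(2 ^ k * R) powr (real ?d + \<mu>) = (2 ^ k * R) ^ ?d * ((2 ^ k) powr \<mu> * R powr \<mu>)"
    using R by (simp add: powr_add powr_realpow powr_mult power_mult_distrib)
   moreover have "(2 ^ k) powr \<mu> * q ^ k = (1::real)"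
    by (simp add: q_def powr_powr flip: powr_realpow) (simp add: mult.commute flip: powr_add)
   ultimately show ?thesis using R q unfolding w_def by (simp add: field_simps)
  qed
  finally have "ennreal (R powr \<mu> / norm (y - c) powr (real ?d + \<mu>)) * F y * indicator {y. R <= norm (y - c)} y
    <= ennreal (w k) * (F y * indicator (cball c (2 ^ Suc k * R)) y)"
   using True k2 by (auto simp: dist_norm norm_minus_commute intro!: mult_right_mono ennreal_leI)
  also have "... <= (\<Sum>k. ennreal (w k) * (F y * indicator (cball c (2 ^ Suc k * R)) y))"
   using sum_le_suminf[of "%k. ennreal (w k) * (F y * indicator (cball c (2 ^ Suc k * R)) y)" "{k}"] by simp
  finally show ?thesis .
 qed auto
 have "(NN y. ennreal (R powr \<mu> / norm (y - c) powr (real ?d + \<mu>)) * F y * indicator {y. R <= norm (y - c)} y)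
   <= (NN y. (\<Sum>k. ennreal (w k) * (F y * indicator (cball c (2 ^ Suc k * R)) y)))"
  by (intro nn_integral_mono pt)
 also have "... = (\<Sum>k. ennreal (w k) * (NN y. F y * indicator (cball c (2 ^ Suc k * R)) y))"
  by (subst nn_integral_suminf) (auto simp: nn_integral_cmult)
 also have "... <= (\<Sum>k. ennreal (q ^ k) * (ennreal (2 ^ ?d) * M))"
 proof (rule suminf_le)
  fix k
  have "R <= 2 ^ Suc k * R" using R one_le_power[of "2::real" "Suc k"] by (auto simp del: power_Suc)
  then have "ennreal (w k) * (NN y. F y * indicator (cball c (2 ^ Suc k * R)) y)
   <= ennreal (w k) * (ennreal ((2 ^ Suc k * R) ^ ?d) * M)"
   by (intro mult_left_mono M) auto
  also have "... = ennreal (w k * (2 ^ Suc k * R) ^ ?d) * M"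
   using w0 R by (simp add: ennreal_mult mult.assoc)
  also have "w k * (2 ^ Suc k * R) ^ ?d = q ^ k * 2 ^ ?d"
   using R by (simp add: w_def power_mult_distrib)
  finally show "ennreal (w k) * (NN y. F y * indicator (cball c (2 ^ Suc k * R)) y)
   <= ennreal (q ^ k) * (ennreal (2 ^ ?d) * M)"
   using q by (simp add: ennreal_mult mult.assoc)
 qed auto
 also have "... = (\<Sum>k. ennreal (q ^ k)) * (ennreal (2 ^ ?d) * M)" by simp
 also have "(\<Sum>k. ennreal (q ^ k)) = ennreal (1 / (1 - q))"
  using q by (simp add: suminf_ennreal2 suminf_geometric summable_geometric)
 also have "ennreal (1 / (1 - q)) * (ennreal (2 ^ ?d) * M) = ennreal (2 ^ ?d / (1 - q)) * M"
  using q by (simp add: ennreal_mult[symmetric] mult.assoc[symmetric])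
 finally show ?thesis by (simp add: q_def)
qed

lemma tail_integral_1:
 fixes c :: "real^'n"
 assumes R: "0 < R" and \<mu>: "0 < \<mu>"
 shows "(NN y. ennreal (R powr \<mu> / norm (y - c) powr (real CARD('n) + \<mu>)) * indicator {y. R <= norm (y - c)} y)
   <= ennreal (2 ^ CARD('n) / (1 - 2 powr (-\<mu>)) * unit_ball_vol (real CARD('n)))"
proof -
 have q: "2 powr (-\<mu>) < 1" using \<mu> by (simp add: powr_less_one)
 have "(NN y. ennreal (R powr \<mu> / norm (y - c) powr (real CARD('n) + \<mu>)) * 1 * indicator {y. R <= norm (y - c)} y)
   <= ennreal (2 ^ CARD('n) / (1 - 2 powr (-\<mu>))) * ennreal (unit_ball_vol (real CARD('n)))"
 proof (rule tail_integral[OF _ R \<mu>])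
  fix \<rho> assume "R <= \<rho>"
  then show "(NN y. 1 * indicator (cball c \<rho>) y) <= ennreal (\<rho> ^ CARD('n)) * ennreal (unit_ball_vol (real CARD('n)))"
   using R by (simp add: emeasure_lebesgue_cball mult.commute flip: ennreal_mult del: emeasure_completion)
 qed auto
 then show ?thesis using q by (subst ennreal_mult) auto
qed

lemma offdiag_section_measurable:
 fixes K :: "real^'n => real^'n => complex"
 assumes K: "K \<in> standard_kernels \<mu> A" and \<mu>: "0 < \<mu>"
 shows "(%y. offdiag K x y) \<in> Meas"
 using measurable_compose[OF measurable_Pair1'[of x lebesgue lebesgue] offdiag_measurable[OF K \<mu>]] by simp

text \<open>Mean zero allows subtracting \<open>K(x,c)\<close> from the kernel, and then its smoothness gives the decay.\<close>

lemma calderon_zygmund_atom: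
 fixes K :: "real^'n => real^'n => complex"
 assumes K: "K \<in> standard_kernels \<mu> A" and \<mu>: "0 < \<mu>" and A: "0 < A" and T: "calderon_zygmund T K"
  and g: "g \<in> Lp 2" and supp: "!!y. g y ~= 0 ==> y \<in> cball c R" and R: "0 < R"
  and mean: "(LINT y|lebesgue. g y) = 0"
 shows "AE x in lebesgue. 2 * R <= norm (x - c) -->
      T g x = (LINT y|lebesgue. (K x y - K x c) * g y) \<and>
      cmod (T g x) <= A * (R powr \<mu> / norm (x - c) powr (real CARD('n) + \<mu>)) * (LINT y|lebesgue. cmod (g y))"
proof -
 have gm[measurable]: "g \<in> Meas" using g by (rule Lp2_measurable)
 have "(%x. g x * indicator (cball c R) x) = g" by (rule ext) (use supp in \<open>auto simp: indicator_def\<close>)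
 then have gint: "integrable lebesgue g" using set_L2_integrable[OF g, of "cball c R"] by simp
 have cl: "closure {y. g y ~= 0} \<subseteq> cball c R" by (intro closure_minimal) (use supp in auto)
 then have "compact (closure {y. g y ~= 0})" by (auto simp: compact_eq_bounded_closed intro: bounded_subset)
 then have "AE x in lebesgue. x \<notin> closure {y. g y ~= 0} --> T g x = (LINT y|lebesgue. K x y * g y)"
  using T g by (auto simp: calderon_zygmund_def)
 then show ?thesis
 proof eventually_elim
  case (elim x)
  show ?case
  proof
   assume x: "2 * R <= norm (x - c)"
   then have xc: "x ~= c" using R by auto
   have "x \<notin> cball c R" using x R by (auto simp: dist_norm norm_minus_commute)
   then have eq: "T g x = (LINT y|lebesgue. K x y * g y)" using elim cl by blast
   define B where "B = A * (R powr \<mu> / norm (x - c) powr (real CARD('n) + \<mu>))"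
   have bd: "cmod ((K x y - K x c) * g y) <= B * cmod (g y)" for y
   proof (cases "g y = 0")
    case False
    then have yR: "norm (c - y) <= R" using supp by (auto simp: dist_norm)
    have "cmod (K x c - K x y) <= A * (norm (c - y) powr \<mu> / norm (x - c) powr (real CARD('n) + \<mu>))"
     using yR x xc by (intro kernel_smooth2[OF K]) auto
    also have "... <= B" unfolding B_def
     using yR \<mu> A by (intro mult_left_mono divide_right_mono powr_mono2) auto
    finally show ?thesis by (simp add: norm_mult norm_minus_commute mult_right_mono)
   qed auto
   have om: "(%y. offdiag K x y) \<in> Meas" by (rule offdiag_section_measurable[OF K \<mu>])
   have od: "(K x y - K x c) * g y = (offdiag K x y - K x c) * g y" for y
    using \<open>x \<notin> cball c R\<close> supp[of y] by (cases "g y = 0") (auto simp: offdiag_def)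
   have i1: "integrable lebesgue (%y. (K x y - K x c) * g y)"
   proof (rule Bochner_Integration.integrable_bound)
    show "integrable lebesgue (%y. B * cmod (g y))" using gint by simp
    show "(%y. (K x y - K x c) * g y) \<in> Meas"
     unfolding od using om by measurable
    show "AE y in lebesgue. norm ((K x y - K x c) * g y) <= norm (B * cmod (g y))"
     using bd by (intro AE_I2) (metis abs_ge_self order_trans real_norm_def)
   qed
   have "(LINT y|lebesgue. K x y * g y) = (LINT y|lebesgue. (K x y - K x c) * g y + K x c * g y)"
    by (simp add: algebra_simps)
   also have "... = (LINT y|lebesgue. (K x y - K x c) * g y) + K x c * (LINT y|lebesgue. g y)"
    using i1 gint by simp
   finally have e2: "T g x = (LINT y|lebesgue. (K x y - K x c) * g y)" using eq mean by simp
   have "cmod (LINT y|lebesgue. (K x y - K x c) * g y) <= (LINT y|lebesgue. B * cmod (g y))"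
    using i1 gint bd by (intro Bochner_Integration.integral_norm_bound_integral) auto
   then show "T g x = (LINT y|lebesgue. (K x y - K x c) * g y) \<and>
      cmod (T g x) <= A * (R powr \<mu> / norm (x - c) powr (real CARD('n) + \<mu>)) * (LINT y|lebesgue. cmod (g y))"
    using e2 unfolding B_def by simp
  qed
 qed
qed

lemma calderon_zygmund_atom_integral:
 fixes K :: "real^'n => real^'n => complex"
 assumes K: "K \<in> standard_kernels \<mu> A" and \<mu>: "0 < \<mu>" and A: "0 < A" and T: "calderon_zygmund T K"
  and g: "g \<in> Lp 2" and supp: "!!y. g y ~= 0 ==> y \<in> cball c R" and R: "0 < R"
  and mean: "(LINT y|lebesgue. g y) = 0"
 shows "(NN x. enorm (T g x) * indicator {x. 2 * R <= norm (x - c)} x)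
  <= ennreal (A * (2 ^ CARD('n) / (1 - 2 powr (-\<mu>)) * unit_ball_vol (real CARD('n)))) * ennreal (LINT y|lebesgue. cmod (g y))"
proof -
 let ?L = "LINT y|lebesgue. cmod (g y)"
 have L: "0 <= ?L" by simp
 have q: "2 powr (-\<mu>) < 1" using \<mu> by (simp add: powr_less_one)
 have ae: "AE x in lebesgue. 2 * R <= norm (x - c) -->
      T g x = (LINT y|lebesgue. (K x y - K x c) * g y) \<and>
      cmod (T g x) <= A * (R powr \<mu> / norm (x - c) powr (real CARD('n) + \<mu>)) * ?L"
  by (rule calderon_zygmund_atom[OF K \<mu> A T g]) (use supp R mean in auto)
 have "(NN x. enorm (T g x) * indicator {x. 2 * R <= norm (x - c)} x) <=
  (NN x. ennreal (A * ?L) * (ennreal ((2*R) powr \<mu> / norm (x - c) powr (real CARD('n) + \<mu>)) * indicator {x. 2 * R <= norm (x - c)} x))"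
 proof (rule nn_integral_mono_AE)
  show "AE x in lebesgue. enorm (T g x) * indicator {x. 2 * R <= norm (x - c)} x <=
    ennreal (A * ?L) * (ennreal ((2*R) powr \<mu> / norm (x - c) powr (real CARD('n) + \<mu>)) * indicator {x. 2 * R <= norm (x - c)} x)"
   using ae
  proof eventually_elim
   case (elim x)
   show ?case
   proof (cases "2 * R <= norm (x - c)")
    case True
    have "cmod (T g x) <= A * (R powr \<mu> / norm (x - c) powr (real CARD('n) + \<mu>)) * ?L" using elim True by blast
    also have "... <= A * ((2*R) powr \<mu> / norm (x - c) powr (real CARD('n) + \<mu>)) * ?L"
     using A R \<mu> L by (intro mult_right_mono mult_left_mono divide_right_mono powr_mono2) auto
    finally show ?thesis using True A L by (simp add: mult_ac ennreal_leI flip: ennreal_mult)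
   qed simp
  qed
 qed
 also have "... = ennreal (A * ?L) * (NN x. ennreal ((2*R) powr \<mu> / norm (x - c) powr (real CARD('n) + \<mu>)) * indicator {x. 2 * R <= norm (x - c)} x)"
 proof (rule nn_integral_cmult)
  have [measurable]: "(%x::real^'n. norm (x - c)) \<in> Meas"
   by (intro measurable_completion) measurable
  show "(%x. ennreal ((2*R) powr \<mu> / norm (x - c) powr (real CARD('n) + \<mu>)) * indicator {x. 2 * R <= norm (x - c)} x) \<in> Meas"
   by measurable
 qed
 also have "... <= ennreal (A * ?L) * ennreal (2 ^ CARD('n) / (1 - 2 powr (-\<mu>)) * unit_ball_vol (real CARD('n)))"
  using R \<mu> by (intro mult_left_mono tail_integral_1) auto
 finally show ?thesis using A L q by (simp add: mult_ac flip: ennreal_mult)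
qed

section \<open>Dyadic cells\<close>

text \<open>The half-open cell of side \<open>h 2\<^sup>j\<close> containing \<open>x\<close>. Cells are indexed by their points, so that the cell of a given
 generation around a point needs no choice.\<close>

definition cell :: "real => nat => real^'n => (real^'n) set" where
 "cell h j x = {y. \<forall>i. \<lfloor>y $ i / (h * 2 ^ j)\<rfloor> = \<lfloor>x $ i / (h * 2 ^ j)\<rfloor>}"

lemma mem_cell_self [simp]: "x \<in> cell h j x" by (simp add: cell_def)

lemma cell_eq: "y \<in> cell h j x ==> cell h j y = cell h j x" by (auto simp: cell_def)

lemma cell_mono:
 assumes "j <= k" shows "cell h j x \<subseteq> cell h k x"
proof -
 have step: "cell h n x \<subseteq> cell h (Suc n) x" for n
 proof
  fix y assume y: "y \<in> cell h n x"
  have e: "z / (h * 2 ^ Suc n) = (z / (h * 2 ^ n)) / real_of_int 2" for z :: real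
   by simp
  show "y \<in> cell h (Suc n) x"
   using y unfolding cell_def mem_Collect_eq e by (subst (1 2) floor_divide_real_eq_div) auto
 qed
 show ?thesis using lift_Suc_mono_le[of "%n. cell h n x", OF step assms] .
qed

lemma cell_eq_le: "y \<in> cell h j x ==> j <= k ==> cell h k y = cell h k x"
 using cell_mono cell_eq by blast

lemma cell_sets [measurable]: "cell h j x \<in> sets borel"
proof -
 have "cell h j x = (\<Inter>i. {y. \<lfloor>y $ i / (h * 2 ^ j)\<rfloor> = \<lfloor>x $ i / (h * 2 ^ j)\<rfloor>})"
  by (auto simp: cell_def)
 also have "... \<in> sets borel" by measurable
 finally show ?thesis .
qed

lemma cell_sets_lebesgue [measurable]: "cell h j x \<in> sets lebesgue"
 using cell_sets[of h j x] by (metis sets_completionI_sets sets_lborel)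

lemma cell_floor:
 assumes "0 < h" "y \<in> cell h j x"
 shows "real_of_int \<lfloor>x $ i / (h * 2 ^ j)\<rfloor> * (h * 2 ^ j) <= y $ i"
  "y $ i < (real_of_int \<lfloor>x $ i / (h * 2 ^ j)\<rfloor> + 1) * (h * 2 ^ j)"
proof -
 have a: "0 < h * 2 ^ j" using assms by simp
 have e: "\<lfloor>y $ i / (h * 2 ^ j)\<rfloor> = \<lfloor>x $ i / (h * 2 ^ j)\<rfloor>" using assms by (simp add: cell_def)
 have "real_of_int \<lfloor>y $ i / (h * 2 ^ j)\<rfloor> <= y $ i / (h * 2 ^ j)" "y $ i / (h * 2 ^ j) < real_of_int \<lfloor>y $ i / (h * 2 ^ j)\<rfloor> + 1"
  by linarith+
 then show "real_of_int \<lfloor>x $ i / (h * 2 ^ j)\<rfloor> * (h * 2 ^ j) <= y $ i"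
  "y $ i < (real_of_int \<lfloor>x $ i / (h * 2 ^ j)\<rfloor> + 1) * (h * 2 ^ j)"
  using a unfolding e by (simp_all add: pos_le_divide_eq pos_divide_less_eq)
qed

lemma emeasure_cell:
 fixes x :: "real^'n"
 assumes h: "0 < h"
 shows "emeasure lebesgue (cell h j x) = ennreal ((h * 2 ^ j) ^ CARD('n))"
proof -
 define a where "a = h * 2 ^ j"
 have a: "0 < a" using h by (simp add: a_def)
 define p :: "real^'n" where "p = (\<chi> i. real_of_int \<lfloor>x $ i / a\<rfloor> * a)"
 define q :: "real^'n" where "q = (\<chi> i. (real_of_int \<lfloor>x $ i / a\<rfloor> + 1) * a)"
 have qp: "(q - p) $ i = a" for i by (simp add: p_def q_def algebra_simps)
 have le: "\<forall>b\<in>Basis. p \<bullet> b <= q \<bullet> b"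
  using a by (auto simp: p_def q_def Basis_vec_def inner_axis algebra_simps)
 have pr: "(\<Prod>b\<in>Basis. (q - p) \<bullet> b) = a ^ CARD('n)"
 proof -
  have "(\<Prod>b\<in>Basis. (q - p) \<bullet> b) = (\<Prod>b\<in>(Basis :: (real^'n) set). a)"
   by (intro prod.cong refl) (use qp in \<open>auto simp: Basis_vec_def inner_axis\<close>)
  then show ?thesis by simp
 qed
 have sub1: "cell h j x \<subseteq> cbox p q"
  using cell_floor(1)[OF h] less_imp_le[OF cell_floor(2)[OF h]] by (auto simp: mem_box_cart p_def q_def a_def)
 have sub2: "box p q \<subseteq> cell h j x"
 proof
  fix y assume "y \<in> box p q"
  then have y: "!!i. p $ i < y $ i \<and> y $ i < q $ i" by (simp add: mem_box_cart)
  have "\<lfloor>y $ i / a\<rfloor> = \<lfloor>x $ i / a\<rfloor>" for i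
  proof (rule floor_unique)
   show "real_of_int \<lfloor>x $ i / a\<rfloor> <= y $ i / a" "y $ i / a < real_of_int \<lfloor>x $ i / a\<rfloor> + 1"
    using y[of i] a by (simp_all add: p_def q_def pos_le_divide_eq pos_divide_less_eq)
  qed
  then show "y \<in> cell h j x" by (simp add: cell_def a_def)
 qed
 have "emeasure lborel (cell h j x) <= emeasure lborel (cbox p q)"
  by (rule emeasure_mono[OF sub1]) auto
 moreover have "emeasure lborel (box p q) <= emeasure lborel (cell h j x)"
  by (rule emeasure_mono[OF sub2]) auto
 ultimately show ?thesis
  using le pr by (simp add: emeasure_lborel_cbox_eq emeasure_lborel_box_eq a_def)
qed

lemma cell_subset_cball:
 fixes x :: "real^'n"
 assumes h: "0 < h"
 shows "cell h j x \<subseteq> cball x (real CARD('n) * (h * 2 ^ j))"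
proof
 fix y assume y: "y \<in> cell h j x"
 let ?a = "h * 2 ^ j"
 have "\<bar>(y - x) $ i\<bar> <= ?a" for i
  using cell_floor[OF h y, of i] cell_floor[OF h mem_cell_self[of x h j], of i] unfolding distrib_right by auto
 then have "(\<Sum>i\<in>UNIV. \<bar>(y - x) $ i\<bar>) <= (\<Sum>i\<in>(UNIV::'n set). ?a)" by (intro sum_mono)
 then have "norm (y - x) <= real CARD('n) * ?a" using norm_le_l1_cart[of "y - x"] by simp
 then show "y \<in> cball x (real CARD('n) * ?a)" by (simp add: dist_norm norm_minus_commute)
qed

lemma bounded_cell: "0 < h ==> bounded (cell h j x)"
 by (rule bounded_subset[OF bounded_cball cell_subset_cball])

text \<open>Bounded functions of bounded support that are constant on the cells of the finest generation. For these the
 stopping time argument below involves only finitely many cells.\<close>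

definition step_fun :: "real => (real^'n => complex) => bool" where
 "step_fun h f \<longleftrightarrow> 0 < h \<and> f \<in> Meas \<and> (\<forall>x y. y \<in> cell h 0 x --> f y = f x) \<and>
   (\<exists>B. \<forall>x. cmod (f x) <= B) \<and> bounded {x. f x ~= 0}"

lemma step_fun_bounded_support:
 assumes "step_fun h f"
 obtains B R where "0 < R" "0 < B" "!!x. cmod (f x) <= B * indicator (cball 0 R) x"
proof -
 obtain B where B: "!!x. cmod (f x) <= B" using assms by (auto simp: step_fun_def)
 obtain R where R: "R > 0" "{x. f x ~= 0} \<subseteq> cball 0 R"
 proof -
  from assms obtain R where "R > 0" "\<forall>x\<in>{x. f x ~= 0}. norm x <= R"
   unfolding step_fun_def bounded_pos by blast
  then show ?thesis by (intro that[of R]) auto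
 qed
 have "cmod (f x) <= (\<bar>B\<bar> + 1) * indicator (cball 0 R) x" for x
  using B[of x] R(2) by (cases "f x = 0") (auto simp: indicator_def)
 then show ?thesis using that[of R "\<bar>B\<bar> + 1"] R(1) by auto
qed

lemma step_fun_Lp:
 assumes f: "step_fun h f" and s: "0 < s"
 shows "f \<in> Lp (ennreal s)"
proof -
 obtain B R where "!!x. cmod (f x) <= B * indicator (cball 0 R) x"
  using step_fun_bounded_support[OF f] by metis
 then show ?thesis using f s
  by (intro Lp_bounded_support[of s f B "cball 0 R"]) (auto simp: step_fun_def)
qed

section \<open>The weak type estimate\<close>

lemma nn_integral_lebesgue_cell_sum:
 assumes "finite X" "disjoint_family_on Q X" "!!x. x \<in> X ==> Q x \<in> sets M" "F \<in> borel_measurable M"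
 shows "(\<Sum>x\<in>X. \<integral>\<^sup>+y. F y * indicator (Q x) y \<partial>M) <= (\<integral>\<^sup>+y. F y \<partial>M)"
proof -
 have "(\<Sum>x\<in>X. \<integral>\<^sup>+y. F y * indicator (Q x) y \<partial>M) = (\<integral>\<^sup>+y. (\<Sum>x\<in>X. F y * indicator (Q x) y) \<partial>M)"
  using assms by (intro nn_integral_sum[symmetric]) auto
 also have "... <= (\<integral>\<^sup>+y. F y \<partial>M)"
 proof (rule nn_integral_mono)
  fix y
  have "(\<Sum>x\<in>X. F y * indicator (Q x) y) = F y * (\<Sum>x\<in>X. indicator (Q x) y)"
   by (simp add: sum_distrib_left)
  also have "(\<Sum>x\<in>X. indicator (Q x) y :: ennreal) = indicator (\<Union>x\<in>X. Q x) y"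
   by (subst indicator_UN_disjoint[OF assms(1,2)]) simp
  also have "F y * indicator (\<Union>x\<in>X. Q x) y <= F y" by (auto simp: indicator_def)
  finally show "(\<Sum>x\<in>X. F y * indicator (Q x) y) <= F y" .
 qed
 finally show ?thesis .
qed

text \<open>For each point where \<open>\<bar>f\<bar> > lam\<close> there are generations in which the average over its cell exceeds \<open>lam\<close>, the
 finest one being such a generation, but large cells have small averages since \<open>f\<close> is integrable. The largest
 generation with a large average gives maximal cells; these are disjoint, and their parents have small average, which is
 the last bound.\<close>

lemma dyadic_stopping_cells:
 fixes f :: "real^'n => complex"
 assumes f: "step_fun h f" and lam: "0 < lam"
 obtains X :: "(real^'n) set" and J :: "real^'n => nat" where
  "finite X"
  "disjoint_family_on (%x. cell h (J x) x) X"
  "!!y. y \<notin> (\<Union>x\<in>X. cell h (J x) x) ==> cmod (f y) <= lam"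
  "!!x. x \<in> X ==> lam * (h * 2 ^ J x) ^ CARD('n) < (LINT y|lebesgue. cmod (f y) * indicator (cell h (J x) x) y)"
  "!!x. x \<in> X ==> (LINT y|lebesgue. cmod (f y) * indicator (cell h (J x) x) y) <= 2 ^ CARD('n) * lam * (h * 2 ^ J x) ^ CARD('n)"
proof -
 let ?d = "CARD('n)"
 have h: "0 < h" using f by (simp add: step_fun_def)
 have fm[measurable]: "f \<in> Meas" using f by (simp add: step_fun_def)
 have "f \<in> Lp (ennreal 1)" using f by (rule step_fun_Lp) simp
 then have "Ipow 1 f < \<infinity>" using mem_Lp_iff[of 1 f] by simp
 then have fint: "integrable lebesgue f" by (simp add: Ipow_def integrable_iff_bounded)
 then have nint: "integrable lebesgue (%y. cmod (f y))" by simp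
 have cint: "integrable lebesgue (%y. cmod (f y) * indicator S y)" if "S \<in> sets lebesgue" for S :: "(real^'n) set"
  using nint that by (intro integrable_real_mult_indicator) auto
 define I where "I S = (LINT y|lebesgue. cmod (f y) * indicator S y)" for S
 define L where "L = (LINT y|lebesgue. cmod (f y))"
 have IL: "I S <= L" if "S \<in> sets lebesgue" for S
  unfolding I_def L_def using that nint cint by (intro integral_mono) (auto simp: indicator_def)
 define V where "V j = (h * 2 ^ j) ^ ?d" for j :: nat
 have V0: "0 < V j" for j using h by (simp add: V_def)
 have Vmono: "V i <= V j" if "i <= j" for i j
  unfolding V_def using h that by (intro power_mono mult_left_mono power_increasing) auto
 have Vdouble: "V (Suc j) = 2 ^ ?d * V j" for j
  unfolding V_def by (simp add: power_mult_distrib)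
 define S where "S x = {j. lam * V j < I (cell h j x)}" for x
 have finS: "finite (S x)" for x
 proof -
  obtain N :: nat where N: "L / (lam * h ^ ?d) < 2 ^ N" using real_arch_pow[of 2] by auto
  have "S x \<subseteq> {..<N}"
  proof
   fix j assume "j \<in> S x"
   then have "lam * V j < L" using IL[OF cell_sets_lebesgue, of h j x] by (simp add: S_def)
   moreover have "h ^ ?d * 2 ^ j <= V j"
   proof -
    have "(2::real) ^ j <= (2 ^ j) ^ ?d"
     using self_le_power[of "(2::real) ^ j" ?d] by simp
    then show ?thesis using h by (simp add: V_def power_mult_distrib)
   qed
   ultimately have "lam * (h ^ ?d * 2 ^ j) < L" using lam by (smt (verit) mult_left_mono)
   then have "2 ^ j < L / (lam * h ^ ?d)" using lam h by (simp add: field_simps)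
   then have "(2::real) ^ j < 2 ^ N" using N by (rule less_trans)
   then show "j \<in> {..<N}" by simp
  qed
  then show ?thesis by (rule finite_subset) auto
 qed
 define J where "J x = Max (S x)" for x
 define Om where "Om = {x. S x ~= {}}"
 define Q where "Q x = cell h (J x) x" for x
 have JS: "J x \<in> S x" if "x \<in> Om" for x unfolding J_def using finS that by (intro Max_in) (auto simp: Om_def)
 have JSuc: "Suc (J x) \<notin> S x" for x using Max_ge[OF finS, of "Suc (J x)" x] by (auto simp: J_def)
 have same: "y \<in> Om \<and> J y = J x" if x: "x \<in> Om" and y: "y \<in> Q x" for x y
 proof -
  have c: "cell h j y = cell h j x" if "J x <= j" for j
   using y that unfolding Q_def by (intro cell_eq_le)
  have 1: "J x \<in> S y" using JS[OF x] c[of "J x"] by (simp add: S_def)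
  have "j <= J x" if "j \<in> S y" for j
  proof (rule ccontr)
   assume "\<not> j <= J x"
   then have "j \<in> S x" using that c[of j] by (simp add: S_def)
   then show False using \<open>\<not> j <= J x\<close> finS by (simp add: J_def)
  qed
  then have "J y = J x" unfolding J_def[of y] using 1 finS by (intro Max_eqI) auto
  then show ?thesis using 1 by (auto simp: Om_def)
 qed
 have Qeq: "Q y = Q x" if "x \<in> Om" "y \<in> Q x" for x y
  using same[OF that] cell_eq[of y h "J x" x] that(2) by (simp add: Q_def)
 define X where "X = (%q. SOME x. x \<in> Om \<and> Q x = q) ` (Q ` Om)"
 have some: "(SOME x. x \<in> Om \<and> Q x = Q z) \<in> Om \<and> Q (SOME x. x \<in> Om \<and> Q x = Q z) = Q z" if "z \<in> Om" for z
  by (rule someI[of _ z]) (use that in auto)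
 have XOm: "X \<subseteq> Om" using some by (auto simp: X_def)
 have injX: "inj_on Q X" using some by (auto simp: X_def inj_on_def)
 have cov: "Om \<subseteq> (\<Union>x\<in>X. Q x)"
 proof
  fix z assume z: "z \<in> Om"
  have "z \<in> Q z" by (simp add: Q_def)
  then show "z \<in> (\<Union>x\<in>X. Q x)" using z some[OF z] by (auto simp: X_def)
 qed
 have disj: "disjoint_family_on Q X"
  unfolding disjoint_family_on_def
 proof (intro ballI impI)
  fix x y assume xy: "x \<in> X" "y \<in> X" "x ~= y"
  show "Q x \<inter> Q y = {}"
  proof (rule ccontr)
   assume "Q x \<inter> Q y ~= {}"
   then obtain z where "z \<in> Q x" "z \<in> Q y" by blast
   then have "Q x = Q y" using Qeq xy XOm by (metis subsetD)
   then show False using injX xy by (auto dest: inj_onD)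
  qed
 qed
 have Qm: "Q x \<in> sets lebesgue" for x unfolding Q_def by simp
 have big: "lam * V (J x) < I (Q x)" if "x \<in> X" for x
  using JS[of x] that XOm by (auto simp: S_def Q_def)
 have finX: "finite X"
 proof -
  obtain C :: nat where C: "L / (lam * V 0) <= real C" using real_arch_simple by blast
  have "card G <= C" if G: "G \<subseteq> X" "finite G" for G
  proof -
   have "real (card G) * (lam * V 0) <= (\<Sum>x\<in>G. lam * V (J x))"
    using lam Vmono[of 0] by (intro sum_bounded_below[where K="lam * V 0", simplified]) auto
   also have "... <= (\<Sum>x\<in>G. I (Q x))" using big G by (intro sum_mono less_imp_le) auto
   also have "... = (LINT y|lebesgue. (\<Sum>x\<in>G. cmod (f y) * indicator (Q x) y))"
    unfolding I_def by (intro Bochner_Integration.integral_sum[symmetric] cint Qm)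
   also have "... = I (\<Union>x\<in>G. Q x)"
   proof -
    have "(\<Sum>x\<in>G. indicator (Q x) y) = (indicator (\<Union>x\<in>G. Q x) y :: real)" for y
     by (subst indicator_UN_disjoint[OF G(2) disjoint_family_on_mono[OF G(1) disj]]) simp
    then show ?thesis unfolding I_def by (simp add: sum_distrib_left[symmetric])
   qed
   also have "... <= L" using Qm G by (intro IL) auto
   finally have "real (card G) <= L / (lam * V 0)" using lam V0[of 0] by (simp add: pos_le_divide_eq)
   then show ?thesis using C by linarith
  qed
  then show ?thesis using finite_if_finite_subsets_card_bdd by blast
 qed
 have small: "cmod (f y) <= lam" if "y \<notin> (\<Union>x\<in>X. Q x)" for y
 proof -
  have "0 \<notin> S y" using that cov by (auto simp: Om_def)
  then have "I (cell h 0 y) <= lam * V 0" by (simp add: S_def)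
  moreover have "I (cell h 0 y) = (LINT z|lebesgue. cmod (f y) * indicator (cell h 0 y) z)"
   unfolding I_def using f
   by (intro Bochner_Integration.integral_cong refl) (auto simp: indicator_def step_fun_def)
  moreover have "(LINT z|lebesgue. cmod (f y) * indicator (cell h 0 y) z) = cmod (f y) * V 0"
  proof -
   have "measure lborel (cell h 0 y) = V 0"
    using emeasure_cell[OF h, of 0 y] V0[of 0] by (simp add: measure_def V_def)
   then show ?thesis by simp
  qed
  ultimately have "cmod (f y) * V 0 <= lam * V 0" by (simp only:)
  then show ?thesis using V0[of 0] by simp
 qed
 have par: "I (Q x) <= 2 ^ ?d * lam * V (J x)" if "x \<in> X" for x
 proof -
  have "I (Q x) <= I (cell h (Suc (J x)) x)"
   unfolding I_def Q_def using cell_mono[of "J x" "Suc (J x)" h x]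
   by (intro integral_mono cint) (auto simp: indicator_def)
  also have "... <= lam * V (Suc (J x))" using JSuc[of x] by (simp add: S_def)
  finally show ?thesis by (simp add: Vdouble mult_ac)
 qed
 show ?thesis
  by (rule that[of X J]) (use finX disj[unfolded disjoint_family_on_def Q_def, folded disjoint_family_on_def] small big par in \<open>auto simp: Q_def V_def I_def\<close>)
qed

lemma Lp2_sum:
 assumes "finite X" "!!x. x \<in> X ==> b x \<in> Lp 2"
 shows "(%y. \<Sum>x\<in>X. b x y) \<in> Lp 2"
 using assms
proof (induction X)
 case empty
 show ?case by (simp add: mem_Lp2_iff Ipow_def)
next
 case (insert x X)
 then show ?case using Lp2_add[of "b x" "%y. \<Sum>x\<in>X. b x y"] by simp
qed

lemma bounded_linear_L2_sum:
 assumes T: "bounded_linear_Lp 2 T" and "finite X" "!!x. x \<in> X ==> b x \<in> Lp 2"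
 shows "AE y in lebesgue. T (%y. \<Sum>x\<in>X. b x y) y = (\<Sum>x\<in>X. T (b x) y)"
 using assms(2,3)
proof (induction X)
 case empty
 have z: "(%y. 0) \<in> Lp 2" by (simp add: mem_Lp2_iff Ipow_def)
 show ?case using bounded_linear_Lp_lin[OF T z z, of 0 0] by simp
next
 case (insert x X)
 have "AE y in lebesgue. T (%y. \<Sum>x\<in>X. b x y) y = (\<Sum>x\<in>X. T (b x) y)"
  using insert by blast
 moreover have "AE y in lebesgue. T (%y. 1 * b x y + 1 * (\<Sum>x\<in>X. b x y)) y = 1 * T (b x) y + 1 * T (%y. \<Sum>x\<in>X. b x y) y"
  using insert Lp2_sum[of X b] by (intro bounded_linear_Lp_lin[OF T]) auto
 ultimately show ?case
  by eventually_elim (use insert in simp)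
qed

text \<open>The values of \<open>f\<close> below \<open>lam / 2\<close> contribute at most half of the integral, so the values above \<open>lam / 2\<close> carry the
 other half.\<close>

lemma emeasure_le_twice_large_part:
 fixes f :: "'a => complex"
 assumes [measurable]: "f \<in> borel_measurable M" "S \<in> sets M" and V: "emeasure M S = ennreal V" "0 <= V" and lam: "0 < lam"
  and ge: "ennreal (lam * V) <= (\<integral>\<^sup>+y. enorm (f y) * indicator S y \<partial>M)"
 shows "ennreal V <= ennreal (2 / lam) * (\<integral>\<^sup>+y. enorm (f y) * indicator {y. lam / 2 < cmod (f y)} y * indicator S y \<partial>M)"
proof -
 define E where "E = (\<integral>\<^sup>+y. enorm (f y) * indicator {y. lam / 2 < cmod (f y)} y * indicator S y \<partial>M)"
 have "(\<integral>\<^sup>+y. enorm (f y) * indicator S y \<partial>M) <=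
   (\<integral>\<^sup>+y. enorm (f y) * indicator {y. lam / 2 < cmod (f y)} y * indicator S y + ennreal (lam / 2) * indicator S y \<partial>M)"
  by (intro nn_integral_mono) (auto simp: indicator_def intro: ennreal_leI)
 also have "... = E + ennreal (lam / 2 * V)"
 proof -
  have "ennreal (lam / 2) * ennreal V = ennreal (lam / 2 * V)" using V lam by (intro ennreal_mult[symmetric]) auto
  then show ?thesis unfolding E_def using V lam by (subst nn_integral_add) (auto simp: nn_integral_cmult)
 qed
 finally have le: "ennreal (lam * V) <= E + ennreal (lam / 2 * V)" using ge by (rule order_trans[rotated])
 show ?thesis
 proof (cases E)
  case (real r)
  then have "lam * V <= r + lam / 2 * V"
   using le V lam by (simp flip: ennreal_plus)
  then have "V <= 2 / lam * r" using lam by (simp add: field_simps)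
  then show ?thesis using real lam unfolding E_def by (simp add: ennreal_leI flip: ennreal_mult)
 next
  case top
  then show ?thesis using lam unfolding E_def by (simp add: ennreal_mult_top)
 qed
qed

text \<open>The Calderon-Zygmund decomposition \<open>f = g + \<Sum> b\<^sub>x\<close>, where \<open>b\<^sub>x\<close> is \<open>f\<close> minus its mean on a stopping cell.
 The good part is estimated in \<open>L\<^sup>2\<close>. The atoms \<open>b\<^sub>x\<close> are integrated outside the balls of twice the radius, and these balls have total
 measure comparable to that of the cells. Both sums of measures are charged to the part of \<open>f\<close> above \<open>lam / 2\<close>; this truncated
 form of the weak type bound can be interpolated directly.\<close>

theorem calderon_zygmund_weak_type:
 fixes K :: "real^'n => real^'n => complex"
 assumes K: "K \<in> standard_kernels \<mu> A" and \<mu>: "0 < \<mu>" and A: "0 < A" and T: "calderon_zygmund T K"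
 shows "\<exists>C>0. \<forall>h f lam. step_fun h f --> 0 < lam -->
  emeasure lebesgue {x. lam < cmod (T f x)} <=
   ennreal (C / lam) * (NN x. enorm (f x) * indicator {x. lam / 2 < cmod (f x)} x) +
   ennreal (C / lam\<^sup>2) * (NN x. ennreal ((cmod (f x))\<^sup>2) * indicator {x. cmod (f x) <= lam} x)"
proof -
 let ?d = "CARD('n)"
 define w where "w = unit_ball_vol (real ?d)"
 have w: "0 <= w" by (simp add: w_def)
 have T2: "bounded_linear_Lp 2 T" using T by (simp add: calderon_zygmund_def)
 obtain C2 where C2: "0 < C2" "!!f. f \<in> Lp 2 ==> Ipow 2 (T f) <= ennreal C2 * Ipow 2 f"
  using bounded_linear_L2_bound[OF T2] by blast
 note Tmem = bounded_linear_Lp_mem[OF T2]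
 define CA where "CA = A * (2 ^ ?d / (1 - 2 powr (-\<mu>)) * w)"
 have q: "2 powr (-\<mu>) < 1" using \<mu> by (simp add: powr_less_one)
 have CA: "0 <= CA" unfolding CA_def using A w q by simp
 define W where "W = 4 * C2 * (2 ^ ?d)\<^sup>2 + w * (2 * real ?d) ^ ?d + 4 * CA * 2 ^ ?d"
 have W: "0 <= W" unfolding W_def using C2 w CA by simp
 define C where "C = 4 * C2 + 2 * W"
 have C: "0 < C" "4 * C2 <= C" "2 * W <= C" using C2 W by (auto simp: C_def)
 have "emeasure lebesgue {x. lam < cmod (T f x)} <=
   ennreal (C / lam) * (NN x. enorm (f x) * indicator {x. lam / 2 < cmod (f x)} x) +
   ennreal (C / lam\<^sup>2) * (NN x. ennreal ((cmod (f x))\<^sup>2) * indicator {x. cmod (f x) <= lam} x)"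
  if f: "step_fun h f" and lam: "0 < lam" for h lam :: real and f
 proof -
  have h: "0 < h" using f by (simp add: step_fun_def)
  have fm[measurable]: "f \<in> Meas" using f by (simp add: step_fun_def)
  have f2: "f \<in> Lp 2" using step_fun_Lp[OF f, of 2] by simp
  obtain X J where finX: "finite X"
   and disj: "disjoint_family_on (%x. cell h (J x) x) X"
   and small: "!!y. y \<notin> (\<Union>x\<in>X. cell h (J x) x) ==> cmod (f y) <= lam"
   and big: "!!x. x \<in> X ==> lam * (h * 2 ^ J x) ^ ?d < (LINT y|lebesgue. cmod (f y) * indicator (cell h (J x) x) y)"
   and par: "!!x. x \<in> X ==> (LINT y|lebesgue. cmod (f y) * indicator (cell h (J x) x) y) <= 2 ^ ?d * lam * (h * 2 ^ J x) ^ ?d"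
   by (rule dyadic_stopping_cells[OF f lam]) (rule that)
  define Q where "Q x = cell h (J x) x" for x
  define V where "V x = (h * 2 ^ J x) ^ ?d" for x
  define R where "R x = real ?d * (h * 2 ^ J x)" for x
  have V0: "0 < V x" for x using h by (simp add: V_def)
  have R0: "0 < R x" for x using h by (simp add: R_def)
  have Qm[measurable]: "Q x \<in> sets lebesgue" for x by (simp add: Q_def)
  have Qb: "bounded (Q x)" for x unfolding Q_def using bounded_cell[OF h] .
  have QV: "emeasure lebesgue (Q x) = ennreal (V x)" for x unfolding Q_def V_def by (rule emeasure_cell[OF h])
  have QR: "Q x \<subseteq> cball x (R x)" for x unfolding Q_def R_def by (rule cell_subset_cball[OF h])
  have mQ: "measure lebesgue (Q x) = V x" for x
   using QV[of x] V0[of x] by (simp add: measure_def del: emeasure_completion measure_completion)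
  have fQint: "integrable lebesgue (%y. f y * indicator (Q x) y)" for x
   using set_L2_integrable[OF f2 Qm Qb] .
  have indL2: "(%y. indicator (Q x) y :: complex) \<in> Lp 2" for x
   using Lp_bounded_support[of 2 "%y. indicator (Q x) y" 1 "Q x"] Qb by (simp add: indicator_def)
  have indint: "integrable lebesgue (%y. indicator (Q x) y :: complex)" for x
   using set_L2_integrable[OF indL2 Qm Qb, of x x] by (simp add: indicator_inter_arith[symmetric])
  have Lind: "(LINT y|lebesgue. indicator (Q x) y :: complex) = of_real (V x)" for x
  proof -
   have e: "complex_of_real (indicator (Q x) y) = indicator (Q x) y" for y by (simp add: indicator_def)
   have "(LINT y|lebesgue. complex_of_real (indicator (Q x) y)) = of_real (LINT y|lebesgue. indicator (Q x) y)"
    by (rule integral_complex_of_real)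
   moreover have "(LINT y|lebesgue. indicator (Q x) y :: real) = V x" using mQ[of x] by simp
   ultimately show ?thesis unfolding e by simp
  qed
  define I where "I x = (LINT y|lebesgue. cmod (f y) * indicator (Q x) y)" for x
  have Inorm: "cmod (f y * indicator (Q x) y) = cmod (f y) * indicator (Q x) y" for x y
   by (simp add: indicator_def)
  have Iint: "integrable lebesgue (%y. cmod (f y) * indicator (Q x) y)" for x
   using integrable_norm[OF fQint[of x]] unfolding Inorm .
  have Ige: "lam * V x <= I x" and Ile: "I x <= 2 ^ ?d * lam * V x" if "x \<in> X" for x
   using big[OF that] par[OF that] by (auto simp: I_def Q_def V_def)
  have Inn: "(NN y. enorm (f y) * indicator (Q x) y) = ennreal (I x)" for x
  proof -
   have "(NN y. enorm (f y) * indicator (Q x) y) = (NN y. ennreal (cmod (f y) * indicator (Q x) y))"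
    by (intro nn_integral_cong) (simp add: indicator_def)
   then show ?thesis unfolding I_def using Iint[of x] by (simp add: nn_integral_eq_integral)
  qed
  define m where "m x = (LINT y|lebesgue. f y * indicator (Q x) y) / of_real (V x)" for x
  have mle: "cmod (m x) * V x <= I x" for x
   unfolding m_def I_def using V0[of x] integral_norm_bound[of lebesgue "%y. f y * indicator (Q x) y"]
   by (simp add: norm_divide Inorm del: norm_mult)
  have mle2: "cmod (m x) <= 2 ^ ?d * lam" if "x \<in> X" for x
   using order_trans[OF mle Ile[OF that]] V0[of x] by simp
  define b where "b x y = f y * indicator (Q x) y - m x * indicator (Q x) y" for x y
  have b2: "b x \<in> Lp 2" for x
  proof -
   have "(%y. f y * indicator (Q x) y) \<in> Lp 2"
    using Lp_restrict[of 2 f "Q x"] f2 by simp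
   from Lp2_diff[OF this Lp2_cmult[OF indL2[of x], of "m x"]] show ?thesis unfolding b_def .
  qed
  have bsupp: "y \<in> cball x (R x)" if "b x y ~= 0" for x y
   using that QR[of x] by (auto simp: b_def indicator_def split: if_splits)
  have bmean: "(LINT y|lebesgue. b x y) = 0" for x
   unfolding b_def using fQint[of x] indint[of x] Lind[of x] V0[of x] by (simp add: m_def)
  have bL1: "(LINT y|lebesgue. cmod (b x y)) <= 2 * I x" for x
  proof -
   have i: "integrable lebesgue (%y. cmod (f y) * indicator (Q x) y + cmod (m x) * indicator (Q x) y)"
    using Iint[of x] QV[of x] by (intro Bochner_Integration.integrable_add integrable_mult_right integrable_real_indicator) auto
   have "(LINT y|lebesgue. cmod (b x y)) <= (LINT y|lebesgue. cmod (f y) * indicator (Q x) y + cmod (m x) * indicator (Q x) y)"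
   proof (rule integral_mono_AE'[OF i])
    show "AE y in lebesgue. cmod (b x y) <= cmod (f y) * indicator (Q x) y + cmod (m x) * indicator (Q x) y"
     by (intro AE_I2) (auto simp: b_def indicator_def intro: norm_triangle_ineq4)
   qed auto
   also have "... = I x + cmod (m x) * V x"
    unfolding I_def using Iint[of x] QV[of x] mQ[of x] by (subst Bochner_Integration.integral_add) (auto intro!: integrable_mult_right integrable_real_indicator)
   finally show ?thesis using mle[of x] by simp
  qed
  define B where "B y = (\<Sum>x\<in>X. b x y)" for y
  define g where "g y = f y - B y" for y
  have B2: "B \<in> Lp 2" unfolding B_def using finX b2 by (intro Lp2_sum)
  have g2: "g \<in> Lp 2" unfolding g_def using f2 B2 by (rule Lp2_diff)
  have gle: "ennreal ((cmod (g y))\<^sup>2) <= ennreal ((cmod (f y))\<^sup>2) * indicator {y. cmod (f y) <= lam} y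
    + (\<Sum>x\<in>X. ennreal ((2 ^ ?d * lam)\<^sup>2) * indicator (Q x) y)" for y
  proof (cases "y \<in> (\<Union>x\<in>X. Q x)")
   case True
   then obtain x0 where x0: "x0 \<in> X" "y \<in> Q x0" by blast
   have "y \<notin> Q x" if "x \<in> X" "x ~= x0" for x
    using disj x0 that unfolding disjoint_family_on_def Q_def by blast
   then have "B y = (\<Sum>x\<in>X. if x = x0 then b x y else 0)"
    unfolding B_def by (intro sum.cong refl) (auto simp: b_def)
   then have "B y = b x0 y" using finX x0 by simp
   then have "g y = m x0" using x0 by (simp add: g_def b_def)
   then have "(cmod (g y))\<^sup>2 <= (2 ^ ?d * lam)\<^sup>2" using mle2[OF x0(1)] by (simp add: power_mono)
   then have "ennreal ((cmod (g y))\<^sup>2) <= ennreal ((2 ^ ?d * lam)\<^sup>2) * indicator (Q x0) y"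
    using x0 by (simp add: ennreal_leI)
   also have "... <= (\<Sum>x\<in>X. ennreal ((2 ^ ?d * lam)\<^sup>2) * indicator (Q x) y)"
    using finX x0 by (intro member_le_sum) auto
   finally show ?thesis by (rule order_trans) simp
  next
   case False
   then have "B y = 0" unfolding B_def by (intro sum.neutral) (auto simp: b_def indicator_def)
   moreover have "cmod (f y) <= lam" using False by (intro small) (auto simp: Q_def)
   ultimately show ?thesis by (simp add: g_def)
  qed
  define SV where "SV = (\<Sum>x\<in>X. ennreal (V x))"
  define E1 where "E1 = (NN x. enorm (f x) * indicator {x. lam / 2 < cmod (f x)} x)"
  define E2 where "E2 = (NN x. ennreal ((cmod (f x))\<^sup>2) * indicator {x. cmod (f x) <= lam} x)"
  have gI: "Ipow 2 g <= E2 + ennreal ((2 ^ ?d * lam)\<^sup>2) * SV"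
  proof -
   have "Ipow 2 g <= (NN y. ennreal ((cmod (f y))\<^sup>2) * indicator {y. cmod (f y) <= lam} y
    + (\<Sum>x\<in>X. ennreal ((2 ^ ?d * lam)\<^sup>2) * indicator (Q x) y))"
    unfolding Ipow2 ennreal_power[OF norm_ge_zero] by (intro nn_integral_mono gle)
   also have "... = E2 + (\<Sum>x\<in>X. ennreal ((2 ^ ?d * lam)\<^sup>2) * emeasure lebesgue (Q x))"
    unfolding E2_def by (subst nn_integral_add) (auto simp: nn_integral_sum nn_integral_cmult simp del: emeasure_completion)
   finally show ?thesis by (simp add: SV_def QV sum_distrib_left del: emeasure_completion)
  qed
  have SV: "SV <= ennreal (2 / lam) * E1"
  proof -
   have "SV <= (\<Sum>x\<in>X. ennreal (2 / lam) * (NN y. enorm (f y) * indicator {y. lam / 2 < cmod (f y)} y * indicator (Q x) y))"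
    unfolding SV_def
   proof (rule sum_mono)
    fix x assume x: "x \<in> X"
    show "ennreal (V x) <= ennreal (2 / lam) * (NN y. enorm (f y) * indicator {y. lam / 2 < cmod (f y)} y * indicator (Q x) y)"
     using V0[of x] lam by (intro emeasure_le_twice_large_part fm Qm QV) (auto simp: Inn intro!: ennreal_leI Ige[OF x])
   qed
   also have "... <= ennreal (2 / lam) * E1"
    unfolding E1_def sum_distrib_left[symmetric]
    using disj by (intro mult_left_mono nn_integral_lebesgue_cell_sum finX) (auto simp: Q_def)
   finally show ?thesis .
  qed
  have lin: "AE y in lebesgue. T f y = T g y + (\<Sum>x\<in>X. T (b x) y)"
  proof -
   have "AE y in lebesgue. T (%y. 1 * g y + 1 * B y) y = 1 * T g y + 1 * T B y"
    by (rule bounded_linear_Lp_lin[OF T2 g2 B2])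
   moreover have "AE y in lebesgue. T B y = (\<Sum>x\<in>X. T (b x) y)"
    unfolding B_def[abs_def] using bounded_linear_L2_sum[OF T2 finX b2] .
   ultimately show ?thesis
    by eventually_elim (simp add: g_def)
  qed
  have [measurable]: "T f \<in> Meas" "T g \<in> Meas" "T (b x) \<in> Meas" for x
   using f2 g2 b2 by (auto intro!: Lp2_measurable Tmem)
  \<comment> \<open>Where \<open>\<bar>T f\<bar> > lam\<close>, the point lies in an enlarged ball, or the image of \<open>g\<close> or the sum of the images of the atoms
   is at least \<open>lam / 2\<close>; in each case \<open>H \<ge> 1\<close>.\<close>
  define H where "H y = ennreal (4 / lam\<^sup>2) * ennreal ((cmod (T g y))\<^sup>2) + ((\<Sum>x\<in>X. indicator (cball x (2 * R x)) y)
    + (\<Sum>x\<in>X. ennreal (2 / lam) * (enorm (T (b x) y) * indicator {y. 2 * R x <= norm (y - x)} y)))" for y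
  have "emeasure lebesgue {x. lam < cmod (T f x)} = (NN y. indicator {x. lam < cmod (T f x)} y)"
  proof -
   have "{x \<in> space lebesgue. lam < cmod (T f x)} \<in> sets lebesgue" by measurable
   then show ?thesis by (subst nn_integral_indicator) auto
  qed
  also have "... <= (NN y. H y)"
  proof (rule nn_integral_mono_AE)
   show "AE y in lebesgue. indicator {x. lam < cmod (T f x)} y <= H y"
    using lin
   proof eventually_elim
    case (elim y)
    show ?case
    proof (cases "lam < cmod (T f y)")
     case True
     consider "\<exists>x\<in>X. y \<in> cball x (2 * R x)" | "lam / 2 < cmod (T g y)"
      | "\<forall>x\<in>X. y \<notin> cball x (2 * R x)" "cmod (T g y) <= lam / 2" by force
     then have "1 <= H y"
     proof cases
      case 1
      then obtain x where x: "x \<in> X" "y \<in> cball x (2 * R x)" by blast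
      then have "1 <= (indicator (cball x (2 * R x)) y :: ennreal)" by simp
      also have "... <= (\<Sum>x\<in>X. indicator (cball x (2 * R x)) y)" using finX x by (intro member_le_sum) auto
      also have "... <= H y" unfolding H_def by (simp add: add.assoc add.left_commute add_increasing)
      finally show ?thesis .
     next
      case 2
      then have "(lam / 2)\<^sup>2 <= (cmod (T g y))\<^sup>2" using lam by (intro power_mono) auto
      then have "1 <= 4 / lam\<^sup>2 * (cmod (T g y))\<^sup>2" using lam by (simp add: field_simps power2_eq_square)
      then have "1 <= ennreal (4 / lam\<^sup>2) * ennreal ((cmod (T g y))\<^sup>2)"
       using lam by (simp flip: ennreal_mult)
      also have "... <= H y" unfolding H_def by simp
      finally show ?thesis .
     next
      case 3
      have "cmod (T f y) <= cmod (T g y) + (\<Sum>x\<in>X. cmod (T (b x) y))"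
       unfolding elim by (rule order_trans[OF norm_triangle_ineq add_left_mono[OF norm_sum]])
      then have "lam / 2 <= (\<Sum>x\<in>X. cmod (T (b x) y))" using True 3 by linarith
      then have "1 <= 2 / lam * (\<Sum>x\<in>X. cmod (T (b x) y))" using lam by (simp add: pos_le_divide_eq)
      then have "1 <= (\<Sum>x\<in>X. 2 / lam * cmod (T (b x) y))" unfolding sum_distrib_left .
      then have "1 <= ennreal (\<Sum>x\<in>X. 2 / lam * cmod (T (b x) y))" by simp
      also have "... = (\<Sum>x\<in>X. ennreal (2 / lam) * enorm (T (b x) y))"
      proof -
       have "ennreal (\<Sum>x\<in>X. 2 / lam * cmod (T (b x) y)) = (\<Sum>x\<in>X. ennreal (2 / lam * cmod (T (b x) y)))"
        by (rule sum_ennreal[symmetric]) (use lam in auto)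
       also have "... = (\<Sum>x\<in>X. ennreal (2 / lam) * enorm (T (b x) y))"
        by (rule sum.cong[OF refl], rule ennreal_mult) (use lam in auto)
       finally show ?thesis .
      qed
      also have "... = (\<Sum>x\<in>X. ennreal (2 / lam) * (enorm (T (b x) y) * indicator {y. 2 * R x <= norm (y - x)} y))"
       by (intro sum.cong refl) (use 3 in \<open>auto simp: dist_norm norm_minus_commute indicator_def\<close>)
      also have "... <= H y" unfolding H_def by (simp add: add.assoc[symmetric] add_increasing)
      finally show ?thesis .
     qed
     then show ?thesis using True by simp
    qed simp
   qed
  qed
  also have "... = ennreal (4 / lam\<^sup>2) * Ipow 2 (T g) + ((\<Sum>x\<in>X. emeasure lebesgue (cball x (2 * R x)))
    + (\<Sum>x\<in>X. ennreal (2 / lam) * (NN y. enorm (T (b x) y) * indicator {y. 2 * R x <= norm (y - x)} y)))"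
   unfolding H_def Ipow2 ennreal_power[OF norm_ge_zero]
   by (simp add: nn_integral_add nn_integral_sum nn_integral_cmult del: emeasure_completion)
  also have "... <= ennreal (4 / lam\<^sup>2) * (ennreal C2 * (E2 + ennreal ((2 ^ ?d * lam)\<^sup>2) * SV)) + (ennreal (w * (2 * real ?d) ^ ?d) * SV
    + ennreal (4 * CA * 2 ^ ?d) * SV)"
  proof (intro add_mono mult_left_mono)
   show "Ipow 2 (T g) <= ennreal C2 * (E2 + ennreal ((2 ^ ?d * lam)\<^sup>2) * SV)"
    using C2(2)[OF g2] gI by (meson mult_left_mono order_trans zero_le)
   have "emeasure lebesgue (cball x (2 * R x)) = ennreal (w * (2 * real ?d) ^ ?d) * ennreal (V x)" for x
   proof -
    have "2 * R x = (2 * real ?d) * (h * 2 ^ J x)" by (simp add: R_def)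
    then show ?thesis using R0[of x] w V0[of x]
     by (subst emeasure_lebesgue_cball) (auto simp: w_def V_def power_mult_distrib mult_ac simp flip: ennreal_mult)
   qed
   then show "(\<Sum>x\<in>X. emeasure lebesgue (cball x (2 * R x))) <= ennreal (w * (2 * real ?d) ^ ?d) * SV"
    by (simp add: SV_def sum_distrib_left del: emeasure_completion)
   have "ennreal (2 / lam) * (NN y. enorm (T (b x) y) * indicator {y. 2 * R x <= norm (y - x)} y)
     <= ennreal (4 * CA * 2 ^ ?d) * ennreal (V x)" if x: "x \<in> X" for x
   proof -
    have "(NN y. enorm (T (b x) y) * indicator {y. 2 * R x <= norm (y - x)} y) <=
     ennreal CA * ennreal (LINT y|lebesgue. cmod (b x y))"
     unfolding CA_def w_def by (rule calderon_zygmund_atom_integral[OF K \<mu> A T b2 bsupp R0 bmean])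
    also have "... <= ennreal CA * ennreal (2 * (2 ^ ?d * lam * V x))"
     using bL1[of x] Ile[OF x] by (intro mult_left_mono ennreal_leI) auto
    finally have "ennreal (2 / lam) * (NN y. enorm (T (b x) y) * indicator {y. 2 * R x <= norm (y - x)} y)
     <= ennreal (2 / lam) * (ennreal CA * ennreal (2 * (2 ^ ?d * lam * V x)))" by (intro mult_left_mono) auto
    also have "... = ennreal (2 / lam * (CA * (2 * (2 ^ ?d * lam * V x))))"
     using lam CA V0[of x] by (simp flip: ennreal_mult)
    also have "2 / lam * (CA * (2 * (2 ^ ?d * lam * V x))) = 4 * CA * 2 ^ ?d * V x" using lam by simp
    also have "ennreal ... = ennreal (4 * CA * 2 ^ ?d) * ennreal (V x)" using CA V0[of x] by (intro ennreal_mult) auto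
    finally show ?thesis .
   qed
   then show "(\<Sum>x\<in>X. ennreal (2 / lam) * (NN y. enorm (T (b x) y) * indicator {y. 2 * R x <= norm (y - x)} y))
     <= ennreal (4 * CA * 2 ^ ?d) * SV"
    unfolding SV_def sum_distrib_left by (intro sum_mono)
  qed auto
  also have "... = ennreal (4 * C2 / lam\<^sup>2) * E2 + ennreal W * SV"
  proof -
   have "ennreal (4 / lam\<^sup>2) * (ennreal C2 * (E2 + ennreal ((2 ^ ?d * lam)\<^sup>2) * SV)) =
    (ennreal (4 / lam\<^sup>2) * ennreal C2) * E2 + (ennreal (4 / lam\<^sup>2) * ennreal C2 * ennreal ((2 ^ ?d * lam)\<^sup>2)) * SV"
    by (simp add: distrib_left mult.assoc)
   also have "ennreal (4 / lam\<^sup>2) * ennreal C2 = ennreal (4 * C2 / lam\<^sup>2)"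
    using C2 by (simp flip: ennreal_mult)
   also have "ennreal (4 * C2 / lam\<^sup>2) * ennreal ((2 ^ ?d * lam)\<^sup>2) = ennreal (4 * C2 * (2 ^ ?d)\<^sup>2)"
    using C2 lam by (simp add: power_mult_distrib flip: ennreal_mult)
   finally show ?thesis
    unfolding W_def using C2 w CA by (simp add: ennreal_plus distrib_right add.assoc)
  qed
  also have "... <= ennreal (C / lam\<^sup>2) * E2 + ennreal W * (ennreal (2 / lam) * E1)"
   using C lam by (intro add_mono mult_right_mono mult_left_mono SV ennreal_leI divide_right_mono) auto
  also have "ennreal W * (ennreal (2 / lam) * E1) = ennreal (W * (2 / lam)) * E1"
   using W lam by (simp add: mult.assoc[symmetric] flip: ennreal_mult)
  also have "ennreal (W * (2 / lam)) * E1 <= ennreal (C / lam) * E1"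
   using C lam by (intro mult_right_mono ennreal_leI) (auto simp: field_simps)
  finally show ?thesis unfolding E1_def E2_def by (simp add: add.commute add_left_mono)
 qed
 then show ?thesis using C(1) by blast
qed

section \<open>Interpolation\<close>

lemma nn_integral_powr_below:
 assumes "0 < a" "0 <= c"
 shows "(\<integral>\<^sup>+t. ennreal (t powr (a - 1)) * indicator {0<..<c} t \<partial>lborel) = ennreal (c powr a / a)"
proof -
 have "(\<integral>\<^sup>+t. ennreal (t powr (a - 1)) * indicator {0..c} t \<partial>lborel) = ennreal (c powr (a - 1 + 1) / (a - 1 + 1))"
  using assms by (intro nn_integral_has_integral_lebesgue' has_integral_powr_from_0) auto
 moreover have "(\<integral>\<^sup>+t. ennreal (t powr (a - 1)) * indicator {0..c} t \<partial>lborel) =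
   (\<integral>\<^sup>+t. ennreal (t powr (a - 1)) * indicator {0<..<c} t \<partial>lborel)"
 proof (rule nn_integral_cong_AE)
  have "AE t in lborel. t ~= c" by (rule AE_lborel_singleton)
  then show "AE t in lborel. ennreal (t powr (a - 1)) * indicator {0..c} t = ennreal (t powr (a - 1)) * indicator {0<..<c} t"
   by eventually_elim (auto simp: indicator_def)
 qed
 ultimately show ?thesis by simp
qed

lemma nn_integral_powr_above:
 assumes "0 < a" "0 < c"
 shows "(\<integral>\<^sup>+t. ennreal (t powr (- a - 1)) * indicator {c..} t \<partial>lborel) = ennreal (c powr (- a) / a)"
proof -
 have "(\<integral>\<^sup>+t. ennreal (t powr (- a - 1)) * indicator {c..} t \<partial>lborel) = ennreal (- (c powr (- a - 1 + 1)) / (- a - 1 + 1))"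
  using assms by (intro nn_integral_has_integral_lebesgue' has_integral_powr_to_inf) auto
 then show ?thesis by simp
qed

lemma layer_cake:
 assumes sf: "sigma_finite_measure M" and [measurable]: "F \<in> borel_measurable M" and F: "!!x. 0 <= F x" and s: "0 < s"
 shows "(\<integral>\<^sup>+x. ennreal (F x powr s) \<partial>M) =
   (\<integral>\<^sup>+t. ennreal (s * t powr (s - 1)) * indicator {0<..} t * emeasure M {x\<in>space M. t < F x} \<partial>lborel)"
proof -
 interpret sigma_finite_measure M by (rule sf)
 interpret pair_sigma_finite M "lborel :: real measure"
  by (simp add: pair_sigma_finite_def sf lborel.sigma_finite_measure_axioms)
 have "(\<integral>\<^sup>+x. ennreal (F x powr s) \<partial>M) =
   (\<integral>\<^sup>+x. \<integral>\<^sup>+t. ennreal (s * t powr (s - 1)) * indicator {0<..} t * indicator {p. fst p < F (snd p)} (t, x) \<partial>lborel \<partial>M)"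
 proof (rule nn_integral_cong)
  fix x
  have "(\<integral>\<^sup>+t. ennreal (s * t powr (s - 1)) * indicator {0<..} t * indicator {p. fst p < F (snd p)} (t, x) \<partial>lborel) =
   (\<integral>\<^sup>+t. ennreal s * (ennreal (t powr (s - 1)) * indicator {0<..<F x} t) \<partial>lborel)"
   using s by (intro nn_integral_cong) (auto simp: indicator_def ennreal_mult)
  also have "... = ennreal s * ennreal (F x powr s / s)"
   by (simp add: nn_integral_cmult nn_integral_powr_below[OF s F])
  also have "... = ennreal (F x powr s)" using s by (simp flip: ennreal_mult)
  finally show "ennreal (F x powr s) = (\<integral>\<^sup>+t. ennreal (s * t powr (s - 1)) * indicator {0<..} t * indicator {p. fst p < F (snd p)} (t, x) \<partial>lborel)" ..
 qed
 also have "... = (\<integral>\<^sup>+t. \<integral>\<^sup>+x. ennreal (s * t powr (s - 1)) * indicator {0<..} t * indicator {p. fst p < F (snd p)} (t, x) \<partial>M \<partial>lborel)"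
  by (rule Fubini'[symmetric]) measurable
 also have "... = (\<integral>\<^sup>+t. ennreal (s * t powr (s - 1)) * indicator {0<..} t * emeasure M {x\<in>space M. t < F x} \<partial>lborel)"
 proof (rule nn_integral_cong)
  fix t
  have "(\<integral>\<^sup>+x. ennreal (s * t powr (s - 1)) * indicator {0<..} t * indicator {p. fst p < F (snd p)} (t, x) \<partial>M) =
    (\<integral>\<^sup>+x. ennreal (s * t powr (s - 1)) * indicator {0<..} t * indicator {x\<in>space M. t < F x} x \<partial>M)"
   by (intro nn_integral_cong) (auto simp: indicator_def)
  then show "(\<integral>\<^sup>+x. ennreal (s * t powr (s - 1)) * indicator {0<..} t * indicator {p. fst p < F (snd p)} (t, x) \<partial>M) =
   ennreal (s * t powr (s - 1)) * indicator {0<..} t * emeasure M {x\<in>space M. t < F x}"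
   by (simp add: nn_integral_cmult)
 qed
 finally show ?thesis .
qed

text \<open>Exchanging the order of integration, \<open>\<integral> t\<^bsup>s-2\<^esup> dt\<close> over \<open>0 < t < 2F\<close> remains, which converges because \<open>s > 1\<close>.\<close>

lemma layer_large_part:
 assumes sf: "sigma_finite_measure N" and [measurable]: "F \<in> borel_measurable N" and F: "!!x. 0 <= F x" and s: "1 < s"
 shows "(\<integral>\<^sup>+t. ennreal (t powr (s - 2)) * indicator {0<..} t * (\<integral>\<^sup>+x. ennreal (F x) * indicator {x. t / 2 < F x} x \<partial>N) \<partial>lborel)
   = ennreal (2 powr (s - 1) / (s - 1)) * (\<integral>\<^sup>+x. ennreal (F x powr s) \<partial>N)"
proof -
 interpret sigma_finite_measure N by (rule sf)
 interpret pair_sigma_finite N "lborel :: real measure"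
  by (simp add: pair_sigma_finite_def sf lborel.sigma_finite_measure_axioms)
 have "(\<integral>\<^sup>+t. ennreal (t powr (s - 2)) * indicator {0<..} t * (\<integral>\<^sup>+x. ennreal (F x) * indicator {x. t / 2 < F x} x \<partial>N) \<partial>lborel) =
  (\<integral>\<^sup>+t. \<integral>\<^sup>+x. ennreal (t powr (s - 2)) * indicator {0<..} t * (ennreal (F x) * indicator {p. fst p / 2 < F (snd p)} (t, x)) \<partial>N \<partial>lborel)"
  by (intro nn_integral_cong, subst nn_integral_cmult[symmetric]) (auto simp: indicator_def)
 also have "... = (\<integral>\<^sup>+x. \<integral>\<^sup>+t. ennreal (t powr (s - 2)) * indicator {0<..} t * (ennreal (F x) * indicator {p. fst p / 2 < F (snd p)} (t, x)) \<partial>lborel \<partial>N)"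
  by (rule Fubini') measurable
 also have "... = (\<integral>\<^sup>+x. ennreal (2 powr (s - 1) / (s - 1)) * ennreal (F x powr s) \<partial>N)"
 proof (rule nn_integral_cong)
  fix x
  have "(\<integral>\<^sup>+t. ennreal (t powr (s - 2)) * indicator {0<..} t * (ennreal (F x) * indicator {p. fst p / 2 < F (snd p)} (t, x)) \<partial>lborel) =
    (\<integral>\<^sup>+t. ennreal (F x) * (ennreal (t powr ((s - 1) - 1)) * indicator {0<..<2 * F x} t) \<partial>lborel)"
   by (intro nn_integral_cong) (auto simp: indicator_def mult.commute)
  also have "... = ennreal (F x) * ennreal ((2 * F x) powr (s - 1) / (s - 1))"
   using nn_integral_powr_below[of "s - 1" "2 * F x"] s F[of x] by (subst nn_integral_cmult) auto
  also have "... = ennreal (2 powr (s - 1) / (s - 1)) * ennreal (F x powr s)"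
  proof (cases "F x = 0")
   case False
   then have "F x * F x powr (s - 1) = F x powr s"
    using F[of x] by (metis add.commute diff_add_cancel order_less_le powr_add powr_one)
   then have "F x * ((2 * F x) powr (s - 1) / (s - 1)) = 2 powr (s - 1) / (s - 1) * F x powr s"
    using F[of x] by (simp add: powr_mult)
   then show ?thesis using s F[of x] by (simp only: ennreal_mult[symmetric] powr_ge_zero divide_nonneg_pos)
  qed simp
  finally show "(\<integral>\<^sup>+t. ennreal (t powr (s - 2)) * indicator {0<..} t * (ennreal (F x) * indicator {p. fst p / 2 < F (snd p)} (t, x)) \<partial>lborel) =
    ennreal (2 powr (s - 1) / (s - 1)) * ennreal (F x powr s)" .
 qed
 also have "... = ennreal (2 powr (s - 1) / (s - 1)) * (\<integral>\<^sup>+x. ennreal (F x powr s) \<partial>N)"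
  by (rule nn_integral_cmult) measurable
 finally show ?thesis .
qed

text \<open>Here \<open>\<integral> t\<^bsup>s-3\<^esup> dt\<close> over \<open>t \<ge> F\<close> remains, which converges because \<open>s < 2\<close>.\<close>

lemma layer_small_part:
 assumes sf: "sigma_finite_measure N" and [measurable]: "F \<in> borel_measurable N" and F: "!!x. 0 <= F x" and s: "0 < s" "s < 2"
 shows "(\<integral>\<^sup>+t. ennreal (t powr (s - 3)) * indicator {0<..} t * (\<integral>\<^sup>+x. ennreal ((F x)\<^sup>2) * indicator {x. F x <= t} x \<partial>N) \<partial>lborel)
   = ennreal (1 / (2 - s)) * (\<integral>\<^sup>+x. ennreal (F x powr s) \<partial>N)"
proof -
 interpret sigma_finite_measure N by (rule sf)
 interpret pair_sigma_finite N "lborel :: real measure"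
  by (simp add: pair_sigma_finite_def sf lborel.sigma_finite_measure_axioms)
 have "(\<integral>\<^sup>+t. ennreal (t powr (s - 3)) * indicator {0<..} t * (\<integral>\<^sup>+x. ennreal ((F x)\<^sup>2) * indicator {x. F x <= t} x \<partial>N) \<partial>lborel) =
  (\<integral>\<^sup>+t. \<integral>\<^sup>+x. ennreal (t powr (s - 3)) * indicator {0<..} t * (ennreal ((F x)\<^sup>2) * indicator {p. F (snd p) <= fst p} (t, x)) \<partial>N \<partial>lborel)"
  by (intro nn_integral_cong, subst nn_integral_cmult[symmetric]) (auto simp: indicator_def)
 also have "... = (\<integral>\<^sup>+x. \<integral>\<^sup>+t. ennreal (t powr (s - 3)) * indicator {0<..} t * (ennreal ((F x)\<^sup>2) * indicator {p. F (snd p) <= fst p} (t, x)) \<partial>lborel \<partial>N)"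
  by (rule Fubini') measurable
 also have "... = (\<integral>\<^sup>+x. ennreal (1 / (2 - s)) * ennreal (F x powr s) \<partial>N)"
 proof (rule nn_integral_cong)
  fix x
  show "(\<integral>\<^sup>+t. ennreal (t powr (s - 3)) * indicator {0<..} t * (ennreal ((F x)\<^sup>2) * indicator {p. F (snd p) <= fst p} (t, x)) \<partial>lborel) =
    ennreal (1 / (2 - s)) * ennreal (F x powr s)"
  proof (cases "F x = 0")
   case False
   then have Fx: "0 < F x" using F[of x] by simp
   have "(\<integral>\<^sup>+t. ennreal (t powr (s - 3)) * indicator {0<..} t * (ennreal ((F x)\<^sup>2) * indicator {p. F (snd p) <= fst p} (t, x)) \<partial>lborel) =
     (\<integral>\<^sup>+t. ennreal ((F x)\<^sup>2) * (ennreal (t powr (- (2 - s) - 1)) * indicator {F x..} t) \<partial>lborel)"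
    using Fx by (intro nn_integral_cong) (auto simp: indicator_def mult.commute)
   also have "... = ennreal ((F x)\<^sup>2) * ennreal (F x powr (- (2 - s)) / (2 - s))"
    using nn_integral_powr_above[of "2 - s" "F x"] s Fx by (subst nn_integral_cmult) auto
   also have "... = ennreal ((F x)\<^sup>2 * (F x powr (- (2 - s)) / (2 - s)))"
    using s by (intro ennreal_mult[symmetric]) auto
   also have "(F x)\<^sup>2 * (F x powr (- (2 - s)) / (2 - s)) = 1 / (2 - s) * F x powr s"
   proof -
    have "(F x)\<^sup>2 * F x powr (- (2 - s)) = F x powr 2 * F x powr (- (2 - s))" using Fx by simp
    also have "... = F x powr s" by (simp add: powr_add[symmetric])
    finally show ?thesis by simp
   qed
   also have "ennreal ... = ennreal (1 / (2 - s)) * ennreal (F x powr s)" using s by (intro ennreal_mult) auto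
   finally show ?thesis .
  qed simp
 qed
 also have "... = ennreal (1 / (2 - s)) * (\<integral>\<^sup>+x. ennreal (F x powr s) \<partial>N)"
  by (rule nn_integral_cmult) measurable
 finally show ?thesis .
qed

text \<open>Marcinkiewicz interpolation, with the truncation built into the hypothesis. It is used with \<open>D > 0\<close> for singular
 integrals, where the second term comes from \<open>L\<^sup>2\<close>, and with \<open>D = 0\<close> and any \<open>s > 1\<close> for the maximal function.\<close>

lemma weak_type_interpolation:
 assumes sM: "sigma_finite_measure M" and sN: "sigma_finite_measure N"
  and [measurable]: "H \<in> borel_measurable M" "F \<in> borel_measurable N"
  and H: "!!x. 0 <= H x" and F: "!!x. 0 <= F x" and s: "1 < s" and C: "0 <= C" "0 <= D" and sD: "D = 0 \<or> s < 2"
  and weak: "!!t. 0 < t ==> emeasure M {x\<in>space M. t < H x} <=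
    ennreal (C / t) * (\<integral>\<^sup>+x. ennreal (F x) * indicator {x. t / 2 < F x} x \<partial>N) +
    ennreal (D / t\<^sup>2) * (\<integral>\<^sup>+x. ennreal ((F x)\<^sup>2) * indicator {x. F x <= t} x \<partial>N)"
 shows "(\<integral>\<^sup>+x. ennreal (H x powr s) \<partial>M) <=
   ennreal (s * C * (2 powr (s - 1) / (s - 1)) + s * D / (2 - s)) * (\<integral>\<^sup>+x. ennreal (F x powr s) \<partial>N)"
proof -
 interpret N: sigma_finite_measure N by (rule sN)
 define E1 where "E1 t = (\<integral>\<^sup>+x. ennreal (F x) * indicator {p. fst p / 2 < F (snd p)} (t, x) \<partial>N)" for t
 define E2 where "E2 t = (\<integral>\<^sup>+x. ennreal ((F x)\<^sup>2) * indicator {p. F (snd p) <= fst p} (t, x) \<partial>N)" for t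
 have [measurable]: "E1 \<in> borel_measurable borel" "E2 \<in> borel_measurable borel"
  unfolding E1_def E2_def by measurable
 have E1: "E1 t = (\<integral>\<^sup>+x. ennreal (F x) * indicator {x. t / 2 < F x} x \<partial>N)" for t
  unfolding E1_def by (intro nn_integral_cong) (auto simp: indicator_def)
 have E2: "E2 t = (\<integral>\<^sup>+x. ennreal ((F x)\<^sup>2) * indicator {x. F x <= t} x \<partial>N)" for t
  unfolding E2_def by (intro nn_integral_cong) (auto simp: indicator_def)
 have "(\<integral>\<^sup>+x. ennreal (H x powr s) \<partial>M) =
   (\<integral>\<^sup>+t. ennreal (s * t powr (s - 1)) * indicator {0<..} t * emeasure M {x\<in>space M. t < H x} \<partial>lborel)"
  using s H by (intro layer_cake sM) auto
 also have "... <= (\<integral>\<^sup>+t. ennreal (s * C) * (ennreal (t powr (s - 2)) * indicator {0<..} t * E1 t)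
   + ennreal (s * D) * (ennreal (t powr (s - 3)) * indicator {0<..} t * E2 t) \<partial>lborel)"
 proof (rule nn_integral_mono)
  fix t :: real
  show "ennreal (s * t powr (s - 1)) * indicator {0<..} t * emeasure M {x\<in>space M. t < H x} <=
   ennreal (s * C) * (ennreal (t powr (s - 2)) * indicator {0<..} t * E1 t)
   + ennreal (s * D) * (ennreal (t powr (s - 3)) * indicator {0<..} t * E2 t)"
  proof (cases "0 < t")
   case True
   have "ennreal (s * t powr (s - 1)) * emeasure M {x\<in>space M. t < H x} <=
     ennreal (s * t powr (s - 1)) * (ennreal (C / t) * E1 t + ennreal (D / t\<^sup>2) * E2 t)"
    unfolding E1 E2 by (intro mult_left_mono weak True) auto
   also have "... = (ennreal (s * t powr (s - 1)) * ennreal (C / t)) * E1 t + (ennreal (s * t powr (s - 1)) * ennreal (D / t\<^sup>2)) * E2 t"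
    by (simp add: distrib_left mult.assoc)
   also have "ennreal (s * t powr (s - 1)) * ennreal (C / t) = ennreal (s * C) * ennreal (t powr (s - 2))"
   proof -
    have "t powr (s - 1) / t = t powr (s - 2)" using True by (simp add: powr_diff power2_eq_square)
    moreover have "s * t powr (s - 1) * (C / t) = s * C * (t powr (s - 1) / t)" by simp
    ultimately have "s * t powr (s - 1) * (C / t) = s * C * t powr (s - 2)" by (simp only:)
    then show ?thesis using s C True by (simp flip: ennreal_mult)
   qed
   also have "ennreal (s * t powr (s - 1)) * ennreal (D / t\<^sup>2) = ennreal (s * D) * ennreal (t powr (s - 3))"
   proof -
    have "t powr (s - 1) / t\<^sup>2 = t powr (s - 3)" using True by (simp add: powr_diff power2_eq_square power3_eq_cube)
    moreover have "s * t powr (s - 1) * (D / t\<^sup>2) = s * D * (t powr (s - 1) / t\<^sup>2)" by simp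
    ultimately have "s * t powr (s - 1) * (D / t\<^sup>2) = s * D * t powr (s - 3)" by (simp only:)
    then show ?thesis using s C True by (simp flip: ennreal_mult)
   qed
   finally show ?thesis using True by (simp add: mult.assoc)
  qed simp
 qed
 also have "... = ennreal (s * C) * (\<integral>\<^sup>+t. ennreal (t powr (s - 2)) * indicator {0<..} t * E1 t \<partial>lborel)
   + ennreal (s * D) * (\<integral>\<^sup>+t. ennreal (t powr (s - 3)) * indicator {0<..} t * E2 t \<partial>lborel)"
  by (subst nn_integral_add) (auto simp: nn_integral_cmult)
 also have "(\<integral>\<^sup>+t. ennreal (t powr (s - 2)) * indicator {0<..} t * E1 t \<partial>lborel) = ennreal (2 powr (s - 1) / (s - 1)) * (\<integral>\<^sup>+x. ennreal (F x powr s) \<partial>N)"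
  unfolding E1 using s F by (intro layer_large_part sN) auto
 also have "ennreal (s * D) * (\<integral>\<^sup>+t. ennreal (t powr (s - 3)) * indicator {0<..} t * E2 t \<partial>lborel) =
   ennreal (s * D / (2 - s)) * (\<integral>\<^sup>+x. ennreal (F x powr s) \<partial>N)"
 proof (cases "D = 0")
  case False
  then have s2: "s < 2" using sD by simp
  have "(\<integral>\<^sup>+t. ennreal (t powr (s - 3)) * indicator {0<..} t * E2 t \<partial>lborel) = ennreal (1 / (2 - s)) * (\<integral>\<^sup>+x. ennreal (F x powr s) \<partial>N)"
   unfolding E2 using s s2 F by (intro layer_small_part sN) auto
  moreover have "ennreal (s * D) * ennreal (1 / (2 - s)) = ennreal (s * D / (2 - s))"
   using s s2 C by (simp flip: ennreal_mult)
  ultimately show ?thesis by (simp add: mult.assoc[symmetric])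
 qed simp
 also have "ennreal (s * C) * (ennreal (2 powr (s - 1) / (s - 1)) * (\<integral>\<^sup>+x. ennreal (F x powr s) \<partial>N)) +
   ennreal (s * D / (2 - s)) * (\<integral>\<^sup>+x. ennreal (F x powr s) \<partial>N) =
   (ennreal (s * C * (2 powr (s - 1) / (s - 1))) + ennreal (s * D / (2 - s))) * (\<integral>\<^sup>+x. ennreal (F x powr s) \<partial>N)"
  using s C by (simp add: distrib_right mult.assoc[symmetric] flip: ennreal_mult)
 also have "ennreal (s * C * (2 powr (s - 1) / (s - 1))) + ennreal (s * D / (2 - s)) = ennreal (s * C * (2 powr (s - 1) / (s - 1)) + s * D / (2 - s))"
 proof (rule ennreal_plus[symmetric])
  show "0 <= s * D / (2 - s)" using sD s C by (elim disjE) auto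
 qed (use s C in auto)
 finally show ?thesis .
qed

section \<open>Density of step functions\<close>

text \<open>The lower corner of the mesh cell containing \<open>x\<close>. Sampling a continuous function there gives a step function.\<close>

definition corner :: "real => real^'n => real^'n" where
 "corner h x = (\<chi> i. real_of_int \<lfloor>x $ i / h\<rfloor> * h)"

lemma corner_measurable: "corner h \<in> borel_measurable borel"
 by (subst borel_measurable_euclidean_space) (auto simp: Basis_vec_def inner_axis corner_def)

lemma norm_corner:
 fixes x :: "real^'n"
 assumes h: "0 < h" shows "norm (corner h x - x) <= real CARD('n) * h"
proof -
 have "\<bar>(corner h x - x) $ i\<bar> <= h" for i
  using cell_floor[OF h mem_cell_self[of x h 0], of i] by (simp add: corner_def algebra_simps)
 then have "(\<Sum>i\<in>UNIV. \<bar>(corner h x - x) $ i\<bar>) <= (\<Sum>i\<in>(UNIV::'n set). h)" by (intro sum_mono)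
 then show ?thesis using norm_le_l1_cart[of "corner h x - x"] by simp
qed

lemma corner_cell: "y \<in> cell h 0 x ==> corner h y = corner h x"
 by (simp add: corner_def cell_def)

text \<open>A measurable function is almost everywhere a limit of continuous ones; cut these off to the size and support
 of \<open>u\<close> and sample them at the corners of finer and finer meshes.\<close>

lemma step_fun_approximation:
 fixes u :: "real^'n => complex"
 assumes um: "u \<in> Meas" and R: "0 < R" and u: "!!x. cmod (u x) <= B * indicator (cball 0 R) x"
 obtains v h where "!!n::nat. step_fun (h n) (v n)" "!!n x. cmod (v n x) <= (B + 1) * indicator (cball 0 (R + 2)) x"
  "AE x in lebesgue. (%n. v n x) \<longlonglongrightarrow> u x"
proof -
 let ?d = "real CARD('n)"
 have d: "1 <= ?d" by (simp add: Suc_le_eq)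
 have B: "0 <= B" using u[of 0] R by (metis indicator_simps(1) centre_in_cball less_imp_le mult.right_neutral norm_ge_zero order_trans)
 have "u measurable_on UNIV" using um by (intro lebesgue_measurable_imp_measurable_on) auto
 then obtain N g where N: "negligible N" and g: "!!n. continuous_on UNIV (g n)"
  and lim: "!!x. x \<notin> N ==> (%n. g n x) \<longlonglongrightarrow> u x"
  unfolding measurable_on_def by auto
 have "\<exists>h. 0 < h \<and> h * ?d <= 1 \<and> (\<forall>x\<in>cball 0 (R + 3). \<forall>y\<in>cball 0 (R + 3). dist y x <= ?d * h --> dist (g n y) (g n x) < 1 / real (Suc n))" for n
 proof -
  have "uniformly_continuous_on (cball 0 (R + 3)) (g n)"
   by (rule compact_uniformly_continuous[OF continuous_on_subset[OF g]]) auto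
  then obtain e where e: "e > 0" "!!x y. x \<in> cball 0 (R + 3) ==> y \<in> cball 0 (R + 3) ==> dist y x < e ==> dist (g n y) (g n x) < 1 / real (Suc n)"
   unfolding uniformly_continuous_on_def by (metis of_nat_0_less_iff zero_less_Suc zero_less_divide_1_iff)
  define h where "h = min e 1 / (2 * ?d)"
  have "?d * h = min e 1 / 2" using d by (simp add: h_def)
  moreover have "min e 1 / 2 < e" "min e 1 / 2 <= 1" using e(1) by (auto simp: min_def)
  ultimately have "?d * h < e" "h * ?d <= 1" by (simp_all only: mult.commute[of h])
  moreover have "0 < h" using e(1) d by (simp add: h_def)
  ultimately show ?thesis using e(2) by (intro exI[of _ h]) force
 qed
 then obtain h where h: "!!n. 0 < h n" "!!n. h n * ?d <= 1"
  and hg: "!!n x y. x \<in> cball 0 (R + 3) ==> y \<in> cball 0 (R + 3) ==> dist y x <= ?d * h n ==> dist (g n y) (g n x) < 1 / real (Suc n)"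
  by metis
 have cor: "norm (corner (h n) x - x) <= ?d * h n" "norm (corner (h n) x - x) <= 1" for n and x :: "real^'n"
  using norm_corner[OF h(1)[of n], of x] h(2)[of n] by (auto simp: mult.commute)
 define v where "v n x = (if cmod (g n (corner (h n) x)) <= B + 1 \<and> norm (corner (h n) x) <= R + 1 then g n (corner (h n) x) else 0)" for n x
 have vle: "cmod (v n x) <= (B + 1) * indicator (cball 0 (R + 2)) x" for n x
 proof (cases "v n x = 0")
  case False
  then have "cmod (g n (corner (h n) x)) <= B + 1" "norm (corner (h n) x) <= R + 1" by (auto simp: v_def split: if_splits)
  moreover have "norm x <= norm (corner (h n) x) + norm (corner (h n) x - x)"
   using norm_triangle_ineq4[of "corner (h n) x" "corner (h n) x - x"] by simp
  ultimately have "norm x <= R + 2" using cor(2)[of n x] by linarith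
  then show ?thesis using \<open>cmod (g n (corner (h n) x)) <= B + 1\<close> B by (simp add: v_def)
 qed (use B in auto)
 have step: "step_fun (h n) (v n)" for n
  unfolding step_fun_def
 proof (intro conjI allI impI)
  have [measurable]: "g n \<in> borel_measurable borel" using g by (rule borel_measurable_continuous_onI)
  note corner_measurable[measurable]
  have "v n \<in> borel_measurable borel" unfolding v_def by measurable
  then show "v n \<in> Meas" by (intro measurable_completion) simp
  show "v n y = v n x" if "y \<in> cell (h n) 0 x" for x y
   using corner_cell[OF that] by (simp add: v_def)
  show "\<exists>B. \<forall>x. cmod (v n x) <= B"
   using vle[of n] B by (intro exI[of _ "B + 1"] allI order_trans[OF vle]) (auto simp: indicator_def)
  show "bounded {x. v n x ~= 0}"
  proof (rule bounded_subset[OF bounded_cball])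
   show "{x. v n x ~= 0} \<subseteq> cball 0 (R + 2)"
   proof
    fix x assume "x \<in> {x. v n x ~= 0}"
    then show "x \<in> cball 0 (R + 2)" using vle[of n x] by (cases "norm x <= R + 2") auto
   qed
  qed
 qed (rule h)
 have conv: "(%n. v n x) \<longlonglongrightarrow> u x" if x: "x \<notin> N" for x
 proof (cases "norm x <= R + 2")
  case False
  then have "v n x = 0" for n using vle[of n x] by simp
  moreover have "u x = 0" using u[of x] False by simp
  ultimately show ?thesis by simp
 next
  case True
  have "(%n. dist (g n (corner (h n) x)) (g n x)) \<longlonglongrightarrow> 0"
  proof (rule real_tendsto_sandwich[of "%n. 0" _ _ "%n. 1 / real (Suc n)"])
   show "\<forall>\<^sub>F n in sequentially. dist (g n (corner (h n) x)) (g n x) <= 1 / real (Suc n)"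
   proof (rule always_eventually, rule allI, rule less_imp_le[OF hg])
    fix n
    show "corner (h n) x \<in> cball 0 (R + 3)"
     using True cor(2)[of n x] norm_triangle_ineq2[of "corner (h n) x" x] by simp
   qed (use True cor in \<open>auto simp: dist_norm\<close>)
  qed (use LIMSEQ_inverse_real_of_nat in \<open>auto simp: inverse_eq_divide\<close>)
  then have "(%n. g n (corner (h n) x) - g n x) \<longlonglongrightarrow> 0"
   by (simp add: dist_norm tendsto_norm_zero_iff)
  from tendsto_add[OF this lim[OF x]] have gc: "(%n. g n (corner (h n) x)) \<longlonglongrightarrow> u x" by simp
  show ?thesis
  proof (cases "norm x <= R")
   case True
   have "cmod (u x) < B + 1" using u[of x] True by simp
   then have "\<forall>\<^sub>F n in sequentially. cmod (g n (corner (h n) x)) < B + 1"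
    using tendsto_norm[OF gc] by (rule order_tendstoD(2)[rotated])
   then have "\<forall>\<^sub>F n in sequentially. g n (corner (h n) x) = v n x"
   proof eventually_elim
    case (elim n)
    have "norm (corner (h n) x) <= R + 1"
     using True cor(2)[of n x] norm_triangle_ineq2[of "corner (h n) x" x] by simp
    then show ?case using elim by (simp add: v_def)
   qed
   then show ?thesis by (rule Lim_transform_eventually[OF gc])
  next
   case False
   then have u0: "u x = 0" using u[of x] by simp
   have "(%n. cmod (g n (corner (h n) x))) \<longlonglongrightarrow> 0" using tendsto_norm[OF gc] u0 by simp
   then have "(%n. v n x) \<longlonglongrightarrow> 0"
    by (rule Lim_null_comparison[rotated]) (auto simp: v_def)
   then show ?thesis using u0 by simp
  qed
 qed
 have "AE x in lebesgue. x \<notin> N" using N by (simp add: negligible_iff_null_sets AE_not_in)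
 then have "AE x in lebesgue. (%n. v n x) \<longlonglongrightarrow> u x" by eventually_elim (rule conv)
 then show ?thesis by (intro that[of h v] step vle)
qed

section \<open>Boundedness on \<open>L\<^sup>s\<close> for \<open>1 < s < \<infinity>\<close>\<close>

lemma T_diff_tendsto:
 assumes T: "bounded_linear_Lp 2 T" and u: "u \<in> Lp 2" and v: "!!n. v n \<in> Lp 2"
  and lim: "(%n. Ipow 2 (%x. v n x - u x)) \<longlonglongrightarrow> 0"
 shows "(%n. Ipow 2 (%x. T (v n) x - T u x)) \<longlonglongrightarrow> 0"
proof -
 obtain C where C: "0 < C" "!!f. f \<in> Lp 2 ==> Ipow 2 (T f) <= ennreal C * Ipow 2 f"
  using bounded_linear_L2_bound[OF T] by blast
 have le: "Ipow 2 (%x. T (v n) x - T u x) <= ennreal C * Ipow 2 (%x. v n x - u x)" for n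
 proof -
  have "AE x in lebesgue. T (%y. 1 * v n y + (-1) * u y) x = 1 * T (v n) x + (-1) * T u x"
   by (rule bounded_linear_Lp_lin[OF T v u])
  then have "AE x in lebesgue. T (v n) x - T u x = T (%y. v n y - u y) x"
   by eventually_elim simp
  then have "Ipow 2 (%x. T (v n) x - T u x) = Ipow 2 (T (%y. v n y - u y))"
   by (rule Ipow_cong_AE)
  then show ?thesis using C(2)[OF Lp2_diff[OF v u]] by simp
 qed
 have z: "(%n. ennreal C * Ipow 2 (%x. v n x - u x)) \<longlonglongrightarrow> 0"
  using ennreal_tendsto_cmult[OF _ lim, of "ennreal C"] by simp
 show ?thesis by (rule tendsto_sandwich[OF _ _ tendsto_const z]) (use le in auto)
qed

text \<open>Convergence in \<open>L\<^sup>2\<close> passes to \<open>T\<close>; along a subsequence the images converge almost everywhere, and Fatou's lemma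
 gives the bound.\<close>

lemma Ls_bound_limit:
 assumes T: "bounded_linear_Lp 2 T" and u: "u \<in> Lp 2" and v: "!!n. v n \<in> Lp 2"
  and lim: "(%n. Ipow 2 (%x. v n x - u x)) \<longlonglongrightarrow> 0" and s: "0 < s"
  and bnd: "!!n. Ipow s (T (v n)) <= ennreal C * Ipow s (v n)"
  and lims: "(%n. Ipow s (v n)) \<longlonglongrightarrow> Ipow s u"
 shows "Ipow s (T u) <= ennreal C * Ipow s u"
proof (rule dense_ge)
 fix c assume c: "ennreal C * Ipow s u < c"
 note Tm = Lp2_measurable[OF bounded_linear_Lp_mem[OF T]]
 obtain r where r: "strict_mono r" and ae: "AE x in lebesgue. (%n. T (v (r n)) x) \<longlonglongrightarrow> T u x"
  using Ipow_tendsto_AE_subseq[OF Tm[OF v] Tm[OF u] _ T_diff_tendsto[OF T u v lim]] by auto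
 have "(%n. ennreal C * Ipow s (v n)) \<longlonglongrightarrow> ennreal C * Ipow s u"
  by (intro ennreal_tendsto_cmult lims) auto
 then have "\<forall>\<^sub>F n in sequentially. ennreal C * Ipow s (v n) < c"
  using c by (rule order_tendstoD(2))
 then have "\<forall>\<^sub>F n in sequentially. ennreal C * Ipow s (v (r n)) < c"
  using r by (rule eventually_subseq[rotated])
 then have ev: "\<forall>\<^sub>F n in sequentially. Ipow s (T (v (r n))) <= c"
  by eventually_elim (meson bnd less_imp_le order_trans)
 show "Ipow s (T u) <= c"
  by (rule Ipow_Fatou[OF Tm[OF v] Tm[OF u] s ae ev])
qed

lemma dominated_Ipow_limits:
 fixes u :: "real^'n => complex"
 assumes vm: "!!n. v n \<in> Meas" and um: "u \<in> Meas"
  and s: "0 < s" and ae: "AE x in lebesgue. (%n. v n x) \<longlonglongrightarrow> u x"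
  and b: "!!n x. cmod (v n x) <= B * indicator (cball 0 R) x" "!!x. cmod (u x) <= B * indicator (cball 0 R) x"
 shows "(%n. Ipow s (%x. v n x - u x)) \<longlonglongrightarrow> 0" "(%n. Ipow s (v n)) \<longlonglongrightarrow> Ipow s u"
proof -
 note vm[measurable] um[measurable]
 let ?w = "%x. ennreal ((2 * \<bar>B\<bar>) powr s) * indicator (cball 0 R) (x :: real^'n)"
 have "emeasure lebesgue (cball (0::real^'n) R) < \<infinity>"
  using fmeasurableD2[OF lmeasurable_cball[of "0::real^'n" R]] by (simp only: less_top infinity_ennreal_def)
 then have w: "(NN x. ?w x) < \<infinity>"
  by (subst nn_integral_cmult_indicator) (auto simp: ennreal_mult_less_top simp del: emeasure_completion)
 have "(%n. (NN x. ennreal (cmod (v n x - u x) powr s))) \<longlonglongrightarrow> (NN x. ennreal (cmod (u x - u x) powr s))"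
 proof (rule nn_integral_dominated_convergence[where w="?w"])
  show "AE x in lebesgue. ennreal (cmod (v j x - u x) powr s) <= ?w x" for j
  proof (rule AE_I2)
   fix x
   have "cmod (v j x - u x) <= (2 * \<bar>B\<bar>) * indicator (cball 0 R) x"
    using norm_triangle_ineq4[of "v j x" "u x"] b(1)[of j x] b(2)[of x] by (auto simp: indicator_def split: if_splits)
   then show "ennreal (cmod (v j x - u x) powr s) <= ?w x"
    using s by (auto simp: indicator_def intro!: ennreal_leI powr_mono2 split: if_splits)
  qed
  show "AE x in lebesgue. (%i. ennreal (cmod (v i x - u x) powr s)) \<longlonglongrightarrow> ennreal (cmod (u x - u x) powr s)"
   using ae by eventually_elim (intro tendsto_ennrealI tendsto_powr2 tendsto_norm tendsto_diff tendsto_const; use s in auto)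
 qed (use w in auto)
 then show "(%n. Ipow s (%x. v n x - u x)) \<longlonglongrightarrow> 0" by (simp add: Ipow_def)
 show "(%n. Ipow s (v n)) \<longlonglongrightarrow> Ipow s u"
  unfolding Ipow_def
 proof (rule nn_integral_dominated_convergence[where w="?w"])
  show "AE x in lebesgue. ennreal (cmod (v j x) powr s) <= ?w x" for j
  proof (rule AE_I2)
   fix x
   show "ennreal (cmod (v j x) powr s) <= ?w x"
    using b(1)[of j x] s by (auto simp: indicator_def intro!: ennreal_leI powr_mono2 split: if_splits)
  qed
  show "AE x in lebesgue. (%i. ennreal (cmod (v i x) powr s)) \<longlonglongrightarrow> ennreal (cmod (u x) powr s)"
   using ae by eventually_elim (intro tendsto_ennrealI tendsto_powr2 tendsto_norm tendsto_const; use s in auto)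
 qed (use w in auto)
qed

text \<open>The interpolated bound for step functions is carried to bounded functions of bounded support, and then to
 \<open>L\<^sup>2 \<inter> L\<^sup>s\<close> by truncation.\<close>

theorem calderon_zygmund_Ls_below_2:
 fixes K :: "real^'n => real^'n => complex"
 assumes K: "K \<in> standard_kernels \<mu> A" and \<mu>: "0 < \<mu>" and A: "0 < A" and T: "calderon_zygmund T K"
  and s: "1 < s" "s < 2"
 shows "\<exists>C>0. \<forall>u\<in>Lp 2 \<inter> Lp (ennreal s). Ipow s (T u) <= ennreal C * Ipow s u"
proof -
 have T2: "bounded_linear_Lp 2 T" using T by (simp add: calderon_zygmund_def)
 obtain C where C: "0 < C" and weak: "!!h f lam. step_fun h f ==> 0 < lam ==>
  emeasure lebesgue {x. lam < cmod (T f x)} <=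
   ennreal (C / lam) * (NN x. enorm (f x) * indicator {x. lam / 2 < cmod (f x)} x) +
   ennreal (C / lam\<^sup>2) * (NN x. ennreal ((cmod (f x))\<^sup>2) * indicator {x. cmod (f x) <= lam} x)"
  using calderon_zygmund_weak_type[OF K \<mu> A T] by blast
 define D where "D = s * C * (2 powr (s - 1) / (s - 1)) + s * C / (2 - s)"
 have D: "0 < D" unfolding D_def using s C by (intro add_pos_pos) auto
 have step: "Ipow s (T f) <= ennreal D * Ipow s f" if f: "step_fun h f" for h f
 proof -
  have f2: "f \<in> Lp 2" using step_fun_Lp[OF f, of 2] by simp
  have [measurable]: "T f \<in> Meas" "f \<in> Meas"
   using f2 bounded_linear_Lp_mem[OF T2] by (auto intro: Lp2_measurable)
  show ?thesis unfolding Ipow_def D_def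
   by (rule weak_type_interpolation[OF sigma_finite_lebesgue sigma_finite_lebesgue])
     (use s C weak[OF f] in auto)
 qed
 have bdd: "Ipow s (T u) <= ennreal D * Ipow s u"
  if um: "u \<in> Meas" and R: "0 < R" and u: "!!x. cmod (u x) <= B * indicator (cball 0 R) x" for u R B
 proof -
  obtain v h where v: "!!n::nat. step_fun (h n) (v n)" "!!n x. cmod (v n x) <= (B + 1) * indicator (cball 0 (R + 2)) x"
   and ae: "AE x in lebesgue. (%n. v n x) \<longlonglongrightarrow> u x"
   by (rule step_fun_approximation[OF um R u]) (rule that)
  have "0 <= B" using u[of 0] R norm_ge_zero[of "u 0"] by (simp add: order_trans[OF norm_ge_zero])
  then have u': "cmod (u x) <= (B + 1) * indicator (cball 0 (R + 2)) x" for x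
   using u[of x] R \<open>0 <= B\<close> by (cases "norm x <= R") (auto simp: indicator_def)
  have vm: "v n \<in> Meas" for n using v(1)[of n] by (simp add: step_fun_def)
  have v2: "v n \<in> Lp 2" for n using step_fun_Lp[OF v(1)[of n], of 2] by simp
  have u2: "u \<in> Lp 2" using Lp_bounded_support[of 2 u "B + 1" "cball 0 (R+2)"] um u' by simp
  show ?thesis
   using s by (intro Ls_bound_limit[OF T2 u2 v2 dominated_Ipow_limits(1)[OF vm um _ ae v(2) u'] _ step[OF v(1)]
     dominated_Ipow_limits(2)[OF vm um _ ae v(2) u']]) auto
 qed
 have "Ipow s (T u) <= ennreal D * Ipow s u" if u2: "u \<in> Lp 2" and us: "u \<in> Lp (ennreal s)" for u
 proof -
  have um: "u \<in> Meas" using u2 by (rule Lp2_measurable)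
  have fin: "Ipow 2 u < \<infinity>" "Ipow s u < \<infinity>" using u2 us s by (auto simp: mem_Lp2_iff mem_Lp_iff)
  have t2: "trunc n u \<in> Lp 2" for n using trunc_Lp[OF um, of 2] by simp
  have tb: "Ipow s (T (trunc n u)) <= ennreal D * Ipow s (trunc n u)" for n
  proof (rule bdd)
   show "trunc n u \<in> Meas" using um by measurable
   show "0 < real n + 1" by simp
   show "cmod (trunc n u x) <= real n * indicator (cball 0 (real n + 1)) x" for x
    by (auto simp: trunc_def)
  qed
  show ?thesis
   using s by (intro Ls_bound_limit[OF T2 u2 t2 Ipow_trunc(1)[OF um _ fin(1)] _ tb Ipow_trunc(2)[OF um _ fin(2)]]) auto
 qed
 then show ?thesis using D by blast
qed

text \<open>Young's inequality with the small constant on the second factor, which makes that term absorbable.\<close>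

lemma Young_eps:
 fixes s s' e :: real
 assumes s: "1 < s" "1 < s'" "1 / s + 1 / s' = 1" and e: "0 < e"
 shows "\<exists>K>0. \<forall>a b. 0 <= a --> 0 <= b --> a * b <= K * a powr s + e * b powr s'"
proof -
 define t where "t = (e * s') powr (1 / s')"
 have t: "0 < t" using e s by (simp add: t_def)
 have ts: "t powr s' = e * s'" using e s by (simp add: t_def powr_powr)
 define K where "K = t powr (- s) / s"
 have "a * b <= K * a powr s + e * b powr s'" if "0 <= a" "0 <= b" for a b
 proof -
  have "a * b = (a / t) * (t * b)" using t by simp
  also have "... <= (a / t) powr s / s + (t * b) powr s' / s'"
   using t that s by (intro Youngs_inequality) auto
  also have "(a / t) powr s / s = K * a powr s"
   using t that by (simp add: K_def powr_divide powr_minus field_simps)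
  also have "(t * b) powr s' / s' = e * b powr s'"
   using t that s ts by (simp add: powr_mult)
  finally show ?thesis .
 qed
 moreover have "0 < K" using t s by (simp add: K_def)
 ultimately show ?thesis by blast
qed

text \<open>Duality. Pair \<open>w = T u\<close> with \<open>cnj w \<bar>w\<bar>\<^bsup>s-2\<^esup>\<close>, restricted to a set where \<open>\<bar>w\<bar>\<close> lies between two positive
 constants, move \<open>T\<close> to the other side, and use
 the bound of the transpose for \<open>s' < 2\<close>. Young's inequality with a small constant lets the \<open>L\<^bsup>s'\<^esup>\<close> term be absorbed on the
 left, which is finite because that set has finite measure.\<close>

theorem calderon_zygmund_Ls_above_2:
 fixes K :: "real^'n => real^'n => complex"
 assumes K: "K \<in> standard_kernels \<mu> A" and \<mu>: "0 < \<mu>" and A: "0 < A" and T: "calderon_zygmund T K"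
  and s: "2 < s"
 shows "\<exists>C>0. \<forall>u\<in>Lp 2 \<inter> Lp (ennreal s). Ipow s (T u) <= ennreal C * Ipow s u"
proof -
 have T2: "bounded_linear_Lp 2 T" using T by (simp add: calderon_zygmund_def)
 obtain T' where T': "is_transpose T T'" using transpose_exists[OF T2] by blast
 have CZ': "calderon_zygmund T' (%x y. K y x)" by (rule transpose_calderon_zygmund[OF K \<mu> A T T'])
 have T'2: "bounded_linear_Lp 2 T'" using CZ' by (simp add: calderon_zygmund_def)
 define s' where "s' = s / (s - 1)"
 have s': "1 < s'" "s' < 2" "1 / s + 1 / s' = 1" "(s - 1) * s' = s" using s by (auto simp: s'_def field_simps)
 obtain C where C: "0 < C" and CT': "!!v. v \<in> Lp 2 ==> v \<in> Lp (ennreal s') ==> Ipow s' (T' v) <= ennreal C * Ipow s' v"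
  using calderon_zygmund_Ls_below_2[OF standard_kernels_swap[OF K] \<mu> A CZ' s'(1,2)] by blast
 obtain K0 where K0: "0 < K0" and Y: "!!a b. 0 <= a ==> 0 <= b ==> a * b <= K0 * a powr s + (1 / (2 * C)) * b powr s'"
  using Young_eps[of s s' "1 / (2 * C)"] s s' C by auto
 have "Ipow s (T u) <= ennreal (2 * K0) * Ipow s u" if u2: "u \<in> Lp 2" and us: "u \<in> Lp (ennreal s)" for u
 proof -
  define w where "w = T u"
  have w2: "w \<in> Lp 2" unfolding w_def using bounded_linear_Lp_mem[OF T2 u2] .
  have [measurable]: "w \<in> Meas" "u \<in> Meas" using w2 u2 by (auto intro: Lp2_measurable)
  have usfin: "Ipow s u < \<infinity>" using us s by (simp add: mem_Lp_iff)
  define E where "E N = {x. 1 / real (Suc N) <= cmod (w x) \<and> cmod (w x) <= real (Suc N)}" for N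
  have Em[measurable]: "E N \<in> sets lebesgue" for N
  proof -
   have "{x \<in> space lebesgue. 1 / real (Suc N) <= cmod (w x) \<and> cmod (w x) <= real (Suc N)} \<in> sets lebesgue" by measurable
   then show ?thesis by (simp add: E_def)
  qed
  define f where "f N x = w x * indicator (E N) x" for N x
  have fm[measurable]: "f N \<in> Meas" for N unfolding f_def by measurable
  have bound: "Ipow s (f N) <= ennreal (2 * K0) * Ipow s u" for N
  proof -
   have "ennreal ((1 / real (Suc N))\<^sup>2) * emeasure lebesgue (E N) = (NN x. ennreal ((1 / real (Suc N))\<^sup>2) * indicator (E N) x)"
    by (simp add: nn_integral_cmult_indicator del: emeasure_completion)
   also have "... <= Ipow 2 w"
    unfolding Ipow2 ennreal_power[OF norm_ge_zero]
    by (intro nn_integral_mono) (auto simp: E_def indicator_def intro!: ennreal_leI power_mono)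
   also have "... < \<infinity>" using w2 by (simp add: mem_Lp2_iff)
   finally have Efin: "emeasure lebesgue (E N) < \<infinity>"
    by (auto simp: ennreal_mult_less_top simp del: emeasure_completion)
   have finb: "g \<in> Lp (ennreal q)" if "0 < q" "g \<in> Meas" "!!x. cmod (g x) <= M * indicator (E N) x"
    for g q M
   proof -
    have "Ipow q g <= (NN x. ennreal (\<bar>M\<bar> powr q) * indicator (E N) x)"
     unfolding Ipow_def
    proof (rule nn_integral_mono)
     fix x show "ennreal (cmod (g x) powr q) <= ennreal (\<bar>M\<bar> powr q) * indicator (E N) x"
      using that(3)[of x] that(1) by (auto simp: indicator_def intro!: ennreal_leI powr_mono2 split: if_splits)
    qed
    also have "... < \<infinity>" using Efin by (simp add: nn_integral_cmult_indicator ennreal_mult_less_top del: emeasure_completion)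
    finally show ?thesis using that by (simp add: mem_Lp_iff)
   qed
   define v where "v x = cnj (w x) * of_real (cmod (w x) powr (s - 2)) * indicator (E N) x" for x
   have [measurable]: "v \<in> Meas" unfolding v_def by measurable
   have vn: "cmod (v x) = cmod (w x) powr (s - 1) * indicator (E N) x" for x
   proof (cases "w x = 0")
    case False
    then have "cmod (w x) * cmod (w x) powr (s - 2) = cmod (w x) powr (s - 1)"
     using powr_add[of "cmod (w x)" 1 "s - 2"] by simp
    then show ?thesis by (simp add: v_def norm_mult indicator_def)
   qed (simp add: v_def)
   have vb: "cmod (v x) <= (real (Suc N) powr (s - 1)) * indicator (E N) x" for x
    unfolding vn using s by (auto simp: E_def indicator_def intro!: powr_mono2)
   have v2: "v \<in> Lp 2" using finb[of 2 v "real (Suc N) powr (s - 1)"] vb by simp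
   have vs': "v \<in> Lp (ennreal s')" using finb[of s' v "real (Suc N) powr (s - 1)"] vb s' by simp
   have Iv: "Ipow s' v = Ipow s (f N)"
    unfolding Ipow_def f_def using s' by (intro nn_integral_cong) (auto simp: vn indicator_def powr_powr)
   have wv: "w x * v x = of_real (cmod (f N x) powr s)" for x
   proof (cases "w x = 0 \<or> x \<notin> E N")
    case False
    then have "(cmod (w x))\<^sup>2 * cmod (w x) powr (s - 2) = cmod (w x) powr s"
     using powr_add[of "cmod (w x)" 2 "s - 2"] by simp
    then show ?thesis using False
     by (simp add: v_def f_def complex_norm_square[symmetric] mult.assoc[symmetric] of_real_mult[symmetric] of_real_power[symmetric] del: of_real_mult of_real_power)
   qed (use s in \<open>auto simp: v_def f_def\<close>)
   have fs: "f N \<in> Lp (ennreal s)" using finb[of s "f N" "real (Suc N)"] s by (auto simp: f_def E_def norm_mult indicator_def)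
   have Xfin: "Ipow s (f N) < \<infinity>" using fs s by (simp add: mem_Lp_iff)
   have i: "integrable lebesgue (%x. cmod (f N x) powr s)"
    using Xfin by (intro integrableI_bounded) (auto simp: Ipow_def)
   have X: "Ipow s (f N) = ennreal (LINT x|lebesgue. cmod (f N x) powr s)"
    unfolding Ipow_def using i by (intro nn_integral_eq_integral) auto
   have "(LINT x|lebesgue. w x * v x) = of_real (LINT x|lebesgue. cmod (f N x) powr s)"
    unfolding wv by (rule integral_complex_of_real)
   then have "Ipow s (f N) = enorm (LINT x|lebesgue. w x * v x)"
    unfolding X by (simp add: integral_nonneg_AE)
   also have "(LINT x|lebesgue. w x * v x) = (LINT x|lebesgue. u x * T' v x)"
    using T' u2 v2 unfolding is_transpose_def w_def by blast
   also have "ennreal (cmod ...) <= (NN x. enorm (u x * T' v x))"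
    by (rule integrable_ennreal_bound)
   also have "... <= (NN x. ennreal K0 * ennreal (cmod (u x) powr s) + ennreal (1 / (2 * C)) * ennreal (cmod (T' v x) powr s'))"
   proof (rule nn_integral_mono)
    fix x
    have "cmod (u x * T' v x) <= K0 * cmod (u x) powr s + (1 / (2 * C)) * cmod (T' v x) powr s'"
     using Y[of "cmod (u x)" "cmod (T' v x)"] by (simp add: norm_mult)
    then have "enorm (u x * T' v x) <= ennreal (K0 * cmod (u x) powr s + (1 / (2 * C)) * cmod (T' v x) powr s')"
     by (rule ennreal_leI)
    also have "... = ennreal K0 * ennreal (cmod (u x) powr s) + ennreal (1 / (2 * C)) * ennreal (cmod (T' v x) powr s')"
     using K0 C by (subst ennreal_plus) (auto simp: ennreal_mult[symmetric])
    finally show "enorm (u x * T' v x) <= ennreal K0 * ennreal (cmod (u x) powr s) + ennreal (1 / (2 * C)) * ennreal (cmod (T' v x) powr s')" .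
   qed
   also have "... = ennreal K0 * Ipow s u + ennreal (1 / (2 * C)) * Ipow s' (T' v)"
   proof -
    have [measurable]: "T' v \<in> Meas" using bounded_linear_Lp_mem[OF T'2 v2] by (rule Lp2_measurable)
    show ?thesis unfolding Ipow_def by (subst nn_integral_add) (auto simp: nn_integral_cmult)
   qed
   also have "... <= ennreal K0 * Ipow s u + ennreal (1 / (2 * C)) * (ennreal C * Ipow s (f N))"
    using CT'[OF v2 vs'] unfolding Iv by (intro add_left_mono mult_left_mono) auto
   also have "ennreal (1 / (2 * C)) * (ennreal C * Ipow s (f N)) = ennreal (1/2) * Ipow s (f N)"
    using C by (simp add: mult.assoc[symmetric] flip: ennreal_mult)
   finally have main: "Ipow s (f N) <= ennreal K0 * Ipow s u + ennreal (1/2) * Ipow s (f N)" .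
   obtain a where a: "Ipow s (f N) = ennreal a" "0 <= a" using Xfin by (cases "Ipow s (f N)") auto
   obtain b where b: "Ipow s u = ennreal b" "0 <= b" using usfin by (cases "Ipow s u") auto
   have "ennreal a <= ennreal (K0 * b + 1/2 * a)"
   proof -
    have "ennreal (K0 * b + 1/2 * a) = ennreal (K0 * b) + ennreal (1/2 * a)"
     by (rule ennreal_plus) (use K0 a b in auto)
    also have "ennreal (K0 * b) = ennreal K0 * ennreal b" by (rule ennreal_mult) (use K0 b in auto)
    also have "ennreal (1/2 * a) = ennreal (1/2) * ennreal a" by (rule ennreal_mult) (use a in auto)
    finally show ?thesis using main unfolding a b by (simp only:)
   qed
   then have "a <= K0 * b + 1/2 * a" using K0 a b by (subst (asm) ennreal_le_iff) auto
   then have "a <= 2 * K0 * b" by simp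
   then show ?thesis using K0 unfolding a b by (simp add: b ennreal_leI flip: ennreal_mult)
  qed
  have conv: "(%N. f N x) \<longlonglongrightarrow> w x" for x
  proof (cases "w x = 0")
   case False
   obtain M :: nat where M: "max (cmod (w x)) (1 / cmod (w x)) <= real M" using real_arch_simple by blast
   have "f N x = w x" if "N \<ge> M" for N
   proof -
    have "cmod (w x) <= real (Suc N)" "1 / cmod (w x) <= real (Suc N)" using M that by auto
    then have "x \<in> E N" using False by (simp add: E_def field_simps)
    then show ?thesis by (simp add: f_def)
   qed
   then have "\<forall>\<^sub>F N in sequentially. f N x = w x" unfolding eventually_sequentially by blast
   then show ?thesis by (rule tendsto_eventually)
  qed (simp add: f_def)
  have "Ipow s w <= ennreal (2 * K0) * Ipow s u"
   by (rule Ipow_Fatou[of f]) (use s conv bound in auto)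
  then show ?thesis by (simp add: w_def)
 qed
 then show ?thesis using K0 by (intro exI[of _ "2 * K0"]) auto
qed

theorem calderon_zygmund_Ls:
 fixes K :: "real^'n => real^'n => complex"
 assumes K: "K \<in> standard_kernels \<mu> A" and \<mu>: "0 < \<mu>" and A: "0 < A" and T: "calderon_zygmund T K"
  and s: "1 < s"
 shows "\<exists>C>0. \<forall>u\<in>Lp 2 \<inter> Lp (ennreal s). Ipow s (T u) <= ennreal C * Ipow s u"
proof -
 consider "s < 2" | "s = 2" | "2 < s" by linarith
 then show ?thesis
 proof cases
  case 2
  have T2: "bounded_linear_Lp 2 T" using T by (simp add: calderon_zygmund_def)
  show ?thesis using bounded_linear_L2_bound[OF T2] 2 by (metis IntD1)
 qed (use calderon_zygmund_Ls_below_2[OF K \<mu> A T s] calderon_zygmund_Ls_above_2[OF K \<mu> A T] in auto)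
qed

lemma Ipow_tendsto_diff:
 assumes m: "!!n. f n \<in> Meas" "!!n. g n \<in> Meas" and s: "0 < s"
  and lim: "(%n. Ipow s (f n)) \<longlonglongrightarrow> 0" "(%n. Ipow s (g n)) \<longlonglongrightarrow> 0"
 shows "(%n. Ipow s (%x. f n x - g n x)) \<longlonglongrightarrow> 0" "(%n. Ipow s (%x. f n x + g n x)) \<longlonglongrightarrow> 0"
proof -
 have z: "(%n. ennreal (2 powr s) * (Ipow s (f n) + Ipow s (g n))) \<longlonglongrightarrow> 0"
  using ennreal_tendsto_cmult[OF _ tendsto_add[OF lim], of "ennreal (2 powr s)"] by simp
 show "(%n. Ipow s (%x. f n x - g n x)) \<longlonglongrightarrow> 0"
  by (rule tendsto_sandwich[OF _ _ tendsto_const z]) (use Ipow_diff[OF m s] in auto)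
 show "(%n. Ipow s (%x. f n x + g n x)) \<longlonglongrightarrow> 0"
  by (rule tendsto_sandwich[OF _ _ tendsto_const z]) (use Ipow_add[OF m s] in auto)
qed

text \<open>An extension is determined by density: on any approximating sequence it is the limit of \<open>T\<close>.\<close>

lemma Ls_extension_tendsto:
 assumes T2: "bounded_linear_Lp 2 T" and Ss: "bounded_linear_Lp (ennreal s) S" and s: "0 < s"
  and eq: "!!u. u \<in> Lp 2 \<inter> Lp (ennreal s) ==> AE x in lebesgue. S u x = T u x"
  and f: "f \<in> Lp (ennreal s)" and g: "!!n. g n \<in> Lp 2" "!!n. g n \<in> Lp (ennreal s)"
  and lim: "(%n. Ipow s (%x. g n x - f x)) \<longlonglongrightarrow> 0"
 shows "(%n. Ipow s (%x. T (g n) x - S f x)) \<longlonglongrightarrow> 0"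
proof -
 obtain C where C: "0 < C" "!!f. f \<in> Lp (ennreal s) ==> Ipow s (S f) <= ennreal C * Ipow s f"
  using Ss unfolding bounded_linear_Lp_iff[OF s] by blast
 have le: "Ipow s (%x. T (g n) x - S f x) <= ennreal C * Ipow s (%x. g n x - f x)" for n
 proof -
  have "AE x in lebesgue. S (%y. 1 * g n y + (-1) * f y) x = 1 * S (g n) x + (-1) * S f x"
   by (rule bounded_linear_Lp_lin[OF Ss g(2) f])
  moreover have "AE x in lebesgue. S (g n) x = T (g n) x" using g by (intro eq) auto
  ultimately have "AE x in lebesgue. T (g n) x - S f x = S (%y. g n y - f y) x"
   by eventually_elim simp
  then have "Ipow s (%x. T (g n) x - S f x) = Ipow s (S (%y. g n y - f y))"
   by (rule Ipow_cong_AE)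
  then show ?thesis using C(2)[OF Lp_diff[OF s g(2) f]] by simp
 qed
 have z: "(%n. ennreal C * Ipow s (%x. g n x - f x)) \<longlonglongrightarrow> 0"
  using ennreal_tendsto_cmult[OF _ lim, of "ennreal C"] by simp
 show ?thesis by (rule tendsto_sandwich[OF _ _ tendsto_const z]) (use le in auto)
qed

text \<open>The value at \<open>f\<close> is the \<open>L\<^sup>s\<close> limit of \<open>T\<close> on the truncations of \<open>f\<close>.\<close>

lemma Ls_extension_exists:
 fixes T :: "(real^'n => complex) => (real^'n => complex)"
 assumes T2: "bounded_linear_Lp 2 T" and s: "0 < s" and C: "0 < C"
  and bnd: "!!u. u \<in> Lp 2 ==> u \<in> Lp (ennreal s) ==> Ipow s (T u) <= ennreal C * Ipow s u"
 shows "\<exists>S. bounded_linear_Lp (ennreal s) S \<and> (\<forall>u\<in>Lp 2 \<inter> Lp (ennreal s). AE x in lebesgue. S u x = T u x)"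
proof -
 note Tm = Lp2_measurable[OF bounded_linear_Lp_mem[OF T2]]
 have Tdiff: "Ipow s (%x. T u x - T v x) <= ennreal C * Ipow s (%x. u x - v x)"
  if u: "u \<in> Lp 2" "u \<in> Lp (ennreal s)" and v: "v \<in> Lp 2" "v \<in> Lp (ennreal s)" for u v
 proof -
  have "AE x in lebesgue. T (%y. 1 * u y + (-1) * v y) x = 1 * T u x + (-1) * T v x"
   by (rule bounded_linear_Lp_lin[OF T2 u(1) v(1)])
  then have "AE x in lebesgue. T u x - T v x = T (%y. u y - v y) x" by eventually_elim simp
  then have "Ipow s (%x. T u x - T v x) = Ipow s (T (%y. u y - v y))" by (rule Ipow_cong_AE)
  then show ?thesis using bnd[OF Lp2_diff[OF u(1) v(1)] Lp_diff[OF s u(2) v(2)]] by simp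
 qed
 have "\<exists>w. w \<in> Lp (ennreal s) \<and> (%n. Ipow s (%x. T (trunc n f) x - w x)) \<longlonglongrightarrow> 0" if f: "f \<in> Lp (ennreal s)" for f
 proof -
  have fm: "f \<in> Meas" and fin: "Ipow s f < \<infinity>" using f s by (auto simp: mem_Lp_iff)
  have t2: "trunc n f \<in> Lp 2" for n using trunc_Lp[OF fm, of 2] by simp
  have ts: "trunc n f \<in> Lp (ennreal s)" for n using trunc_Lp[OF fm s] .
  have tm: "trunc n f \<in> Meas" for n using fm by measurable
  have "\<exists>N. \<forall>m\<ge>N. \<forall>n\<ge>N. Ipow s (%x. T (trunc m f) x - T (trunc n f) x) <= ennreal e" if e: "e > 0" for e
  proof -
   obtain N where N: "!!m n. m \<ge> N ==> n \<ge> N ==> Ipow s (%x. trunc m f x - trunc n f x) <= ennreal (e / C)"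
    using Ipow_Cauchy[OF tm fm s Ipow_trunc(1)[OF fm s fin], of "e / C"] e C by auto
   have "Ipow s (%x. T (trunc m f) x - T (trunc n f) x) <= ennreal e" if "m \<ge> N" "n \<ge> N" for m n
   proof -
    have "Ipow s (%x. T (trunc m f) x - T (trunc n f) x) <= ennreal C * ennreal (e / C)"
     by (rule order_trans[OF Tdiff[OF t2 ts t2 ts] mult_left_mono[OF N[OF that]]]) simp
    also have "... = ennreal e" using C e by (simp flip: ennreal_mult)
    finally show ?thesis .
   qed
   then show ?thesis by blast
  qed
  from Ipow_Cauchy_complete[OF Tm[OF t2] s this]
  obtain w where wm[measurable]: "w \<in> Meas" and lim: "(%n. Ipow s (%x. T (trunc n f) x - w x)) \<longlonglongrightarrow> 0"
   by blast
  obtain N where N: "Ipow s (%x. T (trunc N f) x - w x) <= ennreal 1"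
   using tendsto0_ennreal_small[OF lim, of 1] by auto
  have [measurable]: "T (trunc N f) \<in> Meas" by (rule Tm[OF t2])
  have d: "(%x. T (trunc N f) x - w x) \<in> Lp (ennreal s)"
   using N s by (auto simp: mem_Lp_iff intro: le_less_trans)
  have "Ipow s (T (trunc N f)) < \<infinity>"
   using bnd[OF t2[of N] ts[of N]] ts[of N] s by (auto simp: mem_Lp_iff ennreal_mult_less_top intro: le_less_trans)
  then have "T (trunc N f) \<in> Lp (ennreal s)" using s by (simp add: mem_Lp_iff)
  from Lp_diff[OF s this d] have "w \<in> Lp (ennreal s)" by simp
  then show ?thesis using lim by blast
 qed
 note ex = this
 define S where "S f = (SOME w. w \<in> Lp (ennreal s) \<and> (%n. Ipow s (%x. T (trunc n f) x - w x)) \<longlonglongrightarrow> 0)" for f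
 have S: "S f \<in> Lp (ennreal s)" and Slim: "(%n. Ipow s (%x. T (trunc n f) x - S f x)) \<longlonglongrightarrow> 0"
  if "f \<in> Lp (ennreal s)" for f
  using someI_ex[OF ex[OF that]] unfolding S_def by blast+
 have Sm: "S f \<in> Meas" if "f \<in> Lp (ennreal s)" for f using S[OF that] s by (simp add: mem_Lp_iff)
 text \<open>Any approximating sequence computes the extension.\<close>
 have lims: "(%n. Ipow s (%x. T (g n) x - S f x)) \<longlonglongrightarrow> 0"
  if f: "f \<in> Lp (ennreal s)" and g: "!!n. g n \<in> Lp 2" "!!n. g n \<in> Lp (ennreal s)"
   and lim: "(%n. Ipow s (%x. g n x - f x)) \<longlonglongrightarrow> 0" for f g
 proof -
  have fm: "f \<in> Meas" and fin: "Ipow s f < \<infinity>" using f s by (auto simp: mem_Lp_iff)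
  have t2: "trunc n f \<in> Lp 2" for n using trunc_Lp[OF fm, of 2] by simp
  have ts: "trunc n f \<in> Lp (ennreal s)" for n using trunc_Lp[OF fm s] .
  have tm: "trunc n f \<in> Meas" for n using fm by measurable
  have gm: "g n \<in> Meas" for n using g(1) by (rule Lp2_measurable)
  have d: "(%n. Ipow s (%x. (g n x - f x) - (trunc n f x - f x))) \<longlonglongrightarrow> 0"
   by (rule Ipow_tendsto_diff(1)) (use gm fm tm s lim Ipow_trunc(1)[OF fm s fin] in auto)
  then have d: "(%n. Ipow s (%x. g n x - trunc n f x)) \<longlonglongrightarrow> 0" by simp
  have z: "(%n. ennreal C * Ipow s (%x. g n x - trunc n f x)) \<longlonglongrightarrow> 0"
   using ennreal_tendsto_cmult[OF _ d, of "ennreal C"] by simp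
  have Td: "(%n. Ipow s (%x. T (g n) x - T (trunc n f) x)) \<longlonglongrightarrow> 0"
   by (rule tendsto_sandwich[OF _ _ tendsto_const z]) (use Tdiff[OF g t2 ts] in auto)
  have "(%n. Ipow s (%x. (T (g n) x - T (trunc n f) x) + (T (trunc n f) x - S f x))) \<longlonglongrightarrow> 0"
   using Tm[OF g(1)] Tm[OF t2] Sm[OF f] s by (intro Ipow_tendsto_diff(2) Td Slim f borel_measurable_diff) auto
  then show ?thesis by simp
 qed
 have uniq: "AE x in lebesgue. a x = b x"
  if "!!n. F n \<in> Meas" "a \<in> Meas" "b \<in> Meas"
   "(%n. Ipow s (%x. F n x - a x)) \<longlonglongrightarrow> 0" "(%n. Ipow s (%x. F n x - b x)) \<longlonglongrightarrow> 0" for F a b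
  using Ipow_limit_unique[OF that(1-3) s that(4,5)] that(2,3) by (subst (asm) Ipow_eq_0_iff) auto
 have "bounded_linear_Lp (ennreal s) S"
  unfolding bounded_linear_Lp_iff[OF s]
 proof (intro conjI ballI allI)
  show "S f \<in> Lp (ennreal s)" if "f \<in> Lp (ennreal s)" for f :: "real^'n => complex" using S[OF that] .
  fix f g :: "real^'n => complex" and a b assume f: "f \<in> Lp (ennreal s)" and g: "g \<in> Lp (ennreal s)"
  have fm: "f \<in> Meas" "g \<in> Meas" and fin: "Ipow s f < \<infinity>" "Ipow s g < \<infinity>"
   using f g s by (auto simp: mem_Lp_iff)
  note [measurable] = fm
  let ?l = "%n y. a * trunc n f y + b * trunc n g y"
  have l2: "?l n \<in> Lp 2" for n using trunc_Lp[OF fm(1), of 2] trunc_Lp[OF fm(2), of 2] by (intro Lp2_lincomb) auto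
  have ls: "?l n \<in> Lp (ennreal s)" for n using s by (intro Lp_lincomb trunc_Lp fm)
  have h: "(%y. a * f y + b * g y) \<in> Lp (ennreal s)" using s f g by (intro Lp_lincomb)
  have sc: "(%n. Ipow s (%x. c * F n x)) \<longlonglongrightarrow> 0" if "!!n. F n \<in> Meas" "(%n. Ipow s (F n)) \<longlonglongrightarrow> 0"
   for c and F :: "nat => real^'n => complex"
   using ennreal_tendsto_cmult[OF _ that(2), of "ennreal (cmod c powr s)"] Ipow_scale[OF that(1), of 0 s c] by simp
  have "(%n. Ipow s (%x. a * (trunc n f x - f x) + b * (trunc n g x - g x))) \<longlonglongrightarrow> 0"
   using s by (intro Ipow_tendsto_diff(2) sc Ipow_trunc(1) fm fin) auto
  then have "(%n. Ipow s (%x. ?l n x - (a * f x + b * g x))) \<longlonglongrightarrow> 0" by (simp add: algebra_simps)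
  then have 1: "(%n. Ipow s (%x. T (?l n) x - S (%y. a * f y + b * g y) x)) \<longlonglongrightarrow> 0"
   by (rule lims[OF h l2 ls])
  have t2: "trunc n f \<in> Lp 2" "trunc n g \<in> Lp 2" for n using trunc_Lp[OF fm(1), of 2] trunc_Lp[OF fm(2), of 2] by auto
  note mm[measurable] = Tm[OF t2(1)] Tm[OF t2(2)] Sm[OF f] Sm[OF g]
  have "(%n. Ipow s (%x. a * (T (trunc n f) x - S f x) + b * (T (trunc n g) x - S g x))) \<longlonglongrightarrow> 0"
   using s by (intro Ipow_tendsto_diff(2) sc Slim f g) auto
  moreover have "Ipow s (%x. a * (T (trunc n f) x - S f x) + b * (T (trunc n g) x - S g x)) =
    Ipow s (%x. T (?l n) x - (a * S f x + b * S g x))" for n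
  proof (rule Ipow_cong_AE)
   show "AE x in lebesgue. a * (T (trunc n f) x - S f x) + b * (T (trunc n g) x - S g x) = T (?l n) x - (a * S f x + b * S g x)"
    using bounded_linear_Lp_lin[OF T2 t2(1) t2(2), of a n b n] by eventually_elim (simp add: algebra_simps)
  qed
  ultimately have 2: "(%n. Ipow s (%x. T (?l n) x - (a * S f x + b * S g x))) \<longlonglongrightarrow> 0" by simp
  show "AE x in lebesgue. S (%y. a * f y + b * g y) x = a * S f x + b * S g x"
   by (rule uniq[OF Tm[OF l2] Sm[OF h] _ 1 2]) measurable
 next
  show "\<exists>C::real. 0 < C \<and> (\<forall>f\<in>Lp (ennreal s). Ipow s (S f) <= ennreal C * Ipow s f)"
  proof (intro exI conjI ballI)
   show "0 < 2 powr s * C" using C by simp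
   fix f :: "real^'n => complex" assume f: "f \<in> Lp (ennreal s)"
   have fm: "f \<in> Meas" and fin: "Ipow s f < \<infinity>" using f s by (auto simp: mem_Lp_iff)
   have t2: "trunc n f \<in> Lp 2" for n using trunc_Lp[OF fm, of 2] by simp
   have ts: "trunc n f \<in> Lp (ennreal s)" for n using trunc_Lp[OF fm s] .
   have le: "Ipow s (S f) <= ennreal (2 powr s) * (ennreal C * Ipow s f + Ipow s (%x. T (trunc n f) x - S f x))" for n
   proof -
    have "Ipow s (%x. T (trunc n f) x - (T (trunc n f) x - S f x)) <=
      ennreal (2 powr s) * (Ipow s (T (trunc n f)) + Ipow s (%x. T (trunc n f) x - S f x))"
     using s Tm[OF t2] Sm[OF f] by (intro Ipow_diff borel_measurable_diff)
    also have "... <= ennreal (2 powr s) * (ennreal C * Ipow s f + Ipow s (%x. T (trunc n f) x - S f x))"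
    proof (intro mult_left_mono add_right_mono)
     have "Ipow s (trunc n f) <= Ipow s f" using s by (intro Ipow_mono_AE) (auto simp: trunc_norm_le)
     then show "Ipow s (T (trunc n f)) <= ennreal C * Ipow s f"
      by (intro order_trans[OF bnd[OF t2 ts]] mult_left_mono) auto
    qed auto
    finally show ?thesis by simp
   qed
   have "(%n. ennreal (2 powr s) * (ennreal C * Ipow s f + Ipow s (%x. T (trunc n f) x - S f x)))
     \<longlonglongrightarrow> ennreal (2 powr s) * (ennreal C * Ipow s f + 0)"
    by (intro ennreal_tendsto_cmult tendsto_add tendsto_const Slim f) auto
   then have "Ipow s (S f) <= ennreal (2 powr s) * (ennreal C * Ipow s f + 0)"
    by (rule tendsto_lowerbound) (use le in auto)
   then show "Ipow s (S f) <= ennreal (2 powr s * C) * Ipow s f"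
    using C by (simp add: ennreal_mult mult.assoc)
  qed
 qed
 moreover have "AE x in lebesgue. S u x = T u x" if u: "u \<in> Lp 2" "u \<in> Lp (ennreal s)" for u
 proof (rule uniq[of "%n. T u"])
  show "(%n. Ipow s (%x. T u x - S u x)) \<longlonglongrightarrow> 0"
   by (rule lims) (use u in \<open>auto simp: Ipow_def\<close>)
 qed (use Tm[OF u(1)] Sm[OF u(2)] in \<open>auto simp: Ipow_def\<close>)
 ultimately show ?thesis by blast
qed

section \<open>Singular integrals of bounded functions\<close>

definition near_part :: "real^'n => real => (real^'n => complex) => real^'n => complex" where
 "near_part c R f x = f x * indicator {x. norm (x - c) < 2 * R} x"

text \<open>The kernel is renormalised by its value at \<open>c\<close>. The difference decays like \<open>\<bar>x - c\<bar>\<^bsup>-d-\<mu>\<^esup>\<close>, so the integral converges for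
 bounded \<open>f\<close>; without it the integral could diverge.\<close>

definition far_part ::
  "(real^'n => real^'n => complex) => real^'n => real => (real^'n => complex) => real^'n => complex" where
 "far_part K c R f y =
   (LINT x|lebesgue. f x * indicator {x. 2 * R <= norm (x - c)} x * (offdiag K y x - offdiag K c x))"

lemma near_part_Lp:
 assumes "f \<in> Meas" "AE x in lebesgue. cmod (f x) <= M" "0 < s"
 shows "near_part c R f \<in> Lp (ennreal s)"
proof (rule Lp_bounded_support[OF assms(3), of _ M "cball c (2 * R)"])
 have [measurable]: "{x. norm (x - c) < 2 * R} \<in> sets lebesgue"
 proof -
  have "{x \<in> space lebesgue. norm (x - c) < 2 * R} \<in> sets lebesgue" by measurable
  then show ?thesis by simp
 qed
 show "near_part c R f \<in> Meas"
  unfolding near_part_def using assms(1) by measurable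
 show "AE x in lebesgue. cmod (near_part c R f x) <= M * indicator (cball c (2 * R)) x"
  using assms(2) by eventually_elim (auto simp: near_part_def indicator_def dist_norm norm_minus_commute intro: order_trans[OF norm_ge_zero])
qed auto

lemma far_set_measurable [measurable]: "{x. r <= norm (x - c)} \<in> sets (lebesgue :: (real^'n) measure)"
proof -
 have "{x \<in> space (lebesgue :: (real^'n) measure). r <= norm (x - c)} \<in> sets lebesgue" by measurable
 then show ?thesis by simp
qed

lemma far_part_measurable:
 fixes K :: "real^'n => real^'n => complex"
 assumes K: "K \<in> standard_kernels \<mu> A" and \<mu>: "0 < \<mu>" and fm[measurable]: "f \<in> Meas"
 shows "far_part K c R f \<in> Meas"
  and "(%p. f (snd p) * indicator {x. 2 * R <= norm (x - c)} (snd p) * (offdiag K (fst p) (snd p) - offdiag K c (snd p)))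
    \<in> borel_measurable (lebesgue \<Otimes>\<^sub>M lebesgue)"
proof -
 note om[measurable] = offdiag_measurable[OF K \<mu>]
 have sec[measurable]: "(%x. offdiag K c x) \<in> Meas" by (rule offdiag_section_measurable[OF K \<mu>])
 have s2: "(%p::(real^'n) \<times> (real^'n). offdiag K c (snd p)) \<in> borel_measurable (lebesgue \<Otimes>\<^sub>M lebesgue)"
  using measurable_compose[OF measurable_snd sec] .
 have f2: "(%p::(real^'n) \<times> (real^'n). f (snd p) * indicator {x. 2 * R <= norm (x - c)} (snd p)) \<in> borel_measurable (lebesgue \<Otimes>\<^sub>M lebesgue)"
  by (rule measurable_compose[OF measurable_snd, of "%x. f x * indicator {x. 2 * R <= norm (x - c)} x"]) measurable
 show m: "(%p. f (snd p) * indicator {x. 2 * R <= norm (x - c)} (snd p) * (offdiag K (fst p) (snd p) - offdiag K c (snd p)))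
    \<in> borel_measurable (lebesgue \<Otimes>\<^sub>M lebesgue)"
  by (intro borel_measurable_times borel_measurable_diff om s2 f2)
 show "far_part K c R f \<in> Meas"
  unfolding far_part_def
  by (rule leb.borel_measurable_lebesgue_integral) (use m in \<open>simp add: case_prod_beta\<close>)
qed

lemma kernel_far_difference:
 fixes K :: "real^'n => real^'n => complex"
 assumes K: "K \<in> standard_kernels \<mu> A" and \<mu>: "0 < \<mu>" and A: "0 < A" and R: "0 < R"
  and y: "y \<in> cball c R" and x: "2 * R <= norm (x - c)"
 shows "cmod (offdiag K y x - offdiag K c x) <= A * ((2 * R) powr \<mu> / norm (x - c) powr (real CARD('n) + \<mu>))"
proof -
 have cy: "norm (c - y) <= R" using y by (simp add: dist_norm)
 have ne: "c ~= x" "y ~= x" using x R cy by (auto simp: norm_minus_commute)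
 have "cmod (K c x - K y x) <= A * (norm (c - y) powr \<mu> / norm (c - x) powr (real CARD('n) + \<mu>))"
  using x cy ne by (intro kernel_smooth1[OF K]) (auto simp: norm_minus_commute)
 also have "... <= A * ((2 * R) powr \<mu> / norm (c - x) powr (real CARD('n) + \<mu>))"
  using cy R \<mu> A by (intro mult_left_mono divide_right_mono powr_mono2) auto
 finally show ?thesis using ne by (simp add: offdiag_def norm_minus_commute)
qed

text \<open>Kernel smoothness reduces the bound to the tail integral over annuli.\<close>

lemma far_part_bound:
 fixes K :: "real^'n => real^'n => complex"
 assumes K: "K \<in> standard_kernels \<mu> A" and \<mu>: "0 < \<mu>" and A: "0 < A" and R: "0 < R"
  and y: "y \<in> cball c R" and fm[measurable]: "f \<in> Meas"
  and G: "!!\<rho>. 2 * R <= \<rho> ==> (NN x. enorm (f x) * indicator (cball c \<rho>) x) <= ennreal (\<rho> ^ CARD('n)) * G"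
 shows "enorm (far_part K c R f y) <= ennreal (A * (2 ^ CARD('n) / (1 - 2 powr (-\<mu>)))) * G"
proof -
 have q: "2 powr (-\<mu>) < 1" using \<mu> by (simp add: powr_less_one)
 have "enorm (far_part K c R f y) <=
   (NN x. enorm (f x * indicator {x. 2 * R <= norm (x - c)} x * (offdiag K y x - offdiag K c x)))"
  unfolding far_part_def by (rule integrable_ennreal_bound)
 also have "... <= (NN x. ennreal A * (ennreal ((2 * R) powr \<mu> / norm (x - c) powr (real CARD('n) + \<mu>)) * enorm (f x) * indicator {x. 2 * R <= norm (x - c)} x))"
 proof (rule nn_integral_mono)
  fix x
  show "enorm (f x * indicator {x. 2 * R <= norm (x - c)} x * (offdiag K y x - offdiag K c x)) <=
    ennreal A * (ennreal ((2 * R) powr \<mu> / norm (x - c) powr (real CARD('n) + \<mu>)) * enorm (f x) * indicator {x. 2 * R <= norm (x - c)} x)"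
  proof (cases "2 * R <= norm (x - c)")
   case True
   have "cmod (f x) * cmod (offdiag K y x - offdiag K c x) <= cmod (f x) * (A * ((2 * R) powr \<mu> / norm (x - c) powr (real CARD('n) + \<mu>)))"
    by (intro mult_left_mono kernel_far_difference[OF K \<mu> A R y True]) auto
   then show ?thesis using True A
    by (simp add: norm_mult ennreal_leI mult_ac flip: ennreal_mult)
  qed simp
 qed
 also have "... = ennreal A * (NN x. ennreal ((2 * R) powr \<mu> / norm (x - c) powr (real CARD('n) + \<mu>)) * enorm (f x) * indicator {x. 2 * R <= norm (x - c)} x)"
  by (rule nn_integral_cmult) measurable
 also have "... <= ennreal A * (ennreal (2 ^ CARD('n) / (1 - 2 powr (-\<mu>))) * G)"
  using R \<mu> by (intro mult_left_mono tail_integral G) auto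
 also have "... = ennreal (A * (2 ^ CARD('n) / (1 - 2 powr (-\<mu>)))) * G"
  using A q by (simp add: mult.assoc[symmetric] flip: ennreal_mult)
 finally show ?thesis .
qed

lemma bounded_average:
 fixes f :: "real^'n => complex"
 assumes fm: "f \<in> Meas" and ae: "AE x in lebesgue. cmod (f x) <= M" and \<rho>: "0 <= \<rho>"
 shows "(NN x. enorm (f x) * indicator (cball c \<rho>) x) <= ennreal (\<rho> ^ CARD('n)) * ennreal (\<bar>M\<bar> * unit_ball_vol (real CARD('n)))"
proof -
 have "(NN x. enorm (f x) * indicator (cball c \<rho>) x) <= (NN x. ennreal \<bar>M\<bar> * indicator (cball c \<rho>) x)"
  using ae by (intro nn_integral_mono_AE) (auto elim!: eventually_mono intro!: mult_right_mono ennreal_leI)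
 also have "... = ennreal \<bar>M\<bar> * emeasure lebesgue (cball c \<rho>)" by (simp add: nn_integral_cmult_indicator del: emeasure_completion)
 also have "... = ennreal (\<rho> ^ CARD('n)) * ennreal (\<bar>M\<bar> * unit_ball_vol (real CARD('n)))"
  using \<rho> by (subst emeasure_lebesgue_cball) (auto simp: mult_ac simp flip: ennreal_mult)
 finally show ?thesis by simp
qed

lemma far_part_bounded:
 fixes K :: "real^'n => real^'n => complex"
 assumes K: "K \<in> standard_kernels \<mu> A" and \<mu>: "0 < \<mu>" and A: "0 < A" and R: "0 < R"
  and fm: "f \<in> Meas" and ae: "AE x in lebesgue. cmod (f x) <= M"
 shows "\<exists>B. \<forall>y\<in>cball c R. cmod (far_part K c R f y) <= B"
proof -
 have q: "2 powr (-\<mu>) < 1" using \<mu> by (simp add: powr_less_one)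
 let ?G = "\<bar>M\<bar> * unit_ball_vol (real CARD('n))"
 have "cmod (far_part K c R f y) <= A * (2 ^ CARD('n) / (1 - 2 powr (-\<mu>))) * ?G" if y: "y \<in> cball c R" for y
 proof -
  have "enorm (far_part K c R f y) <= ennreal (A * (2 ^ CARD('n) / (1 - 2 powr (-\<mu>)))) * ennreal ?G"
   using R by (intro far_part_bound[OF K \<mu> A R y fm] bounded_average[OF fm ae]) auto
  also have "... = ennreal (A * (2 ^ CARD('n) / (1 - 2 powr (-\<mu>))) * ?G)"
   using A q by (intro ennreal_mult[symmetric]) auto
  finally show ?thesis using A q by (subst (asm) ennreal_le_iff) auto
 qed
 then show ?thesis by blast
qed

lemma transpose_atom_integrable:
 fixes K :: "real^'n => real^'n => complex"
 assumes K: "K \<in> standard_kernels \<mu> A" and \<mu>: "0 < \<mu>" and A: "0 < A" and T: "calderon_zygmund T K"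
  and g: "g \<in> Lp 2" and supp: "!!y. g y ~= 0 ==> y \<in> cball c R" and R: "0 < R"
  and mean: "(LINT y|lebesgue. g y) = 0"
 shows "integrable lebesgue (T g)"
proof (rule integrableI_bounded)
 have T2: "bounded_linear_Lp 2 T" using T by (simp add: calderon_zygmund_def)
 have Tg: "T g \<in> Lp 2" by (rule bounded_linear_Lp_mem[OF T2 g])
 show m[measurable]: "T g \<in> Meas" using Tg by (rule Lp2_measurable)
 have i: "integrable lebesgue (%x. T g x * indicator (cball c (2 * R)) x)"
  by (rule set_L2_integrable[OF Tg]) auto
 have "(NN x. enorm (T g x)) <=
   (NN x. enorm (T g x * indicator (cball c (2 * R)) x) + enorm (T g x) * indicator {x. 2 * R <= norm (x - c)} x)"
  by (intro nn_integral_mono) (auto simp: indicator_def dist_norm norm_minus_commute)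
 also have "... = (NN x. enorm (T g x * indicator (cball c (2 * R)) x)) +
   (NN x. enorm (T g x) * indicator {x. 2 * R <= norm (x - c)} x)"
  by (rule nn_integral_add) measurable
 also have "... < \<infinity>"
 proof -
  have 1: "(NN x. enorm (T g x * indicator (cball c (2 * R)) x)) < \<infinity>"
   using i by (simp add: integrable_iff_bounded)
  have "(NN x. enorm (T g x) * indicator {x. 2 * R <= norm (x - c)} x)
    <= ennreal (A * (2 ^ CARD('n) / (1 - 2 powr (-\<mu>)) * unit_ball_vol (real CARD('n)))) * ennreal (LINT y|lebesgue. cmod (g y))"
   by (rule calderon_zygmund_atom_integral[OF K \<mu> A T g]) (use supp R mean in auto)
  also have "... < \<infinity>" by (simp add: ennreal_mult_less_top)
  finally show ?thesis using 1 by simp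
 qed
 finally show "(NN x. enorm (T g x)) < \<infinity>" .
qed

lemma integrable_bounded_mult:
 fixes f g :: "'a => complex"
 assumes "integrable M g" "f \<in> borel_measurable M" "AE x in M. cmod (f x) <= B"
 shows "integrable M (%x. f x * g x)"
proof (rule Bochner_Integration.integrable_bound[of _ "%x. B * cmod (g x)"])
 show "AE x in M. norm (f x * g x) <= norm (B * cmod (g x))"
  using assms(3) by eventually_elim (simp add: norm_mult abs_mult mult_right_mono)
 show "integrable M (%x. B * cmod (g x))" using assms(1) by simp
 show "(%x. f x * g x) \<in> borel_measurable M" using assms by auto
qed

text \<open>For mean zero \<open>g\<close> the values of \<open>T' g\<close> far from \<open>c\<close> are integrals of \<open>K(y,x) - K(c,x)\<close> against \<open>g\<close>; Fubini's theorem
 moves that kernel to \<open>f\<close>. On the near part the definition of the transpose applies.\<close>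

lemma transpose_pairing:
 fixes K :: "real^'n => real^'n => complex"
 assumes K: "K \<in> standard_kernels \<mu> A" and \<mu>: "0 < \<mu>" and A: "0 < A" and T: "calderon_zygmund T K"
  and T': "is_transpose T T'"
  and fm[measurable]: "f \<in> Meas" and ae: "AE x in lebesgue. cmod (f x) <= M"
  and g: "g \<in> Lp 2" and supp: "!!y. g y ~= 0 ==> y \<in> cball c R" and R: "0 < R"
  and mean: "(LINT y|lebesgue. g y) = 0"
 shows "integrable lebesgue (%x. f x * T' g x)"
  and "integrable lebesgue (%y. (T (near_part c R f) y + far_part K c R f y) * g y)"
  and "(LINT x|lebesgue. f x * T' g x) = (LINT y|lebesgue. (T (near_part c R f) y + far_part K c R f y) * g y)"
proof -
 let ?K' = "%x y. K y x"
 let ?Z = "{x. 2 * R <= norm (x - c)}"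
 have T2: "bounded_linear_Lp 2 T" using T by (simp add: calderon_zygmund_def)
 have K': "?K' \<in> standard_kernels \<mu> A" by (rule standard_kernels_swap[OF K])
 have CZ': "calderon_zygmund T' ?K'" by (rule transpose_calderon_zygmund[OF K \<mu> A T T'])
 have T'2: "bounded_linear_Lp 2 T'" using CZ' by (simp add: calderon_zygmund_def)
 have gm[measurable]: "g \<in> Meas" using g by (rule Lp2_measurable)
 have "(%x. g x * indicator (cball c R) x) = g" by (rule ext) (use supp in \<open>auto simp: indicator_def\<close>)
 then have gint: "integrable lebesgue g" using set_L2_integrable[OF g, of "cball c R"] by simp
 have T'g: "integrable lebesgue (T' g)"
  by (rule transpose_atom_integrable[OF K' \<mu> A CZ' g]) (use supp R mean in auto)
 show i: "integrable lebesgue (%x. f x * T' g x)"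
  by (rule integrable_bounded_mult[OF T'g fm ae])
 have [measurable]: "T' g \<in> Meas" using T'g by (rule borel_measurable_integrable)
 have n2: "near_part c R f \<in> Lp 2" using near_part_Lp[OF fm ae, of 2 c R] by simp
 have i2: "integrable lebesgue (%x. f x * indicator ?Z x * T' g x)"
 proof (rule integrable_bounded_mult[OF T'g])
  show "AE x in lebesgue. cmod (f x * indicator ?Z x) <= \<bar>M\<bar>"
   using ae by eventually_elim (auto simp: indicator_def)
 qed measurable
 have i1: "integrable lebesgue (%x. near_part c R f x * T' g x)"
  by (rule L2_integrable_mult[OF n2 bounded_linear_Lp_mem[OF T'2 g]])
 have split: "f x * T' g x = near_part c R f x * T' g x + f x * indicator ?Z x * T' g x" for x
  by (simp add: near_part_def indicator_def)
 have e1: "(LINT x|lebesgue. near_part c R f x * T' g x) = (LINT x|lebesgue. T (near_part c R f) x * g x)"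
  using T' n2 g unfolding is_transpose_def by simp
 define F where "F y x = f x * indicator ?Z x * (offdiag K y x - offdiag K c x) * g y" for y x
 have Fm: "(%p. F (fst p) (snd p)) \<in> borel_measurable (lebesgue \<Otimes>\<^sub>M lebesgue)"
  unfolding F_def by (intro borel_measurable_times[OF far_part_measurable(2)[OF K \<mu> fm]] measurable_compose[OF measurable_fst gm])
 have Ffin: "(NN y. (NN x. enorm (F y x))) < \<infinity>"
 proof -
  let ?B = "%x. ennreal ((2 * R) powr \<mu> / norm (x - c) powr (real CARD('n) + \<mu>)) * indicator ?Z x"
  have "(NN y. (NN x. enorm (F y x))) <= (NN y. (NN x. ennreal (\<bar>M\<bar> * A * cmod (g y)) * ?B x))"
  proof (rule nn_integral_mono, rule nn_integral_mono_AE)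
   fix y
   show "AE x in lebesgue. enorm (F y x) <= ennreal (\<bar>M\<bar> * A * cmod (g y)) * ?B x"
    using ae
   proof eventually_elim
    case (elim x)
    show ?case
    proof (cases "g y = 0 \<or> x \<notin> ?Z")
     case False
     then have y: "y \<in> cball c R" and x: "2 * R <= norm (x - c)" using supp by auto
     let ?b = "(2 * R) powr \<mu> / norm (x - c) powr (real CARD('n) + \<mu>)"
     have "cmod (F y x) = cmod (f x) * cmod (offdiag K y x - offdiag K c x) * cmod (g y)" using x by (simp add: F_def norm_mult)
     also have "... <= \<bar>M\<bar> * (A * ?b) * cmod (g y)"
      using elim A by (intro mult_right_mono mult_mono kernel_far_difference[OF K \<mu> A R y x]) auto
     also have "... = \<bar>M\<bar> * A * cmod (g y) * ?b" by simp
     finally have "enorm (F y x) <= ennreal (\<bar>M\<bar> * A * cmod (g y) * ?b)" by (rule ennreal_leI)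
     also have "... = ennreal (\<bar>M\<bar> * A * cmod (g y)) * ennreal ?b" using A by (intro ennreal_mult) auto
     finally show ?thesis using x by simp
    qed (auto simp: F_def)
   qed
  qed
  also have "... = (NN y. ennreal (\<bar>M\<bar> * A * cmod (g y)) * (NN x. ?B x))"
   by (intro nn_integral_cong nn_integral_cmult) measurable
  also have "... = (NN y. ennreal (\<bar>M\<bar> * A * cmod (g y))) * (NN x. ?B x)"
   by (rule nn_integral_multc) measurable
  also have "... < \<infinity>"
  proof -
   have "(NN y. ennreal (\<bar>M\<bar> * A * cmod (g y))) < \<infinity>"
   proof -
    have I: "integrable lebesgue (%y. \<bar>M\<bar> * A * cmod (g y))"
     using gint by (intro integrable_mult_right integrable_norm)
    have "(NN y. ennreal (\<bar>M\<bar> * A * cmod (g y))) = ennreal (LINT y|lebesgue. \<bar>M\<bar> * A * cmod (g y))"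
     by (rule nn_integral_eq_integral[OF I]) (use A in auto)
    then show ?thesis by simp
   qed
   moreover have "(NN x. ?B x) < \<infinity>"
    by (rule le_less_trans[OF tail_integral_1]) (use R \<mu> in auto)
   ultimately show ?thesis by (simp add: ennreal_mult_less_top)
  qed
  finally show ?thesis .
 qed
 note Fub = lebesgue_Fubini[OF Fm Ffin]
 have Hg: "(LINT x|lebesgue. F y x) = far_part K c R f y * g y" for y
  unfolding F_def far_part_def by simp
 have "(LINT x|lebesgue. f x * indicator ?Z x * T' g x) = (LINT x|lebesgue. LINT y|lebesgue. F y x)"
 proof (rule integral_cong_AE)
  have "AE x in lebesgue. 2 * R <= norm (x - c) --> T' g x = (LINT y|lebesgue. (?K' x y - ?K' x c) * g y) \<and>
    cmod (T' g x) <= A * (R powr \<mu> / norm (x - c) powr (real CARD('n) + \<mu>)) * (LINT y|lebesgue. cmod (g y))"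
   by (rule calderon_zygmund_atom[OF K' \<mu> A CZ' g]) (use supp R mean in auto)
  then show "AE x in lebesgue. f x * indicator ?Z x * T' g x = (LINT y|lebesgue. F y x)"
  proof eventually_elim
   case (elim x)
   show ?case
   proof (cases "2 * R <= norm (x - c)")
    case True
    have "(LINT y|lebesgue. F y x) = (LINT y|lebesgue. f x * ((K y x - K c x) * g y))"
    proof (rule Bochner_Integration.integral_cong[OF refl])
     fix y
     show "F y x = f x * ((K y x - K c x) * g y)"
     proof (cases "g y = 0")
      case False
      then have "norm (y - c) <= R" using supp[of y] by (simp add: dist_norm norm_minus_commute)
      then have "y ~= x" "c ~= x" using True R by auto
      then show ?thesis using True by (simp add: F_def offdiag_def)
     qed (simp add: F_def)
    qed
    then show ?thesis using elim True by simp
   qed (simp add: F_def)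
  qed
  show "(%x. LINT y|lebesgue. F y x) \<in> Meas"
   using Fub(3) by (rule borel_measurable_integrable)
 qed measurable
 also have "... = (LINT y|lebesgue. far_part K c R f y * g y)"
  using Fub(1) unfolding Hg by simp
 finally have e2: "(LINT x|lebesgue. f x * indicator ?Z x * T' g x) = (LINT y|lebesgue. far_part K c R f y * g y)" .
 have i3: "integrable lebesgue (%x. T (near_part c R f) x * g x)"
  by (rule L2_integrable_mult[OF bounded_linear_Lp_mem[OF T2 n2] g])
 have i4: "integrable lebesgue (%y. far_part K c R f y * g y)" using Fub(2) unfolding Hg .
 show "integrable lebesgue (%y. (T (near_part c R f) y + far_part K c R f y) * g y)"
  using Bochner_Integration.integrable_add[OF i3 i4] by (simp add: distrib_right)
 show "(LINT x|lebesgue. f x * T' g x) = (LINT y|lebesgue. (T (near_part c R f) y + far_part K c R f y) * g y)"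
  unfolding split distrib_right using i1 i2 i3 i4 e1 e2 by simp
qed

lemma indicator_integrable:
 assumes S: "S \<in> sets (lebesgue :: (real^'n) measure)" "bounded S"
 shows "integrable lebesgue (%x. indicator S x :: complex)"
proof -
 have "(%x. indicator S x :: complex) \<in> Lp 2"
  using Lp_bounded_support[of 2 "%x. indicator S x" 1 S] S by (simp add: indicator_def)
 from set_L2_integrable[OF this S] show ?thesis by (simp add: indicator_inter_arith[symmetric])
qed

text \<open>Let \<open>k\<close> be the mean of \<open>D\<close> over the ball, and test with the conjugate of the phase of \<open>D - k\<close>, corrected by a constant to have mean
 zero: \<open>\<bar>D - k\<bar>\<close> has integral zero.\<close>

lemma AE_constant_if_orthogonal:
 fixes D :: "real^'n => complex"
 assumes Dm[measurable]: "D \<in> Meas" and R: "0 < R"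
  and int: "integrable lebesgue (%x. D x * indicator (cball c R) x)"
  and orth: "!!g B. g \<in> Meas ==> (!!x. cmod (g x) <= B) ==> (!!x. g x ~= 0 ==> x \<in> cball c R) ==>
    (LINT x|lebesgue. g x) = 0 ==> (LINT x|lebesgue. D x * g x) = 0"
 shows "AE x in lebesgue. x \<in> cball c R -->
   D x = (LINT x|lebesgue. D x * indicator (cball c R) x) / of_real (measure lebesgue (cball c R))"
proof -
 let ?I = "%x. indicator (cball c R) x :: complex"
 define V where "V = measure lebesgue (cball c R)"
 have V: "0 < V" unfolding V_def using R by simp
 have Iint: "integrable lebesgue ?I"
  by (rule indicator_integrable) auto
 have LI: "(LINT x|lebesgue. ?I x) = of_real V"
 proof -
  have e: "complex_of_real (indicator (cball c R) x) = ?I x" for x by (simp add: indicator_def)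
  have "(LINT x|lebesgue. complex_of_real (indicator (cball c R) x)) = of_real (LINT x|lebesgue. indicator (cball c R) x)"
   by (rule integral_complex_of_real)
  then show ?thesis unfolding e by (simp add: V_def)
 qed
 define k where "k = (LINT x|lebesgue. D x * ?I x) / of_real V"
 define E where "E x = (D x - k) * ?I x" for x
 have Eint: "integrable lebesgue E"
  unfolding E_def using int Iint by (simp add: left_diff_distrib)
 have E0: "(LINT x|lebesgue. E x) = 0"
  unfolding E_def using int Iint V by (simp add: left_diff_distrib LI k_def)
 have [measurable]: "E \<in> Meas" using Eint by (rule borel_measurable_integrable)
 define u where "u x = cnj (E x) / of_real (cmod (E x))" for x
 have [measurable]: "u \<in> Meas" unfolding u_def by measurable
 have ule: "cmod (u x) <= 1" for x by (simp add: u_def norm_divide)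
 have uI: "u x * ?I x = u x" for x by (simp add: u_def E_def indicator_def)
 have uint: "integrable lebesgue u"
  using integrable_bounded_mult[OF Iint, of u 1] ule unfolding uI by simp
 define m where "m = (LINT x|lebesgue. u x) / of_real V"
 define g where "g x = u x - m * ?I x" for x
 have gm[measurable]: "g \<in> Meas" unfolding g_def by measurable
 have g0: "(LINT x|lebesgue. g x) = 0" unfolding g_def using uint Iint V by (simp add: LI m_def)
 have gint: "integrable lebesgue g" unfolding g_def using uint Iint by simp
 have gb: "cmod (g x) <= 1 + cmod m" for x
 proof -
  have "cmod (m * ?I x) <= cmod m" by (simp add: indicator_def)
  then show ?thesis unfolding g_def using ule[of x] norm_triangle_ineq4[of "u x" "m * ?I x"] by linarith
 qed
 have "g x = 0" if "x \<notin> cball c R" for x using that by (simp add: g_def u_def E_def)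
 then have gs: "x \<in> cball c R" if "g x ~= 0" for x using that by blast
 have gI: "?I x * g x = g x" for x using gs[of x] by (auto simp: indicator_def)
 have Dg: "(LINT x|lebesgue. D x * g x) = 0" by (rule orth[OF gm gb gs g0])
 have Dgint: "integrable lebesgue (%x. D x * g x)"
 proof -
  have "integrable lebesgue (%x. g x * (D x * ?I x))"
   using gb by (intro integrable_bounded_mult[OF int gm, of "1 + cmod m"]) auto
  moreover have "g x * (D x * ?I x) = D x * g x" for x using gI[of x] by (metis mult.commute mult.left_commute)
  ultimately show ?thesis by simp
 qed
 have Eu: "E x * u x = (D x * g x - k * g x) + m * E x" for x
 proof -
  have "E x * u x = (D x - k) * (u x * ?I x)" by (simp only: E_def mult_ac)
  also have "... = (D x - k) * u x" unfolding uI ..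
  also have "... = (D x * g x - k * g x) + m * E x" unfolding g_def E_def by algebra
  finally show ?thesis .
 qed
 have "(LINT x|lebesgue. E x * u x) = 0"
  unfolding Eu using Dgint gint Eint by (simp add: Dg g0 E0)
 moreover have Eu2: "E x * u x = of_real (cmod (E x))" for x
 proof -
  have "z * (cnj z / of_real (cmod z)) = of_real (cmod z)" for z :: complex
   using complex_norm_square[of z] by (cases "z = 0") (simp_all add: field_simps power2_eq_square)
  then show ?thesis by (simp add: u_def)
 qed
 ultimately have "(LINT x|lebesgue. complex_of_real (cmod (E x))) = 0" by (simp only:)
 then have "complex_of_real (LINT x|lebesgue. cmod (E x)) = 0" by (simp only: integral_complex_of_real)
 then have "(LINT x|lebesgue. cmod (E x)) = 0" by (simp only: of_real_eq_0_iff)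
 then have "AE x in lebesgue. cmod (E x) = 0"
  using Eint by (subst (asm) integral_nonneg_eq_0_iff_AE) auto
 then show ?thesis
  unfolding V_def[symmetric] k_def[symmetric]
  by eventually_elim (auto simp: E_def)
qed

text \<open>The common consequence of the two meanings of \<open>T f\<close>. The test functions are bounded, so that local integrability of
 \<open>h\<close> is enough for the pairing; mean zero makes \<open>T' g\<close> integrable.\<close>

definition weak_value ::
  "((real^'n => complex) => (real^'n => complex)) => (real^'n => complex) => (real^'n => complex) => bool" where
 "weak_value T' f h \<longleftrightarrow> h \<in> Meas \<and>
   (\<forall>c R. integrable lebesgue (%x. h x * indicator (cball c R) x)) \<and>
   (\<forall>g c R B. g \<in> Meas --> (\<forall>x. cmod (g x) <= B) --> (\<forall>x. g x ~= 0 --> x \<in> cball c R) -->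
    (LINT x|lebesgue. g x) = 0 --> (LINT x|lebesgue. h x * g x) = (LINT x|lebesgue. f x * T' g x))"

lemma bounded_supported_Lp:
 assumes "g \<in> Meas" "!!x. cmod (g x) <= B" "!!x. g x ~= 0 ==> x \<in> cball c R" "0 < s"
 shows "g \<in> Lp (ennreal s)"
proof (rule Lp_bounded_support[OF assms(4,1), of "B" "cball c R"])
 show "AE x in lebesgue. cmod (g x) <= B * indicator (cball c R) x"
  using assms(2,3) by (intro AE_I2) (metis indicator_simps mult.right_neutral mult_zero_right norm_eq_zero order_refl)
qed auto

lemma local_rep_L2:
 fixes K :: "real^'n => real^'n => complex"
 assumes K: "K \<in> standard_kernels \<mu> A" and \<mu>: "0 < \<mu>" and A: "0 < A" and T: "calderon_zygmund T K" and R: "0 < R"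
  and fm: "f \<in> Meas" and ae: "AE x in lebesgue. cmod (f x) <= M"
 shows "(%x. (T (near_part c R f) x + far_part K c R f x) * indicator (cball c R) x) \<in> Lp 2"
  and "integrable lebesgue (%x. (T (near_part c R f) x + far_part K c R f x) * indicator (cball c R) x)"
proof -
 have T2: "bounded_linear_Lp 2 T" using T by (simp add: calderon_zygmund_def)
 have n2: "near_part c R f \<in> Lp 2" using near_part_Lp[OF fm ae, of 2 c R] by simp
 note Tn = bounded_linear_Lp_mem[OF T2 n2]
 have [measurable]: "far_part K c R f \<in> Meas" using far_part_measurable(1)[OF K \<mu> fm] .
 obtain B where B: "!!y. y \<in> cball c R ==> cmod (far_part K c R f y) <= B"
  using far_part_bounded[OF K \<mu> A R fm ae, of c] by blast
 have b: "cmod (far_part K c R f x * indicator (cball c R) x) <= \<bar>B\<bar>" for x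
  using B[of x] by (auto simp: indicator_def)
 have "(%x. far_part K c R f x * indicator (cball c R) x) \<in> Lp (ennreal 2)"
 proof (rule bounded_supported_Lp)
  show "cmod (far_part K c R f x * indicator (cball c R) x) <= \<bar>B\<bar>" for x by (rule b)
  show "x \<in> cball c R" if "far_part K c R f x * indicator (cball c R) x ~= 0" for x
   using that by (auto simp: indicator_def split: if_splits)
 qed measurable
 moreover have "(%x. T (near_part c R f) x * indicator (cball c R) x) \<in> Lp 2"
  using Lp_restrict[of 2 "T (near_part c R f)" "cball c R"] Tn by simp
 ultimately show 2: "(%x. (T (near_part c R f) x + far_part K c R f x) * indicator (cball c R) x) \<in> Lp 2"
  using Lp2_add[of "%x. T (near_part c R f) x * indicator (cball c R) x" "%x. far_part K c R f x * indicator (cball c R) x"]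
  by (simp add: distrib_right)
 have "integrable lebesgue (%x. (T (near_part c R f) x + far_part K c R f x) * indicator (cball c R) x * indicator (cball c R) x)"
  by (rule set_L2_integrable[OF 2]) auto
 then show "integrable lebesgue (%x. (T (near_part c R f) x + far_part K c R f x) * indicator (cball c R) x)"
  by (simp add: mult.assoc indicator_inter_arith[symmetric])
qed

text \<open>Both sides have the same pairing with every bounded mean zero function on the ball, so they differ by a constant.\<close>

lemma weak_value_local:
 fixes K :: "real^'n => real^'n => complex"
 assumes K: "K \<in> standard_kernels \<mu> A" and \<mu>: "0 < \<mu>" and A: "0 < A" and T: "calderon_zygmund T K"
  and T': "is_transpose T T'" and R: "0 < R"
  and fm: "f \<in> Meas" and ae: "AE x in lebesgue. cmod (f x) <= M"
  and h: "weak_value T' f h"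
 shows "\<exists>k. AE y in lebesgue. y \<in> cball c R --> h y = T (near_part c R f) y + far_part K c R f y + k"
proof -
 have T2: "bounded_linear_Lp 2 T" using T by (simp add: calderon_zygmund_def)
 have n2: "near_part c R f \<in> Lp 2" using near_part_Lp[OF fm ae, of 2 c R] by simp
 note Tn = bounded_linear_Lp_mem[OF T2 n2]
 have [measurable]: "h \<in> Meas" "T (near_part c R f) \<in> Meas" "far_part K c R f \<in> Meas"
  using h Tn far_part_measurable(1)[OF K \<mu> fm] by (auto simp: weak_value_def Lp2_measurable)
 define W where "W y = T (near_part c R f) y + far_part K c R f y" for y
 have Wm[measurable]: "W \<in> Meas" unfolding W_def by measurable
 have Wint: "integrable lebesgue (%x. W x * indicator (cball c R) x)"
  unfolding W_def by (rule local_rep_L2(2)[OF K \<mu> A T R fm ae])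
 have hint: "integrable lebesgue (%x. h x * indicator (cball c R) x)" using h by (simp add: weak_value_def)
 have "AE y in lebesgue. y \<in> cball c R --> h y - W y = (LINT x|lebesgue. (h x - W x) * indicator (cball c R) x) / of_real (measure lebesgue (cball c R))"
 proof (rule AE_constant_if_orthogonal[OF _ R])
  show "integrable lebesgue (%x. (h x - W x) * indicator (cball c R) x)"
   using hint Wint by (simp add: left_diff_distrib)
  fix g :: "real^'n => complex" and B
  assume gm: "g \<in> Meas" and gb: "!!x. cmod (g x) <= B" and gs: "!!x. g x ~= 0 ==> x \<in> cball c R"
   and g0: "(LINT x|lebesgue. g x) = 0"
  have g2: "g \<in> Lp 2" using bounded_supported_Lp[OF gm gb gs, of 2] by simp
  have i1: "integrable lebesgue (%x. h x * g x)"
  proof -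
   have "integrable lebesgue (%x. g x * (h x * indicator (cball c R) x))"
    using gb by (intro integrable_bounded_mult[OF hint gm, of B]) auto
   moreover have "g x * (h x * indicator (cball c R) x) = h x * g x" for x using gs[of x] by (auto simp: indicator_def)
   ultimately show ?thesis by simp
  qed
  have "integrable lebesgue (%y. W y * g y)"
   unfolding W_def by (rule transpose_pairing(2)[OF K \<mu> A T T' fm ae g2]) (use gs R g0 in auto)
  moreover have "(LINT x|lebesgue. f x * T' g x) = (LINT y|lebesgue. W y * g y)"
   unfolding W_def by (rule transpose_pairing(3)[OF K \<mu> A T T' fm ae g2]) (use gs R g0 in auto)
  moreover have "(LINT x|lebesgue. h x * g x) = (LINT x|lebesgue. f x * T' g x)"
   using h gm gb gs g0 unfolding weak_value_def by blast
  ultimately show "(LINT x|lebesgue. (h x - W x) * g x) = 0"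
   using i1 by (simp add: left_diff_distrib)
 qed measurable
 then show ?thesis
  by (intro exI) (erule eventually_mono, force simp: W_def algebra_simps)
qed

section \<open>Values of the extended operator\<close>

lemma Ls_pairing:
 assumes s: "1 < s" "1 < s'" "1 / s + 1 / s' = 1" and e: "0 < e"
 obtains K :: real where "0 < K"
  "!!f g :: real^'n => complex. f \<in> Meas ==> g \<in> Meas ==>
   (NN x. enorm (f x * g x)) <= ennreal K * Ipow s f + ennreal e * Ipow s' g"
proof -
 obtain K where K: "0 < K" and Y: "!!a b. 0 <= a ==> 0 <= b ==> a * b <= K * a powr s + e * b powr s'"
  using Young_eps[OF s e] by auto
 have "(NN x. enorm (f x * g x)) <= ennreal K * Ipow s f + ennreal e * Ipow s' g"
  if [measurable]: "f \<in> Meas" "g \<in> Meas" for f g :: "real^'n => complex"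
 proof -
  have "(NN x. enorm (f x * g x)) <=
    (NN x. ennreal K * ennreal (cmod (f x) powr s) + ennreal e * ennreal (cmod (g x) powr s'))"
  proof (rule nn_integral_mono)
   fix x
   have "enorm (f x * g x) <= ennreal (K * cmod (f x) powr s + e * cmod (g x) powr s')"
    using Y[of "cmod (f x)" "cmod (g x)"] by (simp add: norm_mult ennreal_leI)
   also have "... = ennreal K * ennreal (cmod (f x) powr s) + ennreal e * ennreal (cmod (g x) powr s')"
    using K e by (subst ennreal_plus) (auto simp: ennreal_mult[symmetric])
   finally show "enorm (f x * g x) <= ennreal K * ennreal (cmod (f x) powr s) + ennreal e * ennreal (cmod (g x) powr s')" .
  qed
  also have "... = ennreal K * Ipow s f + ennreal e * Ipow s' g"
   unfolding Ipow_def by (subst nn_integral_add) (auto simp: nn_integral_cmult)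
  finally show ?thesis .
 qed
 then show ?thesis by (rule that[OF K])
qed

lemma Ls_integrable_mult:
 fixes f g :: "real^'n => complex"
 assumes s: "1 < s" "1 < s'" "1 / s + 1 / s' = 1" and f: "f \<in> Lp (ennreal s)" and g: "g \<in> Lp (ennreal s')"
 shows "integrable lebesgue (%x. f x * g x)"
proof -
 have m: "f \<in> Meas" "g \<in> Meas" and fin: "Ipow s f < \<infinity>" "Ipow s' g < \<infinity>"
  using f g s by (auto simp: mem_Lp_iff)
 obtain K :: real where P: "!!f g :: real^'n => complex. f \<in> Meas ==> g \<in> Meas ==>
   (NN x. enorm (f x * g x)) <= ennreal K * Ipow s f + ennreal 1 * Ipow s' g"
  by (rule Ls_pairing[OF s zero_less_one]) (rule that)
 have "(NN x. enorm (f x * g x)) <= ennreal K * Ipow s f + ennreal 1 * Ipow s' g"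
  by (rule P[OF m])
 also have "... < \<infinity>" using fin by (auto simp: ennreal_mult_less_top)
 finally show ?thesis using m by (intro integrableI_bounded) auto
qed

lemma Ls_pairing_tendsto:
 fixes D :: "nat => real^'n => complex"
 assumes s: "1 < s" "1 < s'" "1 / s + 1 / s' = 1" and D: "!!n. D n \<in> Meas"
  and lim: "(%n. Ipow s (D n)) \<longlonglongrightarrow> 0" and g: "g \<in> Lp (ennreal s')"
 shows "(%n. LINT x|lebesgue. D n x * g x) \<longlonglongrightarrow> 0"
proof (rule LIMSEQ_I)
 fix e :: real assume e: "0 < e"
 have gm: "g \<in> Meas" and gfin: "Ipow s' g < \<infinity>" using g s by (auto simp: mem_Lp_iff)
 obtain G where G: "Ipow s' g = ennreal G" "0 <= G" using gfin by (cases "Ipow s' g") auto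
 define d where "d = e / (3 * (G + 1))"
 have d: "0 < d" "d * G <= e / 3" using e G by (auto simp: d_def field_simps)
 obtain K :: real where K: "0 < K" and P: "!!f g :: real^'n => complex. f \<in> Meas ==> g \<in> Meas ==>
   (NN x. enorm (f x * g x)) <= ennreal K * Ipow s f + ennreal d * Ipow s' g"
  by (rule Ls_pairing[OF s d(1)]) (rule that)
 obtain N where N: "!!n. n \<ge> N ==> Ipow s (D n) <= ennreal (e / (3 * K))"
  using tendsto0_ennreal_small[OF lim, of "e / (3 * K)"] e K by auto
 have "norm ((LINT x|lebesgue. D n x * g x) - 0) < e" if "n \<ge> N" for n
 proof -
  have "enorm (LINT x|lebesgue. D n x * g x) <= (NN x. enorm (D n x * g x))"
   by (rule integrable_ennreal_bound)
  also have "... <= ennreal K * Ipow s (D n) + ennreal d * Ipow s' g" by (rule P[OF D gm])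
  also have "... <= ennreal K * ennreal (e / (3 * K)) + ennreal d * ennreal G"
   using N[OF that] G by (intro add_mono mult_left_mono) auto
  also have "... = ennreal (e / 3 + d * G)"
   using K e d G by (subst ennreal_plus) (auto simp: ennreal_mult[symmetric])
  finally have "cmod (LINT x|lebesgue. D n x * g x) <= e / 3 + d * G"
   using e d G by (subst (asm) ennreal_le_iff) auto
  then show ?thesis using d e by simp
 qed
 then show "\<exists>N. \<forall>n\<ge>N. norm ((LINT x|lebesgue. D n x * g x) - 0) < e" by blast
qed

text \<open>Truncate \<open>f\<close>. The identity holds for the truncations by the definition of the transpose, the left-hand side
 converges by continuity of the extension on \<open>L\<^sup>s\<close>, and the right-hand side by dominated convergence, since \<open>f\<close> is bounded and
 \<open>T' g\<close> integrable.\<close>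

lemma weak_value_finite:
 fixes K :: "real^'n => real^'n => complex"
 assumes K: "K \<in> standard_kernels \<mu> A" and \<mu>: "0 < \<mu>" and A: "0 < A" and T: "calderon_zygmund T K"
  and T': "is_transpose T T'" and s: "1 < s"
  and f: "f \<in> Lp (ennreal s)" and ae: "AE x in lebesgue. cmod (f x) <= M"
  and S: "bounded_linear_Lp (ennreal s) S" and eq: "!!u. u \<in> Lp 2 \<inter> Lp (ennreal s) ==> AE x in lebesgue. S u x = T u x"
  and h: "h \<in> Lp (ennreal s)" "AE x in lebesgue. h x = S f x"
 shows "weak_value T' f h"
proof -
 have T2: "bounded_linear_Lp 2 T" using T by (simp add: calderon_zygmund_def)
 have fm: "f \<in> Meas" and fin: "Ipow s f < \<infinity>" using f s by (auto simp: mem_Lp_iff)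
 have hm[measurable]: "h \<in> Meas" using h s by (simp add: mem_Lp_iff)
 define s' where "s' = s / (s - 1)"
 have s': "1 < s" "1 < s'" "1 / s + 1 / s' = 1" using s by (auto simp: s'_def field_simps)
 have t2: "trunc n f \<in> Lp 2" for n using trunc_Lp[OF fm, of 2] by simp
 have ts: "trunc n f \<in> Lp (ennreal s)" for n using trunc_Lp[OF fm] s by simp
 have lim: "(%n. Ipow s (%x. T (trunc n f) x - S f x)) \<longlonglongrightarrow> 0"
  using s by (intro Ls_extension_tendsto[OF T2 S _ eq f t2 ts Ipow_trunc(1)[OF fm _ fin]]) auto
 have "Ipow s (%x. T (trunc n f) x - S f x) = Ipow s (%x. T (trunc n f) x - h x)" for n
  by (rule Ipow_cong_AE) (use h(2) in \<open>eventually_elim, simp\<close>)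
 then have lim': "(%n. Ipow s (%x. T (trunc n f) x - h x)) \<longlonglongrightarrow> 0" using lim by simp
 have Tm[measurable]: "T (trunc n f) \<in> Meas" for n
  using bounded_linear_Lp_mem[OF T2 t2] by (rule Lp2_measurable)
 have hloc: "integrable lebesgue (%x. h x * indicator (cball c R) x)" for c R
 proof (rule Ls_integrable_mult[OF s' h(1)])
  show "(%x. indicator (cball c R) x :: complex) \<in> Lp (ennreal s')"
  proof (rule Lp_bounded_support[of s' _ 1 "cball c R"])
   show "AE x in lebesgue. cmod (indicator (cball c R) x) <= 1 * indicator (cball c R) x"
    by (auto simp: indicator_def)
   show "(%x. indicator (cball c R) x :: complex) \<in> Meas" by measurable
  qed (use s' in auto)
 qed
 have "(LINT x|lebesgue. h x * g x) = (LINT x|lebesgue. f x * T' g x)"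
  if gm: "g \<in> Meas" and gb: "!!x. cmod (g x) <= B" and gs: "!!x. g x ~= 0 ==> x \<in> cball c R"
   and g0: "(LINT x|lebesgue. g x) = 0" for g c R B
 proof -
  have g2: "g \<in> Lp 2" using bounded_supported_Lp[OF gm gb gs, of 2] by simp
  have gs': "g \<in> Lp (ennreal s')" using s' by (intro bounded_supported_Lp[OF gm gb gs]) auto
  have T'g: "integrable lebesgue (T' g)"
  proof (rule transpose_atom_integrable[OF standard_kernels_swap[OF K] \<mu> A transpose_calderon_zygmund[OF K \<mu> A T T'] g2])
   show "y \<in> cball c (max R 1)" if "g y ~= 0" for y using gs[OF that] by auto
  qed (use g0 in auto)
  have [measurable]: "T' g \<in> Meas" using T'g by (rule borel_measurable_integrable)
  have "(%n. LINT x|lebesgue. (T (trunc n f) x - h x) * g x) \<longlonglongrightarrow> 0"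
   by (rule Ls_pairing_tendsto[OF s' _ lim' gs']) measurable
  moreover have "(LINT x|lebesgue. (T (trunc n f) x - h x) * g x) = (LINT x|lebesgue. trunc n f x * T' g x) - (LINT x|lebesgue. h x * g x)" for n
  proof -
   have "(LINT x|lebesgue. T (trunc n f) x * g x) = (LINT x|lebesgue. trunc n f x * T' g x)"
    using T' t2 g2 unfolding is_transpose_def by blast
   then show ?thesis
    using L2_integrable_mult[OF bounded_linear_Lp_mem[OF T2 t2] g2, of n] Ls_integrable_mult[OF s' h(1) gs']
    by (simp add: left_diff_distrib)
  qed
  ultimately have "(%n. (LINT x|lebesgue. trunc n f x * T' g x) - (LINT x|lebesgue. h x * g x)) \<longlonglongrightarrow> 0" by simp
  then have 1: "(%n. LINT x|lebesgue. trunc n f x * T' g x) \<longlonglongrightarrow> (LINT x|lebesgue. h x * g x)"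
   by (simp add: LIM_zero_iff)
  have 2: "(%n. LINT x|lebesgue. trunc n f x * T' g x) \<longlonglongrightarrow> (LINT x|lebesgue. f x * T' g x)"
  proof (rule integral_dominated_convergence[where w="%x. M * cmod (T' g x)"])
   show "AE x in lebesgue. (%n. trunc n f x * T' g x) \<longlonglongrightarrow> f x * T' g x"
    by (intro AE_I2 tendsto_eventually) (use trunc_eventually[of f] in \<open>auto elim!: eventually_mono\<close>)
   show "AE x in lebesgue. norm (trunc n f x * T' g x) <= M * cmod (T' g x)" for n
    using ae by eventually_elim (auto simp: norm_mult intro!: mult_right_mono order_trans[OF trunc_norm_le])
  qed (use T'g fm in auto)
  show ?thesis using LIMSEQ_unique[OF 1 2] .
 qed
 note main = this
 show ?thesis unfolding weak_value_def
 proof (intro conjI allI impI hm hloc)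
  fix g :: "real^'n => complex" and c R B
  assume "g \<in> Meas" "\<forall>x. cmod (g x) <= B" "\<forall>x. g x ~= 0 --> x \<in> cball c R" "(LINT x|lebesgue. g x) = 0"
  then show "(LINT x|lebesgue. h x * g x) = (LINT x|lebesgue. f x * T' g x)" by (intro main[of g B c R]) auto
 qed
qed

lemma Lp_loc_mem_iff:
 "h \<in> Lp_loc r \<longleftrightarrow> h \<in> Meas \<and> (\<forall>S. compact S --> set_integrable lebesgue S (%x. cmod (h x) powr r))"
 by (simp add: Lp_loc_def)

lemma Lp_loc2_restrict:
 assumes h: "h \<in> Lp_loc 2"
 shows "(%x. h x * indicator (cball c R) x) \<in> Lp 2"
proof -
 have [measurable]: "h \<in> Meas" and "set_integrable lebesgue (cball c R) (%x. cmod (h x) powr 2)"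
  using h by (auto simp: Lp_loc_mem_iff)
 then have i: "integrable lebesgue (%x. indicator (cball c R) x * cmod (h x) powr 2)" by (simp add: set_integrable_def)
 have "Ipow 2 (%x. h x * indicator (cball c R) x) = (NN x. ennreal (indicator (cball c R) x * cmod (h x) powr 2))"
  unfolding Ipow_def by (intro nn_integral_cong) (auto simp: indicator_def)
 also have "... = ennreal (LINT x|lebesgue. indicator (cball c R) x * cmod (h x) powr 2)"
  by (rule nn_integral_eq_integral[OF i]) auto
 also have "... < \<infinity>" by simp
 finally show ?thesis by (simp add: mem_Lp2_iff)
qed

lemma compact_support_cball:
 assumes "!!x. g x ~= 0 ==> x \<in> cball c R"
 shows "compact (closure {x :: real^'n. g x ~= (0::complex)})"
proof -
 have "closure {x. g x ~= 0} \<subseteq> cball c R" by (intro closure_minimal) (use assms in auto)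
 then show ?thesis by (auto simp: compact_eq_bounded_closed intro: bounded_subset)
qed

lemma weak_value_infinite:
 assumes h: "h \<in> Lp_loc 2"
  and eq: "!!g. g \<in> Lp 2 ==> compact (closure {x. g x ~= 0}) ==> (LINT x|lebesgue. g x) = 0 ==>
       (LINT x|lebesgue. h x * g x) = (LINT x|lebesgue. f x * T' g x)"
 shows "weak_value T' f h"
proof -
 have "integrable lebesgue (%x. h x * indicator (cball c R) x * indicator (cball c R) x)" for c R
  by (rule set_L2_integrable[OF Lp_loc2_restrict[OF h]]) auto
 then have loc: "integrable lebesgue (%x. h x * indicator (cball c R) x)" for c R
  by (simp add: mult.assoc indicator_inter_arith[symmetric])
 have "(LINT x|lebesgue. h x * g x) = (LINT x|lebesgue. f x * T' g x)"
  if gm: "g \<in> Meas" and gb: "!!x. cmod (g x) <= B" and gs: "!!x. g x ~= 0 ==> x \<in> cball c R"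
   and g0: "(LINT x|lebesgue. g x) = 0" for g c R B
  using bounded_supported_Lp[OF gm gb gs, of 2] compact_support_cball[of g c R] gs g0 by (intro eq) auto
 note main = this
 show ?thesis unfolding weak_value_def
 proof (intro conjI allI impI loc)
  show "h \<in> Meas" using h by (simp add: Lp_loc_mem_iff)
  fix g :: "real^'a => complex" and c R B
  assume "g \<in> Meas" "\<forall>x. cmod (g x) <= B" "\<forall>x. g x ~= 0 --> x \<in> cball c R" "(LINT x|lebesgue. g x) = 0"
  then show "(LINT x|lebesgue. h x * g x) = (LINT x|lebesgue. f x * T' g x)" by (intro main[of g B c R]) auto
 qed
qed

text \<open>On the ball of radius \<open>n + 1\<close> about the origin take near part plus far part, normalised to have mean zero on the unit
 ball. On a smaller ball two of these functions differ by a constant, which the normalisation makes zero; so they can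
 be glued.\<close>

theorem extended_value_infinite_exists:
 fixes K :: "real^'n => real^'n => complex"
 assumes K: "K \<in> standard_kernels \<mu> A" and \<mu>: "0 < \<mu>" and A: "0 < A" and T: "calderon_zygmund T K"
  and fm: "f \<in> Meas" and ae: "AE x in lebesgue. cmod (f x) <= M"
 shows "\<exists>h. extended_value T \<infinity> f h"
proof -
 have T2: "bounded_linear_Lp 2 T" using T by (simp add: calderon_zygmund_def)
 obtain T' where T': "is_transpose T T'" using transpose_exists[OF T2] by blast
 define \<rho> where "\<rho> n = real n + 1" for n :: nat
 have \<rho>: "0 < \<rho> n" "1 <= \<rho> n" for n by (auto simp: \<rho>_def)
 have \<rho>mono: "\<rho> n <= \<rho> m" if "n <= m" for n m using that by (simp add: \<rho>_def)
 define W where "W n y = T (near_part 0 (\<rho> n) f) y + far_part K 0 (\<rho> n) f y" for n y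
 have n2: "near_part 0 (\<rho> n) f \<in> Lp 2" for n using near_part_Lp[OF fm ae, of 2 0 "\<rho> n"] by simp
 have Wm[measurable]: "W n \<in> Meas" for n
  unfolding W_def using Lp2_measurable[OF bounded_linear_Lp_mem[OF T2 n2]] far_part_measurable(1)[OF K \<mu> fm] by measurable
 have WL2: "(%x. W n x * indicator (cball 0 (\<rho> n)) x) \<in> Lp 2" for n
  unfolding W_def by (rule local_rep_L2(1)[OF K \<mu> A T \<rho>(1) fm ae])
 have Wint: "integrable lebesgue (%x. W n x * indicator (cball 0 r) x)" if "r <= \<rho> n" for n r
 proof -
  have "integrable lebesgue (%x. W n x * indicator (cball 0 (\<rho> n)) x * indicator (cball 0 r) x)"
   by (rule set_L2_integrable[OF WL2]) auto
  moreover have "W n x * indicator (cball 0 (\<rho> n)) x * indicator (cball 0 r) x = W n x * indicator (cball 0 r) x" for x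
   using that by (auto simp: indicator_def)
  ultimately show ?thesis by simp
 qed
 define V where "V = measure lebesgue (cball (0::real^'n) 1)"
 have V: "0 < V" unfolding V_def by simp
 have LI: "(LINT x|lebesgue. indicator (cball (0::real^'n) 1) x :: complex) = of_real V"
 proof -
  have e: "complex_of_real (indicator (cball 0 1) x) = indicator (cball 0 1) x" for x :: "real^'n" by (simp add: indicator_def)
  have "(LINT x|lebesgue. complex_of_real (indicator (cball (0::real^'n) 1) x)) = of_real (LINT x|lebesgue. indicator (cball (0::real^'n) 1) x)"
   by (rule integral_complex_of_real)
  then show ?thesis unfolding e by (simp add: V_def)
 qed
 have Iint: "integrable lebesgue (%x. indicator (cball (0::real^'n) 1) x :: complex)" by (rule indicator_integrable) auto
 define k where "k n = (LINT x|lebesgue. W n x * indicator (cball 0 1) x) / of_real V" for n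
 define H where "H n x = W n x - k n" for n x
 have Hm[measurable]: "H n \<in> Meas" for n unfolding H_def by measurable
 have pair: "(LINT x|lebesgue. f x * T' g x) = (LINT x|lebesgue. W n x * g x)" "integrable lebesgue (%x. W n x * g x)"
  if g: "g \<in> Lp 2" and gs: "!!x. g x ~= 0 ==> x \<in> cball 0 (\<rho> n)" and g0: "(LINT x|lebesgue. g x) = 0" for g n
 proof -
  show "(LINT x|lebesgue. f x * T' g x) = (LINT x|lebesgue. W n x * g x)"
   unfolding W_def by (rule transpose_pairing(3)[OF K \<mu> A T T' fm ae g]) (use gs \<rho> g0 in auto)
  show "integrable lebesgue (%x. W n x * g x)"
   unfolding W_def by (rule transpose_pairing(2)[OF K \<mu> A T T' fm ae g]) (use gs \<rho> g0 in auto)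
 qed
 have cons: "AE x in lebesgue. x \<in> cball 0 (\<rho> n) --> H n x = H m x" if nm: "n <= m" for n m
 proof -
  define \<kappa> where "\<kappa> = (LINT x|lebesgue. (W n x - W m x) * indicator (cball 0 (\<rho> n)) x) / of_real (measure lebesgue (cball (0::real^'n) (\<rho> n)))"
  have D: "AE x in lebesgue. x \<in> cball 0 (\<rho> n) --> W n x - W m x = \<kappa>"
   unfolding \<kappa>_def
  proof (rule AE_constant_if_orthogonal[OF _ \<rho>(1)])
   show "integrable lebesgue (%x. (W n x - W m x) * indicator (cball 0 (\<rho> n)) x)"
    using Wint[of "\<rho> n" n] Wint[of "\<rho> n" m] \<rho>mono[OF nm] by (simp add: left_diff_distrib)
   fix g :: "real^'n => complex" and B
   assume gm: "g \<in> Meas" and gb: "!!x. cmod (g x) <= B" and gs: "!!x. g x ~= 0 ==> x \<in> cball 0 (\<rho> n)"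
    and g0: "(LINT x|lebesgue. g x) = 0"
   have g2: "g \<in> Lp 2" using bounded_supported_Lp[OF gm gb gs, of 2] by simp
   have gs': "x \<in> cball 0 (\<rho> m)" if "g x ~= 0" for x using gs[OF that] \<rho>mono[OF nm] by simp
   show "(LINT x|lebesgue. (W n x - W m x) * g x) = 0"
    using pair[OF g2 gs g0] pair[OF g2 gs' g0] by (simp add: left_diff_distrib)
  qed measurable
  have "k n - k m = (LINT x|lebesgue. (W n x - W m x) * indicator (cball 0 1) x) / of_real V"
   unfolding k_def using Wint[OF \<rho>(2), of n] Wint[OF \<rho>(2), of m] by (simp add: left_diff_distrib diff_divide_distrib)
  also have "(LINT x|lebesgue. (W n x - W m x) * indicator (cball 0 1) x) = (LINT x|lebesgue. \<kappa> * indicator (cball (0::real^'n) 1) x)"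
  proof (rule integral_cong_AE)
   show "AE x in lebesgue. (W n x - W m x) * indicator (cball 0 1) x = \<kappa> * indicator (cball 0 1) x"
    using D
   proof eventually_elim
    case (elim x)
    then show ?case using \<rho>(2)[of n] by (cases "x \<in> cball 0 1") auto
   qed
  qed measurable
  also have "... / of_real V = \<kappa>" using Iint V by (simp add: LI)
  finally have "k n - k m = \<kappa>" .
  with D show ?thesis by (auto elim!: eventually_mono simp: H_def algebra_simps)
 qed
 define h where "h x = lim (%n. H n x)" for x
 have hm[measurable]: "h \<in> Meas" unfolding h_def by measurable
 have "AE x in lebesgue. \<forall>n m. n <= m --> x \<in> cball 0 (\<rho> n) --> H n x = H m x"
  unfolding AE_all_countable using cons by simp
 then have hH: "AE x in lebesgue. \<forall>n. x \<in> cball 0 (\<rho> n) --> h x = H n x"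
 proof eventually_elim
  case (elim x)
  show ?case
  proof (intro allI impI)
   fix n assume "x \<in> cball 0 (\<rho> n)"
   then have "\<forall>\<^sub>F m in sequentially. H m x = H n x"
    unfolding eventually_sequentially using elim by (intro exI[of _ n]) auto
   then have "(%m. H m x) \<longlonglongrightarrow> H n x" by (rule tendsto_eventually)
   then show "h x = H n x" unfolding h_def by (rule limI)
  qed
 qed
 have big: "\<exists>n. S \<subseteq> cball 0 (\<rho> n)" if b: "bounded S" for S :: "(real^'n) set"
 proof -
  obtain r where r: "!!x. x \<in> S ==> norm x <= r" using b unfolding bounded_iff by blast
  obtain n :: nat where "r <= real n" using real_arch_simple by blast
  then have "S \<subseteq> cball 0 (\<rho> n)" using r by (force simp: \<rho>_def)
  then show ?thesis by blast
 qed
 have HL2: "(%x. H n x * indicator (cball 0 (\<rho> n)) x) \<in> Lp 2" for n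
 proof -
  have "(%x. indicator (cball 0 (\<rho> n)) x :: complex) \<in> Lp 2"
   using Lp_bounded_support[of 2 "%x. indicator (cball 0 (\<rho> n)) x" 1 "cball 0 (\<rho> n)"] by (simp add: indicator_def)
  from Lp2_diff[OF WL2 Lp2_cmult[OF this, of "k n"]] show ?thesis by (simp add: H_def left_diff_distrib)
 qed
 have "h \<in> Lp_loc 2"
  unfolding Lp_loc_mem_iff
 proof (intro conjI allI impI hm)
  fix S :: "(real^'n) set" assume S: "compact S"
  then obtain n where n: "S \<subseteq> cball 0 (\<rho> n)" using big compact_imp_bounded by blast
  have Sm[measurable]: "S \<in> sets lebesgue" using S by (simp add: compact_imp_closed)
  show "set_integrable lebesgue S (%x. cmod (h x) powr 2)"
   unfolding set_integrable_def
  proof (rule integrableI_bounded)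
   have "(NN x. ennreal (norm (indicator S x *\<^sub>R cmod (h x) powr 2))) <= Ipow 2 (%x. H n x * indicator (cball 0 (\<rho> n)) x)"
    unfolding Ipow_def
   proof (rule nn_integral_mono_AE)
    show "AE x in lebesgue. ennreal (norm (indicator S x *\<^sub>R cmod (h x) powr 2)) <= ennreal (cmod (H n x * indicator (cball 0 (\<rho> n)) x) powr 2)"
     using hH
    proof eventually_elim
     case (elim x)
     show ?case
     proof (cases "x \<in> S")
      case True
      then have x: "x \<in> cball 0 (\<rho> n)" using n by blast
      then have "h x = H n x" using elim by blast
      then show ?thesis using True x by (simp add: norm_mult)
     qed simp
    qed
   qed
   also have "... < \<infinity>" using HL2 by (simp add: mem_Lp2_iff)
   finally show "(NN x. ennreal (norm (indicator S x *\<^sub>R cmod (h x) powr 2))) < \<infinity>" .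
  qed measurable
 qed
 moreover have "(LINT x|lebesgue. h x * g x) = (LINT x|lebesgue. f x * T' g x)"
  if g: "g \<in> Lp 2" and cpt: "compact (closure {x. g x ~= 0})" and g0: "(LINT x|lebesgue. g x) = 0" for g
 proof -
  have [measurable]: "g \<in> Meas" using g by (rule Lp2_measurable)
  obtain n where n: "closure {x. g x ~= 0} \<subseteq> cball 0 (\<rho> n)" using big[OF compact_imp_bounded[OF cpt]] by blast
  have gs: "x \<in> cball 0 (\<rho> n)" if "g x ~= 0" for x using n closure_subset[of "{x. g x ~= 0}"] that by blast
  have "(%x. g x * indicator (cball 0 (\<rho> n)) x) = g" by (rule ext) (use gs in \<open>auto simp: indicator_def\<close>)
  then have gint: "integrable lebesgue g" using set_L2_integrable[OF g, of "cball 0 (\<rho> n)"] by simp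
  have "(LINT x|lebesgue. h x * g x) = (LINT x|lebesgue. W n x * g x - k n * g x)"
  proof (rule integral_cong_AE)
   show "AE x in lebesgue. h x * g x = W n x * g x - k n * g x"
    using hH
   proof eventually_elim
    case (elim x)
    show ?case
    proof (cases "g x = 0")
     case False
     then have "h x = H n x" using elim gs by blast
     then show ?thesis by (simp add: H_def left_diff_distrib)
    qed simp
   qed
  qed measurable
  also have "... = (LINT x|lebesgue. W n x * g x)"
   using pair(2)[OF g gs g0] gint g0 by simp
  also have "... = (LINT x|lebesgue. f x * T' g x)" using pair(1)[OF g gs g0] by simp
  finally show ?thesis .
 qed
 ultimately have "extended_value T \<infinity> f h"
  unfolding extended_value_def using T' by auto
 then show ?thesis by blast
qed

section \<open>Polynomial projections\<close>

definition mon :: "('n => nat) => real^'n => real" where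
 "mon \<alpha> x = (\<Prod>i\<in>UNIV. (x $ i) ^ \<alpha> i)"

lemma finite_multi_indices: "finite {\<alpha> :: 'n::finite => nat. (\<Sum>i\<in>UNIV. \<alpha> i) <= \<delta>}"
proof (rule finite_subset)
 show "{\<alpha> :: 'n => nat. (\<Sum>i\<in>UNIV. \<alpha> i) <= \<delta>} \<subseteq> PiE UNIV (%_. {..\<delta>})"
 proof
  fix \<alpha> :: "'n => nat" assume "\<alpha> \<in> {\<alpha>. (\<Sum>i\<in>UNIV. \<alpha> i) <= \<delta>}"
  then have "\<alpha> i <= \<delta>" for i using member_le_sum[of i UNIV \<alpha>] by (simp add: order_trans)
  then show "\<alpha> \<in> PiE UNIV (%_. {..\<delta>})" by auto
 qed
qed (simp add: finite_PiE)

lemma polys_iff: "P \<in> polys \<delta> \<longleftrightarrow> (\<exists>a. \<forall>x. P x = (\<Sum>\<alpha> | (\<Sum>i\<in>UNIV. \<alpha> i) <= \<delta>. a \<alpha> * of_real (mon \<alpha> x)))"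
 unfolding polys_def mon_def by (auto simp: fun_eq_iff)

lemma polys_lincomb:
 assumes "P \<in> polys \<delta>" "Q \<in> polys \<delta>" shows "(%x. s * P x + t * Q x) \<in> polys \<delta>"
proof -
 obtain a b where "!!x. P x = (\<Sum>\<alpha> | (\<Sum>i\<in>UNIV. \<alpha> i) <= \<delta>. a \<alpha> * of_real (mon \<alpha> x))"
   "!!x. Q x = (\<Sum>\<alpha> | (\<Sum>i\<in>UNIV. \<alpha> i) <= \<delta>. b \<alpha> * of_real (mon \<alpha> x))"
  using assms unfolding polys_iff by blast
 then show ?thesis unfolding polys_iff
  by (intro exI[of _ "%\<alpha>. s * a \<alpha> + t * b \<alpha>"]) (simp add: sum_distrib_left sum.distrib distrib_right mult.assoc)
qed

lemma polys_add: "P \<in> polys \<delta> ==> Q \<in> polys \<delta> ==> (%x. P x + Q x) \<in> polys \<delta>"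
 using polys_lincomb[of P \<delta> Q 1 1] by simp
lemma polys_diff: "P \<in> polys \<delta> ==> Q \<in> polys \<delta> ==> (%x. P x - Q x) \<in> polys \<delta>"
 using polys_lincomb[of P \<delta> Q 1 "-1"] by simp
lemma polys_cmult: "P \<in> polys \<delta> ==> (%x. s * P x) \<in> polys \<delta>"
 using polys_lincomb[of P \<delta> P s 0] by simp
lemma polys_zero: "(%x. 0) \<in> polys \<delta>"
 unfolding polys_iff by (intro exI[of _ "%_. 0"]) simp

lemma polys_sum: "finite I ==> (!!i. i \<in> I ==> P i \<in> polys \<delta>) ==> (%x. \<Sum>i\<in>I. P i x) \<in> polys \<delta>"
 by (induction I rule: finite_induct) (auto simp: polys_zero intro: polys_add)

lemma polys_cnj: "P \<in> polys \<delta> ==> (%x. cnj (P x)) \<in> polys \<delta>"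
proof -
 assume "P \<in> polys \<delta>"
 then obtain a where "!!x. P x = (\<Sum>\<alpha> | (\<Sum>i\<in>UNIV. \<alpha> i) <= \<delta>. a \<alpha> * of_real (mon \<alpha> x))"
  unfolding polys_iff by blast
 then show ?thesis unfolding polys_iff by (intro exI[of _ "%\<alpha>. cnj (a \<alpha>)"]) simp
qed

lemma mon_in_polys: "(\<Sum>i\<in>UNIV. \<alpha> i) <= \<delta> ==> (%x. of_real (mon \<alpha> x)) \<in> polys \<delta>"
 unfolding polys_iff
proof (intro exI[of _ "%\<beta>. if \<beta> = \<alpha> then 1 else 0"] allI)
 fix x assume "(\<Sum>i\<in>UNIV. \<alpha> i) <= \<delta>"
 then show "complex_of_real (mon \<alpha> x) = (\<Sum>\<beta> | (\<Sum>i\<in>UNIV. \<beta> i) <= \<delta>. (if \<beta> = \<alpha> then 1 else 0) * of_real (mon \<beta> x))"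
  by (simp add: if_distrib[of "%z. z * _"] finite_multi_indices cong: if_cong)
qed

lemma polys_weaken:
 assumes "P \<in> polys \<delta>" "\<delta> <= \<delta>'" shows "P \<in> polys \<delta>'"
proof -
 obtain a where a: "!!x. P x = (\<Sum>\<alpha> | (\<Sum>i\<in>UNIV. \<alpha> i) <= \<delta>. a \<alpha> * of_real (mon \<alpha> x))"
  using assms(1) unfolding polys_iff by blast
 have "(%x. \<Sum>\<alpha> | (\<Sum>i\<in>UNIV. \<alpha> i) <= \<delta>. a \<alpha> * of_real (mon \<alpha> x)) \<in> polys \<delta>'"
  using assms(2) by (intro polys_sum finite_multi_indices polys_cmult mon_in_polys) auto
 moreover have "P = (%x. \<Sum>\<alpha> | (\<Sum>i\<in>UNIV. \<alpha> i) <= \<delta>. a \<alpha> * of_real (mon \<alpha> x))" by (rule ext) (rule a)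
 ultimately show ?thesis by (simp only:)
qed

lemma polys_const: "(%x. k) \<in> polys \<delta>"
proof -
 have "(%x::real^'a. complex_of_real (mon (%i. 0) x)) \<in> polys \<delta>" by (rule mon_in_polys) simp
 from polys_cmult[OF this, of k] show ?thesis by (simp add: mon_def)
qed

lemma polys_mult_coord:
 assumes "P \<in> polys \<delta>" shows "(%x. of_real (x $ i) * P x) \<in> polys (Suc \<delta>)"
proof -
 obtain a where a: "!!x. P x = (\<Sum>\<alpha> | (\<Sum>i\<in>UNIV. \<alpha> i) <= \<delta>. a \<alpha> * of_real (mon \<alpha> x))"
  using assms(1) unfolding polys_iff by blast
 have m: "x $ i * mon \<alpha> x = mon (\<alpha>(i := Suc (\<alpha> i))) x" for \<alpha> x
 proof -
  have "(\<Prod>j\<in>UNIV - {i}. (x $ j) ^ (\<alpha>(i := Suc (\<alpha> i))) j) = (\<Prod>j\<in>UNIV - {i}. (x $ j) ^ \<alpha> j)"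
   by (intro prod.cong) auto
  then show ?thesis unfolding mon_def
   by (subst (1 2) prod.remove[of UNIV i]) (auto simp: mult_ac)
 qed
 have s: "(\<Sum>j\<in>UNIV. (\<alpha>(i := Suc (\<alpha> i))) j) = Suc (\<Sum>j\<in>UNIV. \<alpha> j)" for \<alpha> :: "'a => nat"
 proof -
  have "(\<Sum>j\<in>UNIV - {i}. (\<alpha>(i := Suc (\<alpha> i))) j) = (\<Sum>j\<in>UNIV - {i}. \<alpha> j)" by (intro sum.cong) auto
  then show ?thesis by (subst (1 2) sum.remove[of UNIV i]) auto
 qed
 have "(%x. \<Sum>\<alpha> | (\<Sum>i\<in>UNIV. \<alpha> i) <= \<delta>. a \<alpha> * of_real (mon (\<alpha>(i := Suc (\<alpha> i))) x)) \<in> polys (Suc \<delta>)"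
  by (intro polys_sum finite_multi_indices polys_cmult mon_in_polys) (auto simp: s simp del: fun_upd_apply)
 then show ?thesis
  unfolding a by (simp add: sum_distrib_left m[symmetric] mult_ac)
qed

lemma polys_mult_affine_power:
 assumes "P \<in> polys \<delta>" shows "(%x. of_real (c + l * x $ i) ^ k * P x) \<in> polys (\<delta> + k)"
proof (induction k)
 case (Suc k)
 let ?R = "%x. of_real (c + l * x $ i) ^ k * P x"
 have "(%x. of_real c * ?R x + of_real l * (of_real (x $ i) * ?R x)) \<in> polys (Suc (\<delta> + k))"
  by (intro polys_lincomb polys_mult_coord Suc polys_weaken[OF Suc]) simp
 moreover have "(%x. of_real c * ?R x + of_real l * (of_real (x $ i) * ?R x)) = (%x. of_real (c + l * x $ i) ^ Suc k * P x)"
  by (rule ext) (simp add: algebra_simps)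
 ultimately show ?case by simp
qed (use assms in simp)

lemma polys_mult_affine_prod:
 assumes "finite F"
 shows "(%x. \<Prod>i\<in>F. of_real (c i + l * x $ i) ^ \<beta> i) \<in> polys (\<Sum>i\<in>F. \<beta> i)"
 using assms
proof (induction F)
 case (insert i F)
 have "(%x. of_real (c i + l * x $ i) ^ \<beta> i * (\<Prod>i\<in>F. of_real (c i + l * x $ i) ^ \<beta> i)) \<in> polys ((\<Sum>i\<in>F. \<beta> i) + \<beta> i)"
  by (rule polys_mult_affine_power[OF insert.IH])
 then show ?case using insert by (simp add: add.commute)
qed (simp add: polys_const)

lemma polys_affine:
 assumes "P \<in> polys \<delta>" shows "(%x. P (c + l *\<^sub>R x)) \<in> polys \<delta>"
proof -
 obtain a where a: "!!x. P x = (\<Sum>\<alpha> | (\<Sum>i\<in>UNIV. \<alpha> i) <= \<delta>. a \<alpha> * of_real (mon \<alpha> x))"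
  using assms(1) unfolding polys_iff by blast
 have "(%x. complex_of_real (mon \<alpha> (c + l *\<^sub>R x))) \<in> polys \<delta>" if "(\<Sum>i\<in>UNIV. \<alpha> i) <= \<delta>" for \<alpha>
  using polys_weaken[OF polys_mult_affine_prod[of UNIV "%i. c $ i" l \<alpha>] that] by (simp add: mon_def)
 then show ?thesis unfolding a by (intro polys_sum finite_multi_indices polys_cmult) auto
qed

lemma mon_continuous: "continuous_on S (mon \<alpha>)"
 unfolding mon_def[abs_def] by (intro continuous_intros)

lemma polys_continuous:
 assumes "P \<in> polys \<delta>" shows "continuous_on S P"
proof -
 obtain a where a: "!!x. P x = (\<Sum>\<alpha> | (\<Sum>i\<in>UNIV. \<alpha> i) <= \<delta>. a \<alpha> * of_real (mon \<alpha> x))"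
  using assms(1) unfolding polys_iff by blast
 have "continuous_on S (%x. \<Sum>\<alpha> | (\<Sum>i\<in>UNIV. \<alpha> i) <= \<delta>. a \<alpha> * of_real (mon \<alpha> x))"
  by (intro continuous_intros mon_continuous)
 moreover have "P = (%x. \<Sum>\<alpha> | (\<Sum>i\<in>UNIV. \<alpha> i) <= \<delta>. a \<alpha> * of_real (mon \<alpha> x))" by (rule ext) (rule a)
 ultimately show ?thesis by (simp only:)
qed

text \<open>Restricting to a line turns a polynomial function into a polynomial in one variable, so uniqueness can be reduced to
 the finiteness of the set of roots.\<close>

lemma polys_line:
 assumes "P \<in> polys \<delta>" shows "\<exists>p :: complex poly. \<forall>t. poly p (of_real t) = P (x + t *\<^sub>R v)"
proof -
 obtain a where a: "!!x. P x = (\<Sum>\<alpha> | (\<Sum>i\<in>UNIV. \<alpha> i) <= \<delta>. a \<alpha> * of_real (mon \<alpha> x))"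
  using assms(1) unfolding polys_iff by blast
 show ?thesis
  by (intro exI[of _ "\<Sum>\<alpha> | (\<Sum>i\<in>UNIV. \<alpha> i) <= \<delta>. [:a \<alpha>:] * (\<Prod>i\<in>UNIV. [:of_real (x $ i), of_real (v $ i):] ^ \<alpha> i)"])
    (simp add: a poly_sum poly_prod mon_def)
qed

lemma mem_cube: "x \<in> cube c l \<longleftrightarrow> (\<forall>i. \<bar>x $ i - c $ i\<bar> <= l / 2)"
proof -
 have "(c $ i - l / 2 <= x $ i \<and> x $ i <= c $ i + l / 2) \<longleftrightarrow> \<bar>x $ i - c $ i\<bar> <= l / 2" for i
  by arith
 then show ?thesis by (simp add: cube_def mem_box_cart)
qed

lemma polys_zero_on_cube:
 fixes P :: "real^'n => complex"
 assumes P: "P \<in> polys \<delta>" and l: "0 < l" and z: "!!x. x \<in> cube c l ==> P x = 0"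
 shows "P x = 0"
proof -
 obtain p :: "complex poly" where p: "!!t. poly p (of_real t) = P (c + t *\<^sub>R (x - c))"
  using polys_line[OF P] by blast
 define e where "e = (l / 2) / (norm (x - c) + 1)"
 have e: "0 < e" unfolding e_def using l by (intro divide_pos_pos add_nonneg_pos) auto
 have "poly p (of_real t) = 0" if t: "t \<in> {0..e}" for t
 proof -
  have "\<bar>t * (x $ i - c $ i)\<bar> <= l / 2" for i
  proof -
   have "\<bar>t * (x $ i - c $ i)\<bar> = t * \<bar>(x - c) $ i\<bar>" using t by (simp add: abs_mult)
   also have "... <= e * (norm (x - c) + 1)"
    using t e component_le_norm_cart[of "x - c" i] by (intro mult_mono) auto
   also have "... = l / 2"
   proof -
    have N1: "norm (x - c) + 1 ~= 0" using norm_ge_zero[of "x - c"] by linarith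
    have "(l / 2) / (norm (x - c) + 1) = e" by (simp only: e_def)
    then show ?thesis by (subst (asm) nonzero_divide_eq_eq[OF N1]) simp
   qed
   finally show ?thesis .
  qed
  then have "c + t *\<^sub>R (x - c) \<in> cube c l" by (simp add: mem_cube)
  then show ?thesis using p z by simp
 qed
 then have "complex_of_real ` {0..e} \<subseteq> {z. poly p z = 0}" by auto
 moreover have "infinite (complex_of_real ` {0..e})"
  using e by (subst finite_image_iff) (auto simp: inj_on_def)
 ultimately have "p = 0" using poly_roots_finite[of p] finite_subset by blast
 then show ?thesis using p[of 1] by simp
qed

lemma cube_measure:
 fixes c :: "real^'n"
 assumes "0 < l"
 shows "measure lebesgue (cube c l) = l ^ CARD('n)" "emeasure lebesgue (cube c l) = ennreal (l ^ CARD('n))"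
proof -
 have le: "\<forall>b\<in>Basis. (c - (\<chi> i. l / 2)) \<bullet> b <= (c + (\<chi> i. l / 2)) \<bullet> b"
  using assms by (auto simp: Basis_vec_def inner_axis)
 have pr: "(\<Prod>b\<in>Basis. ((c + (\<chi> i. l / 2)) - (c - (\<chi> i. l / 2))) \<bullet> b) = l ^ CARD('n)"
 proof -
  have "(\<Prod>b\<in>Basis. ((c + (\<chi> i. l / 2)) - (c - (\<chi> i. l / 2))) \<bullet> b) = (\<Prod>b\<in>(Basis :: (real^'n) set). l)"
   by (intro prod.cong refl) (auto simp: Basis_vec_def inner_axis)
  then show ?thesis by simp
 qed
 show 1: "emeasure lebesgue (cube c l) = ennreal (l ^ CARD('n))"
  using le pr by (simp add: cube_def emeasure_lborel_cbox_eq)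
 show "measure lebesgue (cube c l) = l ^ CARD('n)"
  using 1 assms by (simp add: measure_def del: measure_completion emeasure_completion)
qed

lemma cube_sets [measurable]: "cube c l \<in> sets lebesgue"
 by (simp add: cube_def)

lemma cube_compact: "compact (cube c l)"
 by (simp add: cube_def)

lemma continuous_cube_integrable:
 fixes F :: "real^'n => 'b::euclidean_space"
 assumes "continuous_on UNIV F" shows "set_integrable lebesgue (cube c l) F"
 unfolding cube_def by (rule absolutely_integrable_continuous) (rule continuous_on_subset[OF assms], simp)

lemma cube_integral_zero:
 fixes F :: "real^'n => real"
 assumes F: "continuous_on UNIV F" "!!x. 0 <= F x" and l: "0 < l" and z: "(LINT x:cube c l|lebesgue. F x) = 0" and x: "x \<in> cube c l"
 shows "F x = 0"
proof -
 have "(F has_integral 0) (cube c l)"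
  using has_integral_set_lebesgue[OF continuous_cube_integrable[OF F(1), of c l]] z by simp
 then show ?thesis
  using F l x unfolding cube_def
  by (intro has_integral_0_cbox_imp_0[of "c - (\<chi> i. l / 2)" "c + (\<chi> i. l / 2)" F])
    (auto simp: box_ne_empty Basis_vec_def inner_axis intro: continuous_on_subset[OF F(1)])
qed

lemma cube_affine_integral:
 fixes F :: "real^'n => real"
 assumes F: "continuous_on UNIV F" and l: "0 < l"
 shows "(LINT x:cube c l|lebesgue. F ((1 / l) *\<^sub>R (x - c))) = l ^ CARD('n) * (LINT y:cube 0 1|lebesgue. F y)"
proof -
 have h: "(F has_integral (LINT y:cube 0 1|lebesgue. F y)) (cbox (0 - (\<chi> i. 1 / 2)) (0 + (\<chi> i. 1 / 2)))"
  using has_integral_set_lebesgue[OF continuous_cube_integrable[OF F, of 0 1]] by (simp add: cube_def)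
 have "((%x. F ((1 / l) *\<^sub>R x + (- (1 / l) *\<^sub>R c))) has_integral ((LINT y:cube 0 1|lebesgue. F y) /\<^sub>R (1 / l) ^ DIM(real^'n)))
   (cbox (((0 - (\<chi> i. 1 / 2)) - (- (1 / l) *\<^sub>R c)) /\<^sub>R (1 / l)) (((0 + (\<chi> i. 1 / 2)) - (- (1 / l) *\<^sub>R c)) /\<^sub>R (1 / l)))"
  using l by (intro has_integral_affinity'[OF h]) auto
 moreover have "cbox (((0 - (\<chi> i. 1 / 2)) - (- (1 / l) *\<^sub>R c)) /\<^sub>R (1 / l)) (((0 + (\<chi> i. 1 / 2)) - (- (1 / l) *\<^sub>R c)) /\<^sub>R (1 / l)) = cube c l"
 proof -
  have "((0 - (\<chi> i. 1 / 2)) - (- (1 / l) *\<^sub>R c)) /\<^sub>R (1 / l) = c - (\<chi> i. l / 2)"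
   "((0 + (\<chi> i. 1 / 2)) - (- (1 / l) *\<^sub>R c)) /\<^sub>R (1 / l) = c + (\<chi> i. l / 2)"
   using l by (simp_all add: vec_eq_iff algebra_simps)
  then show ?thesis by (simp only: cube_def)
 qed
 moreover have "(LINT y:cube 0 1|lebesgue. F y) /\<^sub>R (1 / l) ^ DIM(real^'n) = l ^ CARD('n) * (LINT y:cube 0 1|lebesgue. F y)"
  using l by (simp add: power_divide)
 moreover have "(1 / l) *\<^sub>R x + (- (1 / l) *\<^sub>R c) = (1 / l) *\<^sub>R (x - c)" for x
  by (simp add: scaleR_diff_right)
 ultimately have "((%x. F ((1 / l) *\<^sub>R (x - c))) has_integral (l ^ CARD('n) * (LINT y:cube 0 1|lebesgue. F y))) (cube c l)"
  by (simp only:)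
 moreover have "continuous_on UNIV (%x. F ((1 / l) *\<^sub>R (x - c)))"
  by (intro continuous_on_compose2[OF F] continuous_intros) auto
 ultimately show ?thesis
  using has_integral_set_lebesgue[OF continuous_cube_integrable[of "%x. F ((1 / l) *\<^sub>R (x - c))" c l]]
  by (metis has_integral_unique)
qed

text \<open>The representation is required only on the cube, hence a function that is already dependent there can simply be
 skipped.\<close>

lemma gram_schmidt:
 fixes V :: "(real^'n => real) set"
 defines "ip \<equiv> %u v. LINT x:cube 0 1|lebesgue. u x * v x :: real"
 assumes V: "!!u v a b. u \<in> V ==> v \<in> V ==> (%x. a * u x + b * v x) \<in> V"
  and cont: "!!v. v \<in> V ==> continuous_on UNIV v" and "finite S" "S \<subseteq> V"
 shows "\<exists>E. finite E \<and> E \<subseteq> V \<and> (\<forall>e\<in>E. \<forall>e'\<in>E. ip e e' = (if e = e' then 1 else 0)) \<and>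
   (\<forall>v\<in>S. \<forall>x\<in>cube 0 1. v x = (\<Sum>e\<in>E. ip v e * e x))"
 using assms(4,5)
proof (induction S)
 case empty
 show ?case by (intro exI[of _ "{}"]) auto
next
 case (insert v S)
 then have "S \<subseteq> V" by simp
 from insert.IH[OF this] obtain E where E: "finite E" "E \<subseteq> V"
  and on0: "\<forall>e\<in>E. \<forall>e'\<in>E. ip e e' = (if e = e' then 1 else 0)"
  and rep0: "\<forall>v\<in>S. \<forall>x\<in>cube 0 1. v x = (\<Sum>e\<in>E. ip v e * e x)" by (elim exE conjE, intro that)
 note on = on0[rule_format] and rep = rep0[rule_format]
 have vV: "v \<in> V" using insert by simp
 have int: "set_integrable lebesgue (cube 0 1) (%x. u x * w x)" if "u \<in> V" "w \<in> V" for u w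
  by (intro continuous_cube_integrable continuous_on_mult cont that)
 have ip_add: "ip (%x. a * u x + b * w x) z = a * ip u z + b * ip w z" if "u \<in> V" "w \<in> V" "z \<in> V" for a b u w z
 proof -
  have "ip (%x. a * u x + b * w x) z = (LINT x:cube 0 1|lebesgue. a * (u x * z x) + b * (w x * z x))"
   unfolding ip_def by (simp add: algebra_simps)
  also have "... = a * ip u z + b * ip w z"
   unfolding ip_def using int[OF that(1,3)] int[OF that(2,3)] by (simp add: set_integral_add)
  finally show ?thesis .
 qed
 have ip_sym: "ip u w = ip w u" for u w unfolding ip_def by (simp add: mult.commute)
 have sumV: "(%x. u x - (\<Sum>e\<in>G. k e * e x)) \<in> V \<and> (\<forall>z\<in>V. ip (%x. u x - (\<Sum>e\<in>G. k e * e x)) z = ip u z - (\<Sum>e\<in>G. k e * ip e z))"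
  if "finite G" "G \<subseteq> V" "u \<in> V" for G u k
  using that
 proof (induction G)
  case (insert e G)
  let ?u = "%x. u x - (\<Sum>e\<in>G. k e * e x)"
  have u: "?u \<in> V" "e \<in> V" using insert by auto
  have eq: "(%x. u x - (\<Sum>e\<in>insert e G. k e * e x)) = (%x. 1 * ?u x + (- k e) * e x)"
   using insert by (auto simp: fun_eq_iff)
  show ?case unfolding eq using V[OF u, of 1 "- k e"] ip_add[OF u, of _ 1 "- k e"] insert by auto
 qed auto
 define w where "w x = v x - (\<Sum>e\<in>E. ip v e * e x)" for x
 have wV: "w \<in> V" and wip: "!!z. z \<in> V ==> ip w z = ip v z - (\<Sum>e\<in>E. ip v e * ip e z)"
  using sumV[OF E vV, of "ip v"] unfolding w_def[abs_def] by auto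
 have worth: "ip w e = 0" if e: "e \<in> E" for e
 proof -
  have "ip w e = ip v e - (\<Sum>e'\<in>E. ip v e' * ip e' e)" using wip e E by blast
  also have "(\<Sum>e'\<in>E. ip v e' * ip e' e) = (\<Sum>e'\<in>E. if e' = e then ip v e else 0)"
   by (intro sum.cong refl) (use on e in auto)
  finally show ?thesis using E e by simp
 qed
 have wv: "ip v w = ip w w"
 proof -
  have "(\<Sum>e\<in>E. ip v e * ip e w) = 0" by (intro sum.neutral) (use worth ip_sym in auto)
  then show ?thesis using wip[OF wV] by simp
 qed
 have ww: "0 <= ip w w" unfolding ip_def by (auto simp: set_lebesgue_integral_def intro!: integral_nonneg_AE)
 show ?case
 proof (cases "ip w w = 0")
  case True
  have "w x = 0" if "x \<in> cube 0 1" for x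
  proof -
   have "w x * w x = 0"
    by (rule cube_integral_zero[of "%x. w x * w x" 1 0]) (use True that cont[OF wV] in \<open>auto simp: ip_def intro!: continuous_on_mult\<close>)
   then show ?thesis by simp
  qed
  then have "v x = (\<Sum>e\<in>E. ip v e * e x)" if "x \<in> cube 0 1" for x using that unfolding w_def by auto
  then show ?thesis using E on rep by (intro exI[of _ E]) auto
 next
  case False
  then have pos: "0 < ip w w" using ww by simp
  define r where "r = 1 / sqrt (ip w w)"
  define e0 where "e0 x = r * w x + 0 * w x" for x
  have e0V: "e0 \<in> V" unfolding e0_def[abs_def] by (rule V[OF wV wV])
  have e0ip: "ip e0 z = r * ip w z" if "z \<in> V" for z
   unfolding e0_def[abs_def] using ip_add[OF wV wV that, of r 0] by simp
  have e0E: "ip e0 e = 0" if "e \<in> E" for e using e0ip[of e] worth that E by auto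
  have e0E2: "ip e e0 = 0" if "e \<in> E" for e using e0E[OF that] ip_sym[of e e0] by simp
  have rr: "r * r * ip w w = 1" using pos by (simp add: r_def)
  have e00: "ip e0 e0 = 1" using e0ip[OF e0V] ip_sym[of w e0] e0ip[OF wV] rr by simp
  have notin: "e0 \<notin> E" using e0E[of e0] e00 by auto
  have ve0: "ip v e0 * e0 x = w x" for x
  proof -
   have "ip v e0 = r * ip w w" using ip_sym[of v e0] e0ip[OF vV] ip_sym[of w v] wv by simp
   then have "ip v e0 * e0 x = (r * r * ip w w) * w x" by (simp add: e0_def)
   then show ?thesis using rr by simp
  qed
  have ue0: "ip u e0 = 0" if u: "u \<in> S" for u
  proof -
   have uV: "u \<in> V" using u insert by auto
   define k where "k e = ip u e" for e
   have k: "u x = (\<Sum>e\<in>E. k e * e x)" if "x \<in> cube 0 1" for x using rep[OF u that] by (simp only: k_def)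
   have i: "integrable lebesgue (%x. indicator (cube 0 1) x *\<^sub>R (e x * e0 x))" if "e \<in> E" for e
    using int[OF _ e0V, of e] that E by (auto simp: set_integrable_def)
   have "ip u e0 = (LINT x|lebesgue. (\<Sum>e\<in>E. k e * (indicator (cube 0 1) x *\<^sub>R (e x * e0 x))))"
    unfolding ip_def set_lebesgue_integral_def
   proof (intro Bochner_Integration.integral_cong refl)
    fix x
    show "indicator (cube 0 1) x *\<^sub>R (u x * e0 x) = (\<Sum>e\<in>E. k e * (indicator (cube 0 1) x *\<^sub>R (e x * e0 x)))"
     by (cases "x \<in> cube 0 1") (simp_all add: k sum_distrib_right mult.assoc)
   qed
   also have "... = (\<Sum>e\<in>E. LINT x|lebesgue. k e * (indicator (cube 0 1) x *\<^sub>R (e x * e0 x)))"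
    by (intro Bochner_Integration.integral_sum integrable_mult_right i)
   also have "... = (\<Sum>e\<in>E. k e * ip e e0)"
    unfolding ip_def set_lebesgue_integral_def by (intro sum.cong refl integral_mult_right_zero)
   also have "... = 0" by (intro sum.neutral) (use e0E ip_sym in auto)
   finally show ?thesis .
  qed
  have repv: "v x = (\<Sum>e\<in>insert e0 E. ip v e * e x)" for x
   using E notin ve0[of x] by (simp add: w_def)
  show ?thesis
  proof (intro exI[of _ "insert e0 E"] conjI ballI)
   fix e e' assume "e \<in> insert e0 E" "e' \<in> insert e0 E"
   then show "ip e e' = (if e = e' then 1 else 0)"
    using on e0E e0E2 e00 notin by auto
  next
   fix u x assume u: "u \<in> insert v S" and x: "x \<in> cube (0::real^'n) 1"
   show "u x = (\<Sum>e\<in>insert e0 E. ip u e * e x)"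
   proof (cases "u = v")
    case False
    then have "u \<in> S" using u by simp
    then show ?thesis using rep[OF _ x] ue0 E notin by simp
   qed (use repv in simp)
  qed (use E e0V in auto)
 qed
qed

text \<open>On the unit cube the projection is given by an orthonormal basis of polynomials, whose elements are bounded
 there, so it is dominated by the mean of \<open>\<bar>g\<bar>\<close>; the affine map of the unit cube onto the given one preserves
 degrees and scales the constant. Constants are reproduced, which allows \<open>g - k\<close> in place of \<open>g\<close>.\<close>

theorem poly_proj_bound:
 "\<exists>C>0. \<forall>(c :: real^'n) l g k. 0 < l --> set_integrable lebesgue (cube c l) g -->
   poly_proj \<delta> (cube c l) g \<in> polys \<delta> \<and>
   (\<forall>x\<in>cube c l. cmod (poly_proj \<delta> (cube c l) g x - k) <= C / l ^ CARD('n) * (LINT x:cube c l|lebesgue. cmod (g x - k)))"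
proof -
 define V :: "(real^'n => real) set" where "V = {v. (%x. of_real (v x)) \<in> polys \<delta>}"
 define S :: "(real^'n => real) set" where "S = mon ` {\<alpha>. (\<Sum>i\<in>UNIV. \<alpha> i) <= \<delta>}"
 have Vlin: "(%x. a * u x + b * v x) \<in> V" if "u \<in> V" "v \<in> V" for u v a b
  using polys_lincomb[of "%x. of_real (u x)" \<delta> "%x. of_real (v x)" "of_real a" "of_real b"] that by (simp add: V_def)
 have Vcont: "continuous_on UNIV v" if v: "v \<in> V" for v
 proof -
  have "continuous_on UNIV (%x. Re (complex_of_real (v x)))"
   using v unfolding V_def mem_Collect_eq by (intro continuous_on_Re polys_continuous)
  then show ?thesis by (simp only: Re_complex_of_real)
 qed
 have SV: "finite S" "S \<subseteq> V" unfolding S_def V_def using finite_multi_indices mon_in_polys by auto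
 obtain E where E: "finite E" "E \<subseteq> V"
  and on0: "\<forall>e\<in>E. \<forall>e'\<in>E. (LINT x:cube 0 1|lebesgue. e x * e' x) = (if e = e' then 1 else 0)"
  and rep0: "\<forall>v\<in>S. \<forall>x\<in>cube 0 1. v x = (\<Sum>e\<in>E. (LINT x:cube 0 1|lebesgue. v x * e x) * e x)"
 proof -
  have "\<exists>E. finite E \<and> E \<subseteq> V \<and>
    (\<forall>e\<in>E. \<forall>e'\<in>E. (LINT x:cube 0 1|lebesgue. e x * e' x) = (if e = e' then 1 else 0)) \<and>
    (\<forall>v\<in>S. \<forall>x\<in>cube 0 1. v x = (\<Sum>e\<in>E. (LINT x:cube 0 1|lebesgue. v x * e x) * e x))"
  proof (rule gram_schmidt)
   show "(%x. a * u x + b * v x) \<in> V" if "u \<in> V" "v \<in> V" for u v a b by (rule Vlin[OF that])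
  qed (use Vcont SV in auto)
  then show ?thesis by (elim exE conjE, intro that)
 qed
 note on = on0[rule_format] and rep = rep0[rule_format]
 have Erep: "\<exists>b. \<forall>y\<in>cube 0 1. P y = (\<Sum>e\<in>E. b e * of_real (e y))" if P: "P \<in> polys \<delta>" for P
 proof -
  obtain a where a: "!!x. P x = (\<Sum>\<alpha> | (\<Sum>i\<in>UNIV. \<alpha> i) <= \<delta>. a \<alpha> * of_real (mon \<alpha> x))"
   using P unfolding polys_iff by blast
  let ?m = "%\<alpha> e. LINT x:cube 0 1|lebesgue. mon \<alpha> x * e x"
  have "P y = (\<Sum>e\<in>E. (\<Sum>\<alpha> | (\<Sum>i\<in>UNIV. \<alpha> i) <= \<delta>. a \<alpha> * of_real (?m \<alpha> e)) * of_real (e y))" if y: "y \<in> cube 0 1" for y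
  proof -
   have "P y = (\<Sum>\<alpha> | (\<Sum>i\<in>UNIV. \<alpha> i) <= \<delta>. a \<alpha> * of_real (\<Sum>e\<in>E. ?m \<alpha> e * e y))"
    unfolding a by (intro sum.cong refl) (use rep[OF _ y] in \<open>auto simp: S_def\<close>)
   also have "... = (\<Sum>\<alpha> | (\<Sum>i\<in>UNIV. \<alpha> i) <= \<delta>. \<Sum>e\<in>E. a \<alpha> * of_real (?m \<alpha> e) * of_real (e y))"
    by (simp add: sum_distrib_left mult.assoc)
   also have "... = (\<Sum>e\<in>E. \<Sum>\<alpha> | (\<Sum>i\<in>UNIV. \<alpha> i) <= \<delta>. a \<alpha> * of_real (?m \<alpha> e) * of_real (e y))" by (rule sum.swap)
   finally show ?thesis by (simp add: sum_distrib_right)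
  qed
  then show ?thesis
   by (intro exI[of _ "%e. \<Sum>\<alpha> | (\<Sum>i\<in>UNIV. \<alpha> i) <= \<delta>. a \<alpha> * of_real (?m \<alpha> e)"] ballI)
 qed
 have "\<exists>B. \<forall>y\<in>cube 0 1. \<bar>e y\<bar> <= B" if e: "e \<in> E" for e
 proof -
  have "compact (e ` cube 0 1)"
   using e E by (intro compact_continuous_image cube_compact continuous_on_subset[OF Vcont]) auto
  from compact_imp_bounded[OF this] obtain B where "\<forall>z\<in>e ` cube 0 1. norm z <= B" unfolding bounded_iff by (elim exE, intro that)
  then show ?thesis by auto
 qed
 then have "\<forall>e\<in>E. \<exists>B. \<forall>y\<in>cube 0 1. \<bar>e y\<bar> <= B" by (rule ballI)
 from bchoice[OF this] obtain B where B0: "\<forall>e\<in>E. \<forall>y\<in>cube 0 1. \<bar>e y\<bar> <= B e" by (elim exE, intro that)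
 note B = B0[rule_format]
 define C where "C = (\<Sum>e\<in>E. B e * B e) + 1"
 have C: "0 < C" unfolding C_def by (intro add_nonneg_pos sum_nonneg) auto
 have main: "poly_proj \<delta> (cube c l) g \<in> polys \<delta> \<and>
   (\<forall>x\<in>cube c l. cmod (poly_proj \<delta> (cube c l) g x - k) <= C / l ^ CARD('n) * (LINT x:cube c l|lebesgue. cmod (g x - k)))"
  if l: "0 < l" and g: "set_integrable lebesgue (cube c l) g" for c :: "real^'n" and l g k
 proof -
  let ?Q = "cube c l" and ?d = "CARD('n)"
  define \<phi> where "\<phi> x = (1 / l) *\<^sub>R (x - c)" for x
  have \<phi>Q: "\<phi> x \<in> cube 0 1" if "x \<in> ?Q" for x
   using that l by (auto simp: mem_cube \<phi>_def abs_mult field_simps)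
  have \<phi>aff: "\<phi> x = - (1 / l) *\<^sub>R c + (1 / l) *\<^sub>R x" for x by (simp add: \<phi>_def scaleR_diff_right)
  have econt: "continuous_on UNIV (%x. e (\<phi> x))" if "e \<in> E" for e
   unfolding \<phi>_def using that E by (intro continuous_on_compose2[OF Vcont] continuous_intros) auto
  have epoly: "(%x. of_real (e (\<phi> x))) \<in> polys \<delta>" if "e \<in> E" for e
  proof -
   have "(%x. complex_of_real (e x)) \<in> polys \<delta>" using that E by (auto simp: V_def)
   from polys_affine[OF this, of "- (1 / l) *\<^sub>R c" "1 / l"] show ?thesis unfolding \<phi>aff .
  qed
  have onQ: "(LINT x:?Q|lebesgue. e (\<phi> x) * e' (\<phi> x)) = (if e = e' then l ^ ?d else 0)" if "e \<in> E" "e' \<in> E" for e e'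
  proof -
   have cc: "continuous_on UNIV (%x. e x * e' x)" using that E by (intro continuous_on_mult Vcont) auto
   show ?thesis unfolding \<phi>_def using cube_affine_integral[OF cc l, of c] on[OF that] by simp
  qed
  have eint: "set_integrable lebesgue ?Q (%x. f x * of_real (e (\<phi> x)))" if f: "set_integrable lebesgue ?Q f" and e: "e \<in> E" for f :: "real^'n => complex" and e
  proof -
   have m: "(%x. complex_of_real (e (\<phi> x))) \<in> Meas"
   proof -
    have "(%x. complex_of_real (e (\<phi> x))) \<in> borel_measurable borel"
     by (intro borel_measurable_continuous_onI continuous_on_of_real econt e)
    then show ?thesis by (intro measurable_completion) simp
   qed
   have "integrable lebesgue (%x. (of_real (e (\<phi> x)) * indicator ?Q x) * (indicator ?Q x *\<^sub>R f x))"
   proof (rule integrable_bounded_mult)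
    show "integrable lebesgue (%x. indicator ?Q x *\<^sub>R f x)" using f by (simp add: set_integrable_def)
    show "(%x. complex_of_real (e (\<phi> x)) * indicator ?Q x) \<in> Meas" using m by measurable
    show "AE x in lebesgue. cmod (of_real (e (\<phi> x)) * indicator ?Q x) <= \<bar>B e\<bar>"
     using B[OF e \<phi>Q] by (intro AE_I2) (auto simp: indicator_def norm_mult intro: order_trans[OF _ abs_ge_self])
   qed
   moreover have "(of_real (e (\<phi> x)) * indicator ?Q x) * (indicator ?Q x *\<^sub>R f x) = indicator ?Q x *\<^sub>R (f x * of_real (e (\<phi> x)))" for x
    by (simp add: indicator_def)
   ultimately show ?thesis unfolding set_integrable_def by (simp only:)
  qed
  define G where "G f e = (LINT x:?Q|lebesgue. f x * of_real (e (\<phi> x)))" for f :: "real^'n => complex" and e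
  define Pr where "Pr f x = (\<Sum>e\<in>E. (G f e / of_real (l ^ ?d)) * of_real (e (\<phi> x)))" for f x
  have Prpoly: "Pr f \<in> polys \<delta>" for f
   unfolding Pr_def[abs_def] using E by (intro polys_sum polys_cmult epoly)
  have polyint: "set_integrable lebesgue ?Q P" if "P \<in> polys \<delta>" for P
   using polys_continuous[OF that] by (rule continuous_cube_integrable)
  have orth: "(LINT x:?Q|lebesgue. (f x - Pr f x) * q x) = 0" if f: "set_integrable lebesgue ?Q f" and q: "q \<in> polys \<delta>" for f q
  proof -
   obtain b where b: "!!y. y \<in> cube 0 1 ==> q (c + l *\<^sub>R y) = (\<Sum>e\<in>E. b e * of_real (e y))"
    using Erep[OF polys_affine[OF q, of c l]] by blast
   have qx: "q x = (\<Sum>e\<in>E. b e * of_real (e (\<phi> x)))" if "x \<in> ?Q" for x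
    using b[OF \<phi>Q[OF that]] l by (simp add: \<phi>_def)
   have fP: "set_integrable lebesgue ?Q (%x. f x - Pr f x)" using f polyint[OF Prpoly] by (rule set_integral_diff)
   have G0: "G (%x. f x - Pr f x) e = 0" if e: "e \<in> E" for e
   proof -
    have "G (%x. f x - Pr f x) e = G f e - G (Pr f) e"
     unfolding G_def using eint[OF f e] eint[OF polyint[OF Prpoly] e] by (simp add: left_diff_distrib set_integral_diff)
    also have "G (Pr f) e = (\<Sum>e'\<in>E. (G f e' / of_real (l ^ ?d)) * (LINT x:?Q|lebesgue. of_real (e' (\<phi> x)) * of_real (e (\<phi> x))))"
    proof -
     have i: "integrable lebesgue (%x. indicator ?Q x *\<^sub>R (complex_of_real (e' (\<phi> x)) * of_real (e (\<phi> x))))" if "e' \<in> E" for e'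
      using eint[OF polyint[OF epoly[OF that]] e] by (simp add: set_integrable_def)
     have "G (Pr f) e = (LINT x|lebesgue. (\<Sum>e'\<in>E. (G f e' / of_real (l ^ ?d)) * (indicator ?Q x *\<^sub>R (complex_of_real (e' (\<phi> x)) * of_real (e (\<phi> x))))))"
      unfolding G_def[of "Pr f"] Pr_def set_lebesgue_integral_def
      by (intro Bochner_Integration.integral_cong refl) (simp add: sum_distrib_right sum_distrib_left scaleR_sum_right mult_ac indicator_def)
     also have "... = (\<Sum>e'\<in>E. LINT x|lebesgue. (G f e' / of_real (l ^ ?d)) * (indicator ?Q x *\<^sub>R (complex_of_real (e' (\<phi> x)) * of_real (e (\<phi> x)))))"
      by (intro Bochner_Integration.integral_sum integrable_mult_right i)
     also have "... = (\<Sum>e'\<in>E. (G f e' / of_real (l ^ ?d)) * (LINT x:?Q|lebesgue. of_real (e' (\<phi> x)) * of_real (e (\<phi> x))))"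
      unfolding set_lebesgue_integral_def by (intro sum.cong refl integral_mult_right_zero)
     finally show ?thesis .
    qed
    also have "... = (\<Sum>e'\<in>E. if e' = e then G f e else 0)"
    proof (intro sum.cong refl)
     fix e' assume e': "e' \<in> E"
     have "(LINT x:?Q|lebesgue. complex_of_real (e' (\<phi> x)) * of_real (e (\<phi> x))) = (LINT x|lebesgue. of_real (indicator ?Q x * (e' (\<phi> x) * e (\<phi> x))))"
      unfolding set_lebesgue_integral_def by (intro Bochner_Integration.integral_cong refl) (simp add: indicator_def)
     also have "... = of_real (LINT x|lebesgue. indicator ?Q x * (e' (\<phi> x) * e (\<phi> x)))" by (rule integral_complex_of_real)
     also have "... = of_real (if e' = e then l ^ ?d else 0)" using onQ[OF e' e] by (simp add: set_lebesgue_integral_def)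
     finally show "(G f e' / of_real (l ^ ?d)) * (LINT x:?Q|lebesgue. of_real (e' (\<phi> x)) * of_real (e (\<phi> x))) = (if e' = e then G f e else 0)"
      using l by auto
    qed
    also have "... = G f e" using E e by simp
    finally show ?thesis by simp
   qed
   have "(LINT x:?Q|lebesgue. (f x - Pr f x) * q x) = (LINT x|lebesgue. (\<Sum>e\<in>E. b e * (indicator ?Q x *\<^sub>R ((f x - Pr f x) * of_real (e (\<phi> x))))))"
    unfolding set_lebesgue_integral_def
   proof (intro Bochner_Integration.integral_cong refl)
    fix x
    show "indicator ?Q x *\<^sub>R ((f x - Pr f x) * q x) = (\<Sum>e\<in>E. b e * (indicator ?Q x *\<^sub>R ((f x - Pr f x) * of_real (e (\<phi> x)))))"
     by (cases "x \<in> ?Q") (simp_all add: qx sum_distrib_left mult_ac)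
   qed
   also have "... = (\<Sum>e\<in>E. LINT x|lebesgue. b e * (indicator ?Q x *\<^sub>R ((f x - Pr f x) * of_real (e (\<phi> x)))))"
    using eint[OF fP] by (intro Bochner_Integration.integral_sum integrable_mult_right) (auto simp: set_integrable_def)
   also have "... = (\<Sum>e\<in>E. b e * G (%x. f x - Pr f x) e)"
    unfolding G_def set_lebesgue_integral_def by (intro sum.cong refl integral_mult_right_zero)
   also have "... = 0" using G0 by simp
   finally show ?thesis .
  qed
  have qint: "set_integrable lebesgue ?Q (%x. f x * q x)" if f: "set_integrable lebesgue ?Q f" and q: "q \<in> polys \<delta>" for f q
  proof -
   obtain M where M: "!!x. x \<in> ?Q ==> cmod (q x) <= M"
   proof -
    have "compact (q ` ?Q)" by (intro compact_continuous_image polys_continuous[OF q] cube_compact)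
    from compact_imp_bounded[OF this] obtain M where "\<forall>z\<in>q ` ?Q. norm z <= M" unfolding bounded_iff by (elim exE, intro that)
    then show ?thesis by (intro that[of M]) auto
   qed
   have "integrable lebesgue (%x. (q x * indicator ?Q x) * (indicator ?Q x *\<^sub>R f x))"
   proof (rule integrable_bounded_mult)
    show "integrable lebesgue (%x. indicator ?Q x *\<^sub>R f x)" using f by (simp add: set_integrable_def)
    have "q \<in> borel_measurable borel"
     by (intro borel_measurable_continuous_onI polys_continuous[OF q])
    then have "q \<in> Meas" by (intro measurable_completion) simp
    then show "(%x. q x * indicator ?Q x) \<in> Meas" by measurable
    show "AE x in lebesgue. cmod (q x * indicator ?Q x) <= \<bar>M\<bar>"
     using M by (intro AE_I2) (auto simp: indicator_def intro: order_trans[OF _ abs_ge_self])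
   qed
   moreover have "(q x * indicator ?Q x) * (indicator ?Q x *\<^sub>R f x) = indicator ?Q x *\<^sub>R (f x * q x)" for x
    by (simp add: indicator_def)
   ultimately show ?thesis unfolding set_integrable_def by (simp only:)
  qed
  have uniq: "P = P'" if P: "P \<in> polys \<delta>" "P' \<in> polys \<delta>" and f: "set_integrable lebesgue ?Q f"
   and o1: "!!q. q \<in> polys \<delta> ==> (LINT x:?Q|lebesgue. (f x - P x) * q x) = 0"
   and o2: "!!q. q \<in> polys \<delta> ==> (LINT x:?Q|lebesgue. (f x - P' x) * q x) = 0" for P P' f
  proof -
   define D where "D x = P x - P' x" for x
   have D: "D \<in> polys \<delta>" unfolding D_def[abs_def] using P by (rule polys_diff)
   have Dc: "(%x. cnj (D x)) \<in> polys \<delta>" using D by (rule polys_cnj)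
   have i: "set_integrable lebesgue ?Q (%x. (f x - P x) * cnj (D x))" "set_integrable lebesgue ?Q (%x. (f x - P' x) * cnj (D x))"
    using f polyint[OF P(1)] polyint[OF P(2)] by (auto intro!: qint Dc set_integral_diff)
   have "(LINT x:?Q|lebesgue. (f x - P' x) * cnj (D x) - (f x - P x) * cnj (D x)) = 0"
    using i o1[OF Dc] o2[OF Dc] by (simp add: set_integral_diff)
   moreover have "(f x - P' x) * cnj (D x) - (f x - P x) * cnj (D x) = of_real ((cmod (D x))\<^sup>2)" for x
   proof -
    have "(f x - P' x) * cnj (D x) - (f x - P x) * cnj (D x) = D x * cnj (D x)"
     unfolding left_diff_distrib[symmetric] by (simp add: D_def)
    then show ?thesis using complex_norm_square[of "D x"] by simp
   qed
   ultimately have "(LINT x|lebesgue. complex_of_real (indicator ?Q x * (cmod (D x))\<^sup>2)) = 0"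
    by (simp add: set_lebesgue_integral_def scaleR_conv_of_real)
   then have "complex_of_real (LINT x|lebesgue. indicator ?Q x * (cmod (D x))\<^sup>2) = 0" by (simp only: integral_complex_of_real)
   then have z: "(LINT x:?Q|lebesgue. (cmod (D x))\<^sup>2) = 0" by (simp add: set_lebesgue_integral_def)
   have "D x = 0" if "x \<in> ?Q" for x
   proof -
    have "continuous_on UNIV (%x. (cmod (D x))\<^sup>2)" by (intro continuous_intros polys_continuous[OF D])
    from cube_integral_zero[OF this _ l z that] show ?thesis by simp
   qed
   then have "D x = 0" for x using polys_zero_on_cube[OF D l] by blast
   then show ?thesis by (auto simp: D_def)
  qed
  have pp: "poly_proj \<delta> ?Q f = Pr f" if f: "set_integrable lebesgue ?Q f" for f
   unfolding poly_proj_def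
  proof (rule the_equality)
   show "Pr f \<in> polys \<delta> \<and> (\<forall>q\<in>polys \<delta>. (LINT x:?Q|lebesgue. (f x - Pr f x) * q x) = 0)" using Prpoly orth[OF f] by blast
   fix P assume "P \<in> polys \<delta> \<and> (\<forall>q\<in>polys \<delta>. (LINT x:?Q|lebesgue. (f x - P x) * q x) = 0)"
   then show "P = Pr f" using uniq[OF _ Prpoly f, of P f] orth[OF f] by blast
  qed
  have kint: "set_integrable lebesgue ?Q (%x. g x - k)"
   using g polyint[OF polys_const] by (rule set_integral_diff)
  have shift: "Pr g = (%x. Pr (%x. g x - k) x + k)"
  proof (rule uniq[OF Prpoly _ g orth[OF g]])
   show "(%x. Pr (%x. g x - k) x + k) \<in> polys \<delta>" by (intro polys_add Prpoly polys_const)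
   fix q :: "real^'n => complex" assume "q \<in> polys \<delta>"
   from orth[OF kint this] show "(LINT x:?Q|lebesgue. (g x - (Pr (%x. g x - k) x + k)) * q x) = 0"
    by (simp add: algebra_simps)
  qed
  have "cmod (poly_proj \<delta> ?Q g x - k) <= C / l ^ ?d * (LINT x:?Q|lebesgue. cmod (g x - k))" if x: "x \<in> ?Q" for x
  proof -
   let ?L = "LINT x:?Q|lebesgue. cmod (g x - k)"
   have ki: "set_integrable lebesgue ?Q (%x. cmod (g x - k))" using kint by (rule set_integrable_norm)
   have L: "0 <= ?L" unfolding set_lebesgue_integral_def by (intro integral_nonneg_AE) auto
   have Gle: "cmod (G (%x. g x - k) e) <= B e * ?L" if e: "e \<in> E" for e
   proof -
    have "cmod (G (%x. g x - k) e) <= (LINT x|lebesgue. B e * (indicator ?Q x *\<^sub>R cmod (g x - k)))"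
     unfolding G_def set_lebesgue_integral_def
    proof (rule Bochner_Integration.integral_norm_bound_integral)
     show "integrable lebesgue (%x. indicator ?Q x *\<^sub>R ((g x - k) * of_real (e (\<phi> x))))"
      using eint[OF kint e] by (simp add: set_integrable_def)
     show "integrable lebesgue (%x. B e * (indicator ?Q x *\<^sub>R cmod (g x - k)))"
      using ki by (intro integrable_mult_right) (simp add: set_integrable_def)
     fix x
     show "cmod (indicator ?Q x *\<^sub>R ((g x - k) * of_real (e (\<phi> x)))) <= B e * (indicator ?Q x *\<^sub>R cmod (g x - k))"
      using B[OF e \<phi>Q, of x] by (auto simp: indicator_def norm_mult mult.commute[of "cmod _"] intro!: mult_right_mono)
    qed
    then show ?thesis by (simp add: set_lebesgue_integral_def)
   qed
   have "poly_proj \<delta> ?Q g x - k = Pr (%x. g x - k) x" using pp[OF g] fun_cong[OF shift, of x] by simp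
   then have "cmod (poly_proj \<delta> ?Q g x - k) <= (\<Sum>e\<in>E. cmod ((G (%x. g x - k) e / of_real (l ^ ?d)) * of_real (e (\<phi> x))))"
    unfolding Pr_def by (simp only: norm_sum)
   also have "... <= (\<Sum>e\<in>E. (B e * ?L / l ^ ?d) * B e)"
   proof (rule sum_mono)
    fix e assume e: "e \<in> E"
    have "cmod (G (%x. g x - k) e / of_real (l ^ ?d)) <= B e * ?L / l ^ ?d"
     using Gle[OF e] l by (simp add: norm_divide norm_power divide_right_mono)
    moreover have "cmod (complex_of_real (e (\<phi> x))) <= B e" using B[OF e \<phi>Q[OF x]] by simp
    ultimately show "cmod ((G (%x. g x - k) e / of_real (l ^ ?d)) * of_real (e (\<phi> x))) <= (B e * ?L / l ^ ?d) * B e"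
     unfolding norm_mult by (intro mult_mono) (auto intro: order_trans[OF norm_ge_zero])
   qed
   also have "... = (\<Sum>e\<in>E. B e * B e) * (?L / l ^ ?d)" by (simp add: sum_distrib_right mult_ac sum_divide_distrib)
   also have "... <= C * (?L / l ^ ?d)" unfolding C_def using L l by (intro mult_right_mono) auto
   finally show ?thesis by simp
  qed
  then show ?thesis using pp[OF g] Prpoly by simp
 qed
 show ?thesis using C main by blast
qed

section \<open>A discrete maximal function\<close>

definition cell_index :: "real^'n => int^'n" where
 "cell_index x = (\<chi> i. \<lfloor>x $ i\<rfloor>)"

definition lattice_point :: "int^'n => real^'n" where
 "lattice_point k = (\<chi> i. of_int (k $ i))"

lemma unit_cube_at_iff: "x \<in> unit_cube_at k \<longleftrightarrow> cell_index x = k"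
 by (auto simp: unit_cube_at_def cell_index_def vec_eq_iff floor_eq_iff)

lemma unit_cube_at_cell: "unit_cube_at (cell_index x) = cell 1 0 x"
 by (auto simp: unit_cube_at_iff cell_def cell_index_def vec_eq_iff)

lemma cell_index_lattice_point [simp]: "cell_index (lattice_point k) = k"
 by (simp add: cell_index_def lattice_point_def vec_eq_iff)

lemma unit_cube_at_sets [measurable]: "unit_cube_at (k :: int^'n) \<in> sets lebesgue"
 using unit_cube_at_cell[of "lattice_point k"] by simp

lemma emeasure_unit_cube_at: "emeasure lebesgue (unit_cube_at (k :: int^'n)) = 1"
 using unit_cube_at_cell[of "lattice_point k"] emeasure_cell[of 1 0 "lattice_point k"] by (simp del: emeasure_completion)

lemma unit_cube_at_dist:
 fixes x y :: "real^'n"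
 assumes "x \<in> unit_cube_at k" "y \<in> unit_cube_at k"
 shows "norm (x - y) <= real CARD('n)"
proof -
 have "cell_index x = k" using assms(1) by (simp add: unit_cube_at_iff)
 then have "unit_cube_at k = cell 1 0 x" using unit_cube_at_cell[of x] by (simp only:)
 then have "y \<in> cell 1 0 x" using assms(2) by (simp only:)
 then show ?thesis using cell_subset_cball[of 1 0 x] by (auto simp: dist_norm)
qed

lemma dist_lattice_point:
 fixes x :: "real^'n" shows "norm (x - lattice_point (cell_index x)) <= real CARD('n)"
 by (rule unit_cube_at_dist[of _ "cell_index x"]) (simp_all add: unit_cube_at_iff)

lemma countable_lattice: "countable (UNIV :: (int^'n) set)"
 by (rule countableI_type)

lemma sigma_finite_lattice: "sigma_finite_measure (count_space (UNIV :: (int^'n) set))"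
 by (rule sigma_finite_measure_count_space_countable[OF countable_lattice])

lemma nn_integral_count_space_single:
 "(\<integral>\<^sup>+k. (g k :: ennreal) * (if k = k0 then 1 else 0) \<partial>count_space UNIV) = g k0"
proof -
 have "(\<integral>\<^sup>+k. g k * (if k = k0 then 1 else 0) \<partial>count_space UNIV) = (\<integral>\<^sup>+k. g k0 * indicator {k0} k \<partial>count_space UNIV)"
  by (intro nn_integral_cong) (auto simp: indicator_def)
 also have "... = g k0 * emeasure (count_space UNIV) {k0}" by (rule nn_integral_cmult_indicator) simp
 finally show ?thesis by simp
qed

text \<open>This identity moves between functions on the lattice and functions that are constant on unit cubes.\<close>

lemma nn_integral_unit_cubes:
 fixes F :: "real^'n => ennreal" and g :: "int^'n => ennreal"
 assumes [measurable]: "F \<in> Meas"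
 shows "(NN x. F x * g (cell_index x)) =
   (\<integral>\<^sup>+k. g k * (NN x. F x * indicator (unit_cube_at k) x) \<partial>count_space UNIV)"
proof -
 have "(NN x. F x * g (cell_index x)) =
   (NN x. \<integral>\<^sup>+k. g k * (F x * indicator (unit_cube_at k) x) \<partial>count_space UNIV)"
 proof (rule nn_integral_cong)
  fix x :: "real^'n"
  have "(\<integral>\<^sup>+k. g k * (F x * indicator (unit_cube_at k) x) \<partial>count_space UNIV) =
    (\<integral>\<^sup>+k. (g k * F x) * (if k = cell_index x then 1 else 0) \<partial>count_space UNIV)"
   by (intro nn_integral_cong) (auto simp: indicator_def unit_cube_at_iff)
  also have "... = g (cell_index x) * F x" by (rule nn_integral_count_space_single)
  finally show "F x * g (cell_index x) = (\<integral>\<^sup>+k. g k * (F x * indicator (unit_cube_at k) x) \<partial>count_space UNIV)"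
   by (simp add: mult.commute)
 qed
 also have "... = (\<integral>\<^sup>+k. (NN x. g k * (F x * indicator (unit_cube_at k) x)) \<partial>count_space UNIV)"
  by (rule nn_integral_count_space_nn_integral[OF countable_lattice]) measurable
 also have "... = (\<integral>\<^sup>+k. g k * (NN x. F x * indicator (unit_cube_at k) x) \<partial>count_space UNIV)"
  by (intro nn_integral_cong nn_integral_cmult) measurable
 finally show ?thesis .
qed

lemma nn_integral_lattice:
 fixes g :: "int^'n => ennreal"
 shows "(NN x. g (cell_index x)) = (\<integral>\<^sup>+k. g k \<partial>count_space UNIV)"
 using nn_integral_unit_cubes[of "%_. 1" g] by (simp add: emeasure_unit_cube_at del: emeasure_completion)

lemma cell_index_measurable:
 "(%x. g (cell_index x)) \<in> borel_measurable (lebesgue :: (real^'n) measure)" for g :: "int^'n => 'b::topological_space"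
proof -
 have "cell_index -` A \<inter> space lebesgue \<in> sets lebesgue" for A :: "(int^'n) set"
 proof -
  have "cell_index -` A \<inter> space lebesgue = (\<Union>k\<in>A. unit_cube_at k)"
   by (auto simp: unit_cube_at_iff)
  also have "... \<in> sets lebesgue"
   by (rule sets.countable_UN') (auto intro: countable_subset[OF _ countable_lattice])
  finally show ?thesis .
 qed
 then have "cell_index \<in> (lebesgue :: (real^'n) measure) \<rightarrow>\<^sub>M count_space UNIV"
  by (intro measurableI) auto
 from measurable_compose[OF this, of g borel] show ?thesis by simp
qed

text \<open>Only radii at least \<open>1\<close> occur: averages over smaller balls are controlled by the finitely many neighbouring values.\<close>

definition lattice_maximal :: "(int^'n => real) => int^'n => ennreal" where
 "lattice_maximal a k = (SUP \<rho>\<in>{1..}. ennreal (1 / (unit_ball_vol (real CARD('n)) * \<rho> ^ CARD('n))) *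
   (NN y. ennreal (a (cell_index y)) * indicator (cball (lattice_point k) \<rho>) y))"

lemma lattice_maximal_upper:
 fixes a :: "int^'n => real"
 assumes "1 <= \<rho>"
 shows "(NN y. ennreal (a (cell_index y)) * indicator (cball (lattice_point k) \<rho>) y)
   <= ennreal (unit_ball_vol (real CARD('n)) * \<rho> ^ CARD('n)) * lattice_maximal a k"
proof -
 let ?I = "(NN y. ennreal (a (cell_index y)) * indicator (cball (lattice_point k) \<rho>) y)"
 define v where "v = unit_ball_vol (real CARD('n)) * \<rho> ^ CARD('n)"
 have v: "0 < v" unfolding v_def using assms by (intro mult_pos_pos) auto
 have "ennreal (1 / v) * ?I <= lattice_maximal a k"
  unfolding lattice_maximal_def v_def using assms by (intro SUP_upper) auto
 then have "ennreal v * (ennreal (1 / v) * ?I) <= ennreal v * lattice_maximal a k"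
  by (intro mult_left_mono) auto
 moreover have "ennreal v * ennreal (1 / v) = 1" using v by (subst ennreal_mult[symmetric]) auto
 ultimately show ?thesis unfolding v_def[symmetric] mult.assoc[symmetric] by (simp only: mult_1)
qed

lemma count_disjoint_le_1:
 fixes B :: "'k => 'x set"
 assumes "!!i j. i \<in> C ==> j \<in> C ==> i ~= j ==> B i \<inter> B j = {}"
 shows "(\<integral>\<^sup>+j. indicator (B j) x \<partial>count_space C) <= (1::ennreal)"
proof (cases "\<exists>j\<in>C. x \<in> B j")
 case True
 then obtain j0 where j0: "j0 \<in> C" "x \<in> B j0" by blast
 have "(\<integral>\<^sup>+j. indicator (B j) x \<partial>count_space C) = (\<integral>\<^sup>+j. indicator {j0} j \<partial>count_space C)"
 proof (rule nn_integral_cong)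
  fix j assume "j \<in> space (count_space C)"
  then have "j \<in> C" by simp
  then have "x \<in> B j \<longleftrightarrow> j = j0" using assms[of j j0] j0 by auto
  then show "(indicator (B j) x :: ennreal) = indicator {j0} j" by (simp add: indicator_def)
 qed
 also have "... = emeasure (count_space C) {j0}" using j0 by (intro nn_integral_indicator) auto
 also have "... = 1" using j0 by simp
 finally show ?thesis by simp
next
 case False
 then have "(\<integral>\<^sup>+j. indicator (B j) x \<partial>count_space C) = (\<integral>\<^sup>+j. (0::ennreal) \<partial>count_space C)"
  by (intro nn_integral_cong) auto
 then show ?thesis by simp
qed

text \<open>Vitali's covering lemma applied to balls about lattice points. Each selected ball has measure at most \<open>2/t\<close> times the
 integral of the part of \<open>a\<close> above \<open>t/2\<close>. Enlarging the balls by \<open>5\<close> and by the diameter of a unit cube covers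
 all unit cubes whose index is in the level set, and the measure of their union is the number of indices.\<close>

lemma lattice_maximal_weak_type:
 fixes a :: "int^'n => real"
 assumes a: "!!k. 0 <= a k" and t: "0 < t"
 shows "emeasure (count_space UNIV) {k. ennreal t < lattice_maximal a k} <=
   ennreal (2 * (5 + real CARD('n)) ^ CARD('n) / t) *
    (NN x. ennreal (a (cell_index x)) * indicator {x. t / 2 < a (cell_index x)} x)"
proof -
 let ?d = "CARD('n)"
 define w where "w = unit_ball_vol (real ?d)"
 have w: "0 < w" unfolding w_def by simp
 define F where "F x = ennreal (a (cell_index x)) * indicator {x. t / 2 < a (cell_index x)} x" for x
 have Fm[measurable]: "F \<in> Meas"
 proof -
  have "F = (%x. (%k. if t / 2 < a k then ennreal (a k) else 0) (cell_index x))"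
   by (auto simp: F_def fun_eq_iff indicator_def)
  then show ?thesis using cell_index_measurable[of "%k. if t / 2 < a k then ennreal (a k) else 0"] by (simp only:)
 qed
 define W where "W = (NN x. F x)"
 define E where "E = {k. ennreal t < lattice_maximal a k}"
 show ?thesis
 proof (cases "W = \<infinity>")
  case True
  then show ?thesis unfolding W_def F_def using t by (simp add: ennreal_mult_top)
 next
  case False
  then obtain W' where W': "W = ennreal W'" "0 <= W'" by (cases W) auto
  have "\<exists>\<rho>\<ge>1. ennreal (w * \<rho> ^ ?d) <= ennreal (2 / t) * (NN y. F y * indicator (cball (lattice_point k) \<rho>) y)"
   if k: "k \<in> E" for k
  proof -
   obtain \<rho> where \<rho>: "1 <= \<rho>" and lt: "ennreal t < ennreal (1 / (w * \<rho> ^ ?d)) *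
     (NN y. ennreal (a (cell_index y)) * indicator (cball (lattice_point k) \<rho>) y)"
    using k unfolding E_def lattice_maximal_def mem_Collect_eq less_SUP_iff w_def by auto
   let ?S = "cball (lattice_point k) \<rho>"
   have v: "0 < w * \<rho> ^ ?d" using w \<rho> by (intro mult_pos_pos) auto
   have le0: "ennreal (w * \<rho> ^ ?d) * ennreal t <= ennreal (w * \<rho> ^ ?d) * (ennreal (1 / (w * \<rho> ^ ?d)) *
     (NN y. ennreal (a (cell_index y)) * indicator ?S y))"
    using lt by (intro mult_left_mono) auto
   have ge: "ennreal (t * (w * \<rho> ^ ?d)) <= (NN y. enorm (of_real (a (cell_index y))) * indicator ?S y)"
   proof -
    have one: "ennreal (w * \<rho> ^ ?d) * ennreal (1 / (w * \<rho> ^ ?d)) = 1"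
    proof -
     have "ennreal (w * \<rho> ^ ?d) * ennreal (1 / (w * \<rho> ^ ?d)) = ennreal ((w * \<rho> ^ ?d) * (1 / (w * \<rho> ^ ?d)))"
      by (rule ennreal_mult[symmetric]) (use v in auto)
     also have "(w * \<rho> ^ ?d) * (1 / (w * \<rho> ^ ?d)) = 1" using v by (metis less_numeral_extra(3) nonzero_mult_div_cancel_left times_divide_eq_right mult.right_neutral)
     finally show ?thesis by simp
    qed
    have "ennreal (t * (w * \<rho> ^ ?d)) = ennreal t * ennreal (w * \<rho> ^ ?d)" by (rule ennreal_mult) (use v t in auto)
    also have "... = ennreal (w * \<rho> ^ ?d) * ennreal t" by (rule mult.commute)
    also note le0
    also have "ennreal (w * \<rho> ^ ?d) * (ennreal (1 / (w * \<rho> ^ ?d)) * (NN y. ennreal (a (cell_index y)) * indicator ?S y))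
      = (NN y. ennreal (a (cell_index y)) * indicator ?S y)"
     unfolding mult.assoc[symmetric] one by (rule mult_1)
    finally show ?thesis using a by simp
   qed
   have "ennreal (w * \<rho> ^ ?d) <= ennreal (2 / t) *
     (NN y. enorm (of_real (a (cell_index y))) * indicator {y. t / 2 < cmod (of_real (a (cell_index y)))} y * indicator ?S y)"
   proof (rule emeasure_le_twice_large_part[OF _ _ _ _ t ge])
    show "(%y. complex_of_real (a (cell_index y))) \<in> Meas" by (rule cell_index_measurable)
    show "emeasure lebesgue ?S = ennreal (w * \<rho> ^ ?d)" using \<rho> unfolding w_def by (intro emeasure_lebesgue_cball) auto
   qed (use v in auto)
   also have "(%y. enorm (of_real (a (cell_index y))) * indicator {y. t / 2 < cmod (of_real (a (cell_index y)))} y * indicator ?S y) = (%y. F y * indicator ?S y)"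
    using a by (simp add: F_def)
   finally show ?thesis using \<rho> by blast
  qed
  then have "\<forall>k\<in>E. \<exists>\<rho>. \<rho> \<ge> 1 \<and> ennreal (w * \<rho> ^ ?d) <= ennreal (2 / t) * (NN y. F y * indicator (cball (lattice_point k) \<rho>) y)" by blast
  from bchoice[OF this] obtain r where r0: "\<forall>k\<in>E. r k \<ge> 1 \<and> ennreal (w * r k ^ ?d) <= ennreal (2 / t) * (NN y. F y * indicator (cball (lattice_point k) (r k)) y)"
   by (elim exE, intro that)
  have r1: "1 <= r k" and rle: "ennreal (w * r k ^ ?d) <= ennreal (2 / t) * (NN y. F y * indicator (cball (lattice_point k) (r k)) y)" if "k \<in> E" for k
   using r0 that by auto
  have rB: "0 < r k \<and> r k <= 2 / t * W' / w" if k: "k \<in> E" for k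
  proof -
   have "ennreal (w * r k ^ ?d) <= ennreal (2 / t) * W"
    unfolding W_def by (rule order_trans[OF rle[OF k]]) (intro mult_left_mono nn_integral_mono, auto simp: indicator_def)
   also have "... = ennreal (2 / t * W')" unfolding W'(1) by (rule ennreal_mult[symmetric]) (use t W' in auto)
   finally have "ennreal (w * r k ^ ?d) <= ennreal (2 / t * W')" .
   then have "w * r k ^ ?d <= 2 / t * W'" using t W' by (subst (asm) ennreal_le_iff) auto
   moreover have "r k <= r k ^ ?d" using r1[OF k] by (intro self_le_power) auto
   ultimately have "w * r k <= 2 / t * W'" using w by (smt (verit) mult_left_mono)
   then have "r k <= 2 / t * W' / w" unfolding pos_le_divide_eq[OF w] by (simp only: mult.commute)
   then show ?thesis using r1[OF k] by (intro conjI) linarith+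
  qed
  obtain C where C: "countable C" "C \<subseteq> E"
   and disj: "pairwise (%i j. disjnt (cball (lattice_point i) (r i)) (cball (lattice_point j) (r j))) C"
   and cov: "lattice_point ` E \<subseteq> (\<Union>i\<in>C. cball (lattice_point i) (5 * r i))"
  proof (rule Vitali_covering_lemma_cballs[where S="lattice_point ` E" and K=E and a=lattice_point and r=r and B="2 / t * W' / w"])
   show "lattice_point ` E \<subseteq> (\<Union>i\<in>E. cball (lattice_point i) (r i))" using rB by force
   show "0 < r i \<and> r i <= 2 / t * W' / w" if "i \<in> E" for i using rB[OF that] .
  qed (rule that)
  have cover: "indicator E (cell_index x) <= (\<integral>\<^sup>+j. indicator (cball (lattice_point j) ((5 + real ?d) * r j)) x \<partial>count_space C)" for x :: "real^'n"
  proof (cases "cell_index x \<in> E")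
   case True
   then obtain j where j: "j \<in> C" "dist (lattice_point j) (lattice_point (cell_index x)) <= 5 * r j" using cov by auto
   have "dist (lattice_point j) x <= dist (lattice_point j) (lattice_point (cell_index x)) + dist (lattice_point (cell_index x)) x"
    by (rule dist_triangle)
   also have "dist (lattice_point (cell_index x)) x <= real ?d" using dist_lattice_point[of x] by (simp add: dist_norm norm_minus_commute)
   also have "real ?d <= real ?d * r j" using r1[of j] j C by auto
   finally have xj: "x \<in> cball (lattice_point j) ((5 + real ?d) * r j)" using j by (simp add: distrib_right)
   have "1 = (\<integral>\<^sup>+i. indicator {j} i \<partial>count_space C)" using j by simp
   also have "... <= (\<integral>\<^sup>+j. indicator (cball (lattice_point j) ((5 + real ?d) * r j)) x \<partial>count_space C)"
    by (intro nn_integral_mono) (use xj in \<open>auto simp: indicator_def\<close>)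
   finally show ?thesis using True by simp
  qed simp
  have "emeasure (count_space UNIV) E = (\<integral>\<^sup>+k. indicator E k \<partial>count_space UNIV)" by simp
  also have "... = (NN x. indicator E (cell_index x))" by (rule nn_integral_lattice[symmetric])
  also have "... <= (NN x. \<integral>\<^sup>+j. indicator (cball (lattice_point j) ((5 + real ?d) * r j)) x \<partial>count_space C)"
   by (intro nn_integral_mono cover)
  also have "... = (\<integral>\<^sup>+j. (NN x. indicator (cball (lattice_point j) ((5 + real ?d) * r j)) x) \<partial>count_space C)"
   by (rule nn_integral_count_space_nn_integral[OF C(1)]) measurable
  also have "... <= (\<integral>\<^sup>+j. ennreal ((5 + real ?d) ^ ?d) * (ennreal (2 / t) * (NN y. F y * indicator (cball (lattice_point j) (r j)) y)) \<partial>count_space C)"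
  proof (rule nn_integral_mono)
   fix j assume "j \<in> space (count_space C)"
   then have j: "j \<in> E" using C by auto
   have "(NN x. indicator (cball (lattice_point j) ((5 + real ?d) * r j)) x) = emeasure lebesgue (cball (lattice_point j) ((5 + real ?d) * r j))"
    by (rule nn_integral_indicator) measurable
   also have "... = ennreal (w * ((5 + real ?d) * r j) ^ ?d)" using r1[OF j] unfolding w_def by (intro emeasure_lebesgue_cball) auto
   also have "w * ((5 + real ?d) * r j) ^ ?d = (5 + real ?d) ^ ?d * (w * r j ^ ?d)" by (simp add: power_mult_distrib)
   also have "ennreal ... = ennreal ((5 + real ?d) ^ ?d) * ennreal (w * r j ^ ?d)" using w r1[OF j] by (intro ennreal_mult) auto
   also have "... <= ennreal ((5 + real ?d) ^ ?d) * (ennreal (2 / t) * (NN y. F y * indicator (cball (lattice_point j) (r j)) y))"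
    by (intro mult_left_mono rle[OF j]) auto
   finally show "(NN x. indicator (cball (lattice_point j) ((5 + real ?d) * r j)) x) <=
     ennreal ((5 + real ?d) ^ ?d) * (ennreal (2 / t) * (NN y. F y * indicator (cball (lattice_point j) (r j)) y))" .
  qed
  also have "... = ennreal ((5 + real ?d) ^ ?d) * (ennreal (2 / t) * (\<integral>\<^sup>+j. (NN y. F y * indicator (cball (lattice_point j) (r j)) y) \<partial>count_space C))"
   by (simp add: nn_integral_cmult)
  also have "(\<integral>\<^sup>+j. (NN y. F y * indicator (cball (lattice_point j) (r j)) y) \<partial>count_space C) =
    (NN y. \<integral>\<^sup>+j. F y * indicator (cball (lattice_point j) (r j)) y \<partial>count_space C)"
   by (rule nn_integral_count_space_nn_integral[OF C(1), symmetric]) measurable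
  also have "... <= W"
   unfolding W_def
  proof (rule nn_integral_mono)
   fix y
   have "(\<integral>\<^sup>+j. F y * indicator (cball (lattice_point j) (r j)) y \<partial>count_space C) = F y * (\<integral>\<^sup>+j. indicator (cball (lattice_point j) (r j)) y \<partial>count_space C)"
    by (rule nn_integral_cmult) simp
   also have "... <= F y * 1"
    using disj by (intro mult_left_mono count_disjoint_le_1) (auto simp: pairwise_def disjnt_def)
   finally show "(\<integral>\<^sup>+j. F y * indicator (cball (lattice_point j) (r j)) y \<partial>count_space C) <= F y" by simp
  qed
  finally have "emeasure (count_space UNIV) E <= ennreal ((5 + real ?d) ^ ?d) * (ennreal (2 / t) * W)" by (simp add: mult_left_mono)
  also have "... = ennreal (2 * (5 + real ?d) ^ ?d / t) * W"
  proof -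
   have "ennreal ((5 + real ?d) ^ ?d) * ennreal (2 / t) = ennreal ((5 + real ?d) ^ ?d * (2 / t))"
    by (rule ennreal_mult[symmetric]) (use t in auto)
   also have "(5 + real ?d) ^ ?d * (2 / t) = 2 * (5 + real ?d) ^ ?d / t" by simp
   finally show ?thesis by (simp only: mult.assoc[symmetric])
  qed
  finally show ?thesis unfolding E_def W_def F_def .
 qed
qed

text \<open>Interpolation integrates real-valued functions, so finiteness of the maximal function comes first: a value \<open>\<infinity>\<close>
 would contradict the weak type bound at a single high level.\<close>

theorem lattice_maximal_strong_type:
 assumes q: "1 < q"
 shows "\<exists>C>0. \<forall>a :: int^'n => real. (\<forall>k. 0 <= a k) --> (\<integral>\<^sup>+k. ennreal (a k powr q) \<partial>count_space UNIV) < \<infinity> -->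
   (\<integral>\<^sup>+k. enn_powr (lattice_maximal a k) q \<partial>count_space UNIV) <= ennreal C * (\<integral>\<^sup>+k. ennreal (a k powr q) \<partial>count_space UNIV)"
proof -
 let ?d = "CARD('n)"
 define c where "c = 2 * (5 + real ?d) ^ ?d"
 have c: "0 < c" unfolding c_def by (intro mult_pos_pos zero_less_power) auto
 define C where "C = q * c * (2 powr (q - 1) / (q - 1)) + 1"
 have C: "0 < C" unfolding C_def using q c by (intro add_nonneg_pos) auto
 have "(\<integral>\<^sup>+k. enn_powr (lattice_maximal a k) q \<partial>count_space UNIV) <= ennreal C * (\<integral>\<^sup>+k. ennreal (a k powr q) \<partial>count_space UNIV)"
  if a: "!!k. 0 <= a k" and fin: "(\<integral>\<^sup>+k. ennreal (a k powr q) \<partial>count_space UNIV) < \<infinity>" for a :: "int^'n => real"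
 proof -
  define X where "X = (\<integral>\<^sup>+k. ennreal (a k powr q) \<partial>count_space UNIV)"
  have XF: "(NN x. ennreal (a (cell_index x) powr q)) = X"
   unfolding X_def using nn_integral_lattice[of "%k. ennreal (a k powr q)"] .
  have am[measurable]: "(%x. a (cell_index x)) \<in> borel_measurable (lebesgue :: (real^'n) measure)" by (rule cell_index_measurable)
  obtain X' where X': "X = ennreal X'" "0 <= X'" using fin unfolding X_def[symmetric] by (cases X) auto
  have finG: "lattice_maximal a k ~= \<infinity>" for k
  proof
   assume inf: "lattice_maximal a k = \<infinity>"
   \<comment> \<open>Chosen so large that the weak type bound at level \<open>t\<close> is less than one lattice point.\<close>
   define t where "t = (c * 2 powr (q - 1) * X' + 1) powr (1 / q)"
   have pos: "0 < c * 2 powr (q - 1) * X' + 1" using c X' by (intro add_nonneg_pos) auto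
   have t: "0 < t" unfolding t_def using pos by simp
   have tq: "t powr q = c * 2 powr (q - 1) * X' + 1" unfolding t_def using pos q by (simp add: powr_powr)
   have "1 = emeasure (count_space UNIV) {k}" by simp
   also have "... <= emeasure (count_space UNIV) {k. ennreal t < lattice_maximal a k}"
    by (intro emeasure_mono) (use inf in auto)
   also have "... <= ennreal (c / t) * (NN x. ennreal (a (cell_index x)) * indicator {x. t / 2 < a (cell_index x)} (x :: real^'n))"
    using lattice_maximal_weak_type[OF a t] unfolding c_def .
   also have "... <= ennreal (c / t) * (NN x. ennreal ((2 / t) powr (q - 1)) * ennreal (a (cell_index (x :: real^'n)) powr q))"
   proof (intro mult_left_mono nn_integral_mono)
    fix x :: "real^'n"
    show "ennreal (a (cell_index x)) * indicator {x. t / 2 < a (cell_index x)} x <= ennreal ((2 / t) powr (q - 1)) * ennreal (a (cell_index x) powr q)"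
    proof (cases "t / 2 < a (cell_index x)")
     case True
     define b where "b = a (cell_index x)"
     have b: "t / 2 < b" "0 < b" using True t by (auto simp: b_def)
     have "1 <= 2 / t * b" using b t by (simp add: field_simps)
     then have "1 <= (2 / t * b) powr (q - 1)" using q by (intro ge_one_powr_ge_zero) auto
     then have "b * 1 <= b * (2 / t * b) powr (q - 1)" using b by (intro mult_left_mono) auto
     also have "(2 / t * b) powr (q - 1) = (2 / t) powr (q - 1) * b powr (q - 1)" using b t by (simp only: powr_mult)
     also have "b * ((2 / t) powr (q - 1) * b powr (q - 1)) = (2 / t) powr (q - 1) * (b powr 1 * b powr (q - 1))" using b by simp
     also have "... = (2 / t) powr (q - 1) * b powr q" using powr_add[of b 1 "q - 1", symmetric] by simp
     finally show ?thesis using True t b by (simp add: b_def[symmetric] ennreal_leI flip: ennreal_mult)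
    qed simp
   qed auto
   also have "... = ennreal (c / t) * (ennreal ((2 / t) powr (q - 1)) * X)"
    by (subst nn_integral_cmult) (auto simp: XF)
   also have "... = ennreal (c / t * (2 / t) powr (q - 1) * X')"
    using X' c t by (simp add: mult.assoc flip: ennreal_mult)
   finally have "1 <= c / t * (2 / t) powr (q - 1) * X'" by simp
   also have "... = c * 2 powr (q - 1) * X' / t powr q"
   proof -
    have "t * t powr (q - 1) = t powr q" using t powr_add[of t 1 "q - 1"] by simp
    then have "c / t * (2 / t) powr (q - 1) = c * 2 powr (q - 1) / t powr q" using t by (simp add: powr_divide)
    then show ?thesis by simp
   qed
   also have "... < 1" unfolding tq using pos by (simp add: pos_divide_less_eq)
   finally show False by simp
  qed
  define H where "H k = enn2real (lattice_maximal a k)" for k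
  have "(\<integral>\<^sup>+k. ennreal (H k powr q) \<partial>count_space UNIV) <=
    ennreal (q * c * (2 powr (q - 1) / (q - 1)) + q * 0 / (2 - q)) * (NN x. ennreal (a (cell_index (x :: real^'n)) powr q))"
  proof (rule weak_type_interpolation[OF sigma_finite_lattice sigma_finite_lebesgue])
   fix t :: real assume t: "0 < t"
   have "emeasure (count_space UNIV) {k \<in> space (count_space UNIV). t < H k} <= emeasure (count_space UNIV) {k. ennreal t < lattice_maximal a k}"
   proof (intro emeasure_mono subsetI)
    fix k assume "k \<in> {k \<in> space (count_space UNIV). t < H k}"
    then have tH: "t < H k" by simp
    have "ennreal (H k) = lattice_maximal a k" using finG[of k] by (simp add: H_def less_top)
    moreover have "ennreal t < ennreal (H k)" using tH t by (simp add: ennreal_less_iff)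
    ultimately show "k \<in> {k. ennreal t < lattice_maximal a k}" by simp
   qed simp
   also have "... <= ennreal (c / t) * (NN x. ennreal (a (cell_index x)) * indicator {x. t / 2 < a (cell_index x)} (x :: real^'n))"
    using lattice_maximal_weak_type[OF a t] unfolding c_def .
   finally show "emeasure (count_space UNIV) {k \<in> space (count_space UNIV). t < H k} <=
    ennreal (c / t) * (NN x. ennreal (a (cell_index x)) * indicator {x. t / 2 < a (cell_index x)} (x :: real^'n)) +
    ennreal (0 / t\<^sup>2) * (NN x. ennreal ((a (cell_index x))\<^sup>2) * indicator {x. a (cell_index x) <= t} (x :: real^'n))"
    by simp
  qed (use q c a in \<open>auto simp: H_def\<close>)
  also have "... <= ennreal C * X"
   unfolding XF C_def by (intro mult_right_mono ennreal_leI) auto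
  also have "(\<integral>\<^sup>+k. ennreal (H k powr q) \<partial>count_space UNIV) = (\<integral>\<^sup>+k. enn_powr (lattice_maximal a k) q \<partial>count_space UNIV)"
   using finG by (intro nn_integral_cong) (auto simp: H_def enn_powr_def)
  finally show ?thesis unfolding X_def .
 qed
 then show ?thesis using C by blast
qed

text \<open>For large radii the ball is contained in a comparable ball about the lattice point. For small radii every value of
 \<open>a\<close> met by the ball is at most a constant times the maximal function.\<close>

lemma lattice_average_le:
 "\<exists>C>0. \<forall>(a :: int^'n => real) x \<rho>. (\<forall>k. 0 <= a k) --> 0 < \<rho> -->
   (NN y. ennreal (a (cell_index y)) * indicator (cball x \<rho>) y) <= ennreal (C * \<rho> ^ CARD('n)) * lattice_maximal a (cell_index x)"
proof -
 let ?d = "CARD('n)"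
 define w where "w = unit_ball_vol (real ?d)"
 have w: "0 < w" unfolding w_def by simp
 define C where "C = w * (1 + real ?d) ^ ?d + w * (w * (1 + 2 * real ?d) ^ ?d)"
 have C: "0 < C" unfolding C_def using w by (intro add_pos_pos mult_pos_pos zero_less_power) auto
 have "(NN y. ennreal (a (cell_index y)) * indicator (cball x \<rho>) y) <= ennreal (C * \<rho> ^ ?d) * lattice_maximal a (cell_index x)"
  if a: "!!k. 0 <= a k" and \<rho>: "0 < \<rho>" for a :: "int^'n => real" and x \<rho>
 proof -
  let ?p = "lattice_point (cell_index x)" and ?G = "lattice_maximal a (cell_index x)"
  have dx: "norm (x - ?p) <= real ?d" by (rule dist_lattice_point)
  show ?thesis
  proof (cases "1 <= \<rho>")
   case True
   have sub: "cball x \<rho> \<subseteq> cball ?p ((1 + real ?d) * \<rho>)"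
   proof
    fix y assume "y \<in> cball x \<rho>"
    then have "dist ?p y <= real ?d + \<rho>" using dx dist_triangle[of ?p y x] by (simp add: dist_norm norm_minus_commute)
    also have "... <= (1 + real ?d) * \<rho>" using True by (simp add: distrib_right)
    finally show "y \<in> cball ?p ((1 + real ?d) * \<rho>)" by simp
   qed
   have "(NN y. ennreal (a (cell_index y)) * indicator (cball x \<rho>) y) <=
     (NN y. ennreal (a (cell_index y)) * indicator (cball ?p ((1 + real ?d) * \<rho>)) y)"
    using sub by (intro nn_integral_mono mult_left_mono) (auto simp: indicator_def)
   also have "... <= ennreal (w * ((1 + real ?d) * \<rho>) ^ ?d) * ?G"
    unfolding w_def using True by (intro lattice_maximal_upper) (auto simp: distrib_right intro: add_increasing2)
   also have "... <= ennreal (C * \<rho> ^ ?d) * ?G"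
   proof (intro mult_right_mono ennreal_leI)
    have "w * ((1 + real ?d) * \<rho>) ^ ?d = w * (1 + real ?d) ^ ?d * \<rho> ^ ?d" by (simp add: power_mult_distrib)
    also have "... <= C * \<rho> ^ ?d" unfolding C_def using w \<rho> by (intro mult_right_mono) auto
    finally show "w * ((1 + real ?d) * \<rho>) ^ ?d <= C * \<rho> ^ ?d" .
   qed simp
   finally show ?thesis .
  next
   case False
   let ?A = "ennreal (w * (1 + 2 * real ?d) ^ ?d) * ?G"
   have le: "ennreal (a (cell_index y)) <= ?A" if y: "y \<in> cball x \<rho>" for y
   proof -
    have sub: "unit_cube_at (cell_index y) \<subseteq> cball ?p (1 + 2 * real ?d)"
    proof
     fix z assume z: "z \<in> unit_cube_at (cell_index y)"
     have "norm (z - y) <= real ?d" by (rule unit_cube_at_dist[OF z]) (simp add: unit_cube_at_iff)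
     moreover have "norm (y - x) <= 1" using y False by (simp add: dist_norm norm_minus_commute)
     moreover have "norm (z - ?p) <= norm (z - y) + norm (y - x) + norm (x - ?p)"
      using norm_triangle_ineq[of "z - y" "y - x"] norm_triangle_ineq[of "z - x" "x - ?p"] by simp
     ultimately show "z \<in> cball ?p (1 + 2 * real ?d)" using dx by (simp add: dist_norm norm_minus_commute)
    qed
    have "ennreal (a (cell_index y)) = (NN z. ennreal (a (cell_index y)) * indicator (unit_cube_at (cell_index y)) z)"
     by (simp add: nn_integral_cmult_indicator emeasure_unit_cube_at del: emeasure_completion)
    also have "... <= (NN z. ennreal (a (cell_index z)) * indicator (cball ?p (1 + 2 * real ?d)) z)"
    proof (rule nn_integral_mono)
     fix z
     show "ennreal (a (cell_index y)) * indicator (unit_cube_at (cell_index y)) z <= ennreal (a (cell_index z)) * indicator (cball ?p (1 + 2 * real ?d)) z"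
     proof (cases "z \<in> unit_cube_at (cell_index y)")
      case True
      then have "cell_index z = cell_index y" "z \<in> cball ?p (1 + 2 * real ?d)" using sub by (auto simp: unit_cube_at_iff)
      then show ?thesis using True by simp
     qed simp
    qed
    also have "... <= ?A" unfolding w_def by (intro lattice_maximal_upper) auto
    finally show ?thesis .
   qed
   have "(NN y. ennreal (a (cell_index y)) * indicator (cball x \<rho>) y) <= (NN y. ?A * indicator (cball x \<rho>) y)"
   proof (rule nn_integral_mono)
    fix y
    show "ennreal (a (cell_index y)) * indicator (cball x \<rho>) y <= ?A * indicator (cball x \<rho>) y"
     using le[of y] by (cases "y \<in> cball x \<rho>") auto
   qed
   also have "... = ?A * ennreal (w * \<rho> ^ ?d)"
    using \<rho> emeasure_lebesgue_cball[of \<rho> x] by (simp add: nn_integral_cmult_indicator w_def del: emeasure_completion)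
   also have "... = ennreal (w * (1 + 2 * real ?d) ^ ?d * (w * \<rho> ^ ?d)) * ?G"
   proof -
    have "ennreal (w * (1 + 2 * real ?d) ^ ?d * (w * \<rho> ^ ?d)) = ennreal (w * (1 + 2 * real ?d) ^ ?d) * ennreal (w * \<rho> ^ ?d)"
     using w \<rho> by (intro ennreal_mult) auto
    then show ?thesis by (simp only: mult_ac)
   qed
   also have "... <= ennreal (C * \<rho> ^ ?d) * ?G"
   proof (intro mult_right_mono ennreal_leI)
    have "w * (1 + 2 * real ?d) ^ ?d * (w * \<rho> ^ ?d) = w * (w * (1 + 2 * real ?d) ^ ?d) * \<rho> ^ ?d" by simp
    also have "... <= C * \<rho> ^ ?d" unfolding C_def using w \<rho> by (intro mult_right_mono) auto
    finally show "w * (1 + 2 * real ?d) ^ ?d * (w * \<rho> ^ ?d) <= C * \<rho> ^ ?d" .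
   qed simp
   finally show ?thesis .
  qed
 qed
 then show ?thesis using C by blast
qed

section \<open>Local averages of functions in amalgam spaces\<close>

lemma enn_powr_cmult: "0 < c ==> 0 < a ==> enn_powr (ennreal c * x) a = ennreal (c powr a) * enn_powr x a"
proof (cases "x = \<infinity>")
 case True
 assume "0 < c" "0 < a"
 then show ?thesis using True by (simp add: ennreal_mult_top enn_powr_def)
next
 case False
 assume "0 < c" "0 < a"
 then show ?thesis using False by (simp add: enn_powr_mult enn_powr_ennreal)
qed

lemma count_space_term_le: "(g k :: ennreal) <= (\<integral>\<^sup>+k. g k \<partial>count_space UNIV)"
proof -
 have "g k = (\<integral>\<^sup>+j. g k * indicator {k} j \<partial>count_space UNIV)"
  by (simp add: nn_integral_cmult_indicator)
 also have "... <= (\<integral>\<^sup>+j. g j \<partial>count_space UNIV)" by (intro nn_integral_mono) (auto simp: indicator_def)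
 finally show ?thesis .
qed

text \<open>The norm of \<open>\<ell>\<^bsup>p'\<^esup>\<close> dominates every entry, so the amalgam space \<open>(L\<^sup>\<infinity>, \<ell>\<^bsup>p'\<^esup>)\<close> consists of bounded functions.\<close>

lemma lp_term_le:
 assumes "p' = \<infinity> \<or> (\<exists>P>0. p' = ennreal P)"
 shows "g k <= Lp_norm (count_space UNIV) p' g"
 using assms
proof (elim disjE exE conjE)
 assume p: "p' = \<infinity>"
 have "AE k in count_space UNIV. g k <= esssup (count_space UNIV) g" by (rule esssup_AE)
 then show ?thesis unfolding p Lp_norm_def by (simp add: AE_count_space)
next
 fix P :: real assume P: "0 < P" "p' = ennreal P"
 have "enn_powr (g k) P <= (\<integral>\<^sup>+k. enn_powr (g k) P \<partial>count_space UNIV)" by (rule count_space_term_le)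
 then show ?thesis unfolding P(2) Lp_norm_ennreal[OF P(1)] using P(1) by (simp add: enn_powr_le_iff)
qed

lemma Lp_norm_mono:
 assumes "0 < p" "!!x. F x <= G x"
 shows "Lp_norm M (ennreal p) F <= Lp_norm M (ennreal p) G"
 unfolding Lp_norm_ennreal[OF assms(1)]
 by (intro enn_powr_mono nn_integral_mono) (use assms in \<open>auto intro: less_imp_le\<close>)

definition cube_sup :: "(real^'n => complex) => int^'n => ennreal" where
 "cube_sup f k = esssup lebesgue (%x. enorm (f x) * indicator (unit_cube_at k) x)"

lemma amalgam_norm_infinity:
 fixes f :: "real^'n => complex"
 shows "amalgam_norm \<infinity> p' (%x. enorm (f x)) = Lp_norm (count_space UNIV) p' (cube_sup f)"
 unfolding amalgam_norm_def cube_sup_def[abs_def] Lp_norm_def[of lebesgue] by simp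

lemma cube_sup_AE:
 fixes f :: "real^'n => complex"
 shows "AE x in lebesgue. enorm (f x) <= cube_sup f (cell_index x)"
proof -
 have "AE x in lebesgue. \<forall>k\<in>(UNIV :: (int^'n) set). enorm (f x) * indicator (unit_cube_at k) x <= cube_sup f k"
  unfolding cube_sup_def by (subst AE_ball_countable[OF countable_lattice]) (intro ballI esssup_AE)
 then show ?thesis
 proof (rule AE_mp, intro AE_I2 impI)
  fix x :: "real^'n" assume "\<forall>k\<in>(UNIV :: (int^'n) set). enorm (f x) * indicator (unit_cube_at k) x <= cube_sup f k"
  then have "enorm (f x) * indicator (unit_cube_at (cell_index x)) x <= cube_sup f (cell_index x)" by simp
  then show "enorm (f x) <= cube_sup f (cell_index x)" by (simp add: unit_cube_at_iff indicator_def)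
 qed
qed

lemma amalgam_bounded:
 fixes f :: "real^'n => complex"
 assumes p: "p' = \<infinity> \<or> (\<exists>P>0. p' = ennreal P)" and f: "f \<in> amalgam \<infinity> p'"
 shows "\<exists>M. AE x in lebesgue. cmod (f x) <= M"
proof -
 let ?X = "amalgam_norm \<infinity> p' (%x. enorm (f x))"
 obtain M where M: "?X = ennreal M" "0 <= M" using f unfolding amalgam_def by (cases ?X) auto
 have le: "cube_sup f k <= ennreal M" for k unfolding M(1)[symmetric] amalgam_norm_infinity by (rule lp_term_le[OF p])
 have "AE x in lebesgue. cmod (f x) <= M"
  using cube_sup_AE[of f]
 proof (rule AE_mp, intro AE_I2 impI)
  fix x assume "enorm (f x) <= cube_sup f (cell_index x)"
  also have "... <= ennreal M" by (rule le)
  finally show "cmod (f x) <= M" using M by simp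
 qed
 then show ?thesis by blast
qed

lemma amalgam_Lp:
 fixes f :: "real^'n => complex"
 assumes P: "0 < P" and f: "f \<in> amalgam \<infinity> (ennreal P)"
 shows "f \<in> Lp (ennreal P)"
proof -
 have fm: "f \<in> Meas" using f unfolding amalgam_def by blast
 have "amalgam_norm \<infinity> (ennreal P) (%x. enorm (f x)) < \<infinity>" using f unfolding amalgam_def by blast
 then have fin: "(\<integral>\<^sup>+k. enn_powr (cube_sup f k) P \<partial>count_space UNIV) < \<infinity>"
  unfolding amalgam_norm_infinity Lp_norm_ennreal[OF P] enn_powr_finite_iff .
 have "Ipow P f <= (NN x. enn_powr (cube_sup f (cell_index x)) P)"
  unfolding Ipow_def
 proof (rule nn_integral_mono_AE)
  show "AE x in lebesgue. ennreal (cmod (f x) powr P) <= enn_powr (cube_sup f (cell_index x)) P"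
   using cube_sup_AE[of f]
  proof (rule AE_mp, intro AE_I2 impI)
   fix x assume "enorm (f x) <= cube_sup f (cell_index x)"
   then have "enn_powr (enorm (f x)) P <= enn_powr (cube_sup f (cell_index x)) P" using P by (intro enn_powr_mono) auto
   then show "ennreal (cmod (f x) powr P) <= enn_powr (cube_sup f (cell_index x)) P" by (simp add: enn_powr_ennreal)
  qed
 qed
 also have "... = (\<integral>\<^sup>+k. enn_powr (cube_sup f k) P \<partial>count_space UNIV)" by (rule nn_integral_lattice)
 finally show ?thesis using fin fm P by (simp add: mem_Lp_iff)
qed

lemma local_averages_infinity:
 fixes s :: real
 assumes s: "0 < s"
 shows "\<exists>C>0. \<forall>f\<in>(amalgam \<infinity> \<infinity> :: (real^'n => complex) set). \<exists>g :: int^'n => ennreal.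
   Lp_norm (count_space UNIV) \<infinity> g <= ennreal C * amalgam_norm \<infinity> \<infinity> (%x. enorm (f x)) \<and>
   (\<forall>x \<rho>. 0 < \<rho> --> (NN y. ennreal (cmod (f y) powr s) * indicator (cball x \<rho>) y) <= ennreal (\<rho> ^ CARD('n)) * enn_powr (g (cell_index x)) s)"
proof -
 define w where "w = unit_ball_vol (real CARD('n))"
 have w: "0 < w" unfolding w_def by simp
 define C where "C = w powr (1 / s)"
 have C: "0 < C" unfolding C_def using w by simp
 have Cs: "C powr s = w" unfolding C_def using w s by (simp add: powr_powr)
 have "\<exists>g :: int^'n => ennreal.
   Lp_norm (count_space UNIV) \<infinity> g <= ennreal C * amalgam_norm \<infinity> \<infinity> (%x. enorm (f x)) \<and>
   (\<forall>x \<rho>. 0 < \<rho> --> (NN y. ennreal (cmod (f y) powr s) * indicator (cball x \<rho>) y) <= ennreal (\<rho> ^ CARD('n)) * enn_powr (g (cell_index x)) s)"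
  if f: "f \<in> amalgam \<infinity> \<infinity>" for f :: "real^'n => complex"
 proof -
  let ?X = "amalgam_norm \<infinity> \<infinity> (%x. enorm (f x))"
  obtain M where M: "?X = ennreal M" "0 <= M" using f unfolding amalgam_def by (cases ?X) auto
  have le: "cube_sup f k <= ennreal M" for k unfolding M(1)[symmetric] amalgam_norm_infinity by (rule lp_term_le) simp
  show ?thesis
  proof (intro exI[of _ "%_. ennreal C * ennreal M"] conjI allI impI)
   show "Lp_norm (count_space UNIV) \<infinity> (%_ :: int^'n. ennreal C * ennreal M) <= ennreal C * ?X"
    unfolding M Lp_norm_def by (simp, intro esssup_I) auto
   fix x :: "real^'n" and \<rho> :: real assume \<rho>: "0 < \<rho>"
   have "(NN y. ennreal (cmod (f y) powr s) * indicator (cball x \<rho>) y) <= (NN y. ennreal (M powr s) * indicator (cball x \<rho>) y)"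
   proof (rule nn_integral_mono_AE)
    show "AE y in lebesgue. ennreal (cmod (f y) powr s) * indicator (cball x \<rho>) y <= ennreal (M powr s) * indicator (cball x \<rho>) y"
     using cube_sup_AE[of f]
    proof (rule AE_mp, intro AE_I2 impI)
     fix y assume "enorm (f y) <= cube_sup f (cell_index y)"
     also have "... <= ennreal M" by (rule le)
     finally have "cmod (f y) <= M" using M by simp
     then have "cmod (f y) powr s <= M powr s" using s by (intro powr_mono2) auto
     then show "ennreal (cmod (f y) powr s) * indicator (cball x \<rho>) y <= ennreal (M powr s) * indicator (cball x \<rho>) y"
      by (intro mult_right_mono ennreal_leI) auto
    qed
   qed
   also have "... = ennreal (M powr s) * emeasure lebesgue (cball x \<rho>)" by (rule nn_integral_cmult_indicator) measurable
   also have "emeasure lebesgue (cball x \<rho>) = ennreal (w * \<rho> ^ CARD('n))" unfolding w_def using \<rho> by (intro emeasure_lebesgue_cball) auto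
   also have "ennreal (M powr s) * ennreal (w * \<rho> ^ CARD('n)) = ennreal (M powr s * (w * \<rho> ^ CARD('n)))"
    by (rule ennreal_mult[symmetric]) (use w \<rho> in auto)
   also have "M powr s * (w * \<rho> ^ CARD('n)) = \<rho> ^ CARD('n) * (C powr s * M powr s)" unfolding Cs by simp
   also have "ennreal ... = ennreal (\<rho> ^ CARD('n)) * (ennreal (C powr s) * ennreal (M powr s))"
    using \<rho> by (simp add: ennreal_mult)
   also have "ennreal (C powr s) * ennreal (M powr s) = enn_powr (ennreal C * ennreal M) s"
    using C s M by (simp add: enn_powr_cmult enn_powr_ennreal)
   finally show "(NN y. ennreal (cmod (f y) powr s) * indicator (cball x \<rho>) y) <= ennreal (\<rho> ^ CARD('n)) * enn_powr (ennreal C * ennreal M) s" by simp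
  qed
 qed
 then show ?thesis using C by blast
qed

text \<open>The maximal function is applied to \<open>N\<^sup>s\<close>, where \<open>N\<close> is the sequence of suprema on unit cubes; the exponent \<open>P / s\<close> exceeds \<open>1\<close>.\<close>

lemma local_averages_finite:
 fixes s P :: real
 assumes s: "0 < s" "s < P"
 shows "\<exists>C>0. \<forall>f\<in>(amalgam \<infinity> (ennreal P) :: (real^'n => complex) set). \<exists>g :: int^'n => ennreal.
   Lp_norm (count_space UNIV) (ennreal P) g <= ennreal C * amalgam_norm \<infinity> (ennreal P) (%x. enorm (f x)) \<and>
   (\<forall>x \<rho>. 0 < \<rho> --> (NN y. ennreal (cmod (f y) powr s) * indicator (cball x \<rho>) y) <= ennreal (\<rho> ^ CARD('n)) * enn_powr (g (cell_index x)) s)"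
proof -
 have P: "0 < P" using s by simp
 define q where "q = P / s"
 have q: "1 < q" unfolding q_def using s by (simp add: field_simps)
 have sq: "s * q = P" "1 / s * P = q" unfolding q_def using s by auto
 obtain C1 where C1: "0 < C1" and strong: "\<forall>a :: int^'n => real. (\<forall>k. 0 <= a k) --> (\<integral>\<^sup>+k. ennreal (a k powr q) \<partial>count_space UNIV) < \<infinity> -->
   (\<integral>\<^sup>+k. enn_powr (lattice_maximal a k) q \<partial>count_space UNIV) <= ennreal C1 * (\<integral>\<^sup>+k. ennreal (a k powr q) \<partial>count_space UNIV)"
  using lattice_maximal_strong_type[OF q, where 'n='n] by (elim exE conjE, intro that)
 obtain C2 where C2: "0 < C2" and avg: "\<forall>(a :: int^'n => real) x \<rho>. (\<forall>k. 0 <= a k) --> 0 < \<rho> -->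
   (NN y. ennreal (a (cell_index y)) * indicator (cball x \<rho>) y) <= ennreal (C2 * \<rho> ^ CARD('n)) * lattice_maximal a (cell_index x)"
  using lattice_average_le[where 'n='n] by (elim exE conjE, intro that)
 define C where "C = (C2 powr q * C1) powr (1 / P)"
 have C: "0 < C" unfolding C_def using C1 C2 by simp
 have "\<exists>g :: int^'n => ennreal.
   Lp_norm (count_space UNIV) (ennreal P) g <= ennreal C * amalgam_norm \<infinity> (ennreal P) (%x. enorm (f x)) \<and>
   (\<forall>x \<rho>. 0 < \<rho> --> (NN y. ennreal (cmod (f y) powr s) * indicator (cball x \<rho>) y) <= ennreal (\<rho> ^ CARD('n)) * enn_powr (g (cell_index x)) s)"
  if f: "f \<in> amalgam \<infinity> (ennreal P)" for f :: "real^'n => complex"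
 proof -
  let ?X = "amalgam_norm \<infinity> (ennreal P) (%x. enorm (f x))"
  define Y where "Y = (\<integral>\<^sup>+k. enn_powr (cube_sup f k) P \<partial>count_space UNIV)"
  have XY: "?X = enn_powr Y (1 / P)" unfolding amalgam_norm_infinity Lp_norm_ennreal[OF P] Y_def ..
  have fin: "Y < \<infinity>" using f unfolding amalgam_def mem_Collect_eq XY enn_powr_finite_iff by blast
  have cf: "cube_sup f k < \<infinity>" for k
  proof -
   have "enn_powr (cube_sup f k) P <= Y" unfolding Y_def by (rule count_space_term_le)
   then have "enn_powr (cube_sup f k) P < \<infinity>" using fin by (rule le_less_trans)
   then show ?thesis unfolding enn_powr_finite_iff .
  qed
  define a where "a k = enn2real (cube_sup f k) powr s" for k
  have a0: "\<forall>k. 0 <= a k" unfolding a_def by simp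
  have ea: "ennreal (a k) = enn_powr (cube_sup f k) s" for k
   unfolding a_def enn_powr_def using cf[of k] by auto
  have aq: "ennreal (a k powr q) = enn_powr (cube_sup f k) P" for k
   using enn_powr_ennreal[of "a k" q] a0 unfolding ea enn_powr_powr sq by simp
  have int_a: "(\<integral>\<^sup>+k. ennreal (a k powr q) \<partial>count_space UNIV) = Y" unfolding aq Y_def ..
  define g where "g k = enn_powr (ennreal C2 * lattice_maximal a k) (1 / s)" for k
  have gs: "enn_powr (g k) s = ennreal C2 * lattice_maximal a k" for k
   unfolding g_def enn_powr_powr using s by simp
  have gP: "enn_powr (g k) P = ennreal (C2 powr q) * enn_powr (lattice_maximal a k) q" for k
   unfolding g_def enn_powr_powr sq using C2 q by (simp add: enn_powr_cmult)
  show ?thesis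
  proof (intro exI[of _ g] conjI allI impI)
   have "(\<integral>\<^sup>+k. enn_powr (g k) P \<partial>count_space UNIV) = ennreal (C2 powr q) * (\<integral>\<^sup>+k. enn_powr (lattice_maximal a k) q \<partial>count_space UNIV)"
    unfolding gP by (rule nn_integral_cmult) simp
   also have "... <= ennreal (C2 powr q) * (ennreal C1 * Y)"
    using strong[rule_format, of a] a0 fin unfolding int_a by (intro mult_left_mono) auto
   also have "... = ennreal (C2 powr q * C1) * Y" using C1 by (simp add: ennreal_mult mult.assoc)
   finally have "enn_powr (\<integral>\<^sup>+k. enn_powr (g k) P \<partial>count_space UNIV) (1 / P) <= enn_powr (ennreal (C2 powr q * C1) * Y) (1 / P)"
    using P by (intro enn_powr_mono) auto
   also have "... = ennreal C * enn_powr Y (1 / P)" unfolding C_def using C1 C2 P by (intro enn_powr_cmult) auto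
   finally show "Lp_norm (count_space UNIV) (ennreal P) g <= ennreal C * ?X" unfolding XY Lp_norm_ennreal[OF P] .
   fix x :: "real^'n" and \<rho> :: real assume \<rho>: "0 < \<rho>"
   have "(NN y. ennreal (cmod (f y) powr s) * indicator (cball x \<rho>) y) <= (NN y. ennreal (a (cell_index y)) * indicator (cball x \<rho>) y)"
   proof (rule nn_integral_mono_AE)
    show "AE y in lebesgue. ennreal (cmod (f y) powr s) * indicator (cball x \<rho>) y <= ennreal (a (cell_index y)) * indicator (cball x \<rho>) y"
     using cube_sup_AE[of f]
    proof (rule AE_mp, intro AE_I2 impI)
     fix y assume "enorm (f y) <= cube_sup f (cell_index y)"
     then have "enn_powr (enorm (f y)) s <= ennreal (a (cell_index y))" unfolding ea using s by (intro enn_powr_mono) auto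
     then have "ennreal (cmod (f y) powr s) <= ennreal (a (cell_index y))" by (simp add: enn_powr_ennreal)
     then show "ennreal (cmod (f y) powr s) * indicator (cball x \<rho>) y <= ennreal (a (cell_index y)) * indicator (cball x \<rho>) y"
      by (rule mult_right_mono) simp
    qed
   qed
   also have "... <= ennreal (C2 * \<rho> ^ CARD('n)) * lattice_maximal a (cell_index x)" using avg a0 \<rho> by blast
   also have "... = ennreal (\<rho> ^ CARD('n)) * enn_powr (g (cell_index x)) s"
   proof -
    have "ennreal (C2 * \<rho> ^ CARD('n)) = ennreal (\<rho> ^ CARD('n)) * ennreal C2"
     unfolding mult.commute[of C2] by (rule ennreal_mult) (use C2 \<rho> in auto)
    then show ?thesis unfolding gs by (simp only: mult.assoc)
   qed
   finally show "(NN y. ennreal (cmod (f y) powr s) * indicator (cball x \<rho>) y) <= ennreal (\<rho> ^ CARD('n)) * enn_powr (g (cell_index x)) s" .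
  qed
 qed
 then show ?thesis using C by blast
qed

section \<open>Duality between the norms on the lattice\<close>

text \<open>Young's inequality for the normalised sequences; a vanishing norm makes the product vanish identically.\<close>

lemma lattice_Hoelder:
 fixes a b :: "int^'n => ennreal" and p :: real
 assumes p: "(p = 1 \<and> p' = \<infinity>) \<or> (\<exists>P. 1 < p \<and> 1 < P \<and> 1 / p + 1 / P = 1 \<and> p' = ennreal P)"
  and fa: "Lp_norm (count_space UNIV) (ennreal p) a < \<infinity>" and fb: "Lp_norm (count_space UNIV) p' b < \<infinity>"
 shows "(\<integral>\<^sup>+k. a k * b k \<partial>count_space UNIV) <= Lp_norm (count_space UNIV) (ennreal p) a * Lp_norm (count_space UNIV) p' b"
 using p
proof (elim disjE exE conjE)
 assume p1: "p = 1" "p' = \<infinity>"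
 let ?B = "Lp_norm (count_space UNIV) p' b"
 have "(\<integral>\<^sup>+k. a k * b k \<partial>count_space UNIV) <= (\<integral>\<^sup>+k. a k * ?B \<partial>count_space UNIV)"
  using p1 by (intro nn_integral_mono mult_left_mono lp_term_le) auto
 also have "... = (\<integral>\<^sup>+k. a k \<partial>count_space UNIV) * ?B" by (rule nn_integral_multc) simp
 also have "(\<integral>\<^sup>+k. a k \<partial>count_space UNIV) = Lp_norm (count_space UNIV) (ennreal p) a"
  using Lp_norm_ennreal[of 1 "count_space UNIV" a] unfolding p1 by simp
 finally show ?thesis .
next
 fix P assume P: "1 < p" "1 < P" "1 / p + 1 / P = 1" "p' = ennreal P"
 have p0: "0 < p" "0 < P" using P by auto
 let ?A = "Lp_norm (count_space UNIV) (ennreal p) a" and ?B = "Lp_norm (count_space UNIV) p' b"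
 obtain \<alpha> where \<alpha>: "?A = ennreal \<alpha>" "0 <= \<alpha>" using fa by (cases ?A) auto
 obtain \<beta> where \<beta>: "?B = ennreal \<beta>" "0 <= \<beta>" using fb by (cases ?B) auto
 have ale: "a k <= ennreal \<alpha>" for k unfolding \<alpha>(1)[symmetric] by (rule lp_term_le) (use p0 in auto)
 have ble: "b k <= ennreal \<beta>" for k unfolding \<beta>(1)[symmetric] by (rule lp_term_le, rule disjI2, rule exI[of _ P]) (use p0 P in auto)
 show ?thesis
 proof (cases "\<alpha> = 0 \<or> \<beta> = 0")
  case True
  then have "a k * b k = 0" for k using ale[of k] ble[of k] by auto
  then have "(\<integral>\<^sup>+k. a k * b k \<partial>count_space UNIV) = (\<integral>\<^sup>+k. 0 \<partial>count_space (UNIV :: (int^'n) set))" by (intro nn_integral_cong) blast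
  then show ?thesis by simp
 next
  case False
  then have pos: "0 < \<alpha>" "0 < \<beta>" using \<alpha> \<beta> by auto
  have Ia: "(\<integral>\<^sup>+k. enn_powr (a k) p \<partial>count_space UNIV) = ennreal (\<alpha> powr p)"
  proof -
   have "enn_powr ?A p = (\<integral>\<^sup>+k. enn_powr (a k) p \<partial>count_space UNIV)"
    unfolding Lp_norm_ennreal[OF p0(1)] enn_powr_powr using p0 by simp
   then show ?thesis unfolding \<alpha>(1) using \<alpha>(2) by (simp add: enn_powr_ennreal)
  qed
  have Ib: "(\<integral>\<^sup>+k. enn_powr (b k) P \<partial>count_space UNIV) = ennreal (\<beta> powr P)"
  proof -
   have "enn_powr ?B P = (\<integral>\<^sup>+k. enn_powr (b k) P \<partial>count_space UNIV)"
    unfolding P(4) Lp_norm_ennreal[OF p0(2)] enn_powr_powr using p0 by simp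
   then show ?thesis unfolding \<beta>(1) using \<beta>(2) by (simp add: enn_powr_ennreal)
  qed
  define u where "u = \<alpha> * \<beta> / p * (1 / \<alpha>) powr p"
  define v where "v = \<alpha> * \<beta> / P * (1 / \<beta>) powr P"
  have uv0: "0 <= u" "0 <= v" unfolding u_def v_def using pos p0 by auto
  have pt: "a k * b k <= ennreal u * enn_powr (a k) p + ennreal v * enn_powr (b k) P" for k
  proof -
   obtain x where x: "a k = ennreal x" "0 <= x" using ale[of k] by (cases "a k") (auto simp: top_unique)
   obtain y where y: "b k = ennreal y" "0 <= y" using ble[of k] by (cases "b k") (auto simp: top_unique)
   have "x / \<alpha> * (y / \<beta>) <= (x / \<alpha>) powr p / p + (y / \<beta>) powr P / P"
    using x y pos P by (intro Youngs_inequality) auto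
   then have "\<alpha> * \<beta> * (x / \<alpha> * (y / \<beta>)) <= \<alpha> * \<beta> * ((x / \<alpha>) powr p / p + (y / \<beta>) powr P / P)"
    using pos by (intro mult_left_mono) auto
   also have "(x / \<alpha>) powr p = (1 / \<alpha>) powr p * x powr p" using x pos by (simp add: powr_divide)
   also have "(y / \<beta>) powr P = (1 / \<beta>) powr P * y powr P" using y pos by (simp add: powr_divide)
   also have "\<alpha> * \<beta> * (x / \<alpha> * (y / \<beta>)) = x * y" using pos by simp
   also have "\<alpha> * \<beta> * ((1 / \<alpha>) powr p * x powr p / p + (1 / \<beta>) powr P * y powr P / P) = u * x powr p + v * y powr P"
    unfolding u_def v_def by (simp add: distrib_left)
   finally have "ennreal (x * y) <= ennreal (u * x powr p + v * y powr P)" by (rule ennreal_leI)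
   also have "... = ennreal u * ennreal (x powr p) + ennreal v * ennreal (y powr P)"
    using uv0 by (simp add: ennreal_mult)
   also have "ennreal (x * y) = ennreal x * ennreal y" by (rule ennreal_mult) (use x y in auto)
   finally show ?thesis unfolding x(1) y(1) using x(2) y(2) by (simp add: enn_powr_ennreal)
  qed
  have "(\<integral>\<^sup>+k. a k * b k \<partial>count_space UNIV) <= (\<integral>\<^sup>+k. ennreal u * enn_powr (a k) p + ennreal v * enn_powr (b k) P \<partial>count_space UNIV)"
   by (intro nn_integral_mono pt)
  also have "... = (\<integral>\<^sup>+k. ennreal u * enn_powr (a k) p \<partial>count_space UNIV) + (\<integral>\<^sup>+k. ennreal v * enn_powr (b k) P \<partial>count_space UNIV)"
   by (rule nn_integral_add) auto
  also have "... = ennreal u * ennreal (\<alpha> powr p) + ennreal v * ennreal (\<beta> powr P)"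
   unfolding Ia[symmetric] Ib[symmetric] by (subst (1 2) nn_integral_cmult) auto
  also have "... = ennreal (u * \<alpha> powr p + v * \<beta> powr P)" using uv0 by (simp add: ennreal_mult)
  also have "u * \<alpha> powr p + v * \<beta> powr P = \<alpha> * \<beta> * (1 / p + 1 / P)"
   unfolding u_def v_def using pos by (simp add: powr_divide distrib_left)
  also have "... = \<alpha> * \<beta>" using P by simp
  finally show ?thesis unfolding \<alpha>(1) \<beta>(1) using \<alpha>(2) \<beta>(2) by (simp add: ennreal_mult)
 qed
qed

text \<open>The power \<open>1/\<eta>\<close> turns the quasi-norm with exponents \<open>1/\<eta>, p/\<eta>\<close> of \<open>F\<close> into the norm with exponents \<open>1, p\<close> of
 \<open>F\<^bsup>1/\<eta>\<^esup>\<close>, to which Hoelder's inequality on the lattice applies.\<close>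

lemma amalgam_pairing:
 fixes F :: "real^'n => ennreal" and g :: "int^'n => ennreal" and p \<eta> :: real
 assumes p: "(p = 1 \<and> p' = \<infinity>) \<or> (\<exists>P. 1 < p \<and> 1 < P \<and> 1 / p + 1 / P = 1 \<and> p' = ennreal P)"
  and \<eta>: "0 < \<eta>" and Fm[measurable]: "F \<in> Meas"
  and fF: "amalgam_norm (ennreal (1 / \<eta>)) (ennreal (p / \<eta>)) F < \<infinity>" and fg: "Lp_norm (count_space UNIV) p' g < \<infinity>"
 shows "(NN x. enn_powr (F x) (1 / \<eta>) * g (cell_index x)) <=
   enn_powr (amalgam_norm (ennreal (1 / \<eta>)) (ennreal (p / \<eta>)) F) (1 / \<eta>) * Lp_norm (count_space UNIV) p' g"
proof -
 have p0: "0 < p" using p by auto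
 define a where "a k = (NN x. enn_powr (F x) (1 / \<eta>) * indicator (unit_cube_at k) x)" for k
 have inner: "Lp_norm lebesgue (ennreal (1 / \<eta>)) (%x. F x * indicator (unit_cube_at k) x) = enn_powr (a k) \<eta>" for k
 proof -
  have "(%x. enn_powr (F x * indicator (unit_cube_at k) x) (1 / \<eta>)) = (%x. enn_powr (F x) (1 / \<eta>) * indicator (unit_cube_at k) x)"
   by (auto simp: indicator_def fun_eq_iff)
  then show ?thesis unfolding a_def using \<eta> by (subst Lp_norm_ennreal) auto
 qed
 have norm: "enn_powr (amalgam_norm (ennreal (1 / \<eta>)) (ennreal (p / \<eta>)) F) (1 / \<eta>) = Lp_norm (count_space UNIV) (ennreal p) a"
  unfolding amalgam_norm_def inner using p0 \<eta> by (simp add: Lp_norm_ennreal enn_powr_powr)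
 have "Lp_norm (count_space UNIV) (ennreal p) a < \<infinity>" unfolding norm[symmetric] enn_powr_finite_iff by (rule fF)
 from lattice_Hoelder[OF p this fg]
 have "(\<integral>\<^sup>+k. a k * g k \<partial>count_space UNIV) <= Lp_norm (count_space UNIV) (ennreal p) a * Lp_norm (count_space UNIV) p' g" .
 moreover have "(NN x. enn_powr (F x) (1 / \<eta>) * g (cell_index x)) = (\<integral>\<^sup>+k. g k * a k \<partial>count_space UNIV)"
  unfolding a_def by (rule nn_integral_unit_cubes) measurable
 ultimately show ?thesis unfolding norm by (simp only: mult.commute)
qed

section \<open>Oscillation of the image\<close>

lemma powr_le_interpolate:
 fixes t \<Gamma> \<sigma> s :: real
 assumes t: "0 <= t" and \<Gamma>: "0 < \<Gamma>" and \<sigma>: "0 < \<sigma>" "\<sigma> <= s"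
 shows "t powr \<sigma> <= \<Gamma> powr \<sigma> + \<Gamma> powr (\<sigma> - s) * t powr s"
proof (cases "t <= \<Gamma>")
 case True
 then have "t powr \<sigma> <= \<Gamma> powr \<sigma>" using t \<sigma> by (intro powr_mono2) auto
 then show ?thesis by (simp add: add_increasing2)
next
 case False
 then have "t powr (\<sigma> - s) <= \<Gamma> powr (\<sigma> - s)" using \<Gamma> \<sigma> by (intro powr_mono2') auto
 then have "t powr (\<sigma> - s) * t powr s <= \<Gamma> powr (\<sigma> - s) * t powr s" by (intro mult_right_mono) auto
 moreover have "t powr (\<sigma> - s) * t powr s = t powr \<sigma>" by (simp add: powr_add[symmetric])
 ultimately show ?thesis by (simp add: add_increasing)
qed

text \<open>Splitting at the level \<open>\<Gamma>\<close> passes from the exponent \<open>s\<close> to smaller ones with the right homogeneity in \<open>\<Gamma>\<close>; it plays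
 the role of Jensen's inequality.\<close>

lemma nn_integral_lower_power:
 fixes v :: "real^'n => complex"
 assumes vm[measurable]: "v \<in> Meas" and Q[measurable]: "Q \<in> sets lebesgue"
  and V: "emeasure lebesgue Q = ennreal V" "0 <= V" and \<Gamma>: "0 < \<Gamma>" and \<sigma>: "0 < \<sigma>" "\<sigma> <= s" and c1: "0 <= c1"
  and I: "(NN x. ennreal (cmod (v x) powr s) * indicator Q x) <= ennreal (c1 * V * \<Gamma> powr s)"
 shows "(NN x. ennreal (cmod (v x) powr \<sigma>) * indicator Q x) <= ennreal ((1 + c1) * V * \<Gamma> powr \<sigma>)"
proof -
 have "(NN x. ennreal (cmod (v x) powr \<sigma>) * indicator Q x) <=
   (NN x. ennreal (\<Gamma> powr \<sigma>) * indicator Q x + ennreal (\<Gamma> powr (\<sigma> - s)) * (ennreal (cmod (v x) powr s) * indicator Q x))"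
 proof (rule nn_integral_mono)
  fix x
  have "ennreal (cmod (v x) powr \<sigma>) <= ennreal (\<Gamma> powr \<sigma> + \<Gamma> powr (\<sigma> - s) * cmod (v x) powr s)"
   by (intro ennreal_leI powr_le_interpolate) (use \<Gamma> \<sigma> in auto)
  also have "... = ennreal (\<Gamma> powr \<sigma>) + ennreal (\<Gamma> powr (\<sigma> - s)) * ennreal (cmod (v x) powr s)"
   by (simp add: ennreal_mult)
  finally have "ennreal (cmod (v x) powr \<sigma>) * indicator Q x <= (ennreal (\<Gamma> powr \<sigma>) + ennreal (\<Gamma> powr (\<sigma> - s)) * ennreal (cmod (v x) powr s)) * indicator Q x"
   by (rule mult_right_mono) simp
  then show "ennreal (cmod (v x) powr \<sigma>) * indicator Q x <= ennreal (\<Gamma> powr \<sigma>) * indicator Q x + ennreal (\<Gamma> powr (\<sigma> - s)) * (ennreal (cmod (v x) powr s) * indicator Q x)"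
   by (simp only: distrib_right mult.assoc)
 qed
 also have "... = (NN x. ennreal (\<Gamma> powr \<sigma>) * indicator Q x) + (NN x. ennreal (\<Gamma> powr (\<sigma> - s)) * (ennreal (cmod (v x) powr s) * indicator Q x))"
  by (rule nn_integral_add) measurable
 also have "(NN x. ennreal (\<Gamma> powr \<sigma>) * indicator Q x) = ennreal (\<Gamma> powr \<sigma>) * ennreal V"
  unfolding V(1)[symmetric] by (rule nn_integral_cmult_indicator) (rule Q)
 also have "(NN x. ennreal (\<Gamma> powr (\<sigma> - s)) * (ennreal (cmod (v x) powr s) * indicator Q x)) =
   ennreal (\<Gamma> powr (\<sigma> - s)) * (NN x. ennreal (cmod (v x) powr s) * indicator Q x)"
  by (rule nn_integral_cmult) measurable
 also have "ennreal (\<Gamma> powr \<sigma>) * ennreal V + ennreal (\<Gamma> powr (\<sigma> - s)) * (NN x. ennreal (cmod (v x) powr s) * indicator Q x)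
   <= ennreal (\<Gamma> powr \<sigma>) * ennreal V + ennreal (\<Gamma> powr (\<sigma> - s)) * ennreal (c1 * V * \<Gamma> powr s)"
  by (intro add_left_mono mult_left_mono I) simp
 also have "... = ennreal (\<Gamma> powr \<sigma> * V + \<Gamma> powr (\<sigma> - s) * (c1 * V * \<Gamma> powr s))"
  using V c1 by (simp add: ennreal_mult)
 also have "\<Gamma> powr \<sigma> * V + \<Gamma> powr (\<sigma> - s) * (c1 * V * \<Gamma> powr s) = (1 + c1) * V * \<Gamma> powr \<sigma>"
 proof -
  have "\<Gamma> powr (\<sigma> - s) * \<Gamma> powr s = \<Gamma> powr \<sigma>" by (simp add: powr_add[symmetric])
  then have "\<Gamma> powr (\<sigma> - s) * (c1 * V * \<Gamma> powr s) = c1 * V * \<Gamma> powr \<sigma>" by (metis mult.left_commute)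
  then show ?thesis by (simp add: algebra_simps)
 qed
 finally show ?thesis .
qed

lemma nn_integral_powr_shift:
 fixes g v :: "real^'n => complex"
 assumes vm[measurable]: "v \<in> Meas" and Q[measurable]: "Q \<in> sets lebesgue"
  and V: "emeasure lebesgue Q = ennreal V" "0 <= V" and r: "0 < r" and b: "0 <= b" and J: "0 <= J"
  and le: "AE x in lebesgue. x \<in> Q --> cmod (g x) <= cmod (v x) + b"
  and I: "(NN x. ennreal (cmod (v x) powr r) * indicator Q x) <= ennreal J"
 shows "(NN x. ennreal (cmod (g x) powr r) * indicator Q x) <= ennreal (2 powr r * (J + b powr r * V))"
proof -
 have "(NN x. ennreal (cmod (g x) powr r) * indicator Q x) <=
   (NN x. ennreal (2 powr r) * (ennreal (cmod (v x) powr r) * indicator Q x + ennreal (b powr r) * indicator Q x))"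
 proof (rule nn_integral_mono_AE, rule AE_mp[OF le], intro AE_I2 impI)
  fix x assume *: "x \<in> Q --> cmod (g x) <= cmod (v x) + b"
  show "ennreal (cmod (g x) powr r) * indicator Q x <= ennreal (2 powr r) * (ennreal (cmod (v x) powr r) * indicator Q x + ennreal (b powr r) * indicator Q x)"
  proof (cases "x \<in> Q")
   case True
   have "cmod (g x) powr r <= (cmod (v x) + b) powr r" using * True r by (intro powr_mono2) auto
   also have "... <= 2 powr r * (cmod (v x) powr r + b powr r)" using b r by (intro powr_add_le) auto
   finally have "ennreal (cmod (g x) powr r) <= ennreal (2 powr r * (cmod (v x) powr r + b powr r))" by (rule ennreal_leI)
   also have "... = ennreal (2 powr r) * (ennreal (cmod (v x) powr r) + ennreal (b powr r))" by (simp add: ennreal_mult)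
   finally show ?thesis using True by simp
  qed simp
 qed
 also have "... = ennreal (2 powr r) * (NN x. ennreal (cmod (v x) powr r) * indicator Q x + ennreal (b powr r) * indicator Q x)"
  by (rule nn_integral_cmult) measurable
 also have "(NN x. ennreal (cmod (v x) powr r) * indicator Q x + ennreal (b powr r) * indicator Q x) =
   (NN x. ennreal (cmod (v x) powr r) * indicator Q x) + (NN x. ennreal (b powr r) * indicator Q x)"
  by (rule nn_integral_add) measurable
 also have "(NN x. ennreal (b powr r) * indicator Q x) = ennreal (b powr r) * ennreal V"
  unfolding V(1)[symmetric] by (rule nn_integral_cmult_indicator) (rule Q)
 also have "ennreal (2 powr r) * ((NN x. ennreal (cmod (v x) powr r) * indicator Q x) + ennreal (b powr r) * ennreal V)
   <= ennreal (2 powr r) * (ennreal J + ennreal (b powr r) * ennreal V)"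
  by (intro mult_left_mono add_right_mono I) simp
 also have "... = ennreal (2 powr r * (J + b powr r * V))" using J V b by (simp add: ennreal_mult)
 finally show ?thesis .
qed

lemma cube_dist_le:
 fixes c x :: "real^'n"
 assumes "x \<in> cube c l"
 shows "dist c x <= real CARD('n) * (l / 2)"
proof -
 have "norm (x - c) <= (\<Sum>i\<in>UNIV. \<bar>(x - c) $ i\<bar>)" by (rule norm_le_l1_cart)
 also have "... <= (\<Sum>i\<in>(UNIV :: 'n set). l / 2)" by (intro sum_mono) (use assms in \<open>simp add: mem_cube\<close>)
 finally show ?thesis by (simp add: dist_norm norm_minus_commute)
qed

text \<open>The local representation bounds \<open>h - k\<close> in \<open>L\<^sup>s\<close> of the cube by \<open>\<Gamma>\<close>; passing to the exponents \<open>1\<close> and \<open>r\<close>, the first one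
 controls the projection of \<open>h\<close> minus \<open>k\<close>, the second one the oscillation.\<close>

lemma oscillation_bound_pos:
 fixes K :: "real^'n => real^'n => complex" and T :: "(real^'n => complex) => real^'n => complex"
 assumes K: "K \<in> standard_kernels \<mu> A" and \<mu>: "0 < \<mu>" and A: "0 < A" and T: "calderon_zygmund T K"
  and rs: "1 <= r" "r <= s" "1 < s"
 shows "\<exists>C>0. \<forall>T' f h M (c :: real^'n) L \<Gamma>. is_transpose T T' --> f \<in> Meas -->
   (AE x in lebesgue. cmod (f x) <= M) --> weak_value T' f h --> 0 < L --> 0 < \<Gamma> -->
   (\<forall>\<rho>. 2 * (real CARD('n) * L) <= \<rho> -->
    (NN y. ennreal (cmod (f y) powr s) * indicator (cball c \<rho>) y) <= ennreal (\<rho> ^ CARD('n) * \<Gamma> powr s)) -->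
   (NN y. ennreal (cmod (h y) powr r) * indicator (cube c L) y) < \<infinity> \<and>
   oscillation \<delta> r h (cube c L) <= C * L ^ CARD('n) * \<Gamma>"
proof -
 let ?d = "CARD('n)"
 define w where "w = unit_ball_vol (real ?d)"
 have w: "0 < w" unfolding w_def by simp
 obtain C1 where C1: "0 < C1" "\<forall>u\<in>Lp 2 \<inter> Lp (ennreal s). Ipow s (T u) <= ennreal C1 * Ipow s u"
  using calderon_zygmund_Ls[OF K \<mu> A T rs(3)] by blast
 obtain Cp where Cp: "0 < Cp" and proj: "\<forall>(c :: real^'n) l g k. 0 < l --> set_integrable lebesgue (cube c l) g -->
   poly_proj \<delta> (cube c l) g \<in> polys \<delta> \<and>
   (\<forall>x\<in>cube c l. cmod (poly_proj \<delta> (cube c l) g x - k) <= Cp / l ^ CARD('n) * (LINT x:cube c l|lebesgue. cmod (g x - k)))"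
  using poly_proj_bound[where 'n='n, of \<delta>] by blast
 define D where "D = A * (2 ^ ?d / (1 - 2 powr (-\<mu>)))"
 have "2 powr (-\<mu>) < (1::real)" using \<mu> by (simp add: powr_less_one)
 then have D: "0 < D" unfolding D_def using A by (intro mult_pos_pos divide_pos_pos) auto
 define B where "B = D * (w + 1)"
 have B: "0 < B" unfolding B_def using D w by (intro mult_pos_pos) auto
 define c1 where "c1 = 2 powr s * (C1 * (2 * real ?d) ^ ?d + B powr s)"
 have c1: "0 < c1" unfolding c1_def using C1 B by (intro mult_pos_pos add_nonneg_pos) auto
 define e where "e = Cp * (1 + c1)"
 have e: "0 < e" unfolding e_def using Cp c1 by (intro mult_pos_pos) auto
 define c2 where "c2 = 2 powr r * ((1 + c1) + e powr r)"
 have c2: "0 < c2" unfolding c2_def using c1 e by (intro mult_pos_pos add_pos_pos) auto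
 have r0: "0 < r" and s0: "0 < s" using rs by auto
 have main: "(NN y. ennreal (cmod (h y) powr r) * indicator (cube c L) y) < \<infinity> \<and>
   oscillation \<delta> r h (cube c L) <= c2 powr (1 / r) * L ^ ?d * \<Gamma>"
  if T': "is_transpose T T'" and fm[measurable]: "f \<in> Meas" and ae: "AE x in lebesgue. cmod (f x) <= M"
   and h: "weak_value T' f h" and L: "0 < L" and \<Gamma>: "0 < \<Gamma>"
   and avg: "!!\<rho>. 2 * (real ?d * L) <= \<rho> ==>
    (NN y. ennreal (cmod (f y) powr s) * indicator (cball c \<rho>) y) <= ennreal (\<rho> ^ ?d * \<Gamma> powr s)"
  for T' f h M L \<Gamma> and c :: "real^'n"
 proof -
  define V where "V = L ^ ?d"
  have V: "0 < V" unfolding V_def using L by simp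
  define Q where "Q = cube c L"
  have Qs[measurable]: "Q \<in> sets lebesgue" unfolding Q_def by (rule cube_sets)
  have Qe: "emeasure lebesgue Q = ennreal V" unfolding Q_def V_def by (rule cube_measure(2)[OF L])
  have Qm: "measure lebesgue Q = V" unfolding Q_def V_def by (rule cube_measure(1)[OF L])
  define R where "R = real ?d * L"
  have R: "0 < R" unfolding R_def using L by simp
  have QR: "Q \<subseteq> cball c R"
  proof
   fix x assume "x \<in> Q"
   then have "dist c x <= real ?d * (L / 2)" unfolding Q_def by (rule cube_dist_le)
   also have "... <= R" unfolding R_def using L by (intro mult_left_mono) auto
   finally show "x \<in> cball c R" by simp
  qed
  define u where "u = near_part c R f"
  have u2: "u \<in> Lp 2" using near_part_Lp[OF fm ae, of 2 c R] unfolding u_def by simp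
  have us: "u \<in> Lp (ennreal s)" unfolding u_def by (rule near_part_Lp[OF fm ae s0])
  have "Ipow s u <= (NN y. ennreal (cmod (f y) powr s) * indicator (cball c (2 * R)) y)"
   unfolding Ipow_def
  proof (rule nn_integral_mono)
   fix y
   show "ennreal (cmod (u y) powr s) <= ennreal (cmod (f y) powr s) * indicator (cball c (2 * R)) y"
   proof (cases "norm (y - c) < 2 * R")
    case True
    then have "y \<in> cball c (2 * R)" by (simp add: dist_norm norm_minus_commute)
    then show ?thesis using True unfolding u_def near_part_def by simp
   next
    case False
    then show ?thesis unfolding u_def near_part_def by simp
   qed
  qed
  also have "... <= ennreal ((2 * R) ^ ?d * \<Gamma> powr s)" by (rule avg) (simp add: R_def)
  also have "(2 * R) ^ ?d = (2 * real ?d) ^ ?d * V" unfolding R_def V_def by (simp add: power_mult_distrib)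
  finally have Iu: "Ipow s u <= ennreal ((2 * real ?d) ^ ?d * V * \<Gamma> powr s)" .
  have Tum[measurable]: "T u \<in> Meas"
   using bounded_linear_Lp_mem[of 2 T u] T u2 unfolding calderon_zygmund_def Lp_def by blast
  have "(NN y. ennreal (cmod (T u y) powr s) * indicator Q y) <= Ipow s (T u)"
   unfolding Ipow_def by (intro nn_integral_mono) (auto simp: indicator_def)
  also have "... <= ennreal C1 * Ipow s u" using C1(2) u2 us by blast
  also have "... <= ennreal C1 * ennreal ((2 * real ?d) ^ ?d * V * \<Gamma> powr s)" by (intro mult_left_mono Iu) simp
  also have "... = ennreal (C1 * ((2 * real ?d) ^ ?d * V * \<Gamma> powr s))"
   by (rule ennreal_mult[symmetric]) (use C1 V in auto)
  finally have ITu: "(NN y. ennreal (cmod (T u y) powr s) * indicator Q y) <= ennreal (C1 * ((2 * real ?d) ^ ?d * V * \<Gamma> powr s))" .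
  \<comment> \<open>The far part needs averages of the first power of \<open>\<bar>f\<bar>\<close>.\<close>
  have avg1: "(NN x. enorm (f x) * indicator (cball c \<rho>) x) <= ennreal (\<rho> ^ ?d) * ennreal ((w + 1) * \<Gamma>)"
   if \<rho>: "2 * R <= \<rho>" for \<rho>
  proof -
   have \<rho>0: "0 < \<rho>" using \<rho> R by linarith
   have "(NN x. ennreal (cmod (f x) powr 1) * indicator (cball c \<rho>) x) <= ennreal ((1 + 1 / w) * (w * \<rho> ^ ?d) * \<Gamma> powr 1)"
   proof (rule nn_integral_lower_power[OF fm, where s=s])
    show "emeasure lebesgue (cball c \<rho>) = ennreal (w * \<rho> ^ ?d)" unfolding w_def using \<rho>0 by (intro emeasure_lebesgue_cball) auto
    have "1 / w * (w * \<rho> ^ ?d) * \<Gamma> powr s = \<rho> ^ ?d * \<Gamma> powr s" using w by simp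
    then show "(NN x. ennreal (cmod (f x) powr s) * indicator (cball c \<rho>) x) <= ennreal (1 / w * (w * \<rho> ^ ?d) * \<Gamma> powr s)"
     using avg[of \<rho>] \<rho> unfolding R_def by (simp only:)
   qed (use w \<rho>0 \<Gamma> rs in auto)
   also have "(1 + 1 / w) * (w * \<rho> ^ ?d) * \<Gamma> powr 1 = \<rho> ^ ?d * ((w + 1) * \<Gamma>)" using w \<Gamma> by (simp add: field_simps)
   also have "ennreal ... = ennreal (\<rho> ^ ?d) * ennreal ((w + 1) * \<Gamma>)" by (rule ennreal_mult) (use \<rho>0 w \<Gamma> in auto)
   finally show ?thesis by simp
  qed
  have far: "cmod (far_part K c R f y) <= B * \<Gamma>" if y: "y \<in> cball c R" for y
  proof -
   have "enorm (far_part K c R f y) <= ennreal D * ennreal ((w + 1) * \<Gamma>)"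
    unfolding D_def by (rule far_part_bound[OF K \<mu> A R y fm avg1])
   also have "... = ennreal (D * ((w + 1) * \<Gamma>))" by (rule ennreal_mult[symmetric]) (use D w \<Gamma> in auto)
   finally have "cmod (far_part K c R f y) <= D * ((w + 1) * \<Gamma>)" using D w \<Gamma> by (subst (asm) ennreal_le_iff) auto
   then show ?thesis unfolding B_def by (simp only: mult.assoc)
  qed
  obtain k where k: "AE y in lebesgue. y \<in> cball c R --> h y = T u y + far_part K c R f y + k"
   using weak_value_local[OF K \<mu> A T T' R fm ae h] unfolding u_def by blast
  have hm[measurable]: "h \<in> Meas" using h unfolding weak_value_def by blast
  define v where "v x = h x - k" for x
  have vm[measurable]: "v \<in> Meas" unfolding v_def[abs_def] by measurable
  have "(NN x. ennreal (cmod (v x) powr s) * indicator Q x) <=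
    ennreal (2 powr s * (C1 * ((2 * real ?d) ^ ?d * V * \<Gamma> powr s) + (B * \<Gamma>) powr s * V))"
  proof (rule nn_integral_powr_shift[OF Tum Qs Qe _ s0 _ _ _ ITu])
   show "AE x in lebesgue. x \<in> Q --> cmod (v x) <= cmod (T u x) + B * \<Gamma>"
   proof (rule AE_mp[OF k], intro AE_I2 impI)
    fix y assume *: "y \<in> cball c R --> h y = T u y + far_part K c R f y + k" and y: "y \<in> Q"
    have yR: "y \<in> cball c R" using y QR by blast
    then have "v y = T u y + far_part K c R f y" using * by (simp add: v_def)
    then show "cmod (v y) <= cmod (T u y) + B * \<Gamma>" using norm_triangle_ineq[of "T u y" "far_part K c R f y"] far[OF yR] by simp
   qed
  qed (use V B \<Gamma> C1 in auto)
  also have "2 powr s * (C1 * ((2 * real ?d) ^ ?d * V * \<Gamma> powr s) + (B * \<Gamma>) powr s * V) = c1 * V * \<Gamma> powr s"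
  proof -
   have "(B * \<Gamma>) powr s = B powr s * \<Gamma> powr s" by (rule powr_mult)
   then show ?thesis unfolding c1_def by (simp add: algebra_simps)
  qed
  finally have Iv: "(NN x. ennreal (cmod (v x) powr s) * indicator Q x) <= ennreal (c1 * V * \<Gamma> powr s)" .
  have low: "(NN x. ennreal (cmod (v x) powr \<sigma>) * indicator Q x) <= ennreal ((1 + c1) * V * \<Gamma> powr \<sigma>)"
   if "0 < \<sigma>" "\<sigma> <= s" for \<sigma>
   by (rule nn_integral_lower_power[OF vm Qs Qe _ \<Gamma> that _ Iv]) (use V c1 in auto)
  have Lv: "(LINT x:Q|lebesgue. cmod (v x)) <= (1 + c1) * V * \<Gamma>"
   unfolding set_lebesgue_integral_def
  proof (rule integral_real_bounded)
   have "(NN x. ennreal (indicator Q x *\<^sub>R cmod (v x))) = (NN x. ennreal (cmod (v x) powr 1) * indicator Q x)"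
    by (intro nn_integral_cong) (auto simp: indicator_def)
   also have "... <= ennreal ((1 + c1) * V * \<Gamma> powr 1)" by (rule low) (use rs in auto)
   also have "\<Gamma> powr 1 = \<Gamma>" using \<Gamma> by simp
   finally show "(NN x. ennreal (indicator Q x *\<^sub>R cmod (v x))) <= ennreal ((1 + c1) * V * \<Gamma>)" .
  qed (use V c1 \<Gamma> in auto)
  have hQ: "set_integrable lebesgue Q h"
  proof -
   have "integrable lebesgue (%x. h x * indicator (cball c R) x)" using h unfolding weak_value_def by blast
   from integrable_mult_indicator[OF Qs this]
   have "integrable lebesgue (%x. indicator Q x *\<^sub>R (h x * indicator (cball c R) x))" .
   moreover have "(%x. indicator Q x *\<^sub>R (h x * indicator (cball c R) x)) = (%x. indicator Q x *\<^sub>R h x)"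
   proof
    fix x
    show "indicator Q x *\<^sub>R (h x * indicator (cball c R) x) = indicator Q x *\<^sub>R h x"
    proof (cases "x \<in> Q")
     case True
     then have "x \<in> cball c R" using QR by blast
     then have "indicator (cball c R) x = (1 :: complex)" by (rule indicator_simps(1))
     then show ?thesis by (simp only: mult_1_right)
    qed simp
   qed
   ultimately show ?thesis unfolding set_integrable_def by (simp only:)
  qed
  define P where "P = poly_proj \<delta> Q h"
  have Pb: "cmod (P x - k) <= e * \<Gamma>" if x: "x \<in> Q" for x
  proof -
   have "cmod (P x - k) <= Cp / L ^ ?d * (LINT x:Q|lebesgue. cmod (h x - k))"
    unfolding P_def Q_def using proj[rule_format, OF L hQ[unfolded Q_def]] x[unfolded Q_def] by blast
   also have "... <= Cp / V * ((1 + c1) * V * \<Gamma>)"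
    unfolding V_def[symmetric] using Lv Cp V unfolding v_def by (intro mult_left_mono) auto
   also have "... = e * \<Gamma>" unfolding e_def using V by simp
   finally show ?thesis .
  qed
  have "(NN x. ennreal (cmod (h x - P x) powr r) * indicator Q x) <=
    ennreal (2 powr r * ((1 + c1) * V * \<Gamma> powr r + (e * \<Gamma>) powr r * V))"
  proof (rule nn_integral_powr_shift[OF vm Qs Qe _ r0 _ _ _ low[OF r0 rs(2)]])
   show "AE x in lebesgue. x \<in> Q --> cmod (h x - P x) <= cmod (v x) + e * \<Gamma>"
   proof (intro AE_I2 impI)
    fix x assume "x \<in> Q"
    then have "cmod (P x - k) <= e * \<Gamma>" by (rule Pb)
    moreover have "h x - P x = v x - (P x - k)" by (simp add: v_def)
    ultimately show "cmod (h x - P x) <= cmod (v x) + e * \<Gamma>" using norm_triangle_ineq4[of "v x" "P x - k"] by (simp only:)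
   qed
  qed (use V e \<Gamma> c1 in auto)
  also have "2 powr r * ((1 + c1) * V * \<Gamma> powr r + (e * \<Gamma>) powr r * V) = c2 * V * \<Gamma> powr r"
  proof -
   have "(e * \<Gamma>) powr r = e powr r * \<Gamma> powr r" by (rule powr_mult)
   then show ?thesis unfolding c2_def by (simp add: algebra_simps)
  qed
  finally have IP: "(NN x. ennreal (cmod (h x - P x) powr r) * indicator Q x) <= ennreal (c2 * V * \<Gamma> powr r)" .
  have LP: "(LINT x:Q|lebesgue. cmod (h x - P x) powr r) <= c2 * V * \<Gamma> powr r"
   unfolding set_lebesgue_integral_def
  proof (rule integral_real_bounded)
   have "(NN x. ennreal (indicator Q x *\<^sub>R cmod (h x - P x) powr r)) = (NN x. ennreal (cmod (h x - P x) powr r) * indicator Q x)"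
    by (intro nn_integral_cong) (auto simp: indicator_def)
   also note IP
   finally show "(NN x. ennreal (indicator Q x *\<^sub>R cmod (h x - P x) powr r)) <= ennreal (c2 * V * \<Gamma> powr r)" .
  qed (use V c2 in auto)
  have LP0: "0 <= (LINT x:Q|lebesgue. cmod (h x - P x) powr r)"
   unfolding set_lebesgue_integral_def by (rule Bochner_Integration.integral_nonneg) (auto simp: indicator_def)
  have "oscillation \<delta> r h Q = V powr (1 - 1 / r) * (LINT x:Q|lebesgue. cmod (h x - P x) powr r) powr (1 / r)"
   unfolding oscillation_def P_def Qm ..
  also have "... <= V powr (1 - 1 / r) * (c2 * V * \<Gamma> powr r) powr (1 / r)"
   using LP LP0 r0 by (intro mult_left_mono powr_mono2) auto
  also have "(c2 * V * \<Gamma> powr r) powr (1 / r) = c2 powr (1 / r) * V powr (1 / r) * \<Gamma>"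
  proof -
   have "(c2 * V * \<Gamma> powr r) powr (1 / r) = (c2 * V) powr (1 / r) * (\<Gamma> powr r) powr (1 / r)" by (rule powr_mult)
   also have "(c2 * V) powr (1 / r) = c2 powr (1 / r) * V powr (1 / r)" by (rule powr_mult)
   also have "(\<Gamma> powr r) powr (1 / r) = \<Gamma>" using r0 \<Gamma> by (simp add: powr_powr)
   finally show ?thesis .
  qed
  also have "V powr (1 - 1 / r) * (c2 powr (1 / r) * V powr (1 / r) * \<Gamma>) = c2 powr (1 / r) * V * \<Gamma>"
  proof -
   have "V powr (1 - 1 / r) * V powr (1 / r) = V" unfolding powr_add[symmetric] using V by simp
   then have "c2 powr (1 / r) * (V powr (1 - 1 / r) * V powr (1 / r)) * \<Gamma> = c2 powr (1 / r) * V * \<Gamma>" by (simp only:)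
   then show ?thesis by (simp only: ac_simps)
  qed
  finally have osc: "oscillation \<delta> r h (cube c L) <= c2 powr (1 / r) * L ^ ?d * \<Gamma>" unfolding Q_def V_def .
  have "(NN x. ennreal (cmod (h x) powr r) * indicator Q x) <=
    ennreal (2 powr r * ((1 + c1) * V * \<Gamma> powr r + cmod k powr r * V))"
  proof (rule nn_integral_powr_shift[OF vm Qs Qe _ r0 _ _ _ low[OF r0 rs(2)]])
   show "AE x in lebesgue. x \<in> Q --> cmod (h x) <= cmod (v x) + cmod k"
   proof (intro AE_I2 impI)
    fix x show "cmod (h x) <= cmod (v x) + cmod k" using norm_triangle_ineq[of "v x" k] by (simp add: v_def)
   qed
  qed (use V \<Gamma> c1 in auto)
  also have "... < \<infinity>" by simp
  finally show ?thesis using osc unfolding Q_def by blast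
 qed
 have "0 < c2 powr (1 / r)" using c2 by simp
 then show ?thesis by (intro exI[of _ "c2 powr (1 / r)"] conjI allI impI) (assumption, blast intro: main[THEN conjunct1], blast intro: main[THEN conjunct2])
qed

text \<open>The case \<open>\<Gamma> = 0\<close> follows by letting \<open>\<Gamma>\<close> decrease to its value.\<close>

lemma oscillation_bound:
 fixes K :: "real^'n => real^'n => complex" and T :: "(real^'n => complex) => real^'n => complex"
 assumes K: "K \<in> standard_kernels \<mu> A" and \<mu>: "0 < \<mu>" and A: "0 < A" and T: "calderon_zygmund T K"
  and rs: "1 <= r" "r <= s" "1 < s"
 shows "\<exists>C>0. \<forall>T' f h M (c :: real^'n) L \<Gamma>. is_transpose T T' --> f \<in> Meas -->
   (AE x in lebesgue. cmod (f x) <= M) --> weak_value T' f h --> 0 < L --> 0 <= \<Gamma> -->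
   (\<forall>\<rho>. 2 * (real CARD('n) * L) <= \<rho> -->
    (NN y. ennreal (cmod (f y) powr s) * indicator (cball c \<rho>) y) <= ennreal (\<rho> ^ CARD('n) * \<Gamma> powr s)) -->
   (NN y. ennreal (cmod (h y) powr r) * indicator (cube c L) y) < \<infinity> \<and>
   oscillation \<delta> r h (cube c L) <= C * L ^ CARD('n) * \<Gamma>"
proof -
 let ?d = "CARD('n)"
 obtain C where C: "0 < C" and main: "\<forall>T' f h M (c :: real^'n) L \<Gamma>. is_transpose T T' --> f \<in> Meas -->
   (AE x in lebesgue. cmod (f x) <= M) --> weak_value T' f h --> 0 < L --> 0 < \<Gamma> -->
   (\<forall>\<rho>. 2 * (real CARD('n) * L) <= \<rho> -->
    (NN y. ennreal (cmod (f y) powr s) * indicator (cball c \<rho>) y) <= ennreal (\<rho> ^ CARD('n) * \<Gamma> powr s)) -->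
   (NN y. ennreal (cmod (h y) powr r) * indicator (cube c L) y) < \<infinity> \<and>
   oscillation \<delta> r h (cube c L) <= C * L ^ CARD('n) * \<Gamma>"
  using oscillation_bound_pos[OF K \<mu> A T rs, of \<delta>] by (elim exE conjE, intro that)
 show ?thesis
 proof (intro exI[of _ C] conjI[OF C] allI impI)
  fix T' f h M L \<Gamma> and c :: "real^'n"
  assume *: "is_transpose T T'" "f \<in> Meas" "AE x in lebesgue. cmod (f x) <= M" "weak_value T' f h" "0 < L"
   and \<Gamma>: "0 <= \<Gamma>" and avg: "\<forall>\<rho>. 2 * (real ?d * L) <= \<rho> -->
    (NN y. ennreal (cmod (f y) powr s) * indicator (cball c \<rho>) y) <= ennreal (\<rho> ^ ?d * \<Gamma> powr s)"
  have CL: "0 < C * L ^ ?d" using C \<open>0 < L\<close> by simp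
  have eps: "(NN y. ennreal (cmod (h y) powr r) * indicator (cube c L) y) < \<infinity> \<and>
    oscillation \<delta> r h (cube c L) <= C * L ^ ?d * (\<Gamma> + e)" if e: "0 < e" for e
  proof (rule main[rule_format, OF *])
   show "0 < \<Gamma> + e" using \<Gamma> e by simp
   fix \<rho> assume \<rho>: "2 * (real ?d * L) <= \<rho>"
   have "0 <= 2 * (real ?d * L)" using \<open>0 < L\<close> by simp
   then have \<rho>0: "0 <= \<rho>" using \<rho> by linarith
   have "(NN y. ennreal (cmod (f y) powr s) * indicator (cball c \<rho>) y) <= ennreal (\<rho> ^ ?d * \<Gamma> powr s)"
    using avg \<rho> by blast
   also have "... <= ennreal (\<rho> ^ ?d * (\<Gamma> + e) powr s)"
    using \<Gamma> e rs \<rho>0 by (intro ennreal_leI mult_left_mono powr_mono2) auto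
   finally show "(NN y. ennreal (cmod (f y) powr s) * indicator (cball c \<rho>) y) <= ennreal (\<rho> ^ ?d * (\<Gamma> + e) powr s)" .
  qed
  have "oscillation \<delta> r h (cube c L) <= C * L ^ ?d * \<Gamma>"
  proof (rule field_le_epsilon)
   fix e :: real assume e: "0 < e"
   have "oscillation \<delta> r h (cube c L) <= C * L ^ ?d * (\<Gamma> + e / (C * L ^ ?d))" using eps[of "e / (C * L ^ ?d)"] e CL by simp
   also have "... = C * L ^ ?d * \<Gamma> + e" unfolding distrib_left times_divide_eq_right by (metis CL less_irrefl nonzero_mult_div_cancel_left)
   finally show "oscillation \<delta> r h (cube c L) <= C * L ^ ?d * \<Gamma> + e" .
  qed
  then show "(NN y. ennreal (cmod (h y) powr r) * indicator (cube c L) y) < \<infinity> \<and>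
    oscillation \<delta> r h (cube c L) <= C * L ^ ?d * \<Gamma>"
   using eps[of 1] by (intro conjI) simp_all
 qed
qed

lemma Lp_loc_if_cubes:
 fixes h :: "real^'n => complex"
 assumes hm[measurable]: "h \<in> Meas"
  and fin: "!!L. 0 < L ==> (NN y. ennreal (cmod (h y) powr r) * indicator (cube 0 L) y) < \<infinity>"
 shows "h \<in> Lp_loc r"
 unfolding Lp_loc_mem_iff
proof (intro conjI allI impI hm)
 fix S :: "(real^'n) set" assume S: "compact S"
 then obtain a where a: "0 < a" "\<forall>x\<in>S. norm x <= a" using compact_imp_bounded[OF S] unfolding bounded_pos by blast
 have sub: "S \<subseteq> cube 0 (2 * a)"
 proof
  fix x assume "x \<in> S"
  then have "norm x <= a" using a by blast
  then have "\<bar>x $ i\<bar> <= a" for i using component_le_norm_cart[of x i] by linarith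
  then show "x \<in> cube 0 (2 * a)" by (simp add: mem_cube)
 qed
 have Ss[measurable]: "S \<in> sets lebesgue" using compact_imp_closed[OF S] by (intro lmeasurable_compact fmeasurableD S)
 show "set_integrable lebesgue S (%x. cmod (h x) powr r)"
  unfolding set_integrable_def
 proof (rule integrableI_bounded)
  show "(%x. indicator S x *\<^sub>R cmod (h x) powr r) \<in> Meas" by measurable
  have "(NN x. ennreal (norm (indicator S x *\<^sub>R cmod (h x) powr r))) <= (NN y. ennreal (cmod (h y) powr r) * indicator (cube 0 (2 * a)) y)"
   using sub by (intro nn_integral_mono) (auto simp: indicator_def)
  also have "... < \<infinity>" by (rule fin) (use a in simp)
  finally show "(NN x. ennreal (norm (indicator S x *\<^sub>R cmod (h x) powr r))) < \<infinity>" .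
 qed
qed

section \<open>Summation over families of cubes\<close>

lemma enn_powr_superadditive:
 assumes t: "1 <= t"
 shows "enn_powr x t + enn_powr y t <= enn_powr (x + y) t"
proof (cases "x = \<infinity> \<or> y = \<infinity>")
 case True
 then have "x + y = \<infinity>" by auto
 then show ?thesis by (simp add: enn_powr_def)
next
 case False
 then obtain a b where ab: "x = ennreal a" "0 <= a" "y = ennreal b" "0 <= b" by (cases x; cases y) auto
 have sp: "c powr t = c * c powr (t - 1)" if "0 <= c" for c :: real
  using that t powr_add[of c 1 "t - 1"] by (cases "c = 0") auto
 have "a powr t + b powr t = a * a powr (t - 1) + b * b powr (t - 1)" using sp ab by simp
 also have "... <= a * (a + b) powr (t - 1) + b * (a + b) powr (t - 1)"
  using ab t by (intro add_mono mult_left_mono powr_mono2) auto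
 also have "... = (a + b) powr t" using sp[of "a + b"] ab by (simp add: distrib_right)
 finally have "a powr t + b powr t <= (a + b) powr t" .
 then show ?thesis unfolding ab(1,3) using ab by (simp add: enn_powr_ennreal ennreal_leI flip: ennreal_plus)
qed

lemma enn_powr_sum_superadditive:
 assumes "1 <= t" "finite J"
 shows "(\<Sum>j\<in>J. enn_powr (a j) t) <= enn_powr (\<Sum>j\<in>J. a j) t"
 using assms(2)
proof (induction J)
 case (insert j J)
 have "(\<Sum>j\<in>insert j J. enn_powr (a j) t) <= enn_powr (a j) t + enn_powr (\<Sum>j\<in>J. a j) t" using insert by (simp add: add_left_mono)
 also have "... <= enn_powr (a j + (\<Sum>j\<in>J. a j)) t" by (rule enn_powr_superadditive[OF assms(1)])
 finally show ?case using insert by simp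
qed simp

text \<open>The bound for one cube holds at every point of the cube. Averaging it over the cube replaces the measure of the cube times
 the value of \<open>g\<close> by the integral of \<open>g\<close>, and these integrals add up with bounded overlap.\<close>

lemma osc_sup_le:
 fixes h :: "real^'n => complex" and g :: "int^'n => ennreal"
 assumes osc: "!!c l x. 0 < l ==> x \<in> cube c l ==>
   ennreal (oscillation \<delta> r h (cube c (C\<^sub>0 * l))) <= ennreal (C' * l ^ CARD('n)) * g (cell_index x)"
  and C': "0 <= C'" and Kd: "0 <= Kd" and \<Omega>[measurable]: "\<Omega> \<in> sets lebesgue"
 shows "osc_sup Kd C\<^sub>0 \<delta> h \<Omega> r <= ennreal (C' * Kd) * (NN x. g (cell_index x) * indicator \<Omega> x)"
 unfolding osc_sup_def
proof (rule SUP_least, clarify)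
 let ?d = "CARD('n)"
 note [measurable] = cell_index_measurable
 fix c :: "nat => real^'n" and l :: "nat => real"
 assume cl: "\<forall>n. 0 < l n \<and> cube (c n) (l n) \<subseteq> \<Omega>" and ov: "\<forall>x. (\<Sum>n. indicator (cube (c n) (l n)) x) <= ennreal Kd"
 have gm[measurable]: "(%x. g (cell_index x)) \<in> borel_measurable (lebesgue :: (real^'n) measure)" by (rule cell_index_measurable)
 have one: "ennreal (oscillation \<delta> r h (cube (c n) (C\<^sub>0 * l n))) <= ennreal C' * (NN x. g (cell_index x) * indicator (cube (c n) (l n)) x)" for n
 proof -
  let ?o = "ennreal (oscillation \<delta> r h (cube (c n) (C\<^sub>0 * l n)))" and ?Q = "cube (c n) (l n)" and ?v = "ennreal (l n ^ ?d)"
  have l: "0 < l n" using cl by blast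
  have "?v * ?o = ?o * emeasure lebesgue ?Q" unfolding cube_measure(2)[OF l] by (rule mult.commute)
  also have "... = (NN x. ?o * indicator ?Q x)" by (rule nn_integral_cmult_indicator[symmetric]) (rule cube_sets)
  also have "... <= (NN x. ennreal (C' * l n ^ ?d) * (g (cell_index x) * indicator ?Q x))"
  proof (rule nn_integral_mono)
   fix x
   show "?o * indicator ?Q x <= ennreal (C' * l n ^ ?d) * (g (cell_index x) * indicator ?Q x)"
   proof (cases "x \<in> ?Q")
    case True
    then have "?o <= ennreal (C' * l n ^ ?d) * g (cell_index x)" by (rule osc[OF l])
    then show ?thesis using True by simp
   qed simp
  qed
  also have "... = ennreal (C' * l n ^ ?d) * (NN x. g (cell_index x) * indicator ?Q x)"
   by (rule nn_integral_cmult) measurable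
  also have "ennreal (C' * l n ^ ?d) = ?v * ennreal C'"
   unfolding mult.commute[of C'] by (rule ennreal_mult) (use l C' in auto)
  finally have "?v * ?o <= ?v * (ennreal C' * (NN x. g (cell_index x) * indicator ?Q x))" by (simp only: mult.assoc)
  then show ?thesis using l by (subst (asm) ennreal_mult_le_mult_iff) auto
 qed
 have "(\<Sum>n. ennreal (oscillation \<delta> r h (cube (c n) (C\<^sub>0 * l n)))) <= (\<Sum>n. ennreal C' * (NN x. g (cell_index x) * indicator (cube (c n) (l n)) x))"
  by (intro suminf_le one) auto
 also have "... = ennreal C' * (\<Sum>n. (NN x. g (cell_index x) * indicator (cube (c n) (l n)) x))"
  by (rule ennreal_suminf_cmult)
 also have "(\<Sum>n. (NN x. g (cell_index x) * indicator (cube (c n) (l n)) x)) = (NN x. (\<Sum>n. g (cell_index x) * indicator (cube (c n) (l n)) x))"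
  by (rule nn_integral_suminf[symmetric]) measurable
 also have "... <= (NN x. ennreal Kd * (g (cell_index x) * indicator \<Omega> x))"
 proof (rule nn_integral_mono)
  fix x
  show "(\<Sum>n. g (cell_index x) * indicator (cube (c n) (l n)) x) <= ennreal Kd * (g (cell_index x) * indicator \<Omega> x)"
  proof (cases "x \<in> \<Omega>")
   case True
   have "(\<Sum>n. g (cell_index x) * indicator (cube (c n) (l n)) x) = g (cell_index x) * (\<Sum>n. indicator (cube (c n) (l n)) x)"
    by (rule ennreal_suminf_cmult)
   also have "... <= g (cell_index x) * ennreal Kd" using ov by (intro mult_left_mono) auto
   finally show ?thesis using True by (simp add: mult.commute)
  next
   case False
   then have "x \<notin> cube (c n) (l n)" for n using cl by blast
   then show ?thesis by simp
  qed
 qed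
 also have "... = ennreal Kd * (NN x. g (cell_index x) * indicator \<Omega> x)"
  by (rule nn_integral_cmult) measurable
 finally have "(\<Sum>n. ennreal (oscillation \<delta> r h (cube (c n) (C\<^sub>0 * l n)))) <= ennreal C' * (ennreal Kd * (NN x. g (cell_index x) * indicator \<Omega> x))"
  by (simp add: mult_left_mono)
 also have "... = ennreal (C' * Kd) * (NN x. g (cell_index x) * indicator \<Omega> x)"
  using C' Kd by (simp add: ennreal_mult mult.assoc)
 finally show "(\<Sum>n. ennreal (oscillation \<delta> r h (cube (c n) (C\<^sub>0 * l n)))) <= ennreal (C' * Kd) * (NN x. g (cell_index x) * indicator \<Omega> x)" .
qed

text \<open>Finite partial sums over \<open>j\<close> suffice, and for these the function in the quasi-norm is measurable and dominated by the
 full sum.\<close>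

lemma campanato_norm_le:
 fixes h :: "real^'n => complex" and g :: "int^'n => ennreal"
 assumes p: "(p = 1 \<and> p' = \<infinity>) \<or> (\<exists>P. 1 < p \<and> 1 < P \<and> 1 / p + 1 / P = 1 \<and> p' = ennreal P)"
  and \<eta>: "0 < \<eta>" "\<eta> <= 1" and h: "h \<in> Lp_loc r"
  and osc: "!!c l x. 0 < l ==> x \<in> cube c l ==>
   ennreal (oscillation \<delta> r h (cube c (C\<^sub>0 * l))) <= ennreal (C' * l ^ CARD('n)) * g (cell_index x)"
  and C': "0 <= C'" and Kd: "0 <= Kd" and g: "Lp_norm (count_space UNIV) p' g <= ennreal X" and X: "0 <= X"
 shows "campanato_norm Kd C\<^sub>0 1 p \<eta> r \<delta> h <= ennreal (C' * Kd * X)"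
proof (rule ennreal_le_epsilon)
 fix e :: real assume e: "0 < e"
 have p0: "0 < p" using p by auto
 let ?C = "C' * Kd * X + e"
 have CKX: "0 <= C' * Kd" "0 <= C' * Kd * X" using C' Kd X by auto
 have C: "0 < ?C" using CKX e by linarith
 have body: "(\<Sum>\<^sub>\<infinity>j\<in>UNIV. ennreal (2 powr of_int j) * osc_sup Kd C\<^sub>0 \<delta> h (\<Omega> j) r) <= ennreal ?C * enn_powr N (1 / \<eta>)"
  if N: "N = amalgam_norm (ennreal (1 / \<eta>)) (ennreal (p / \<eta>)) (%x. \<Sum>\<^sub>\<infinity>j\<in>UNIV. ennreal (2 powr (of_int j * \<eta>)) * indicator (\<Omega> j) x)"
   and op: "\<forall>j. open (\<Omega> j)" and Nf: "N < \<infinity>" for \<Omega> :: "int => (real^'n) set" and N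
 proof (rule infsum_le_finite_sums)
  show "(%j. ennreal (2 powr of_int j) * osc_sup Kd C\<^sub>0 \<delta> h (\<Omega> j) r) summable_on UNIV"
   by (rule nonneg_summable_on_complete) simp
  fix J :: "int set" assume J: "finite J"
  have \<Omega>m[measurable]: "\<Omega> j \<in> sets lebesgue" for j by (rule sets_completionI_sets) (use op in \<open>simp add: borel_open\<close>)
  have gm[measurable]: "(%x. g (cell_index x)) \<in> borel_measurable (lebesgue :: (real^'n) measure)" by (rule cell_index_measurable)
  define F where "F x = (\<Sum>j\<in>J. ennreal (2 powr (of_int j * \<eta>)) * indicator (\<Omega> j) x)" for x
  have Fm[measurable]: "F \<in> Meas" unfolding F_def[abs_def] by measurable
  have Fle: "F x <= (\<Sum>\<^sub>\<infinity>j\<in>UNIV. ennreal (2 powr (of_int j * \<eta>)) * indicator (\<Omega> j) x)" for x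
   unfolding F_def infsum_finite[OF J, symmetric]
   by (rule infsum_mono_neutral) (auto intro: nonneg_summable_on_complete)
  let ?NF = "amalgam_norm (ennreal (1 / \<eta>)) (ennreal (p / \<eta>)) F"
  have NFle: "?NF <= N" unfolding N amalgam_norm_def
   by (intro Lp_norm_mono mult_right_mono Fle) (use p0 \<eta> in auto)
  have NFf: "?NF < \<infinity>" using NFle Nf by (rule le_less_trans)
  have gf: "Lp_norm (count_space UNIV) p' g < \<infinity>" using g by (rule le_less_trans) simp
  have "(\<Sum>j\<in>J. ennreal (2 powr of_int j) * osc_sup Kd C\<^sub>0 \<delta> h (\<Omega> j) r) <=
   (\<Sum>j\<in>J. ennreal (2 powr of_int j) * (ennreal (C' * Kd) * (NN x. g (cell_index x) * indicator (\<Omega> j) x)))"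
   by (intro sum_mono mult_left_mono osc_sup_le osc C' Kd \<Omega>m) auto
  also have "... = ennreal (C' * Kd) * (\<Sum>j\<in>J. ennreal (2 powr of_int j) * (NN x. g (cell_index x) * indicator (\<Omega> j) x))"
   unfolding sum_distrib_left by (intro sum.cong refl) (simp only: mult.left_commute)
  also have "(\<Sum>j\<in>J. ennreal (2 powr of_int j) * (NN x. g (cell_index x) * indicator (\<Omega> j) x)) =
    (\<Sum>j\<in>J. (NN x. ennreal (2 powr of_int j) * (g (cell_index x) * indicator (\<Omega> j) x)))"
   by (intro sum.cong refl nn_integral_cmult[symmetric]) measurable
  also have "... = (NN x. (\<Sum>j\<in>J. ennreal (2 powr of_int j) * (g (cell_index x) * indicator (\<Omega> j) x)))"
   by (rule nn_integral_sum[symmetric]) measurable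
  also have "... <= (NN x. enn_powr (F x) (1 / \<eta>) * g (cell_index x))"
  proof (rule nn_integral_mono)
   fix x
   have "ennreal (2 powr of_int j) * indicator (\<Omega> j) x = enn_powr (ennreal (2 powr (of_int j * \<eta>)) * indicator (\<Omega> j) x) (1 / \<eta>)" for j
    using \<eta> by (cases "x \<in> \<Omega> j") (auto simp: enn_powr_ennreal powr_powr)
   then have "(\<Sum>j\<in>J. ennreal (2 powr of_int j) * indicator (\<Omega> j) x) = (\<Sum>j\<in>J. enn_powr (ennreal (2 powr (of_int j * \<eta>)) * indicator (\<Omega> j) x) (1 / \<eta>))"
    by (simp only:)
   also have "... <= enn_powr (F x) (1 / \<eta>)"
    unfolding F_def by (rule enn_powr_sum_superadditive[OF _ J]) (use \<eta> in simp)
   finally have "(\<Sum>j\<in>J. ennreal (2 powr of_int j) * indicator (\<Omega> j) x) * g (cell_index x) <= enn_powr (F x) (1 / \<eta>) * g (cell_index x)"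
    by (rule mult_right_mono) simp
   then show "(\<Sum>j\<in>J. ennreal (2 powr of_int j) * (g (cell_index x) * indicator (\<Omega> j) x)) <= enn_powr (F x) (1 / \<eta>) * g (cell_index x)"
    unfolding sum_distrib_right by (simp only: ac_simps)
  qed
  also have "... <= enn_powr ?NF (1 / \<eta>) * Lp_norm (count_space UNIV) p' g"
   by (rule amalgam_pairing[OF p \<eta>(1) Fm NFf gf])
  also have "... <= enn_powr N (1 / \<eta>) * ennreal X"
   using NFle \<eta> by (intro mult_mono g enn_powr_mono) auto
  finally have "(\<Sum>j\<in>J. ennreal (2 powr of_int j) * osc_sup Kd C\<^sub>0 \<delta> h (\<Omega> j) r) <= ennreal (C' * Kd) * (enn_powr N (1 / \<eta>) * ennreal X)"
   by (simp add: mult_left_mono)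
  also have "... = ennreal (C' * Kd * X) * enn_powr N (1 / \<eta>)"
  proof -
   have "ennreal (C' * Kd * X) = ennreal (C' * Kd) * ennreal X" by (rule ennreal_mult) (use CKX X in auto)
   then show ?thesis by (simp only: ac_simps)
  qed
  also have "... <= ennreal ?C * enn_powr N (1 / \<eta>)" using e by (intro mult_right_mono ennreal_leI) auto
  finally show "(\<Sum>j\<in>J. ennreal (2 powr of_int j) * osc_sup Kd C\<^sub>0 \<delta> h (\<Omega> j) r) <= ennreal ?C * enn_powr N (1 / \<eta>)" .
 qed
 have "campanato_norm Kd C\<^sub>0 1 p \<eta> r \<delta> h <= ennreal ?C"
  unfolding campanato_norm_def
 proof (rule Inf_lower, rule CollectI, rule exI[of _ ?C], intro conjI refl C h allI)
  fix \<Omega> :: "int => (real^'n) set"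
  show "let N = amalgam_norm (ennreal (1 / \<eta>)) (ennreal (p / \<eta>)) (%x. \<Sum>\<^sub>\<infinity>j\<in>UNIV. ennreal (2 powr (of_int j * \<eta>)) * indicator (\<Omega> j) x)
   in (\<forall>j. open (\<Omega> j)) \<and> N < \<infinity> -->
    (\<Sum>\<^sub>\<infinity>j\<in>UNIV. ennreal (2 powr of_int j) * osc_sup Kd C\<^sub>0 \<delta> h (\<Omega> j) r) <= ennreal ?C * enn_powr N (1 / \<eta>)"
   unfolding Let_def by (intro impI, elim conjE, rule body[OF refl])
 qed
 also have "... = ennreal (C' * Kd * X) + ennreal e" using CKX e by simp
 finally show "campanato_norm Kd C\<^sub>0 1 p \<eta> r \<delta> h <= ennreal (C' * Kd * X) + ennreal e" .
qed

section \<open>The two ranges of the exponent\<close>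

lemma extended_value_weak:
 fixes K :: "real^'n => real^'n => complex"
 assumes K: "K \<in> standard_kernels \<mu> A" and \<mu>: "0 < \<mu>" and A: "0 < A" and T: "calderon_zygmund T K"
  and p': "p' = \<infinity> \<or> (\<exists>P. 1 < P \<and> p' = ennreal P)" and f: "f \<in> amalgam \<infinity> p'"
  and h: "extended_value T p' f h"
 shows "\<exists>T'. is_transpose T T' \<and> weak_value T' f h"
 using p'
proof (elim disjE exE conjE)
 assume p: "p' = \<infinity>"
 then obtain T' where "h \<in> Lp_loc 2" and T': "is_transpose T T'"
  and eq: "\<forall>g\<in>Lp 2. compact (closure {x. g x ~= 0}) \<and> (LINT x|lebesgue. g x) = 0 -->
       (LINT x|lebesgue. h x * g x) = (LINT x|lebesgue. f x * T' g x)"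
  using h unfolding extended_value_def by auto
 then have "weak_value T' f h" by (intro weak_value_infinite) blast+
 then show ?thesis using T' by blast
next
 fix P assume P: "1 < P" "p' = ennreal P"
 obtain S where h1: "h \<in> Lp (ennreal P)" and S: "bounded_linear_Lp (ennreal P) S"
  and eq: "\<forall>u\<in>Lp 2 \<inter> Lp (ennreal P). AE x in lebesgue. S u x = T u x" and h2: "AE x in lebesgue. h x = S f x"
  using h unfolding extended_value_def P(2) by auto
 obtain M where M: "AE x in lebesgue. cmod (f x) <= M"
  using amalgam_bounded[OF _ f] P by (metis less_trans zero_less_one)
 have fP: "f \<in> Lp (ennreal P)" using amalgam_Lp[of P f] f P by simp
 obtain T' where T': "is_transpose T T'" using transpose_exists T unfolding calderon_zygmund_def by blast
 have "weak_value T' f h"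
  by (rule weak_value_finite[OF K \<mu> A T T' P(1) fP M S _ h1 h2]) (use eq in blast)
 then show ?thesis using T' by blast
qed

lemma extended_value_exists:
 fixes K :: "real^'n => real^'n => complex"
 assumes K: "K \<in> standard_kernels \<mu> A" and \<mu>: "0 < \<mu>" and A: "0 < A" and T: "calderon_zygmund T K"
  and p': "p' = \<infinity> \<or> (\<exists>P. 1 < P \<and> p' = ennreal P)" and f: "f \<in> amalgam \<infinity> p'"
 shows "\<exists>h. extended_value T p' f h"
 using p'
proof (elim disjE exE conjE)
 assume p: "p' = \<infinity>"
 have fm: "f \<in> Meas" using f unfolding amalgam_def by blast
 obtain M where M: "AE x in lebesgue. cmod (f x) <= M" using amalgam_bounded[OF _ f] p by blast
 show ?thesis unfolding p by (rule extended_value_infinite_exists[OF K \<mu> A T fm M])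
next
 fix P assume P: "1 < P" "p' = ennreal P"
 have fP: "f \<in> Lp (ennreal P)" using amalgam_Lp[of P f] f P by simp
 obtain C where C: "0 < C" "\<forall>u\<in>Lp 2 \<inter> Lp (ennreal P). Ipow P (T u) <= ennreal C * Ipow P u"
  using calderon_zygmund_Ls[OF K \<mu> A T P(1)] by blast
 have T2: "bounded_linear_Lp 2 T" using T unfolding calderon_zygmund_def by blast
 have "\<exists>S. bounded_linear_Lp (ennreal P) S \<and> (\<forall>u\<in>Lp 2 \<inter> Lp (ennreal P). AE x in lebesgue. S u x = T u x)"
  by (rule Ls_extension_exists[OF T2 _ C(1)]) (use P C in auto)
 then obtain S where S: "bounded_linear_Lp (ennreal P) S" "\<forall>u\<in>Lp 2 \<inter> Lp (ennreal P). AE x in lebesgue. S u x = T u x" by blast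
 have "S f \<in> Lp (ennreal P)" using bounded_linear_Lp_mem[OF S(1) fP] .
 then have "extended_value T p' f (S f)" unfolding extended_value_def P(2) using S by auto
 then show ?thesis by blast
qed

text \<open>The hypothesis \<open>1 < p'\<close> serves to exclude \<open>p' = 0\<close>, where division is not informative.\<close>

lemma conjugate_exponent_cases:
 fixes p :: real and p' :: ennreal
 assumes "1 <= p" "1 / ennreal p + 1 / p' = 1" "1 < p'"
 shows "(p = 1 \<and> p' = \<infinity>) \<or> (\<exists>P. 1 < p \<and> 1 < P \<and> 1 / p + 1 / P = 1 \<and> p' = ennreal P)"
proof (cases p')
 case (real P)
 then have P: "1 < P" using assms(3) by (simp add: ennreal_1[symmetric] ennreal_less_iff del: ennreal_1)
 have e: "1 / ennreal p = ennreal (1 / p)" "1 / p' = ennreal (1 / P)"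
  using assms(1) P real by (simp_all add: divide_ennreal ennreal_1[symmetric] del: ennreal_1)
 have "ennreal (1 / p + 1 / P) = ennreal 1" using assms(1,2) P unfolding e by simp
 then have s: "1 / p + 1 / P = 1" using assms(1) P by (subst (asm) ennreal_inj) auto
 then have "p ~= 1" using P by auto
 then show ?thesis using s P real assms(1) by auto
next
 case top
 have "1 / ennreal p = ennreal (1 / p)" using assms(1) by (simp add: divide_ennreal ennreal_1[symmetric] del: ennreal_1)
 then have "ennreal (1 / p) = ennreal 1" using assms(2) top by simp
 then have "1 / p = 1" using assms(1) by (subst (asm) ennreal_inj) auto
 then show ?thesis using top by simp
qed

lemma local_averages:
 fixes p' :: ennreal
 assumes r: "1 <= r" "ennreal r < p'" and p': "p' = \<infinity> \<or> (\<exists>P. 1 < P \<and> p' = ennreal P)"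
 shows "\<exists>s C. r <= s \<and> 1 < s \<and> 0 < C \<and> (\<forall>f\<in>(amalgam \<infinity> p' :: (real^'n => complex) set). \<exists>g :: int^'n => ennreal.
   Lp_norm (count_space UNIV) p' g <= ennreal C * amalgam_norm \<infinity> p' (%x. enorm (f x)) \<and>
   (\<forall>x \<rho>. 0 < \<rho> --> (NN y. ennreal (cmod (f y) powr s) * indicator (cball x \<rho>) y) <= ennreal (\<rho> ^ CARD('n)) * enn_powr (g (cell_index x)) s))"
 using p'
proof (elim disjE exE conjE)
 assume p: "p' = \<infinity>"
 show ?thesis unfolding p
  by (rule exI[of _ "r + 1"]) (use local_averages_infinity[of "r + 1", where 'n='n] r in auto)
next
 fix P assume P: "1 < P" "p' = ennreal P"
 have rP: "r < P" using r P by (simp add: ennreal_less_iff)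
 \<comment> \<open>Any exponent between \<open>r\<close> and \<open>P\<close> that exceeds \<open>1\<close> would do.\<close>
 have s: "0 < (r + P) / 2" "(r + P) / 2 < P" "r <= (r + P) / 2" "1 < (r + P) / 2" using rP r by auto
 obtain C where C: "0 < C" "\<forall>f\<in>(amalgam \<infinity> (ennreal P) :: (real^'n => complex) set). \<exists>g :: int^'n => ennreal.
   Lp_norm (count_space UNIV) (ennreal P) g <= ennreal C * amalgam_norm \<infinity> (ennreal P) (%x. enorm (f x)) \<and>
   (\<forall>x \<rho>. 0 < \<rho> --> (NN y. ennreal (cmod (f y) powr ((r + P) / 2)) * indicator (cball x \<rho>) y) <= ennreal (\<rho> ^ CARD('n)) * enn_powr (g (cell_index x)) ((r + P) / 2))"
  using local_averages_finite[OF s(1,2), where 'n='n] by (elim exE conjE, intro that)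
 show ?thesis unfolding P(2) by (rule exI[of _ "(r + P) / 2"], rule exI[of _ C]) (intro conjI s C)
qed

theorem theorem4p16:
  fixes p r \<eta> \<mu> A Kd C\<^sub>0 :: real and p' :: ennreal and \<delta> :: nat
    and T :: "(real^'n \<Rightarrow> complex) \<Rightarrow> (real^'n \<Rightarrow> complex)"
    and K :: "real^'n \<Rightarrow> real^'n \<Rightarrow> complex"
  assumes "1 < Kd" "1 < C\<^sub>0"
    and "1 \<le> p" "1 / ennreal p + 1 / p' = 1"
    and "1 \<le> r" "ennreal r < p'"
    and "(1 < r \<and> 0 < \<eta> \<and> \<eta> < 1) \<or> (r = 1 \<and> 0 < \<eta> \<and> \<eta> \<le> 1)"
    and "0 < \<mu>" "0 < A" "K \<in> standard_kernels \<mu> A" "calderon_zygmund T K"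
  shows "\<exists>C>0. \<forall>f\<in>amalgam \<infinity> p'.
    (\<exists>h. extended_value T p' f h) \<and>
    (\<forall>h. extended_value T p' f h \<longrightarrow>
       campanato_norm Kd C\<^sub>0 1 p \<eta> r \<delta> h
         \<le> ennreal C * amalgam_norm \<infinity> p' (\<lambda>x. ennreal (cmod (f x))))"
proof -
 let ?d = "CARD('n)"
 note r = \<open>1 <= r\<close> and CZ = \<open>K \<in> standard_kernels \<mu> A\<close> \<open>0 < \<mu>\<close> \<open>0 < A\<close> \<open>calderon_zygmund T K\<close>
 have \<eta>: "0 < \<eta>" "\<eta> <= 1" using assms(7) by auto
 have "ennreal 1 <= ennreal r" using r by (intro ennreal_leI)
 then have "ennreal 1 < p'" using assms(6) by (rule le_less_trans)
 then have "1 < p'" by (simp only: ennreal_1)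
 then have p: "(p = 1 \<and> p' = \<infinity>) \<or> (\<exists>P. 1 < p \<and> 1 < P \<and> 1 / p + 1 / P = 1 \<and> p' = ennreal P)"
  by (rule conjugate_exponent_cases[OF assms(3,4)])
 then have p1: "p' = \<infinity> \<or> (\<exists>P. 1 < P \<and> p' = ennreal P)" by blast
 have p0: "p' = \<infinity> \<or> (\<exists>P>0. p' = ennreal P)"
  using p1
 proof (elim disjE exE conjE)
  fix P assume "1 < P" "p' = ennreal P"
  then have "0 < P \<and> p' = ennreal P" by simp
  then show ?thesis by blast
 qed simp
 obtain s Cg where s: "r <= s" "1 < s" and Cg: "0 < Cg" and avg: "\<forall>f\<in>(amalgam \<infinity> p' :: (real^'n => complex) set). \<exists>g :: int^'n => ennreal.
   Lp_norm (count_space UNIV) p' g <= ennreal Cg * amalgam_norm \<infinity> p' (%x. enorm (f x)) \<and>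
   (\<forall>x \<rho>. 0 < \<rho> --> (NN y. ennreal (cmod (f y) powr s) * indicator (cball x \<rho>) y) <= ennreal (\<rho> ^ CARD('n)) * enn_powr (g (cell_index x)) s)"
  using local_averages[OF r assms(6) p1, where 'n='n] by (elim exE conjE, intro that)
 obtain Co where Co: "0 < Co" and osc: "\<forall>T' f h M (c :: real^'n) L \<Gamma>. is_transpose T T' --> f \<in> Meas -->
   (AE x in lebesgue. cmod (f x) <= M) --> weak_value T' f h --> 0 < L --> 0 <= \<Gamma> -->
   (\<forall>\<rho>. 2 * (real CARD('n) * L) <= \<rho> -->
    (NN y. ennreal (cmod (f y) powr s) * indicator (cball c \<rho>) y) <= ennreal (\<rho> ^ CARD('n) * \<Gamma> powr s)) -->
   (NN y. ennreal (cmod (h y) powr r) * indicator (cube c L) y) < \<infinity> \<and>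
   oscillation \<delta> r h (cube c L) <= Co * L ^ CARD('n) * \<Gamma>"
  using oscillation_bound[OF CZ r s, of \<delta>] by (elim exE conjE, intro that)
 \<comment> \<open>Moving the centre of a ball from \<open>c\<close> to a point of the cube doubles the radius; the factor \<open>2\<^sup>d\<close> becomes
  \<open>\<kappa>\<close> after taking the root.\<close>
 define \<kappa> where "\<kappa> = 2 powr (real ?d / s)"
 have \<kappa>: "0 < \<kappa>" unfolding \<kappa>_def by simp
 have \<kappa>s: "\<kappa> powr s = 2 ^ ?d" unfolding \<kappa>_def using s by (simp add: powr_powr powr_realpow)
 define C' where "C' = Co * C\<^sub>0 ^ ?d * \<kappa>"
 have C': "0 < C'" unfolding C'_def using Co \<kappa> assms(2) by simp
 have bound: "campanato_norm Kd C\<^sub>0 1 p \<eta> r \<delta> h <= ennreal (C' * Kd * Cg) * amalgam_norm \<infinity> p' (%x. enorm (f x))"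
  if f: "f \<in> amalgam \<infinity> p'" and h: "extended_value T p' f h" for f :: "real^'n => complex" and h
 proof -
  let ?N = "amalgam_norm \<infinity> p' (%x. enorm (f x))"
  have fm: "f \<in> Meas" and "?N < \<infinity>" using f unfolding amalgam_def by blast+
  then obtain X where X: "?N = ennreal X" "0 <= X" by (cases ?N) auto
  obtain M where M: "AE x in lebesgue. cmod (f x) <= M" using amalgam_bounded[OF p0 f] by blast
  obtain T' where T': "is_transpose T T'" and wh: "weak_value T' f h" using extended_value_weak[OF CZ p1 f h] by blast
  obtain g :: "int^'n => ennreal" where gN: "Lp_norm (count_space UNIV) p' g <= ennreal Cg * ?N"
   and ga: "\<forall>x \<rho>. 0 < \<rho> --> (NN y. ennreal (cmod (f y) powr s) * indicator (cball x \<rho>) y) <= ennreal (\<rho> ^ ?d) * enn_powr (g (cell_index x)) s"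
   using bspec[OF avg f] by (elim exE conjE, intro that)
  have gX: "Lp_norm (count_space UNIV) p' g <= ennreal (Cg * X)" using gN Cg X by (simp add: ennreal_mult)
  define \<gamma> where "\<gamma> k = enn2real (g k)" for k
  have g\<gamma>: "g k = ennreal (\<gamma> k)" "0 <= \<gamma> k" for k
  proof -
   have "g k <= ennreal (Cg * X)" using lp_term_le[OF p0, of g k] gX by (rule order_trans)
   then have "g k < top" by (rule le_less_trans) simp
   then show "g k = ennreal (\<gamma> k)" "0 <= \<gamma> k" unfolding \<gamma>_def by auto
  qed
  have av: "(NN y. ennreal (cmod (f y) powr s) * indicator (cball c \<rho>) y) <= ennreal (\<rho> ^ ?d * (\<kappa> * \<gamma> (cell_index x)) powr s)"
   if \<rho>: "dist x c <= \<rho>" "0 < \<rho>" for x c :: "real^'n" and \<rho>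
  proof -
   have sub: "cball c \<rho> \<subseteq> cball x (2 * \<rho>)"
   proof
    fix y assume "y \<in> cball c \<rho>"
    then show "y \<in> cball x (2 * \<rho>)" using dist_triangle[of x y c] \<rho> by simp
   qed
   have "(NN y. ennreal (cmod (f y) powr s) * indicator (cball c \<rho>) y) <= (NN y. ennreal (cmod (f y) powr s) * indicator (cball x (2 * \<rho>)) y)"
    using sub by (intro nn_integral_mono mult_left_mono) (auto simp: indicator_def)
   also have "... <= ennreal ((2 * \<rho>) ^ ?d) * enn_powr (g (cell_index x)) s"
    by (rule ga[rule_format]) (use \<rho> in simp)
   also have "... = ennreal ((2 * \<rho>) ^ ?d * \<gamma> (cell_index x) powr s)"
    unfolding g\<gamma>(1) enn_powr_ennreal[OF g\<gamma>(2)] by (rule ennreal_mult[symmetric]) (use \<rho> in auto)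
   also have "(2 * \<rho>) ^ ?d * \<gamma> (cell_index x) powr s = \<rho> ^ ?d * (\<kappa> * \<gamma> (cell_index x)) powr s"
    unfolding powr_mult \<kappa>s power_mult_distrib by (simp only: ac_simps)
   finally show ?thesis .
  qed
  have hl: "h \<in> Lp_loc r"
  proof (rule Lp_loc_if_cubes)
   show "h \<in> Meas" using wh unfolding weak_value_def by blast
   fix L :: real assume L: "0 < L"
   have pos: "0 < 2 * (real ?d * L)" using L by simp
   have "\<forall>\<rho>. 2 * (real ?d * L) <= \<rho> --> (NN y. ennreal (cmod (f y) powr s) * indicator (cball 0 \<rho>) y) <= ennreal (\<rho> ^ ?d * (\<kappa> * \<gamma> (cell_index (0 :: real^'n))) powr s)"
   proof (intro allI impI av)
    fix \<rho> assume "2 * (real ?d * L) <= \<rho>"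
    then show "0 < \<rho>" using pos by linarith
    then show "dist 0 (0 :: real^'n) <= \<rho>" by simp
   qed
   moreover have "0 <= \<kappa> * \<gamma> (cell_index (0 :: real^'n))" using \<kappa> g\<gamma> by simp
   ultimately show "(NN y. ennreal (cmod (h y) powr r) * indicator (cube 0 L) y) < \<infinity>"
    using osc T' fm M wh L by blast
  qed
  have "campanato_norm Kd C\<^sub>0 1 p \<eta> r \<delta> h <= ennreal (C' * Kd * (Cg * X))"
  proof (rule campanato_norm_le[OF p \<eta> hl _ _ _ gX])
   fix c :: "real^'n" and l x assume l: "0 < l" and x: "x \<in> cube c l"
   have CL: "0 < C\<^sub>0 * l" "l <= C\<^sub>0 * l" using l assms(2) by auto
   have "dist x c <= real ?d * (l / 2)" using cube_dist_le[OF x] by (simp add: dist_commute)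
   also have "... <= 2 * (real ?d * (C\<^sub>0 * l))"
   proof -
    have "real ?d * (l / 2) <= real ?d * (2 * (C\<^sub>0 * l))" using l CL by (intro mult_left_mono) auto
    then show ?thesis by simp
   qed
   finally have dist: "dist x c <= 2 * (real ?d * (C\<^sub>0 * l))" .
   have "0 < 2 * (real ?d * (C\<^sub>0 * l))" using CL by simp
   then have "\<forall>\<rho>. 2 * (real ?d * (C\<^sub>0 * l)) <= \<rho> --> (NN y. ennreal (cmod (f y) powr s) * indicator (cball c \<rho>) y) <= ennreal (\<rho> ^ ?d * (\<kappa> * \<gamma> (cell_index x)) powr s)"
    using dist by (intro allI impI av) linarith+
   moreover have "0 <= \<kappa> * \<gamma> (cell_index x)" using \<kappa> g\<gamma> by simp
   ultimately have "oscillation \<delta> r h (cube c (C\<^sub>0 * l)) <= Co * (C\<^sub>0 * l) ^ ?d * (\<kappa> * \<gamma> (cell_index x))"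
    using osc T' fm M wh CL(1) by blast
   also have "... = C' * l ^ ?d * \<gamma> (cell_index x)" unfolding C'_def power_mult_distrib by (simp only: ac_simps)
   finally have "ennreal (oscillation \<delta> r h (cube c (C\<^sub>0 * l))) <= ennreal (C' * l ^ ?d * \<gamma> (cell_index x))" by (rule ennreal_leI)
   also have "... = ennreal (C' * l ^ ?d) * g (cell_index x)"
    unfolding g\<gamma>(1) by (rule ennreal_mult) (use C' l g\<gamma> in auto)
   finally show "ennreal (oscillation \<delta> r h (cube c (C\<^sub>0 * l))) <= ennreal (C' * l ^ ?d) * g (cell_index x)" .
  qed (use C' Cg X assms(1) in auto)
  also have "C' * Kd * (Cg * X) = C' * Kd * Cg * X" by simp
  also have "ennreal (C' * Kd * Cg * X) = ennreal (C' * Kd * Cg) * ennreal X"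
   by (rule ennreal_mult) (use C' Cg X assms(1) in auto)
  finally show ?thesis unfolding X(1) .
 qed
 have "0 < C' * Kd * Cg" using C' Cg assms(1) by simp
 then show ?thesis using bound extended_value_exists[OF CZ p1] by blast
qed

end
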